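(* Let $0<u<1$ and $\xi>0$. If $\sigma>u-\frac12$, then there is a positive self-adjoint operator $\mathcal U$ in $L^2_\sigma$ satisfying the following. (i) $\mathcal S$ is a core of $\mathcal U^{1/2}$ and, for all $\phi,\psi\in\mathcal S$, $$\langle \mathcal U^{1/2}\phi,\mathcal U^{1/2}\psi\rangle_\sigma=\langle J\phi,\psi\rangle_\sigma+\xi\,\langle |x|^{-u}\phi,|x|^{-u}\psi\rangle_\sigma .$$ (ii) $\mathcal U$ has a discrete spectrum. Let $\lambda_0\le\lambda_1\le\cdots$ be its eigenvalues, repeated according to their multiplicity. There is some $D=D(\sigma,u)>0$ and, for each $\epsilon>0$, there is some $C=C(\epsilon,\sigma,u)>0$ so that, for all $k\in\mathbb N$, $$(2k+1+2\sigma)s+\xi D s^u(k+1)^{-u}\le\lambda_k\le(2k+1+2\sigma)(s+\xi\epsilon s^u)+\xi C s^u .$$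
   Context: $s>0$ is a fixed parameter and $\mathbb N=\{0,1,2,\dots\}$. $\mathcal S=\mathcal S(\mathbb R)$ is the (complex) Schwartz space on $\mathbb R$, and $\mathcal S=\mathcal S_{\rm ev}\oplus\mathcal S_{\rm odd}$ is its decomposition into even and odd functions. For $\sigma>-\frac12$, $L^2_\sigma=L^2(\mathbb R,|x|^{2\sigma}dx)$ with scalar product $\langle\phi,\psi\rangle_\sigma=\int_{\mathbb R}\phi\,\overline\psi\,|x|^{2\sigma}dx$. The Dunkl harmonic oscillator $J=J_\sigma$ is the operator in $L^2_\sigma$ with domain $\mathcal S$ which preserves the even/odd decomposition and is given by $J\phi=-\phi''+s^2x^2\phi-2\sigma x^{-1}\phi'$ for $\phi\in\mathcal S_{\rm ev}$ and $J\phi=-\phi''+s^2x^2\phi-2\sigma(x^{-1}\phi)'$ for $\phi\in\mathcal S_{\rm odd}$.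
   Formalization: A constant D depending only on σ and u cannot serve all ξ>0 (λ₀ grows sublinearly in ξ), so D here depends on σ, u and an upper bound B for ξs^{u−1}; every s>0 and ξ>0 is still covered, and C depends only on ε, σ, u. *)

theory Defs
  imports "HOL-Analysis.Analysis"
begin

text \<open>
  The Hilbert space \<open>L\<^sup>2(M)\<close> is handled through representatives: its elements are the
  square-integrable functions in \<open>l2_space M\<close>, two of which denote the same vector iff they
  agree almost everywhere.
\<close>

definition l2_space :: "'a measure \<Rightarrow> ('a \<Rightarrow> complex) set" where
  "l2_space M = {f \<in> borel_measurable M. integrable M (\<lambda>x. (cmod (f x))\<^sup>2)}"

definition l2_inner :: "'a measure \<Rightarrow> ('a \<Rightarrow> complex) \<Rightarrow> ('a \<Rightarrow> complex) \<Rightarrow> complex" where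
  "l2_inner M f g = (LINT x|M. f x * cnj (g x))"

definition l2_norm :: "'a measure \<Rightarrow> ('a \<Rightarrow> complex) \<Rightarrow> real" where
  "l2_norm M f = sqrt (LINT x|M. (cmod (f x))\<^sup>2)"

definition l2_dense :: "'a measure \<Rightarrow> ('a \<Rightarrow> complex) set \<Rightarrow> bool" where
  "l2_dense M D \<longleftrightarrow> D \<subseteq> l2_space M \<and>
     (\<forall>f\<in>l2_space M. \<forall>e>0. \<exists>h\<in>D. l2_norm M (\<lambda>x. f x - h x) < e)"

definition l2_has_dim :: "'a measure \<Rightarrow> ('a \<Rightarrow> complex) set \<Rightarrow> nat \<Rightarrow> bool" where
  "l2_has_dim M E n \<longleftrightarrow>
     (\<exists>b. (\<forall>i<n. b i \<in> E) \<and>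
          (\<forall>c. (AE x in M. (\<Sum>i<n. c i * b i x) = 0) \<longrightarrow> (\<forall>i<n. c i = 0)) \<and>
          (\<forall>f\<in>E. \<exists>c. AE x in M. f x = (\<Sum>i<n. c i * b i x)))"


text \<open>
  A possibly unbounded operator in \<open>L\<^sup>2(M)\<close> is given by its graph, taken to be closed under
  almost everywhere equality of both components. Its domain is \<open>Domain T\<close>, and \<open>T O T\<close> is its
  square with the natural domain.
\<close>

type_synonym 'a l2_op = "(('a \<Rightarrow> complex) \<times> ('a \<Rightarrow> complex)) set"

definition l2_operator :: "'a measure \<Rightarrow> 'a l2_op \<Rightarrow> bool" where
  "l2_operator M T \<longleftrightarrow>
     T \<subseteq> l2_space M \<times> l2_space M \<and>
     (\<lambda>x. 0, \<lambda>x. 0) \<in> T \<and>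
     (\<forall>f g f' g'. (f, g) \<in> T \<longrightarrow> (f', g') \<in> T \<longrightarrow> (\<lambda>x. f x + f' x, \<lambda>x. g x + g' x) \<in> T) \<and>
     (\<forall>c f g. (f, g) \<in> T \<longrightarrow> (\<lambda>x. c * f x, \<lambda>x. c * g x) \<in> T) \<and>
     (\<forall>f g. \<forall>f'\<in>l2_space M. \<forall>g'\<in>l2_space M.
        (f, g) \<in> T \<longrightarrow> (AE x in M. f x = f' x) \<longrightarrow> (AE x in M. g x = g' x) \<longrightarrow> (f', g') \<in> T) \<and>
     (\<forall>f g g'. (f, g) \<in> T \<longrightarrow> (f, g') \<in> T \<longrightarrow> (AE x in M. g x = g' x))"

text \<open>A representative of \<open>T f\<close>, for \<open>f\<close> in the domain of \<open>T\<close>.\<close>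

definition l2_apply :: "'a l2_op \<Rightarrow> ('a \<Rightarrow> complex) \<Rightarrow> ('a \<Rightarrow> complex)" where
  "l2_apply T f = (SOME g. (f, g) \<in> T)"

definition l2_adjoint :: "'a measure \<Rightarrow> 'a l2_op \<Rightarrow> 'a l2_op" where
  "l2_adjoint M T = {(f, g). f \<in> l2_space M \<and> g \<in> l2_space M \<and>
     (\<forall>(h, k)\<in>T. l2_inner M k f = l2_inner M h g)}"

definition l2_selfadjoint :: "'a measure \<Rightarrow> 'a l2_op \<Rightarrow> bool" where
  "l2_selfadjoint M T \<longleftrightarrow>
     l2_operator M T \<and> l2_dense M (Domain T) \<and> l2_adjoint M T = T"

definition l2_positive :: "'a measure \<Rightarrow> 'a l2_op \<Rightarrow> bool" where
  "l2_positive M T \<longleftrightarrow>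
     (\<forall>(f, g)\<in>T. Im (l2_inner M g f) = 0 \<and> Re (l2_inner M g f) \<ge> 0)"

text \<open>The unique positive self-adjoint square root of a positive self-adjoint operator.\<close>

definition l2_sqrt :: "'a measure \<Rightarrow> 'a l2_op \<Rightarrow> 'a l2_op" where
  "l2_sqrt M T = (THE R. l2_selfadjoint M R \<and> l2_positive M R \<and> R O R = T)"

definition l2_closure :: "'a measure \<Rightarrow> 'a l2_op \<Rightarrow> 'a l2_op" where
  "l2_closure M T = {(f, g). f \<in> l2_space M \<and> g \<in> l2_space M \<and>
     (\<forall>e>0. \<exists>(h, k)\<in>T. l2_norm M (\<lambda>x. f x - h x) < e \<and> l2_norm M (\<lambda>x. g x - k x) < e)}"

definition l2_core :: "'a measure \<Rightarrow> ('a \<Rightarrow> complex) set \<Rightarrow> 'a l2_op \<Rightarrow> bool" where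
  "l2_core M D T \<longleftrightarrow> D \<subseteq> Domain T \<and> l2_closure M (T \<inter> D \<times> UNIV) = T"

definition l2_resolvent_set :: "'a measure \<Rightarrow> 'a l2_op \<Rightarrow> complex set" where
  "l2_resolvent_set M T = {z.
     (\<exists>K. \<forall>(f, g)\<in>T. l2_norm M f \<le> K * l2_norm M (\<lambda>x. g x - z * f x)) \<and>
     (\<forall>h\<in>l2_space M. \<exists>(f, g)\<in>T. AE x in M. g x - z * f x = h x)}"

definition l2_spectrum :: "'a measure \<Rightarrow> 'a l2_op \<Rightarrow> complex set" where
  "l2_spectrum M T = - l2_resolvent_set M T"

definition l2_eigenspace :: "'a l2_op \<Rightarrow> complex \<Rightarrow> ('a \<Rightarrow> complex) set" where
  "l2_eigenspace T z = {f. (f, \<lambda>x. z * f x) \<in> T}"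

definition l2_discrete_spectrum :: "'a measure \<Rightarrow> 'a l2_op \<Rightarrow> bool" where
  "l2_discrete_spectrum M T \<longleftrightarrow>
     (\<forall>z\<in>l2_spectrum M T. \<not> z islimpt l2_spectrum M T \<and>
        (\<exists>n>0. l2_has_dim M (l2_eigenspace T z) n))"

text \<open>
  \<open>\<Lambda> 0 \<le> \<Lambda> 1 \<le> \<dots>\<close> lists all the eigenvalues, each repeated according to its multiplicity;
  a number \<open>z\<close> that is not an eigenvalue has a zero-dimensional eigenspace and does not occur.
\<close>

definition l2_eigenvalue_seq :: "'a measure \<Rightarrow> 'a l2_op \<Rightarrow> (nat \<Rightarrow> real) \<Rightarrow> bool" where
  "l2_eigenvalue_seq M T \<Lambda> \<longleftrightarrow> incseq \<Lambda> \<and>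
     (\<forall>z. finite {k. complex_of_real (\<Lambda> k) = z} \<and>
          l2_has_dim M (l2_eigenspace T z) (card {k. complex_of_real (\<Lambda> k) = z}))"


definition vderiv :: "(real \<Rightarrow> complex) \<Rightarrow> real \<Rightarrow> complex" where
  "vderiv f x = vector_derivative f (at x)"

definition schwartz :: "(real \<Rightarrow> complex) set" where
  "schwartz = {\<phi>. \<forall>n. (\<forall>x. (vderiv ^^ n) \<phi> differentiable (at x)) \<and>
     (\<forall>m. bounded (range (\<lambda>x. complex_of_real (x ^ m) * (vderiv ^^ n) \<phi> x)))}"

definition even_part :: "(real \<Rightarrow> complex) \<Rightarrow> real \<Rightarrow> complex" where
  "even_part \<phi> x = (\<phi> x + \<phi> (- x)) / 2"

definition odd_part :: "(real \<Rightarrow> complex) \<Rightarrow> real \<Rightarrow> complex" where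
  "odd_part \<phi> x = (\<phi> x - \<phi> (- x)) / 2"

definition dunkl_measure :: "real \<Rightarrow> real measure" where
  "dunkl_measure \<sigma> = density lborel (\<lambda>x. ennreal (\<bar>x\<bar> powr (2 * \<sigma>)))"

text \<open>
  The quotients by \<open>x\<close> take junk values at \<open>x = 0\<close> only, which is a null set and so does not
  affect the elements of \<open>L\<^sup>2\<^sub>\<sigma>\<close> defined here.
\<close>

definition dunkl_J_even :: "real \<Rightarrow> real \<Rightarrow> (real \<Rightarrow> complex) \<Rightarrow> real \<Rightarrow> complex" where
  "dunkl_J_even s \<sigma> \<phi> x =
     - vderiv (vderiv \<phi>) x + of_real (s\<^sup>2 * x\<^sup>2) * \<phi> x
     - of_real (2 * \<sigma>) * (vderiv \<phi> x / of_real x)"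

definition dunkl_J_odd :: "real \<Rightarrow> real \<Rightarrow> (real \<Rightarrow> complex) \<Rightarrow> real \<Rightarrow> complex" where
  "dunkl_J_odd s \<sigma> \<phi> x =
     - vderiv (vderiv \<phi>) x + of_real (s\<^sup>2 * x\<^sup>2) * \<phi> x
     - of_real (2 * \<sigma>) * vderiv (\<lambda>y. \<phi> y / of_real y) x"

definition dunkl_J :: "real \<Rightarrow> real \<Rightarrow> (real \<Rightarrow> complex) \<Rightarrow> real \<Rightarrow> complex" where
  "dunkl_J s \<sigma> \<phi> x = dunkl_J_even s \<sigma> (even_part \<phi>) x + dunkl_J_odd s \<sigma> (odd_part \<phi>) x"

definition abs_power_mult :: "real \<Rightarrow> (real \<Rightarrow> complex) \<Rightarrow> real \<Rightarrow> complex" where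
  "abs_power_mult a \<phi> x = of_real (\<bar>x\<bar> powr a) * \<phi> x"

end

theory Submission
  imports Defs "HOL-Library.Function_Algebras" "HOL-Library.Diagonal_Subsequence" "HOL-Probability.Probability"
begin

text \<open>
  Let \<open>e\<^sub>k\<close> be the eigenfunctions of \<open>J\<close> (Gaussians times generalised Hermite polynomials). They
  form an orthonormal basis of \<open>L\<^sup>2\<^sub>\<sigma>\<close> with eigenvalues \<open>(2k + 1 + 2\<sigma>)s\<close>, so \<open>J\<close> extends to a
  closed form \<open>j\<close> with compactly embedded domain \<open>V\<close>. Expanding the square
  \<open>\<integral> |\<phi>' + \<kappa> x\<^bsup>1 - 2u\<^esup> \<phi>|\<^sup>2 \<ge> 0\<close> gives a Hardy-type inequality which, after scaling, bounds
  \<open>h(\<phi>) = \<parallel>|x|\<^bsup>-u\<^esup> \<phi>\<parallel>\<^sup>2\<close> by \<open>\<epsilon> s\<^bsup>u - 1\<^esup> j(\<phi>) + C s\<^sup>u \<parallel>\<phi>\<parallel>\<^sup>2\<close>. Hence \<open>a = j + \<xi> h\<close> is again a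
  closed form on \<open>V\<close>. Successive minimisation of \<open>a\<close> on the unit sphere yields an orthonormal basis \<open>v\<^sub>k\<close>
  with \<open>a(f, v\<^sub>k) = \<lambda>\<^sub>k \<langle>f, v\<^sub>k\<rangle>\<close>, and \<open>U\<close> is the operator that is diagonal in this basis.

  The upper bound for \<open>\<lambda>\<^sub>k\<close> is the min-max principle with the span of \<open>e\<^sub>0, \<dots>, e\<^sub>k\<close>. For the lower
  bound, \<open>r\<^bsup>-u\<^esup>\<close> lies above its tangent at \<open>r\<^sub>0 = \<rho>(k + 1)/s\<close>; taking \<open>r = x\<^sup>2\<close>, the perturbed potential
  dominates that of an oscillator with a slightly smaller frequency \<open>t\<close> plus a constant, and the loss
  in frequency costs less than the constant gains when \<open>\<rho>\<close> is large.
\<close>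

subsection \<open>Semi-inner products\<close>

text \<open>Vectors are representatives, so every form here is only semidefinite and limits are
  unique only up to vectors of square 0. No representation theorem for closed forms is invoked:
  since \<open>U\<close> is diagonal, its adjoint, square root, spectrum and core are read off from
  coefficients. The form domain \<open>V\<close> is also described by coefficients, so no weak
  derivatives occur; inequalities are proved by calculus for Schwartz functions and reach
  \<open>V\<close> through partial sums of expansions in \<open>e\<close>, which are Schwartz. Two
  obstacles shape the estimates. For \<sigma> < 0 the term 2 \<sigma> / x^2 acting on odd functions
  is attractive, so the odd part needs a modified square. And rescaling x by \<open>sqrt s\<close>
  turns the operator into s times the one with frequency 1 and coupling
  \<open>\<xi> * s powr (u - 1)\<close>. The minimum of x^2 + \<xi> |x|^(-2u) grows only like
  \<xi>^(1/(1+u)), so a lower bound linear in \<xi> cannot hold with one constant for all couplings: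
  \<open>D\<close> is chosen for a given bound \<open>B\<close> on the coupling, which enters
  through \<open>\<rho>\<close>.\<close>

locale semi_ip =
  fixes H :: "'v::ab_group_add set"
    and scale :: "complex \<Rightarrow> 'v \<Rightarrow> 'v"
    and ip :: "'v \<Rightarrow> 'v \<Rightarrow> complex"
  assumes zero_mem: "0 \<in> H"
    and add_mem: "\<And>f g. f \<in> H \<Longrightarrow> g \<in> H \<Longrightarrow> f + g \<in> H"
    and scale_mem: "\<And>c f. f \<in> H \<Longrightarrow> scale c f \<in> H"
    and scale_scale: "\<And>c d f. scale c (scale d f) = scale (c * d) f"
    and scale_minus_one: "\<And>f. scale (- 1) f = - f"
    and ip_add_left: "\<And>f g h. f \<in> H \<Longrightarrow> g \<in> H \<Longrightarrow> h \<in> H \<Longrightarrow> ip (f + g) h = ip f h + ip g h"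
    and ip_scale_left: "\<And>c f g. f \<in> H \<Longrightarrow> g \<in> H \<Longrightarrow> ip (scale c f) g = c * ip f g"
    and ip_cnj: "\<And>f g. f \<in> H \<Longrightarrow> g \<in> H \<Longrightarrow> ip f g = cnj (ip g f)"
    and ip_ge_0: "\<And>f. f \<in> H \<Longrightarrow> 0 \<le> Re (ip f f)"
begin

text \<open>Kept real so that it can enter order arguments; \<open>ip_self\<close> recovers the
  complex value. It may vanish on nonzero vectors.\<close>

definition sq :: "'v \<Rightarrow> real" where "sq f = Re (ip f f)"

lemma sq_nonneg: "f \<in> H \<Longrightarrow> 0 \<le> sq f"
  by (simp add: sq_def ip_ge_0)

lemma ip_self: "f \<in> H \<Longrightarrow> ip f f = of_real (sq f)"
  using ip_cnj[of f f] by (simp add: sq_def complex_eq_iff)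

lemma uminus_mem: "f \<in> H \<Longrightarrow> - f \<in> H"
  using scale_mem[of f "- 1"] by (simp add: scale_minus_one)

lemma diff_mem: "f \<in> H \<Longrightarrow> g \<in> H \<Longrightarrow> f - g \<in> H"
  using add_mem[of f "- g"] uminus_mem[of g] by simp

lemma sum_mem: "(\<And>i. i \<in> A \<Longrightarrow> F i \<in> H) \<Longrightarrow> (\<Sum>i\<in>A. F i) \<in> H"
  by (induction A rule: infinite_finite_induct) (auto simp: zero_mem add_mem)

lemma ip_add_right: "f \<in> H \<Longrightarrow> g \<in> H \<Longrightarrow> h \<in> H \<Longrightarrow> ip h (f + g) = ip h f + ip h g"
  by (subst (1 2 3) ip_cnj) (auto simp: add_mem ip_add_left)

lemma ip_scale_right: "f \<in> H \<Longrightarrow> g \<in> H \<Longrightarrow> ip f (scale c g) = cnj c * ip f g"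
  by (subst (1 2) ip_cnj) (auto simp: scale_mem ip_scale_left)

lemma ip_minus_left: "f \<in> H \<Longrightarrow> g \<in> H \<Longrightarrow> ip (- f) g = - ip f g"
  using ip_scale_left[of f g "- 1"] by (simp add: scale_minus_one)

lemma ip_minus_right: "f \<in> H \<Longrightarrow> g \<in> H \<Longrightarrow> ip f (- g) = - ip f g"
  using ip_scale_right[of f g "- 1"] by (simp add: scale_minus_one)

lemma ip_diff_left: "f \<in> H \<Longrightarrow> g \<in> H \<Longrightarrow> h \<in> H \<Longrightarrow> ip (f - g) h = ip f h - ip g h"
  using ip_add_left[of f "- g" h] by (simp add: ip_minus_left uminus_mem)

lemma ip_diff_right: "f \<in> H \<Longrightarrow> g \<in> H \<Longrightarrow> h \<in> H \<Longrightarrow> ip h (f - g) = ip h f - ip h g"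
  using ip_add_right[of f "- g" h] by (simp add: ip_minus_right uminus_mem)

lemma ip_zero_left: "f \<in> H \<Longrightarrow> ip 0 f = 0"
  using ip_add_left[of 0 0 f] by (simp add: zero_mem)

lemma ip_zero_right: "f \<in> H \<Longrightarrow> ip f 0 = 0"
  using ip_add_right[of 0 0 f] by (simp add: zero_mem)

lemma ip_sum_left:
  "(\<And>i. i \<in> A \<Longrightarrow> F i \<in> H) \<Longrightarrow> g \<in> H \<Longrightarrow> ip (\<Sum>i\<in>A. F i) g = (\<Sum>i\<in>A. ip (F i) g)"
  by (induction A rule: infinite_finite_induct) (auto simp: ip_zero_left ip_add_left sum_mem)

lemma ip_sum_right:
  "(\<And>i. i \<in> A \<Longrightarrow> F i \<in> H) \<Longrightarrow> g \<in> H \<Longrightarrow> ip g (\<Sum>i\<in>A. F i) = (\<Sum>i\<in>A. ip g (F i))"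
  by (induction A rule: infinite_finite_induct) (auto simp: ip_zero_right ip_add_right sum_mem)

lemma sq_add: "f \<in> H \<Longrightarrow> g \<in> H \<Longrightarrow> sq (f + g) = sq f + 2 * Re (ip f g) + sq g"
  using ip_cnj[of f g] by (simp add: sq_def ip_add_left ip_add_right add_mem)

lemma sq_diff: "f \<in> H \<Longrightarrow> g \<in> H \<Longrightarrow> sq (f - g) = sq f - 2 * Re (ip f g) + sq g"
  using ip_cnj[of f g] by (simp add: sq_def ip_diff_left ip_diff_right diff_mem)

lemma sq_scale: "f \<in> H \<Longrightarrow> sq (scale c f) = (cmod c)\<^sup>2 * sq f"
proof -
  assume f: "f \<in> H"
  have "ip (scale c f) (scale c f) = (c * cnj c) * of_real (sq f)"
    by (simp add: ip_scale_left ip_scale_right scale_mem f ip_self[OF f])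
  also have "c * cnj c = of_real ((cmod c)\<^sup>2)"
    by (simp only: complex_norm_square)
  finally show ?thesis by (simp add: sq_def)
qed

lemma sq_minus: "f \<in> H \<Longrightarrow> sq (- f) = sq f"
  using sq_scale[of f "- 1"] by (simp add: scale_minus_one)

lemma sq_diff_commute: "f \<in> H \<Longrightarrow> g \<in> H \<Longrightarrow> sq (f - g) = sq (g - f)"
  using sq_minus[of "f - g"] by (simp add: diff_mem)

lemma parallelogram: "f \<in> H \<Longrightarrow> g \<in> H \<Longrightarrow> sq (f - g) = 2 * sq f + 2 * sq g - sq (f + g)"
  by (simp add: sq_diff sq_add)

lemma Cauchy_Schwarz_sq:
  assumes f: "f \<in> H" and g: "g \<in> H"
  shows "(cmod (ip f g))\<^sup>2 \<le> sq f * sq g"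
proof -
  define z where "z = ip f g"
  \<comment> \<open>The test vector f - t z g carries the phase of \<open>z = ip f g\<close>, so
    only the real parameter t is left. The best choice is t = 1 / sq g; when sq g = 0 the bound is
    affine in t, and the value inserted below makes it -1 unless z = 0.\<close>
  have *: "0 \<le> sq f - 2 * t * (cmod z)\<^sup>2 + t\<^sup>2 * (cmod z)\<^sup>2 * sq g" for t :: real
  proof -
    have "0 \<le> sq (f - scale (of_real t * z) g)"
      by (intro sq_nonneg diff_mem scale_mem f g)
    also have "\<dots> = sq f - 2 * Re (of_real t * (cnj z * z)) + (t * cmod z)\<^sup>2 * sq g"
      by (subst sq_diff) (simp_all add: f g scale_mem sq_scale ip_scale_right z_def[symmetric]
          norm_mult power_mult_distrib mult.assoc)
    also have "cnj z * z = of_real ((cmod z)\<^sup>2)"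
      by (simp only: complex_norm_square mult.commute)
    finally show ?thesis by (simp add: power_mult_distrib)
  qed
  show ?thesis
  proof (cases "sq g = 0")
    case True
    have "(cmod z)\<^sup>2 = 0"
    proof (rule ccontr)
      assume nz: "(cmod z)\<^sup>2 \<noteq> 0"
      have "0 \<le> sq f - 2 * ((sq f + 1) / (2 * (cmod z)\<^sup>2)) * (cmod z)\<^sup>2"
        using *[of "(sq f + 1) / (2 * (cmod z)\<^sup>2)"] True by simp
      then show False using nz by simp
    qed
    then show ?thesis using True by (simp add: z_def)
  next
    case False
    then have pos: "sq g > 0" using sq_nonneg[OF g] by simp
    have "0 \<le> sq f - 2 * (1 / sq g) * (cmod z)\<^sup>2 + (1 / sq g)\<^sup>2 * (cmod z)\<^sup>2 * sq g"
      by (rule *)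
    also have "\<dots> = sq f - (cmod z)\<^sup>2 / sq g"
      using pos by (simp add: power2_eq_square field_simps)
    finally show ?thesis using pos by (simp add: z_def field_simps)
  qed
qed

definition nrm :: "'v \<Rightarrow> real" where "nrm f = sqrt (sq f)"

lemma nrm_nonneg [simp]: "f \<in> H \<Longrightarrow> 0 \<le> nrm f"
  by (simp add: nrm_def sq_nonneg)

lemma nrm_sq: "f \<in> H \<Longrightarrow> (nrm f)\<^sup>2 = sq f"
  by (simp add: nrm_def sq_nonneg)

lemma Cauchy_Schwarz: "f \<in> H \<Longrightarrow> g \<in> H \<Longrightarrow> cmod (ip f g) \<le> nrm f * nrm g"
  using real_sqrt_le_mono[OF Cauchy_Schwarz_sq, of f g] by (simp add: nrm_def real_sqrt_mult)

lemma nrm_triangle: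
  assumes f: "f \<in> H" and g: "g \<in> H"
  shows "nrm (f + g) \<le> nrm f + nrm g"
proof (rule power2_le_imp_le)
  have "(nrm (f + g))\<^sup>2 = sq f + 2 * Re (ip f g) + sq g"
    by (simp add: nrm_sq add_mem f g sq_add)
  also have "\<dots> \<le> sq f + 2 * (nrm f * nrm g) + sq g"
    using Cauchy_Schwarz[OF f g] complex_Re_le_cmod[of "ip f g"] by linarith
  also have "\<dots> = (nrm f + nrm g)\<^sup>2"
    by (simp add: power2_sum nrm_sq f g)
  finally show "(nrm (f + g))\<^sup>2 \<le> (nrm f + nrm g)\<^sup>2" .
qed (simp add: f g)

lemma nrm_triangle_diff:
  assumes "f \<in> H" "g \<in> H" "h \<in> H"
  shows "nrm (f - h) \<le> nrm (f - g) + nrm (g - h)"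
  using nrm_triangle[of "f - g" "g - h"] assms by (simp add: diff_mem)

lemma nrm_diff_ineq:
  assumes f: "f \<in> H" and g: "g \<in> H"
  shows "\<bar>nrm f - nrm g\<bar> \<le> nrm (f - g)"
proof -
  have "nrm f \<le> nrm (f - g) + nrm g"
    using nrm_triangle[of "f - g" g] f g by (simp add: diff_mem)
  moreover have "nrm g \<le> nrm (g - f) + nrm f"
    using nrm_triangle[of "g - f" f] f g by (simp add: diff_mem)
  moreover have "nrm (g - f) = nrm (f - g)"
    using sq_diff_commute[OF f g] by (simp add: nrm_def)
  ultimately show ?thesis by linarith
qed

lemma sq_triangle: "f \<in> H \<Longrightarrow> g \<in> H \<Longrightarrow> sq (f + g) \<le> 2 * sq f + 2 * sq g"
  using parallelogram[of f g] sq_nonneg[of "f - g"] by (simp add: diff_mem)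

lemma sq_triangle_diff:
  "f \<in> H \<Longrightarrow> g \<in> H \<Longrightarrow> h \<in> H \<Longrightarrow> sq (f - h) \<le> 2 * sq (f - g) + 2 * sq (g - h)"
  using sq_triangle[of "f - g" "g - h"] by (simp add: diff_mem)

definition conv :: "(nat \<Rightarrow> 'v) \<Rightarrow> 'v \<Rightarrow> bool" where
  "conv F f \<longleftrightarrow> (\<lambda>n. sq (F n - f)) \<longlonglongrightarrow> 0"

lemma conv_nrm: "conv F f \<Longrightarrow> (\<lambda>n. nrm (F n - f)) \<longlonglongrightarrow> 0"
  unfolding conv_def nrm_def using tendsto_real_sqrt by fastforce

lemma conv_ip:
  assumes "conv F f" and F: "\<And>n. F n \<in> H" and f: "f \<in> H" and g: "g \<in> H"
  shows "(\<lambda>n. ip (F n) g) \<longlonglongrightarrow> ip f g"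
proof (subst LIM_zero_iff[symmetric], rule Lim_null_comparison)
  show "\<forall>\<^sub>F n in sequentially. norm (ip (F n) g - ip f g) \<le> nrm (F n - f) * nrm g"
  proof (rule always_eventually, rule allI)
    fix n
    have "ip (F n) g - ip f g = ip (F n - f) g"
      by (simp add: ip_diff_left F f g)
    then show "norm (ip (F n) g - ip f g) \<le> nrm (F n - f) * nrm g"
      using Cauchy_Schwarz[of "F n - f" g] F f g by (simp add: diff_mem)
  qed
  show "(\<lambda>n. nrm (F n - f) * nrm g) \<longlonglongrightarrow> 0"
    using tendsto_mult_left_zero[OF conv_nrm[OF assms(1)]] .
qed

lemma conv_ip_right:
  assumes "conv F f" and F: "\<And>n. F n \<in> H" and f: "f \<in> H" and g: "g \<in> H"
  shows "(\<lambda>n. ip g (F n)) \<longlonglongrightarrow> ip g f"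
  using tendsto_cnj[OF conv_ip[OF assms]] ip_cnj[OF g F] ip_cnj[OF g f] by simp

lemma conv_sq:
  assumes "conv F f" and F: "\<And>n. F n \<in> H" and f: "f \<in> H"
  shows "(\<lambda>n. sq (F n)) \<longlonglongrightarrow> sq f"
proof -
  have "(\<lambda>n. nrm (F n)) \<longlonglongrightarrow> nrm f"
  proof (subst LIM_zero_iff[symmetric], rule Lim_null_comparison[OF always_eventually conv_nrm[OF assms(1)]])
    show "\<forall>n. norm (nrm (F n) - nrm f) \<le> nrm (F n - f)"
      using nrm_diff_ineq[OF F f] by (simp add: F f diff_mem)
  qed
  then have "(\<lambda>n. (nrm (F n))\<^sup>2) \<longlonglongrightarrow> (nrm f)\<^sup>2"
    by (rule tendsto_power)
  then show ?thesis by (simp add: nrm_sq F f)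
qed

section \<open>Orthonormal sequences, projections and Bessel's inequality\<close>

definition orthonormal :: "(nat \<Rightarrow> 'v) \<Rightarrow> bool" where
  "orthonormal v \<longleftrightarrow> (\<forall>i. v i \<in> H) \<and> (\<forall>i j. ip (v i) (v j) = (if i = j then 1 else 0))"

definition proj :: "(nat \<Rightarrow> 'v) \<Rightarrow> nat \<Rightarrow> 'v \<Rightarrow> 'v" where
  "proj v n f = (\<Sum>i<n. scale (ip f (v i)) (v i))"

lemma orthonormal_mem: "orthonormal v \<Longrightarrow> v i \<in> H"
  by (simp add: orthonormal_def)

lemma orthonormal_ip: "orthonormal v \<Longrightarrow> ip (v i) (v j) = (if i = j then 1 else 0)"
  by (simp add: orthonormal_def)

lemma sum_scale_mem: "orthonormal v \<Longrightarrow> (\<Sum>i\<in>A. scale (c i) (v i)) \<in> H"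
  by (intro sum_mem scale_mem orthonormal_mem)

lemma ip_sum_scale:
  assumes "orthonormal v" "g \<in> H"
  shows "ip (\<Sum>i\<in>A. scale (c i) (v i)) g = (\<Sum>i\<in>A. c i * cnj (ip g (v i)))"
proof -
  have "ip (\<Sum>i\<in>A. scale (c i) (v i)) g = (\<Sum>i\<in>A. ip (scale (c i) (v i)) g)"
    by (intro ip_sum_left scale_mem orthonormal_mem assms)
  also have "\<dots> = (\<Sum>i\<in>A. c i * cnj (ip g (v i)))"
    using assms by (intro sum.cong refl) (simp add: ip_scale_left orthonormal_mem ip_cnj[of _ g])
  finally show ?thesis .
qed

lemma ip_sum_scale_basis:
  assumes "orthonormal v" "finite A"
  shows "ip (\<Sum>i\<in>A. scale (c i) (v i)) (v j) = (if j \<in> A then c j else 0)"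
proof -
  have "ip (\<Sum>i\<in>A. scale (c i) (v i)) (v j) = (\<Sum>i\<in>A. c i * cnj (ip (v j) (v i)))"
    by (rule ip_sum_scale) (simp_all add: assms orthonormal_mem)
  also have "\<dots> = (\<Sum>i\<in>A. if i = j then c i else 0)"
    by (intro sum.cong refl) (simp add: orthonormal_ip assms)
  finally have "ip (\<Sum>i\<in>A. scale (c i) (v i)) (v j) = (\<Sum>i\<in>A. if i = j then c i else 0)" .
  then show ?thesis using assms(2) by simp
qed

lemma sq_sum_scale:
  assumes v: "orthonormal v" and A: "finite A"
  shows "sq (\<Sum>i\<in>A. scale (c i) (v i)) = (\<Sum>i\<in>A. (cmod (c i))\<^sup>2)"
proof -
  have "ip (\<Sum>i\<in>A. scale (c i) (v i)) (\<Sum>i\<in>A. scale (c i) (v i)) = (\<Sum>i\<in>A. c i * cnj (c i))"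
    by (subst ip_sum_scale) (simp_all add: v A sum_scale_mem ip_sum_scale_basis)
  also have "\<dots> = of_real (\<Sum>i\<in>A. (cmod (c i))\<^sup>2)"
    by (simp add: complex_norm_square del: of_real_power)
  finally show ?thesis by (simp add: sq_def)
qed

lemma proj_mem: "orthonormal v \<Longrightarrow> proj v n f \<in> H"
  by (simp add: proj_def sum_scale_mem)

lemma ip_proj_basis: "orthonormal v \<Longrightarrow> ip (proj v n f) (v j) = (if j < n then ip f (v j) else 0)"
  unfolding proj_def using ip_sum_scale_basis[of v "{..<n}" "\<lambda>i. ip f (v i)" j] by simp

lemma ip_proj: "orthonormal v \<Longrightarrow> g \<in> H \<Longrightarrow> ip (proj v n f) g = (\<Sum>i<n. ip f (v i) * cnj (ip g (v i)))"
  by (simp add: proj_def ip_sum_scale)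

lemma sq_proj: "orthonormal v \<Longrightarrow> sq (proj v n f) = (\<Sum>i<n. (cmod (ip f (v i)))\<^sup>2)"
  by (simp add: proj_def sq_sum_scale)

lemma sq_proj_diff:
  assumes "orthonormal v" "m \<le> n"
  shows "sq (proj v n f - proj v m f) = (\<Sum>i\<in>{m..<n}. (cmod (ip f (v i)))\<^sup>2)"
proof -
  have "proj v n f - proj v m f = (\<Sum>i\<in>{m..<n}. scale (ip f (v i)) (v i))"
    using assms(2) unfolding proj_def
    by (metis (no_types, lifting) atLeast0LessThan sum_diff_nat_ivl zero_le)
  then show ?thesis using assms by (simp add: sq_sum_scale)
qed

lemma sq_minus_proj:
  assumes v: "orthonormal v" and f: "f \<in> H"
  shows "sq (f - proj v n f) = sq f - (\<Sum>i<n. (cmod (ip f (v i)))\<^sup>2)"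
proof -
  have "ip (proj v n f) f = of_real (\<Sum>i<n. (cmod (ip f (v i)))\<^sup>2)"
    by (simp add: ip_proj v f complex_norm_square del: of_real_power)
  then have "ip f (proj v n f) = of_real (\<Sum>i<n. (cmod (ip f (v i)))\<^sup>2)"
    by (subst ip_cnj) (simp_all add: f proj_mem v)
  then show ?thesis by (simp add: sq_diff f v proj_mem sq_proj)
qed

lemma Bessel:
  assumes v: "orthonormal v" and f: "f \<in> H"
  shows "(\<Sum>i<n. (cmod (ip f (v i)))\<^sup>2) \<le> sq f"
  using sq_nonneg[of "f - proj v n f"] sq_minus_proj[OF v f] by (simp add: diff_mem f v proj_mem)

lemma Bessel_summable:
  assumes "orthonormal v" "f \<in> H"
  shows "summable (\<lambda>i. (cmod (ip f (v i)))\<^sup>2)"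
  by (rule summableI_nonneg_bounded[OF _ Bessel[OF assms]]) simp

end

section \<open>Completeness: Riesz-Fischer and Parseval\<close>

locale hilbert_ip = semi_ip +
  assumes complete: "\<And>F. (\<And>n. F n \<in> H) \<Longrightarrow>
    (\<And>e. e > 0 \<Longrightarrow> \<exists>N. \<forall>m\<ge>N. \<forall>n\<ge>N. sq (F m - F n) < e) \<Longrightarrow> \<exists>f\<in>H. conv F f"
begin

lemma Riesz_Fischer:
  assumes v: "orthonormal v" and c: "summable (\<lambda>i. (cmod (c i))\<^sup>2)"
  shows "\<exists>f\<in>H. \<forall>i. ip f (v i) = c i"
proof -
  define F where "F n = (\<Sum>i<n. scale (c i) (v i))" for n
  have FH: "F n \<in> H" for n
    by (simp add: F_def sum_scale_mem v)
  have Fdiff: "F m - F n = (\<Sum>i\<in>{n..<m}. scale (c i) (v i))" if "n \<le> m" for m n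
    unfolding F_def using that
    by (metis (no_types, lifting) atLeast0LessThan sum_diff_nat_ivl zero_le)
  have Fsq: "sq (F m - F n) = (\<Sum>i\<in>{n..<m}. (cmod (c i))\<^sup>2)" if "n \<le> m" for m n
    by (simp add: Fdiff that sq_sum_scale v)
  have "\<exists>f\<in>H. conv F f"
  proof (rule complete[OF FH])
    fix e :: real assume "e > 0"
    then obtain N where N: "\<And>m n. m \<ge> N \<Longrightarrow> norm (\<Sum>i\<in>{m..<n}. (cmod (c i))\<^sup>2) < e"
      using c unfolding summable_Cauchy by blast
    have "sq (F m - F n) < e" if "m \<ge> N" "n \<ge> N" for m n
    proof (cases "n \<le> m")
      case True
      then show ?thesis using N[of n m] that by (simp add: Fsq)
    next
      case False
      then show ?thesis using N[of m n] that sq_diff_commute[OF FH[of m] FH[of n]] by (simp add: Fsq)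
    qed
    then show "\<exists>N. \<forall>m\<ge>N. \<forall>n\<ge>N. sq (F m - F n) < e" by blast
  qed
  then obtain f where f: "f \<in> H" "conv F f" by blast
  have "ip f (v i) = c i" for i
  proof (rule LIMSEQ_unique[OF conv_ip[OF f(2) FH f(1) orthonormal_mem[OF v]]])
    show "(\<lambda>n. ip (F n) (v i)) \<longlonglongrightarrow> c i"
    proof (rule tendsto_eventually, unfold eventually_sequentially, intro exI[of _ "Suc i"] allI impI)
      fix n assume "Suc i \<le> n"
      then show "ip (F n) (v i) = c i"
        by (simp add: F_def ip_sum_scale_basis v)
    qed
  qed
  then show ?thesis using f by blast
qed

text \<open>By Bessel the projections are Cauchy, so they converge to some g with the same
  coefficients as f. Totality gives only sq (g - f) = 0, not g = f, but the seminorm cannot tell the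
  two apart, so f is a limit as well.\<close>

lemma proj_conv:
  assumes v: "orthonormal v" and total: "\<And>f. f \<in> H \<Longrightarrow> (\<And>i. ip f (v i) = 0) \<Longrightarrow> sq f = 0"
    and f: "f \<in> H"
  shows "conv (\<lambda>n. proj v n f) f"
proof -
  have PH: "proj v n f \<in> H" for n by (simp add: proj_mem v)
  have "\<exists>g\<in>H. conv (\<lambda>n. proj v n f) g"
  proof (rule complete[OF PH])
    fix e :: real assume "e > 0"
    then obtain N where N: "\<And>m n. m \<ge> N \<Longrightarrow> norm (\<Sum>i\<in>{m..<n}. (cmod (ip f (v i)))\<^sup>2) < e"
      using Bessel_summable[OF v f] unfolding summable_Cauchy by blast
    have "sq (proj v m f - proj v n f) < e" if "m \<ge> N" "n \<ge> N" for m n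
      using N[of n m] N[of m n] that sq_diff_commute[OF PH[of m] PH[of n]]
      by (cases "n \<le> m") (simp_all add: sq_proj_diff v sum_nonneg)
    then show "\<exists>N. \<forall>m\<ge>N. \<forall>n\<ge>N. sq (proj v m f - proj v n f) < e" by blast
  qed
  then obtain g where g: "g \<in> H" "conv (\<lambda>n. proj v n f) g" by blast
  have "ip g (v i) = ip f (v i)" for i
  proof (rule LIMSEQ_unique[OF conv_ip[OF g(2) PH g(1) orthonormal_mem[OF v]]])
    show "(\<lambda>n. ip (proj v n f) (v i)) \<longlonglongrightarrow> ip f (v i)"
    proof (rule tendsto_eventually, unfold eventually_sequentially, intro exI[of _ "Suc i"] allI impI)
      fix n assume "Suc i \<le> n"
      then show "ip (proj v n f) (v i) = ip f (v i)"
        by (simp add: ip_proj_basis v)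
    qed
  qed
  then have z: "sq (g - f) = 0"
    by (intro total) (simp_all add: diff_mem ip_diff_left f g orthonormal_mem[OF v])
  have "(\<lambda>n. sq (proj v n f - f)) \<longlonglongrightarrow> 0"
  proof (rule Lim_null_comparison[OF always_eventually])
    show "\<forall>n. norm (sq (proj v n f - f)) \<le> 2 * sq (proj v n f - g)"
      using sq_triangle_diff[OF PH g(1) f] z by (simp add: sq_nonneg diff_mem PH f)
    show "(\<lambda>n. 2 * sq (proj v n f - g)) \<longlonglongrightarrow> 0"
      using tendsto_mult_right_zero[OF g(2)[unfolded conv_def]] .
  qed
  then show ?thesis by (simp add: conv_def)
qed

lemma Parseval:
  assumes v: "orthonormal v" and total: "\<And>f. f \<in> H \<Longrightarrow> (\<And>i. ip f (v i) = 0) \<Longrightarrow> sq f = 0"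
    and f: "f \<in> H" and g: "g \<in> H"
  shows "(\<lambda>i. ip f (v i) * cnj (ip g (v i))) sums ip f g"
  using conv_ip[OF proj_conv[OF v total f] proj_mem[OF v] f g]
  by (simp add: sums_def ip_proj v g)

lemma Parseval_sq:
  assumes v: "orthonormal v" and total: "\<And>f. f \<in> H \<Longrightarrow> (\<And>i. ip f (v i) = 0) \<Longrightarrow> sq f = 0"
    and f: "f \<in> H"
  shows "(\<lambda>i. (cmod (ip f (v i)))\<^sup>2) sums sq f"
  using conv_sq[OF proj_conv[OF v total f] proj_mem[OF v] f]
  by (simp add: sums_def sq_proj v)

end

subsection \<open>Simultaneous diagonalisation of two forms\<close>

text \<open>Gaussian elimination, one equation at a time: the unknown \<open>p\<close> with nonzero
  entry in row \<open>j\<close> is eliminated from the other rows, and a solution of the smaller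
  system \<open>A'\<close> determines \<open>c p\<close>.\<close>

lemma underdetermined_system:
  fixes A :: "'i \<Rightarrow> 'j \<Rightarrow> 'a::field"
  assumes "finite J" "finite I" "card J < card I"
  shows "\<exists>c. (\<exists>i\<in>I. c i \<noteq> 0) \<and> (\<forall>j\<in>J. (\<Sum>i\<in>I. c i * A i j) = 0)"
  using assms
proof (induction J arbitrary: I A rule: finite_induct)
  case empty
  then have "I \<noteq> {}" by auto
  then show ?case by (intro exI[of _ "\<lambda>_. 1"]) auto
next
  case (insert j J)
  show ?case
  proof (cases "\<forall>i\<in>I. A i j = 0")
    case True
    have "card J < card I" using insert by simp
    from insert.IH[OF insert.prems(1) this, of A] obtain c where
      "\<exists>i\<in>I. c i \<noteq> 0" "\<forall>j\<in>J. (\<Sum>i\<in>I. c i * A i j) = 0" by blast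
    then show ?thesis using True by (intro exI[of _ c]) auto
  next
    case False
    then obtain p where p: "p \<in> I" "A p j \<noteq> 0" by blast
    define A' where "A' = (\<lambda>i k. A i k - A i j / A p j * A p k)"
    have "finite (I - {p})" "card J < card (I - {p})"
      using insert p by auto
    from insert.IH[OF this, of A'] obtain c where c:
      "\<exists>i\<in>I - {p}. c i \<noteq> 0" "\<forall>k\<in>J. (\<Sum>i\<in>I - {p}. c i * A' i k) = 0" by blast
    define d where "d = c(p := - (\<Sum>i\<in>I - {p}. c i * A i j) / A p j)"
    have split: "(\<Sum>i\<in>I. d i * A i k) = (\<Sum>i\<in>I - {p}. c i * A i k) + d p * A p k" for k
    proof -
      have "(\<Sum>i\<in>I. d i * A i k) = d p * A p k + (\<Sum>i\<in>I - {p}. d i * A i k)"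
        by (rule sum.remove) (use insert p in auto)
      also have "(\<Sum>i\<in>I - {p}. d i * A i k) = (\<Sum>i\<in>I - {p}. c i * A i k)"
        by (intro sum.cong) (auto simp: d_def)
      finally show ?thesis by simp
    qed
    have "(\<Sum>i\<in>I. d i * A i k) = 0" if "k \<in> insert j J" for k
    proof (cases "k = j")
      case True
      then show ?thesis using p by (simp add: split) (simp add: d_def)
    next
      case False
      then have "k \<in> J" using that by simp
      have "(\<Sum>i\<in>I - {p}. c i * A' i k) =
          (\<Sum>i\<in>I - {p}. c i * A i k) - (\<Sum>i\<in>I - {p}. c i * A i j) / A p j * A p k"
        by (simp add: A'_def algebra_simps sum_subtractf sum_distrib_left sum_distrib_right sum_divide_distrib)
      then show ?thesis using c(2) \<open>k \<in> J\<close> by (simp add: split) (simp add: d_def)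
    qed
    moreover have "\<exists>i\<in>I. d i \<noteq> 0"
      using c(1) by (auto simp: d_def)
    ultimately show ?thesis by blast
  qed
qed

text \<open>
  \<open>a\<close> plays the role of the energy form and \<open>b\<close> of the ambient inner product; \<open>compact\<close> says that the
  \<open>a\<close>-unit ball is totally bounded for \<open>b\<close>.
\<close>

locale compact_pair = a: hilbert_ip V scale a + b: semi_ip V scale b
  for V :: "'v::ab_group_add set" and scale :: "complex \<Rightarrow> 'v \<Rightarrow> 'v"
    and a b :: "'v \<Rightarrow> 'v \<Rightarrow> complex" +
  fixes e :: "nat \<Rightarrow> 'v" and K :: real
  assumes e: "b.orthonormal e"
    and b_le: "\<And>f. f \<in> V \<Longrightarrow> b.sq f \<le> K * a.sq f"
    and compact: "\<And>\<epsilon>. \<epsilon> > 0 \<Longrightarrow>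
      \<exists>N. \<forall>f\<in>V. b.sq f \<le> (\<Sum>i<N. (cmod (b f (e i)))\<^sup>2) + \<epsilon> * a.sq f"
    and null: "\<And>f. f \<in> V \<Longrightarrow> b.sq f = 0 \<Longrightarrow> a.sq f = 0"
begin

lemma K_pos: "0 < K"
proof (rule ccontr)
  assume "\<not> 0 < K"
  then have "K * a.sq (e 0) \<le> 0"
    by (intro mult_nonpos_nonneg a.sq_nonneg b.orthonormal_mem[OF e]) auto
  moreover have "b.sq (e 0) = 1"
    using e by (simp add: b.sq_def b.orthonormal_def)
  ultimately show False using b_le[OF b.orthonormal_mem[OF e], of 0] by simp
qed

lemma a_conv_imp_b_conv:
  assumes "a.conv F f" "\<And>n. F n \<in> V" "f \<in> V"
  shows "b.conv F f"
  unfolding b.conv_def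
proof (rule Lim_null_comparison[OF always_eventually])
  show "\<forall>n. norm (b.sq (F n - f)) \<le> K * a.sq (F n - f)"
    using b_le assms by (simp add: a.diff_mem b.sq_nonneg)
  show "(\<lambda>n. K * a.sq (F n - f)) \<longlonglongrightarrow> 0"
    using tendsto_mult_right_zero[OF assms(1)[unfolded a.conv_def]] .
qed

text \<open>Bounded energy gives bounded coefficients with respect to \<open>e\<close>, and a
  diagonal subsequence makes each of them converge. The hypothesis \<open>compact\<close> reduces
  the b-distance to finitely many coefficients plus a small multiple of the energy, so the
  subsequence is b-Cauchy.\<close>

lemma compact_subseq:
  assumes F: "\<And>n. F n \<in> V" and B: "\<And>n. a.sq (F n) \<le> B"
  shows "\<exists>r. strict_mono (r :: nat \<Rightarrow> nat) \<and>
    (\<forall>\<epsilon>>0. \<exists>N. \<forall>m\<ge>N. \<forall>n\<ge>N. b.sq (F (r m) - F (r n)) < \<epsilon>)"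
proof -
  have B0: "B \<ge> 0" using B[of 0] a.sq_nonneg[OF F[of 0]] by linarith
  have ee: "e i \<in> V" for i using e by (rule b.orthonormal_mem)
  have bdd: "cmod (b (F n) (e i)) \<le> sqrt (K * B)" for n i
  proof (rule real_le_rsqrt)
    have "(cmod (b (F n) (e i)))\<^sup>2 \<le> b.sq (F n) * b.sq (e i)"
      by (rule b.Cauchy_Schwarz_sq[OF F ee])
    also have "b.sq (e i) = 1"
      using e by (simp add: b.sq_def b.orthonormal_def)
    also have "b.sq (F n) * 1 \<le> K * a.sq (F n)"
      using b_le[OF F] by simp
    also have "\<dots> \<le> K * B"
      using K_pos B by (intro mult_left_mono) auto
    finally show "(cmod (b (F n) (e i)))\<^sup>2 \<le> K * B" .
  qed
  interpret S: subseqs "\<lambda>i s. convergent (\<lambda>n. b (F (s n)) (e i))"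
  proof
    fix i and s :: "nat \<Rightarrow> nat"
    have "bounded (range (\<lambda>n. b (F (s n)) (e i)))"
      using bdd by (auto simp: bounded_iff)
    from bounded_imp_convergent_subsequence[OF this]
    show "\<exists>r'. strict_mono r' \<and> convergent (\<lambda>n. b (F ((s \<circ> r') n)) (e i))"
      by (auto simp: convergent_def o_def)
  qed
  define r where "r = S.diagseq"
  have conv: "Cauchy (\<lambda>n. b (F (r n)) (e i))" for i
  proof -
    have "convergent (\<lambda>n. b (F ((S.diagseq \<circ> (+) (Suc i)) n)) (e i))"
      by (rule S.diagseq_holds) (auto simp: o_def dest: convergent_subseq_convergent)
    then have "convergent (\<lambda>n. b (F (r (n + Suc i))) (e i))"
      by (simp add: r_def o_def add.commute)
    then have "convergent (\<lambda>n. b (F (r n)) (e i))"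
      using convergent_ignore_initial_segment[of "\<lambda>n. b (F (r n)) (e i)" "Suc i"] by blast
    then show ?thesis by (rule convergent_Cauchy)
  qed
  have "\<exists>N. \<forall>m\<ge>N. \<forall>n\<ge>N. b.sq (F (r m) - F (r n)) < \<epsilon>" if "\<epsilon> > 0" for \<epsilon>
  proof -
    \<comment> \<open>Differences of members of the sequence have energy at most
      \<open>4 * B\<close>, so this \<delta> keeps the energy term below \<epsilon>/2; the summand 1
      avoids division by 0. Below, \<eta> is such that N coefficients of size \<eta> contribute less
      than the other \<epsilon>/2.\<close>
    define \<delta> where "\<delta> = \<epsilon> / (2 * (4 * B + 1))"
    have "\<delta> > 0" using that B0 by (simp add: \<delta>_def)
    then obtain N where N: "\<And>f. f \<in> V \<Longrightarrow> b.sq f \<le> (\<Sum>i<N. (cmod (b f (e i)))\<^sup>2) + \<delta> * a.sq f"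
      using compact by meson
    define \<eta> where "\<eta> = sqrt (\<epsilon> / (2 * (real N + 1)))"
    have \<eta>: "\<eta> > 0" using that by (simp add: \<eta>_def)
    have "\<forall>i. \<exists>M. \<forall>m\<ge>M. \<forall>n\<ge>M. cmod (b (F (r m)) (e i) - b (F (r n)) (e i)) < \<eta>"
      using conv \<eta> unfolding Cauchy_def dist_norm by blast
    then obtain M where M: "\<And>i m n. m \<ge> M i \<Longrightarrow> n \<ge> M i \<Longrightarrow>
        cmod (b (F (r m)) (e i) - b (F (r n)) (e i)) < \<eta>" by metis
    define L where "L = (\<Sum>i<N. M i)"
    have LM: "M i \<le> L" if "i < N" for i
      unfolding L_def using that by (intro member_le_sum) auto
    have "b.sq (F (r m) - F (r n)) < \<epsilon>" if mn: "m \<ge> L" "n \<ge> L" for m n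
    proof -
      have "(\<Sum>i<N. (cmod (b (F (r m) - F (r n)) (e i)))\<^sup>2) \<le> (\<Sum>i<N. \<eta>\<^sup>2)"
      proof (intro sum_mono power_mono)
        fix i assume "i \<in> {..<N}"
        then have "cmod (b (F (r m)) (e i) - b (F (r n)) (e i)) < \<eta>"
          using LM[of i] mn by (intro M) auto
        then show "cmod (b (F (r m) - F (r n)) (e i)) \<le> \<eta>"
          by (simp add: b.ip_diff_left F ee)
      qed simp
      also have "\<dots> = real N * (\<epsilon> / (2 * (real N + 1)))"
        using \<open>\<epsilon> > 0\<close> by (simp add: \<eta>_def)
      also have "\<dots> < \<epsilon> / 2"
        using \<open>\<epsilon> > 0\<close> by (simp add: field_simps)
      finally have 1: "(\<Sum>i<N. (cmod (b (F (r m) - F (r n)) (e i)))\<^sup>2) < \<epsilon> / 2" .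
      have "a.sq (F (r m) - F (r n)) \<le> 2 * a.sq (F (r m)) + 2 * a.sq (F (r n))"
        using a.parallelogram[OF F F, of "r m" "r n"] a.sq_nonneg[OF a.add_mem[OF F F], of "r m" "r n"]
        by linarith
      also have "\<dots> \<le> 4 * B" using B[of "r m"] B[of "r n"] by linarith
      finally have "\<delta> * a.sq (F (r m) - F (r n)) \<le> \<delta> * (4 * B)"
        using \<open>\<delta> > 0\<close> by (intro mult_left_mono) auto
      also have "\<dots> \<le> \<epsilon> / 2"
        using B0 that \<open>\<epsilon> > 0\<close> by (simp add: \<delta>_def field_simps)
      finally show ?thesis
        using N[OF a.diff_mem[OF F F], of "r m" "r n"] 1 by linarith
    qed
    then show ?thesis by blast
  qed
  then show ?thesis using S.subseq_diagseq r_def by blast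
qed

text \<open>Two distinct members of a b-orthonormal sequence have squared distance 2, so no
  subsequence is b-Cauchy; by compactness their energies cannot stay bounded. This is what forces
  the eigenvalues to infinity.\<close>

lemma orthonormal_unbounded:
  assumes v: "b.orthonormal v"
  shows "\<exists>n. a.sq (v n) > Z"
proof (rule ccontr)
  assume "\<not> ?thesis"
  then have le: "a.sq (v n) \<le> Z" for n by (simp add: not_less)
  have vV: "v n \<in> V" for n using v by (rule b.orthonormal_mem)
  obtain r where r: "strict_mono (r :: nat \<Rightarrow> nat)"
    "\<forall>\<epsilon>>0. \<exists>N. \<forall>m\<ge>N. \<forall>n\<ge>N. b.sq (v (r m) - v (r n)) < \<epsilon>"
    using compact_subseq[of v, OF vV le] by blast
  obtain N where N: "\<forall>m\<ge>N. \<forall>n\<ge>N. b.sq (v (r m) - v (r n)) < 1"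
    using r(2) zero_less_one by blast
  have "r (Suc N) \<noteq> r N" using strict_monoD[OF r(1), of N "Suc N"] by simp
  moreover have "b.sq (v i) = 1" for i
    using b.orthonormal_ip[OF v, of i i] by (simp add: b.sq_def)
  ultimately have "b.sq (v (r (Suc N)) - v (r N)) = 2"
    by (simp add: b.sq_diff vV b.orthonormal_ip[OF v])
  moreover have "b.sq (v (r (Suc N)) - v (r N)) < 1"
    using N[rule_format, of "Suc N" N] by simp
  ultimately show False by simp
qed

text \<open>The Rayleigh quotient is minimised on the b-orthogonal complement \<open>W\<close> of
  the given vectors. Compactness makes a minimising sequence b-Cauchy along a subsequence, and the
  parallelogram law upgrades this to a-Cauchy: the sum of two members lies in \<open>W\<close>, so
  its energy is at least \<mu> times its b-square, which is close to 4. No weak convergence is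
  needed.\<close>

lemma minimiser:
  assumes v: "\<And>i. i < n \<Longrightarrow> v i \<in> V"
    and f0: "f0 \<in> V" "b.sq f0 > 0" "\<And>i. i < n \<Longrightarrow> b f0 (v i) = 0"
  shows "\<exists>y\<in>V. (\<forall>i<n. b y (v i) = 0) \<and> b.sq y = 1 \<and>
    (\<forall>f\<in>V. (\<forall>i<n. b f (v i) = 0) \<longrightarrow> a.sq y * b.sq f \<le> a.sq f)"
proof -
  define W where "W = {f \<in> V. \<forall>i<n. b f (v i) = 0}"
  have WV: "f \<in> V" if "f \<in> W" for f using that by (simp add: W_def)
  have W_add: "f + g \<in> W" if "f \<in> W" "g \<in> W" for f g
    using that v by (simp add: W_def a.add_mem b.ip_add_left)
  have W_scale: "scale c f \<in> W" if "f \<in> W" for c f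
    using that v by (simp add: W_def a.scale_mem b.ip_scale_left)
  have normalise: "b.sq (scale (1 / sqrt (b.sq f)) f) = 1"
    "a.sq (scale (1 / sqrt (b.sq f)) f) = a.sq f / b.sq f" if "f \<in> W" "b.sq f > 0" for f
    using that WV by (simp_all add: b.sq_scale a.sq_scale norm_divide power_divide)
  define A where "A = {a.sq f | f. f \<in> W \<and> b.sq f = 1}"
  have "f0 \<in> W" using f0 by (simp add: W_def)
  then have "a.sq (scale (1 / sqrt (b.sq f0)) f0) \<in> A"
    using normalise(1)[of f0] f0(2) W_scale[of f0] unfolding A_def by blast
  then have Ane: "A \<noteq> {}" by auto
  have Abdd: "bdd_below A"
    by (rule bdd_belowI[of _ 0]) (auto simp: A_def a.sq_nonneg WV)
  define \<mu> where "\<mu> = Inf A"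
  have \<mu>: "\<mu> * b.sq f \<le> a.sq f" if "f \<in> W" for f
  proof (cases "b.sq f = 0")
    case True
    then show ?thesis using a.sq_nonneg WV that by simp
  next
    case False
    then have pos: "b.sq f > 0" using b.sq_nonneg[OF WV[OF that]] by simp
    have "a.sq f / b.sq f \<in> A"
      using normalise[OF that pos] W_scale[OF that] unfolding A_def by (metis (mono_tags, lifting) mem_Collect_eq)
    then have "\<mu> \<le> a.sq f / b.sq f"
      unfolding \<mu>_def by (rule cInf_lower[OF _ Abdd])
    then show ?thesis using pos by (simp add: field_simps)
  qed
  have \<mu>0: "\<mu> \<ge> 0"
    unfolding \<mu>_def by (rule cInf_greatest[OF Ane]) (auto simp: A_def a.sq_nonneg WV)
  have "\<exists>f. f \<in> W \<and> b.sq f = 1 \<and> a.sq f < \<mu> + inverse (real (Suc m))" for m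
  proof -
    have "\<exists>x\<in>A. x < \<mu> + inverse (real (Suc m))"
      using cInf_lessD[OF Ane, of "\<mu> + inverse (real (Suc m))"] by (simp add: \<mu>_def)
    then show ?thesis by (auto simp: A_def)
  qed
  then obtain y where y: "\<And>m. y m \<in> W" "\<And>m. b.sq (y m) = 1"
    "\<And>m. a.sq (y m) < \<mu> + inverse (real (Suc m))" by metis
  have yV: "y m \<in> V" for m using y(1) WV by blast
  have "a.sq (y m) \<le> \<mu> + 1" for m
    using y(3)[of m] by (smt (verit) inverse_le_1_iff of_nat_0_less_iff of_nat_Suc of_nat_0_le_iff)
  from compact_subseq[of y, OF yV this] obtain r where r: "strict_mono (r :: nat \<Rightarrow> nat)"
    "\<forall>\<epsilon>>0. \<exists>N. \<forall>m\<ge>N. \<forall>n\<ge>N. b.sq (y (r m) - y (r n)) < \<epsilon>" by blast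
  have yr: "a.sq (y (r m)) < \<mu> + inverse (real (Suc m))" for m
  proof -
    have "inverse (real (Suc (r m))) \<le> inverse (real (Suc m))"
      using seq_suble[OF r(1), of m] by (intro le_imp_inverse_le) auto
    then show ?thesis using y(3)[of "r m"] by linarith
  qed
  have "\<exists>f\<in>V. a.conv (\<lambda>m. y (r m)) f"
  proof (rule a.complete[OF yV])
    fix \<epsilon> :: real assume "\<epsilon> > 0"
    then have "\<epsilon> / (2 * (\<mu> + 1)) > 0" using \<mu>0 by simp
    from r(2)[rule_format, OF this] obtain N1 where N1: "\<And>m n. m \<ge> N1 \<Longrightarrow> n \<ge> N1 \<Longrightarrow>
        b.sq (y (r m) - y (r n)) < \<epsilon> / (2 * (\<mu> + 1))" by blast
    obtain N2 where N2: "inverse (real (Suc N2)) < \<epsilon> / 8"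
      using reals_Archimedean[of "\<epsilon> / 8"] \<open>\<epsilon> > 0\<close> by auto
    have "a.sq (y (r m) - y (r n)) < \<epsilon>" if mn: "m \<ge> max N1 N2" "n \<ge> max N1 N2" for m n
    proof -
      have inv: "inverse (real (Suc k)) < \<epsilon> / 8" if "k \<ge> max N1 N2" for k
      proof -
        have "inverse (real (Suc k)) \<le> inverse (real (Suc N2))"
          using that by (intro le_imp_inverse_le) auto
        then show ?thesis using N2 by linarith
      qed
      have *: "\<mu> * b.sq (y (r m) + y (r n)) \<le> a.sq (y (r m) + y (r n))"
        by (intro \<mu> W_add y)
      \<comment> \<open>Inserted into the parallelogram law of \<open>a\<close>, this leaves the two
        excesses over \<mu>, each counted twice, and \<mu> times the b-distance; each group is at
        most \<epsilon>/2.\<close>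
      have **: "b.sq (y (r m) + y (r n)) = 4 - b.sq (y (r m) - y (r n))"
        using b.parallelogram[OF yV yV, of "r m" "r n"] y(2) by simp
      have "\<mu> * b.sq (y (r m) - y (r n)) \<le> (\<mu> + 1) * b.sq (y (r m) - y (r n))"
        by (intro mult_right_mono b.sq_nonneg a.diff_mem yV) auto
      also have "\<dots> < (\<mu> + 1) * (\<epsilon> / (2 * (\<mu> + 1)))"
        using N1[of m n] mn \<mu>0 by (intro mult_strict_left_mono) auto
      also have "\<dots> = \<epsilon> / 2" using \<mu>0 by (simp add: field_simps)
      finally have "\<mu> * b.sq (y (r m) - y (r n)) < \<epsilon> / 2" .
      moreover have "\<mu> * b.sq (y (r m) + y (r n)) = 4 * \<mu> - \<mu> * b.sq (y (r m) - y (r n))"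
        by (simp add: ** algebra_simps)
      ultimately show ?thesis
        using a.parallelogram[OF yV yV, of "r m" "r n"] * yr[of m] yr[of n] inv[of m] inv[of n] mn
        by linarith
    qed
    then show "\<exists>N. \<forall>m\<ge>N. \<forall>n\<ge>N. a.sq (y (r m) - y (r n)) < \<epsilon>" by blast
  qed
  then obtain z where z: "z \<in> V" "a.conv (\<lambda>m. y (r m)) z" by blast
  have zb: "b.conv (\<lambda>m. y (r m)) z"
    by (rule a_conv_imp_b_conv[OF z(2) yV z(1)])
  have "b z (v i) = 0" if "i < n" for i
  proof (rule LIMSEQ_unique[OF b.conv_ip[OF zb yV z(1) v[OF that]]])
    show "(\<lambda>m. b (y (r m)) (v i)) \<longlonglongrightarrow> 0"
      using y(1) that by (simp add: W_def)
  qed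
  moreover have "b.sq z = 1"
    using LIMSEQ_unique[OF b.conv_sq[OF zb yV z(1)], of 1] y(2) by simp
  moreover have "a.sq z \<le> \<mu>"
  proof (rule LIMSEQ_le[OF a.conv_sq[OF z(2) yV z(1)]])
    show "(\<lambda>m. \<mu> + inverse (real (Suc m))) \<longlonglongrightarrow> \<mu>"
      using tendsto_add[OF tendsto_const LIMSEQ_inverse_real_of_nat, of \<mu>] by simp
    show "\<exists>N. \<forall>m\<ge>N. a.sq (y (r m)) \<le> \<mu> + inverse (real (Suc m))"
      using yr less_imp_le by blast
  qed
  moreover have "a.sq z * b.sq f \<le> a.sq f" if "f \<in> W" for f
    using \<mu>[OF that] mult_right_mono[OF \<open>a.sq z \<le> \<mu>\<close> b.sq_nonneg[OF WV[OF that]]] by linarith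
  ultimately show ?thesis using z(1) unfolding W_def by blast
qed

text \<open>Minimality says that the form a - a.sq(y) b is positive semidefinite on
  \<open>W\<close>, and it vanishes at y. Its own Cauchy-Schwarz inequality then makes it vanish at
  every pair (f, y), so no derivative of the quotient is taken.\<close>

lemma Euler_Lagrange:
  assumes v: "\<And>i. i < n \<Longrightarrow> v i \<in> V"
    and y: "y \<in> V" "\<And>i. i < n \<Longrightarrow> b y (v i) = 0" "b.sq y = 1"
    and min: "\<And>f. f \<in> V \<Longrightarrow> (\<And>i. i < n \<Longrightarrow> b f (v i) = 0) \<Longrightarrow> a.sq y * b.sq f \<le> a.sq f"
    and f: "f \<in> V" "\<And>i. i < n \<Longrightarrow> b f (v i) = 0"
  shows "a f y = of_real (a.sq y) * b f y"
proof -
  define W where "W = {f \<in> V. \<forall>i<n. b f (v i) = 0}"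
  interpret q: semi_ip W scale "\<lambda>f g. a f g - of_real (a.sq y) * b f g"
  proof
    fix f g assume "f \<in> W" "g \<in> W"
    then have "f \<in> V" "g \<in> V" by (auto simp: W_def)
    then show "a f g - of_real (a.sq y) * b f g = cnj (a g f - of_real (a.sq y) * b g f)"
      using a.ip_cnj[of f g] b.ip_cnj[of f g] by simp
  next
    fix f assume "f \<in> W"
    then have "a.sq y * b.sq f \<le> a.sq f" by (auto simp: W_def intro: min)
    then show "0 \<le> Re (a f f - of_real (a.sq y) * b f f)"
      by (simp add: a.sq_def b.sq_def)
  qed (auto simp: W_def a.zero_mem a.add_mem a.scale_mem a.scale_scale a.scale_minus_one
      a.ip_add_left b.ip_add_left a.ip_scale_left b.ip_scale_left b.ip_zero_left v algebra_simps)
  have "q.sq y = 0"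
    unfolding q.sq_def using y(3) by (simp add: a.sq_def b.sq_def)
  then have "a f y - of_real (a.sq y) * b f y = 0"
    using q.Cauchy_Schwarz_sq[of f y] f y by (simp add: W_def)
  then show ?thesis by simp
qed

text \<open>There are n + 1 free coefficients and n conditions; orthonormality of \<open>g\<close>
  turns a nontrivial solution into a vector of positive square. It supplies an admissible vector for
  the next minimisation and drives both min-max bounds.\<close>

lemma exists_orthogonal:
  assumes v: "\<And>i. i < n \<Longrightarrow> v i \<in> V" and g: "b.orthonormal g"
  shows "\<exists>c. b.sq (\<Sum>i\<le>n. scale (c i) (g i)) > 0 \<and>
    (\<forall>j<n. b (\<Sum>i\<le>n. scale (c i) (g i)) (v j) = 0)"
proof -
  obtain c where c: "\<exists>i\<in>{..n}. c i \<noteq> 0" "\<forall>j\<in>{..<n}. (\<Sum>i\<in>{..n}. c i * cnj (b (v j) (g i))) = 0"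
    using underdetermined_system[of "{..<n}" "{..n}" "\<lambda>i j. cnj (b (v j) (g i))"] by auto
  have "0 < (\<Sum>i\<le>n. (cmod (c i))\<^sup>2)"
    using c(1) by (auto intro: sum_pos2)
  then show ?thesis
    using c(2) v by (intro exI[of _ c]) (simp add: b.sq_sum_scale b.ip_sum_scale g)
qed

lemma spectral:
  shows "\<exists>v \<mu>. b.orthonormal v \<and> incseq \<mu> \<and> (\<forall>k. 0 < \<mu> k) \<and> filterlim \<mu> at_top sequentially \<and>
    (\<forall>k. \<forall>f\<in>V. a f (v k) = of_real (\<mu> k) * b f (v k)) \<and>
    (\<forall>k. \<forall>f\<in>V. (\<forall>i<k. b f (v i) = 0) \<longrightarrow> \<mu> k * b.sq f \<le> a.sq f)"
proof -
  \<comment> \<open>\<open>P v n y\<close> looks only at \<open>v i\<close> for i < n, so the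
    eigenvectors can be chosen by well-founded recursion.\<close>
  define P where "P v n y \<longleftrightarrow> y \<in> V \<and> (\<forall>i<n. b y (v i) = 0) \<and> b.sq y = 1 \<and>
    (\<forall>f\<in>V. (\<forall>i<n. b f (v i) = 0) \<longrightarrow> a.sq y * b.sq f \<le> a.sq f)" for v and n :: nat and y
  have PD: "y \<in> V" "i < n \<Longrightarrow> b y (v i) = 0" "b.sq y = 1"
      "f \<in> V \<Longrightarrow> (\<And>i. i < n \<Longrightarrow> b f (v i) = 0) \<Longrightarrow> a.sq y * b.sq f \<le> a.sq f"
    if "P v n y" for v n y i f
    using that unfolding P_def by blast+
  have "\<exists>v. \<forall>n. P v n (v n)"
  proof (rule dependent_wellorder_choice)
    fix v w :: "nat \<Rightarrow> 'v" and n y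
    assume "\<And>i. i < n \<Longrightarrow> v i = w i"
    then show "P v n y = P w n y" by (simp add: P_def)
  next
    fix n and v :: "nat \<Rightarrow> 'v"
    assume "\<And>i. i < n \<Longrightarrow> P v i (v i)"
    then have v: "\<And>i. i < n \<Longrightarrow> v i \<in> V" by (rule PD(1))
    from exists_orthogonal[of n v, OF v e] obtain c where c: "b.sq (\<Sum>i\<le>n. scale (c i) (e i)) > 0"
      "\<And>j. j < n \<Longrightarrow> b (\<Sum>i\<le>n. scale (c i) (e i)) (v j) = 0" by blast
    show "\<exists>y. P v n y"
      unfolding P_def Bex_def[symmetric] by (rule minimiser[OF v b.sum_scale_mem[OF e] c])
  qed
  then obtain v where P: "\<And>n. P v n (v n)" by blast
  define \<mu> where "\<mu> k = a.sq (v k)" for k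
  have vV: "v k \<in> V" and vsq: "b.sq (v k) = 1" for k using PD(1,3)[OF P[of k]] by blast+
  have orth: "b (v i) (v j) = 0" if "i \<noteq> j" for i j
    using PD(2)[OF P[of i], of j] PD(2)[OF P[of j], of i] that b.ip_cnj[OF vV vV, of i j]
    by (cases i j rule: linorder_cases) simp_all
  have min: "\<mu> k * b.sq f \<le> a.sq f" if "f \<in> V" "\<forall>i<k. b f (v i) = 0" for k f
    unfolding \<mu>_def by (rule PD(4)[OF P that(1)]) (use that in simp)
  have vo: "b.orthonormal v"
    unfolding b.orthonormal_def using vV orth b.ip_self[OF vV] vsq by auto
  have EL: "\<forall>f\<in>V. a f (v k) = of_real (\<mu> k) * b f (v k)" for k
  \<comment> \<open>Minimality yields the eigenvalue equation only for f orthogonal to the earlier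
    eigenvectors. A general f is reduced to that case by removing its projection p, and
    \<open>a p (v k) = 0\<close> comes from the equations already known for the smaller indices,
    read with the arguments exchanged.\<close>
  proof (induction k rule: less_induct)
    case (less k)
    show ?case
    proof
      fix f assume f: "f \<in> V"
      define p where "p = b.proj v k f"
      have p: "p \<in> V" by (simp add: p_def b.proj_mem vo)
      have "a (f - p) (v k) = of_real (a.sq (v k)) * b (f - p) (v k)"
      proof (rule Euler_Lagrange[of k v])
        show "b (f - p) (v i) = 0" if "i < k" for i
          using that f p vV by (simp add: b.ip_diff_left p_def b.ip_proj_basis vo)
      next
        show "b (v k) (v i) = 0" if "i < k" for i
          by (rule PD(2)[OF P that])
        show "a.sq (v k) * b.sq g \<le> a.sq g" if "g \<in> V" "\<And>i. i < k \<Longrightarrow> b g (v i) = 0" for g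
          by (rule PD(4)[OF P that])
      qed (use vV vsq f p in \<open>auto simp: a.diff_mem\<close>)
      moreover have "a p (v k) = 0"
      proof -
        have "a (v i) (v k) = 0" if "i < k" for i
          using less[OF that] vV orth[of k i] that a.ip_cnj[of "v i" "v k"] by simp
        then show ?thesis
          unfolding p_def b.proj_def using vV
          by (subst a.ip_sum_left) (auto simp: a.scale_mem a.ip_scale_left)
      qed
      moreover have "b p (v k) = 0"
        by (simp add: p_def b.ip_proj_basis vo)
      ultimately show "a f (v k) = of_real (\<mu> k) * b f (v k)"
        using f p vV by (simp add: a.ip_diff_left b.ip_diff_left \<mu>_def)
    qed
  qed
  have inc: "incseq \<mu>"
  proof (rule incseq_SucI)
    fix k
    show "\<mu> k \<le> \<mu> (Suc k)"
      using min[OF vV, of k "Suc k"] orth[of "Suc k"] vsq by (simp add: \<mu>_def)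
  qed
  have "filterlim \<mu> at_top sequentially"
  proof (rule ccontr)
    assume "\<not> filterlim \<mu> at_top sequentially"
    then obtain Z where Z: "\<not> (\<forall>\<^sub>F n in sequentially. Z \<le> \<mu> n)"
      by (auto simp: filterlim_at_top)
    have "\<mu> n \<le> Z" for n
    proof (rule ccontr)
      assume "\<not> \<mu> n \<le> Z"
      then have "Z \<le> \<mu> m" if "n \<le> m" for m
        using incseqD[OF inc that] by linarith
      then have "\<forall>\<^sub>F m in sequentially. Z \<le> \<mu> m" by (rule eventually_sequentiallyI)
      with Z show False by (rule notE)
    qed
    then show False using orthonormal_unbounded[OF vo, of Z] unfolding \<mu>_def by (meson leD)
  qed
  moreover have "0 < \<mu> k" for k
  proof (rule ccontr)
    assume "\<not> 0 < \<mu> k"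
    then have "K * \<mu> k \<le> 0" using K_pos by (simp add: mult_nonneg_nonpos)
    then show False using b_le[OF vV, of k] vsq[of k] by (simp add: \<mu>_def)
  qed
  ultimately show ?thesis using vo inc EL min by blast
qed

end

section \<open>Eigenfunction expansions and min-max bounds\<close>

locale spectral_pair = compact_pair +
  fixes v :: "nat \<Rightarrow> 'a" and \<mu> :: "nat \<Rightarrow> real"
  assumes v: "b.orthonormal v"
    and \<mu>_inc: "incseq \<mu>"
    and \<mu>_pos: "\<And>k. 0 < \<mu> k"
    and \<mu>_lim: "filterlim \<mu> at_top sequentially"
    and weak: "\<And>k f. f \<in> V \<Longrightarrow> a f (v k) = of_real (\<mu> k) * b f (v k)"
    and min: "\<And>k f. f \<in> V \<Longrightarrow> (\<And>i. i < k \<Longrightarrow> b f (v i) = 0) \<Longrightarrow> \<mu> k * b.sq f \<le> a.sq f"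
begin

text \<open>The energy of \<open>v k\<close> is \<open>\<mu> k\<close>, so these multiples are
  orthonormal for \<open>a\<close>; expansions in the energy norm are then Hilbert space expansions
  in (V, a).\<close>

definition w where "w k = scale (of_real (1 / sqrt (\<mu> k))) (v k)"

lemma vV: "v k \<in> V"
  using v by (rule b.orthonormal_mem)

lemma a_w: "f \<in> V \<Longrightarrow> a f (w k) = of_real (sqrt (\<mu> k)) * b f (v k)"
proof -
  have "1 / sqrt (\<mu> k) * \<mu> k = sqrt (\<mu> k)"
    using \<mu>_pos[of k] by (simp add: real_div_sqrt)
  then show "f \<in> V \<Longrightarrow> a f (w k) = of_real (sqrt (\<mu> k)) * b f (v k)"
    by (simp add: w_def a.ip_scale_right vV weak mult.assoc[symmetric] of_real_mult[symmetric]
      del: of_real_mult of_real_divide)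
qed

lemma w: "a.orthonormal w"
  unfolding a.orthonormal_def
proof (intro conjI allI)
  show "w i \<in> V" for i by (simp add: w_def a.scale_mem vV)
  then show "a (w i) (w j) = (if i = j then 1 else 0)" for i j
    using \<mu>_pos[of i] \<mu>_pos[of j]
    by (simp add: a_w) (simp add: w_def b.ip_scale_left vV b.orthonormal_ip[OF v])
qed

text \<open>A vector orthogonal to every \<open>v k\<close> satisfies
  \<open>\<mu> k * b.sq f \<le> a.sq f\<close> for all k. As \<mu> tends to infinity, b.sq f = 0,
  and \<open>null\<close> turns this into a.sq f = 0.\<close>

lemma w_total:
  assumes f: "f \<in> V" and z: "\<And>i. a f (w i) = 0"
  shows "a.sq f = 0"
proof (rule null[OF f], rule ccontr)
  assume "b.sq f \<noteq> 0"
  then have pos: "b.sq f > 0" using b.sq_nonneg[OF f] by simp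
  have "b f (v i) = 0" for i
    using z[of i] a_w[OF f, of i] \<mu>_pos[of i] by simp
  then have "\<mu> k * b.sq f \<le> a.sq f" for k
    by (intro min f)
  then have "\<mu> k \<le> a.sq f / b.sq f" for k
    using pos by (simp add: field_simps)
  moreover obtain k where "\<mu> k \<ge> a.sq f / b.sq f + 1"
    using \<mu>_lim by (auto simp: filterlim_at_top eventually_sequentially)
  ultimately show False by (metis add_le_same_cancel1 not_one_le_zero order_trans)
qed

lemma a_expansion:
  assumes "f \<in> V" "g \<in> V"
  shows "(\<lambda>k. of_real (\<mu> k) * b f (v k) * cnj (b g (v k))) sums a f g"
proof -
  have "a f (w k) * cnj (a g (w k)) = of_real (\<mu> k) * b f (v k) * cnj (b g (v k))" for k
  proof -
    have "complex_of_real (sqrt (\<mu> k)) * complex_of_real (sqrt (\<mu> k)) = of_real (\<mu> k)"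
      using \<mu>_pos[of k] by (simp add: of_real_mult[symmetric] del: of_real_mult)
    then show ?thesis
      by (simp add: a_w assms mult.assoc mult.left_commute[of "b f (v k)"])
  qed
  then show ?thesis using a.Parseval[OF w w_total assms] by simp
qed

text \<open>The b-projection onto the \<open>v k\<close> is also the a-projection onto the
  \<open>w k\<close>, because the factors sqrt(\<mu> k) cancel. The ordinary partial sums therefore
  converge in the stronger energy norm.\<close>

lemma proj_conv:
  assumes "f \<in> V"
  shows "a.conv (\<lambda>n. b.proj v n f) f"
proof -
  have "b.proj v n f = a.proj w n f" for n
    unfolding b.proj_def a.proj_def
  proof (intro sum.cong refl)
    fix k
    have "complex_of_real (sqrt (\<mu> k)) * complex_of_real (1 / sqrt (\<mu> k)) = 1"
      using \<mu>_pos[of k] by (simp add: of_real_mult[symmetric] del: of_real_mult)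
    then show "scale (b f (v k)) (v k) = scale (a f (w k)) (w k)"
      unfolding a_w[OF assms] unfolding w_def a.scale_scale
      by (simp only: mult.assoc mult.commute[of "b f (v k)"])
        (simp only: mult.assoc[symmetric] mult_1_left)
  qed
  then show ?thesis using a.proj_conv[OF w w_total assms] by simp
qed

text \<open>The span of k + 1 test vectors contains a nonzero vector orthogonal to the first k
  eigenvectors, where \<mu> k bounds the quotient from below.\<close>

lemma eigenvalue_upper:
  assumes g: "b.orthonormal g"
    and le: "\<And>c. a.sq (\<Sum>i\<le>k. scale (c i) (g i)) \<le> \<beta> * b.sq (\<Sum>i\<le>k. scale (c i) (g i))"
  shows "\<mu> k \<le> \<beta>"
proof -
  from exists_orthogonal[of k v, OF vV g] obtain c where c: "b.sq (\<Sum>i\<le>k. scale (c i) (g i)) > 0"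
    "\<And>j. j < k \<Longrightarrow> b (\<Sum>i\<le>k. scale (c i) (g i)) (v j) = 0" by blast
  have "\<mu> k * b.sq (\<Sum>i\<le>k. scale (c i) (g i)) \<le> a.sq (\<Sum>i\<le>k. scale (c i) (g i))"
    by (intro min b.sum_scale_mem g c)
  also have "\<dots> \<le> \<beta> * b.sq (\<Sum>i\<le>k. scale (c i) (g i))" by (rule le)
  finally show ?thesis using c(1) by simp
qed

text \<open>Dual argument: the span of \<open>v 0\<close>, ..., \<open>v k\<close>, on which the
  quotient is at most \<open>\<mu> k\<close>, contains a nonzero vector orthogonal to the k vectors
  \<open>g j\<close>. These need not be orthonormal, nor related to \<open>a\<close>.\<close>

lemma eigenvalue_lower:
  assumes g: "\<And>j. j < k \<Longrightarrow> g j \<in> V"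
    and le: "\<And>f. f \<in> V \<Longrightarrow> (\<And>j. j < k \<Longrightarrow> b f (g j) = 0) \<Longrightarrow> \<beta> * b.sq f \<le> a.sq f"
  shows "\<beta> \<le> \<mu> k"
proof -
  from exists_orthogonal[of k g, OF g v] obtain c where c: "b.sq (\<Sum>i\<le>k. scale (c i) (v i)) > 0"
    "\<And>j. j < k \<Longrightarrow> b (\<Sum>i\<le>k. scale (c i) (v i)) (g j) = 0" by blast
  define f where "f = (\<Sum>i\<le>k. scale (c i) (v i))"
  have f: "f \<in> V" by (simp add: f_def b.sum_scale_mem v)
  have bf: "b f (v i) = (if i \<le> k then c i else 0)" for i
    by (simp add: f_def b.ip_sum_scale_basis v)
  have "a f f = (\<Sum>i\<le>k. a f (scale (c i) (v i)))"
    using a.ip_sum_right[where A = "{..k}" and F = "\<lambda>i. scale (c i) (v i)" and g = f, OF a.scale_mem[OF vV] f]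
    by (simp only: f_def[symmetric])
  also have "\<dots> = (\<Sum>i\<le>k. of_real (\<mu> i * (cmod (c i))\<^sup>2))"
    by (intro sum.cong refl) (simp add: a.ip_scale_right vV f weak bf complex_norm_square mult_ac del: of_real_power)
  finally have "a.sq f = (\<Sum>i\<le>k. \<mu> i * (cmod (c i))\<^sup>2)"
    by (simp add: a.sq_def)
  also have "\<dots> \<le> (\<Sum>i\<le>k. \<mu> k * (cmod (c i))\<^sup>2)"
    by (intro sum_mono mult_right_mono incseqD[OF \<mu>_inc]) auto
  also have "\<dots> = \<mu> k * b.sq f"
    by (simp add: f_def b.sq_sum_scale v sum_distrib_left)
  finally have "\<beta> * b.sq f \<le> \<mu> k * b.sq f"
    using le[OF f] c(2) by (force simp: f_def)
  then show ?thesis using c(1) by (simp add: f_def)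
qed

end

subsection \<open>Square-integrable functions\<close>

definition fscale :: "complex \<Rightarrow> ('a \<Rightarrow> complex) \<Rightarrow> 'a \<Rightarrow> complex" where
  "fscale c f = (\<lambda>x. c * f x)"

lemma fscale_apply [simp]: "fscale c f x = c * f x"
  by (simp add: fscale_def)

lemma sum_fun_apply [simp]: "(\<Sum>i\<in>A. F i) x = (\<Sum>i\<in>A. F i x)"
  for F :: "'i \<Rightarrow> 'a \<Rightarrow> 'b::comm_monoid_add"
  by (induction A rule: infinite_finite_induct) auto

lemma l2_spaceD:
  assumes "f \<in> l2_space M"
  shows "f \<in> borel_measurable M" "integrable M (\<lambda>x. (cmod (f x))\<^sup>2)"
  using assms by (auto simp: l2_space_def)

lemma borel_measurable_fun_ops:
  fixes f g :: "'a \<Rightarrow> complex"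
  assumes "f \<in> borel_measurable M" "g \<in> borel_measurable M"
  shows "f + g \<in> borel_measurable M" "f - g \<in> borel_measurable M" "fscale c f \<in> borel_measurable M"
  using assms by (simp_all add: plus_fun_def fun_diff_def fscale_def)

lemma borel_measurable_cnj:
  "f \<in> borel_measurable M \<Longrightarrow> (\<lambda>x. cnj (f x)) \<in> borel_measurable M"
  by (rule borel_measurable_continuous_on[where f = cnj]) (intro continuous_intros)

lemma l2_integrable_mult:
  assumes f: "f \<in> l2_space M" and g: "g \<in> l2_space M"
  shows "integrable M (\<lambda>x. f x * cnj (g x))"
proof (rule Bochner_Integration.integrable_bound)
  show "integrable M (\<lambda>x. (cmod (f x))\<^sup>2 + (cmod (g x))\<^sup>2)"
    using f g by (intro Bochner_Integration.integrable_add l2_spaceD)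
  show "(\<lambda>x. f x * cnj (g x)) \<in> borel_measurable M"
    using l2_spaceD(1)[OF f] borel_measurable_cnj[OF l2_spaceD(1)[OF g]] by simp
  have "cmod (f x) * cmod (g x) \<le> (cmod (f x))\<^sup>2 + (cmod (g x))\<^sup>2" for x
    using sum_squares_bound[of "cmod (f x)" "cmod (g x)"] mult_nonneg_nonneg[of "cmod (f x)" "cmod (g x)"]
    by (simp only: norm_ge_zero simp_thms mult.assoc True_implies_equals)
  then show "AE x in M. norm (f x * cnj (g x)) \<le> norm ((cmod (f x))\<^sup>2 + (cmod (g x))\<^sup>2)"
    by (simp add: norm_mult)
qed

lemma cmod_add_sq_le: "(cmod (z + w))\<^sup>2 \<le> 2 * (cmod z)\<^sup>2 + 2 * (cmod w)\<^sup>2"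
proof -
  have "(cmod (z + w))\<^sup>2 \<le> (cmod z + cmod w)\<^sup>2"
    by (intro power_mono norm_triangle_ineq) simp
  also have "\<dots> \<le> 2 * (cmod z)\<^sup>2 + 2 * (cmod w)\<^sup>2"
    using sum_squares_bound[of "cmod z" "cmod w"] by (simp add: power2_sum)
  finally show ?thesis .
qed

lemma l2_space_add:
  assumes f: "f \<in> l2_space M" and g: "g \<in> l2_space M"
  shows "f + g \<in> l2_space M"
  unfolding l2_space_def
proof (intro CollectI conjI)
  show "f + g \<in> borel_measurable M"
    using f g by (intro borel_measurable_fun_ops l2_spaceD)
  show "integrable M (\<lambda>x. (cmod ((f + g) x))\<^sup>2)"
  proof (rule Bochner_Integration.integrable_bound)
    show "integrable M (\<lambda>x. 2 * (cmod (f x))\<^sup>2 + 2 * (cmod (g x))\<^sup>2)"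
      using f g by (intro Bochner_Integration.integrable_add integrable_mult_right l2_spaceD)
    show "(\<lambda>x. (cmod ((f + g) x))\<^sup>2) \<in> borel_measurable M"
      using l2_spaceD(1)[OF f] l2_spaceD(1)[OF g] by simp
    show "AE x in M. norm ((cmod ((f + g) x))\<^sup>2) \<le> norm (2 * (cmod (f x))\<^sup>2 + 2 * (cmod (g x))\<^sup>2)"
      using cmod_add_sq_le by simp
  qed
qed

lemma l2_space_fscale: "f \<in> l2_space M \<Longrightarrow> fscale c f \<in> l2_space M"
  by (auto simp: l2_space_def norm_mult power_mult_distrib borel_measurable_fun_ops)

lemma l2_semi_ip: "semi_ip (l2_space M) fscale (l2_inner M)"
proof
  show "0 \<in> l2_space M" by (simp add: l2_space_def zero_fun_def)
  show "f + g \<in> l2_space M" if "f \<in> l2_space M" "g \<in> l2_space M" for f g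
    using that by (rule l2_space_add)
  show "fscale c f \<in> l2_space M" if "f \<in> l2_space M" for c f
    using that by (rule l2_space_fscale)
  show "fscale c (fscale d f) = fscale (c * d) f" for c d and f :: "'a \<Rightarrow> complex"
    by (simp add: fscale_def mult.assoc)
  show "fscale (- 1) f = - f" for f :: "'a \<Rightarrow> complex"
    by (simp add: fun_eq_iff)
  show "l2_inner M (f + g) h = l2_inner M f h + l2_inner M g h"
    if "f \<in> l2_space M" "g \<in> l2_space M" "h \<in> l2_space M" for f g h
    using l2_integrable_mult[OF that(1,3)] l2_integrable_mult[OF that(2,3)]
    by (simp add: l2_inner_def distrib_right)
  show "l2_inner M (fscale c f) g = c * l2_inner M f g"
    if "f \<in> l2_space M" "g \<in> l2_space M" for c f g
    by (simp add: l2_inner_def mult.assoc)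
  show "l2_inner M f g = cnj (l2_inner M g f)"
    if "f \<in> l2_space M" "g \<in> l2_space M" for f g
    using Bochner_Integration.integral_cnj[of M "\<lambda>x. g x * cnj (f x)"] by (simp add: l2_inner_def mult.commute)
  show "0 \<le> Re (l2_inner M f f)" if "f \<in> l2_space M" for f
  proof -
    have "Re (l2_inner M f f) = (LINT x|M. Re (f x * cnj (f x)))"
      unfolding l2_inner_def by (rule integral_Re[symmetric]) (rule l2_integrable_mult[OF that that])
    then show ?thesis by (simp add: Bochner_Integration.integral_nonneg)
  qed
qed

abbreviation l2_sq :: "'a measure \<Rightarrow> ('a \<Rightarrow> complex) \<Rightarrow> real" where
  "l2_sq M \<equiv> semi_ip.sq (l2_inner M)"

lemma l2_sq_eq:
  assumes "f \<in> l2_space M"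
  shows "l2_sq M f = (LINT x|M. (cmod (f x))\<^sup>2)"
proof -
  have "l2_inner M f f = (LINT x|M. complex_of_real ((cmod (f x))\<^sup>2))"
    unfolding l2_inner_def by (simp only: complex_norm_square)
  also have "\<dots> = complex_of_real (LINT x|M. (cmod (f x))\<^sup>2)"
    by (rule integral_complex_of_real)
  finally show ?thesis
    by (simp add: semi_ip.sq_def[OF l2_semi_ip])
qed

lemma l2_norm_eq: "f \<in> l2_space M \<Longrightarrow> l2_norm M f = sqrt (l2_sq M f)"
  by (simp add: l2_norm_def l2_sq_eq)

lemma l2_sq_nn_integral:
  assumes "f \<in> l2_space M"
  shows "(\<integral>\<^sup>+x. ennreal ((cmod (f x))\<^sup>2) \<partial>M) = ennreal (l2_sq M f)"
  unfolding l2_sq_eq[OF assms] using assms by (intro nn_integral_eq_integral l2_spaceD) auto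

lemma l2_sq_le_nn_integral:
  assumes f: "f \<in> borel_measurable M" and le: "(\<integral>\<^sup>+x. ennreal ((cmod (f x))\<^sup>2) \<partial>M) \<le> ennreal B" and B: "B \<ge> 0"
  shows "f \<in> l2_space M" "l2_sq M f \<le> B"
proof -
  have "integrable M (\<lambda>x. (cmod (f x))\<^sup>2)"
    using f le by (intro integrableI_bounded) (auto simp: le_less_trans)
  then show *: "f \<in> l2_space M" using f by (simp add: l2_space_def)
  show "l2_sq M f \<le> B"
    using le B unfolding l2_sq_nn_integral[OF *] by simp
qed

lemma l2_sq_zero_iff:
  assumes "f \<in> l2_space M"
  shows "l2_sq M f = 0 \<longleftrightarrow> (AE x in M. f x = 0)"
  unfolding l2_sq_eq[OF assms]
  by (subst integral_nonneg_eq_0_iff_AE) (auto simp: l2_spaceD[OF assms])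

text \<open>Lower semicontinuity of the norm under pointwise convergence, with membership of the
  limit as part of the conclusion. It closes the completeness proof and later carries the form bound
  from Schwartz functions to \<open>V\<close>.\<close>

lemma l2_Fatou:
  assumes G: "\<And>j. G j \<in> l2_space M" and g: "g \<in> borel_measurable M"
    and lim: "AE x in M. (\<lambda>j. G j x) \<longlonglongrightarrow> g x"
    and B: "\<And>j. j \<ge> J \<Longrightarrow> l2_sq M (G j) \<le> B"
  shows "g \<in> l2_space M" "l2_sq M g \<le> B"
proof -
  have B0: "B \<ge> 0" using B[of J] semi_ip.sq_nonneg[OF l2_semi_ip G[of J]] by simp
  have [measurable]: "G j \<in> borel_measurable M" for j using l2_spaceD(1)[OF G] .
  have "(\<integral>\<^sup>+x. ennreal ((cmod (g x))\<^sup>2) \<partial>M) = (\<integral>\<^sup>+x. liminf (\<lambda>j. ennreal ((cmod (G j x))\<^sup>2)) \<partial>M)"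
  proof (rule nn_integral_cong_AE)
    show "AE x in M. ennreal ((cmod (g x))\<^sup>2) = liminf (\<lambda>j. ennreal ((cmod (G j x))\<^sup>2))"
      using lim
    proof eventually_elim
      case (elim x)
      then have "(\<lambda>j. ennreal ((cmod (G j x))\<^sup>2)) \<longlonglongrightarrow> ennreal ((cmod (g x))\<^sup>2)"
        by (intro tendsto_ennrealI tendsto_power tendsto_norm)
      from lim_imp_Liminf[OF _ this] show ?case by simp
    qed
  qed
  also have "\<dots> \<le> liminf (\<lambda>j. \<integral>\<^sup>+x. ennreal ((cmod (G j x))\<^sup>2) \<partial>M)"
    by (rule nn_integral_liminf) measurable
  also have "\<dots> \<le> liminf (\<lambda>j. ennreal B)"
  proof (rule Liminf_mono)
    show "\<forall>\<^sub>F j in sequentially. (\<integral>\<^sup>+x. ennreal ((cmod (G j x))\<^sup>2) \<partial>M) \<le> ennreal B"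
      unfolding eventually_sequentially
      using B by (intro exI[of _ J]) (auto simp: l2_sq_nn_integral[OF G] intro!: ennreal_leI)
  qed
  also have "\<dots> = ennreal B" by (simp add: Liminf_const)
  finally show "g \<in> l2_space M" "l2_sq M g \<le> B"
    using l2_sq_le_nn_integral[OF g _ B0] by auto
qed

lemma convergent_if_geometric:
  fixes z :: "nat \<Rightarrow> complex"
  assumes "\<And>j. cmod (z (Suc j) - z j) \<le> C * q ^ j" "0 \<le> q" "q < 1"
  shows "convergent z"
proof -
  have "summable (\<lambda>j. z (Suc j) - z j)"
    by (rule summable_comparison_test'[where g = "\<lambda>j. C * q ^ j" and N = 0])
       (use assms in \<open>auto intro!: summable_mult summable_geometric\<close>)
  then have "convergent (\<lambda>n. \<Sum>j<n. z (Suc j) - z j)"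
    by (simp add: summable_iff_convergent)
  then have "convergent (\<lambda>n. z n - z 0)"
    by (simp add: sum_lessThan_telescope)
  then have "convergent (\<lambda>n. (z n - z 0) + z 0)"
    by (intro convergent_add convergent_const)
  then show ?thesis by simp
qed

lemma l2_complete:
  assumes F: "\<And>n. F n \<in> l2_space M"
    and Cauchy: "\<And>e. e > 0 \<Longrightarrow> \<exists>N. \<forall>m\<ge>N. \<forall>n\<ge>N. l2_sq M (F m - F n) < e"
  shows "\<exists>f\<in>l2_space M. semi_ip.conv (l2_inner M) F f"
proof -
  interpret L: semi_ip "l2_space M" fscale "l2_inner M" by (rule l2_semi_ip)
  have [measurable]: "F n \<in> borel_measurable M" for n using l2_spaceD(1)[OF F] .
  have finite: "\<exists>C\<ge>0. S = ennreal C" if "S \<noteq> \<infinity>" for S :: ennreal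
    using that by (cases S) auto
  have "\<forall>j. \<exists>N. \<forall>m\<ge>N. \<forall>n\<ge>N. L.sq (F m - F n) < (1/4) ^ j"
    using Cauchy by simp
  then obtain N where N: "\<And>j m n. m \<ge> N j \<Longrightarrow> n \<ge> N j \<Longrightarrow> L.sq (F m - F n) < (1/4) ^ j"
    by metis
  \<comment> \<open>Summing the thresholds makes \<open>r\<close> increasing while keeping it above
    both \<open>N j\<close> and j.\<close>
  define r where "r j = (\<Sum>i\<le>j. N i) + j" for j
  have r: "N j \<le> r j" "r j \<le> r (Suc j)" "j \<le> r j" for j
  proof -
    have "N j \<le> (\<Sum>i\<le>j. N i)" by (rule member_le_sum) auto
    then show "N j \<le> r j" by (simp add: r_def)
  qed (simp_all add: r_def)
  define G where "G j = F (r (Suc j)) - F (r j)" for j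
  have G: "G j \<in> l2_space M" for j by (simp add: G_def L.diff_mem F)
  have [measurable]: "G j \<in> borel_measurable M" for j using l2_spaceD(1)[OF G] .
  have Gsq: "L.sq (G j) \<le> (1/4) ^ j" for j
    unfolding G_def by (rule less_imp_le[OF N]) (use r[of j] in linarith)+
  \<comment> \<open>The weight 2^j still leaves a convergent series of integrals. Almost everywhere
    the weighted sum is then finite, which bounds |G_j(x)| by a constant times 2^(-j/2) and gives
    pointwise convergence by telescoping.\<close>
  have "(\<integral>\<^sup>+x. (\<Sum>j. ennreal (2 ^ j * (cmod (G j x))\<^sup>2)) \<partial>M) = (\<Sum>j. \<integral>\<^sup>+x. ennreal (2 ^ j * (cmod (G j x))\<^sup>2) \<partial>M)"
    by (rule nn_integral_suminf) measurable
  also have "\<dots> \<le> (\<Sum>j. ennreal ((1/2) ^ j))"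
  proof (intro suminf_le allI summableI)
    fix j
    have "(\<integral>\<^sup>+x. ennreal (2 ^ j * (cmod (G j x))\<^sup>2) \<partial>M) = ennreal (2 ^ j) * ennreal (L.sq (G j))"
      by (simp add: ennreal_mult nn_integral_cmult l2_sq_nn_integral[OF G])
    also have "\<dots> = ennreal (2 ^ j * L.sq (G j))"
      by (simp add: ennreal_mult L.sq_nonneg G)
    also have "\<dots> \<le> ennreal (2 ^ j * (1/4) ^ j)"
      using Gsq by (intro ennreal_leI mult_left_mono) auto
    also have "2 ^ j * (1/4) ^ j = (1/2::real) ^ j"
      by (simp add: power_mult_distrib[symmetric])
    finally show "(\<integral>\<^sup>+x. ennreal (2 ^ j * (cmod (G j x))\<^sup>2) \<partial>M) \<le> ennreal ((1/2) ^ j)" .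
  qed
  also have "\<dots> = ennreal (\<Sum>j. (1/2) ^ j)"
    by (rule suminf_ennreal2) (auto intro!: summable_geometric)
  finally have fin: "(\<integral>\<^sup>+x. (\<Sum>j. ennreal (2 ^ j * (cmod (G j x))\<^sup>2)) \<partial>M) \<noteq> \<infinity>"
    by (auto simp: top_unique)
  have "AE x in M. (\<Sum>j. ennreal (2 ^ j * (cmod (G j x))\<^sup>2)) \<noteq> \<infinity>"
    by (rule nn_integral_noteq_infinite[OF _ fin]) measurable
  then have AEconv: "AE x in M. convergent (\<lambda>j. F (r j) x)"
  proof eventually_elim
    case (elim x)
    then obtain C where C: "C \<ge> 0" "(\<Sum>j. ennreal (2 ^ j * (cmod (G j x))\<^sup>2)) = ennreal C"
      using finite[of "\<Sum>j. ennreal (2 ^ j * (cmod (G j x))\<^sup>2)"] by blast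
    have "cmod (F (r (Suc j)) x - F (r j) x) \<le> sqrt C * (sqrt (1/2)) ^ j" for j
    proof -
      have "(\<Sum>i\<in>{j}. ennreal (2 ^ i * (cmod (G i x))\<^sup>2)) \<le> ennreal C"
        unfolding C(2)[symmetric] by (rule sum_le_suminf) auto
      then have "2 ^ j * (cmod (G j x))\<^sup>2 \<le> C" using C(1) by simp
      then have "(cmod (G j x))\<^sup>2 \<le> C * (1/2) ^ j"
        by (simp add: field_simps power_one_over)
      then have "cmod (G j x) \<le> sqrt (C * (1/2) ^ j)" by (rule real_le_rsqrt)
      then show ?thesis by (simp add: G_def real_sqrt_mult real_sqrt_power)
    qed
    then show ?case
      by (rule convergent_if_geometric) auto
  qed
  define f where "f x = lim (\<lambda>j. F (r j) x)" for x
  have [measurable]: "f \<in> borel_measurable M"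
    unfolding f_def by (rule borel_measurable_lim_metric) measurable
  have lim: "AE x in M. (\<lambda>j. F (r j) x) \<longlonglongrightarrow> f x"
    using AEconv by eventually_elim (simp add: f_def convergent_LIMSEQ_iff)
  \<comment> \<open>Letting j tend to infinity in the Cauchy bound for F n - F (r j) gives the bound
    for F n - f, and f is square integrable because one such difference is.\<close>
  have Fatou: "F n - f \<in> l2_space M" "L.sq (F n - f) \<le> e"
    if "\<And>m. m \<ge> K \<Longrightarrow> L.sq (F n - F m) \<le> e" for n K e
  proof -
    have 1: "F n - F (r j) \<in> l2_space M" for j by (simp add: L.diff_mem F)
    have 2: "F n - f \<in> borel_measurable M" by (intro borel_measurable_fun_ops) auto
    have 3: "AE x in M. (\<lambda>j. (F n - F (r j)) x) \<longlonglongrightarrow> (F n - f) x"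
      using lim by eventually_elim (auto intro!: tendsto_intros)
    have 4: "L.sq (F n - F (r j)) \<le> e" if "j \<ge> K" for j
      using that r(3)[of j] \<open>\<And>m. m \<ge> K \<Longrightarrow> L.sq (F n - F m) \<le> e\<close> by (meson order_trans)
    show "F n - f \<in> l2_space M" by (rule l2_Fatou(1)[OF 1 2 3 4])
    show "L.sq (F n - f) \<le> e" by (rule l2_Fatou(2)[OF 1 2 3 4])
  qed
  obtain K where K: "\<And>m n. m \<ge> K \<Longrightarrow> n \<ge> K \<Longrightarrow> L.sq (F m - F n) < 1"
    using Cauchy[of 1] by auto
  have "F K - f \<in> l2_space M"
    by (rule Fatou(1)[of K K 1]) (use K in \<open>auto intro: less_imp_le\<close>)
  from L.diff_mem[OF F[of K] this] have fH: "f \<in> l2_space M" by simp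
  have "L.conv F f"
    unfolding L.conv_def
  proof (rule LIMSEQ_I)
    fix e :: real assume "e > 0"
    then obtain K where K: "\<And>m n. m \<ge> K \<Longrightarrow> n \<ge> K \<Longrightarrow> L.sq (F m - F n) < e / 2"
      using Cauchy[of "e / 2"] by auto
    have "L.sq (F n - f) < e" if "n \<ge> K" for n
    proof -
      have "L.sq (F n - f) \<le> e / 2"
        by (rule Fatou(2)[of K]) (use K that in \<open>auto intro: less_imp_le\<close>)
      then show ?thesis using \<open>e > 0\<close> by linarith
    qed
    then show "\<exists>K. \<forall>n\<ge>K. norm (L.sq (F n - f) - 0) < e"
      by (auto simp: L.sq_nonneg L.diff_mem F fH)
  qed
  then show ?thesis using fH by blast
qed

lemma l2_hilbert: "hilbert_ip (l2_space M) fscale (l2_inner M)"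
  by (intro hilbert_ip.intro hilbert_ip_axioms.intro l2_semi_ip l2_complete) auto

lemma l2_inner_cong_AE:
  assumes "f \<in> l2_space M" "f' \<in> l2_space M" "g \<in> l2_space M" "g' \<in> l2_space M"
    and "AE x in M. f x = f' x" "AE x in M. g x = g' x"
  shows "l2_inner M f g = l2_inner M f' g'"
  unfolding l2_inner_def
proof (rule integral_cong_AE)
  show "AE x in M. f x * cnj (g x) = f' x * cnj (g' x)"
    using assms(5,6) by eventually_elim simp
qed (intro borel_measurable_times borel_measurable_cnj l2_spaceD(1) assms)+

subsection \<open>Operators diagonal in an orthonormal basis\<close>

text \<open>The maximal domain is implicit: f belongs to it iff the products \<open>d k\<close>
  times the k-th coefficient of f are the coefficients of some square-integrable g. Only inner
  products occur, so the graph respects almost everywhere equality.\<close>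

definition diag_op :: "'a measure \<Rightarrow> (nat \<Rightarrow> 'a \<Rightarrow> complex) \<Rightarrow> (nat \<Rightarrow> real) \<Rightarrow> 'a l2_op" where
  "diag_op M v d = {(f, g). f \<in> l2_space M \<and> g \<in> l2_space M \<and>
     (\<forall>k. l2_inner M g (v k) = of_real (d k) * l2_inner M f (v k))}"

lemma diag_opI:
  "f \<in> l2_space M \<Longrightarrow> g \<in> l2_space M \<Longrightarrow>
    (\<And>k. l2_inner M g (v k) = of_real (d k) * l2_inner M f (v k)) \<Longrightarrow> (f, g) \<in> diag_op M v d"
  by (simp add: diag_op_def)

lemma diag_opD:
  assumes "(f, g) \<in> diag_op M v d"
  shows "f \<in> l2_space M" "g \<in> l2_space M" "l2_inner M g (v k) = of_real (d k) * l2_inner M f (v k)"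
  using assms by (auto simp: diag_op_def)

lemma l2_operatorD:
  assumes "l2_operator M T"
  shows "(f, g) \<in> T \<Longrightarrow> f \<in> l2_space M" "(f, g) \<in> T \<Longrightarrow> g \<in> l2_space M"
    "(f, g) \<in> T \<Longrightarrow> (f', g') \<in> T \<Longrightarrow> (f + f', g + g') \<in> T"
    "(f, g) \<in> T \<Longrightarrow> (fscale c f, fscale c g) \<in> T"
    "(f, g) \<in> T \<Longrightarrow> f' \<in> l2_space M \<Longrightarrow> g' \<in> l2_space M \<Longrightarrow> AE x in M. f x = f' x \<Longrightarrow>
      AE x in M. g x = g' x \<Longrightarrow> (f', g') \<in> T"
    "(f, g) \<in> T \<Longrightarrow> (f, g') \<in> T \<Longrightarrow> AE x in M. g x = g' x"
proof -
  note D = assms[unfolded l2_operator_def]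
  note D1 = D[THEN conjunct1] and D2 = D[THEN conjunct2, THEN conjunct2]
  show "(f, g) \<in> T \<Longrightarrow> f \<in> l2_space M" "(f, g) \<in> T \<Longrightarrow> g \<in> l2_space M"
    using D1 by auto
  show "(f, g) \<in> T \<Longrightarrow> (f', g') \<in> T \<Longrightarrow> (f + f', g + g') \<in> T"
    unfolding plus_fun_def by (rule D2[THEN conjunct1, rule_format])
  show "(f, g) \<in> T \<Longrightarrow> (fscale c f, fscale c g) \<in> T"
    unfolding fscale_def by (rule D2[THEN conjunct2, THEN conjunct1, rule_format])
  show "(f, g) \<in> T \<Longrightarrow> f' \<in> l2_space M \<Longrightarrow> g' \<in> l2_space M \<Longrightarrow> AE x in M. f x = f' x \<Longrightarrow>
      AE x in M. g x = g' x \<Longrightarrow> (f', g') \<in> T"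
    by (rule D2[THEN conjunct2, THEN conjunct2, THEN conjunct1, rule_format])
  show "(f, g) \<in> T \<Longrightarrow> (f, g') \<in> T \<Longrightarrow> AE x in M. g x = g' x"
    by (rule D2[THEN conjunct2, THEN conjunct2, THEN conjunct2, rule_format])
qed

lemma l2_adjoint_antimono: "S \<subseteq> T \<Longrightarrow> l2_adjoint M T \<subseteq> l2_adjoint M S"
  unfolding l2_adjoint_def by blast

locale l2_basis =
  fixes M :: "'a measure" and v :: "nat \<Rightarrow> 'a \<Rightarrow> complex"
  assumes basis: "semi_ip.orthonormal (l2_space M) (l2_inner M) v"
    and total_AE: "\<And>f. f \<in> l2_space M \<Longrightarrow> (\<And>k. l2_inner M f (v k) = 0) \<Longrightarrow> AE x in M. f x = 0"
begin

sublocale L: hilbert_ip "l2_space M" fscale "l2_inner M"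
  by (rule l2_hilbert)

lemma v_mem: "v k \<in> l2_space M"
  using basis by (rule L.orthonormal_mem)

lemma total: "f \<in> l2_space M \<Longrightarrow> (\<And>k. l2_inner M f (v k) = 0) \<Longrightarrow> l2_sq M f = 0"
  using total_AE by (simp add: l2_sq_zero_iff)

lemma Parseval:
  "f \<in> l2_space M \<Longrightarrow> g \<in> l2_space M \<Longrightarrow>
    (\<lambda>i. l2_inner M f (v i) * cnj (l2_inner M g (v i))) sums l2_inner M f g"
  by (rule L.Parseval[OF basis]) (rule total)

lemma Parseval_sq: "f \<in> l2_space M \<Longrightarrow> (\<lambda>i. (cmod (l2_inner M f (v i)))\<^sup>2) sums l2_sq M f"
  by (rule L.Parseval_sq[OF basis]) (rule total)

lemma proj_conv: "f \<in> l2_space M \<Longrightarrow> L.conv (\<lambda>n. L.proj v n f) f"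
  by (rule L.proj_conv[OF basis]) (rule total)

lemma AE_eqI:
  assumes "f \<in> l2_space M" "g \<in> l2_space M" "\<And>k. l2_inner M f (v k) = l2_inner M g (v k)"
  shows "AE x in M. f x = g x"
proof -
  have "AE x in M. (f - g) x = 0"
    by (rule total_AE[of "f - g"]) (simp_all add: L.diff_mem L.ip_diff_left v_mem assms)
  then show ?thesis by simp
qed

lemma diag_add: "(f, g) \<in> diag_op M v d \<Longrightarrow> (f', g') \<in> diag_op M v d \<Longrightarrow> (f + f', g + g') \<in> diag_op M v d"
  by (intro diag_opI) (auto simp: L.add_mem L.ip_add_left v_mem diag_opD distrib_left)

lemma diag_scale: "(f, g) \<in> diag_op M v d \<Longrightarrow> (fscale c f, fscale c g) \<in> diag_op M v d"
  by (intro diag_opI) (auto simp: L.scale_mem L.ip_scale_left v_mem diag_opD)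

lemma diag_operator: "l2_operator M (diag_op M v d)"
  unfolding l2_operator_def
proof (intro conjI allI impI ballI)
  show "diag_op M v d \<subseteq> l2_space M \<times> l2_space M"
    by (auto simp: diag_op_def)
  show "(\<lambda>x. 0, \<lambda>x. 0) \<in> diag_op M v d"
    using L.zero_mem by (intro diag_opI) (simp_all add: zero_fun_def l2_inner_def)
  show "(\<lambda>x. f x + f' x, \<lambda>x. g x + g' x) \<in> diag_op M v d"
    if "(f, g) \<in> diag_op M v d" "(f', g') \<in> diag_op M v d" for f g f' g'
    using diag_add[OF that] by (simp add: plus_fun_def)
  show "(\<lambda>x. c * f x, \<lambda>x. c * g x) \<in> diag_op M v d" if "(f, g) \<in> diag_op M v d" for c f g
    using diag_scale[OF that, of c] by (simp add: fscale_def)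
  show "(f', g') \<in> diag_op M v d"
    if mem: "f' \<in> l2_space M" "g' \<in> l2_space M" and fg: "(f, g) \<in> diag_op M v d"
      and eq: "AE x in M. f x = f' x" "AE x in M. g x = g' x" for f g f' g'
  proof (rule diag_opI[OF mem])
    fix k
    have "l2_inner M f' (v k) = l2_inner M f (v k)"
      using eq(1) by (intro l2_inner_cong_AE mem v_mem diag_opD(1)[OF fg]) auto
    moreover have "l2_inner M g' (v k) = l2_inner M g (v k)"
      using eq(2) by (intro l2_inner_cong_AE mem v_mem diag_opD(2)[OF fg]) auto
    ultimately show "l2_inner M g' (v k) = of_real (d k) * l2_inner M f' (v k)"
      using diag_opD(3)[OF fg] by simp
  qed
  show "AE x in M. g x = g' x" if "(f, g) \<in> diag_op M v d" "(f, g') \<in> diag_op M v d" for f g g'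
    using that by (intro AE_eqI) (auto simp: diag_opD)
qed

lemma diag_sum_scale:
  "finite A \<Longrightarrow> ((\<Sum>i\<in>A. fscale (c i) (v i)), (\<Sum>i\<in>A. fscale (of_real (d i) * c i) (v i))) \<in> diag_op M v d"
  using L.ip_sum_scale_basis[OF basis, of A c] L.ip_sum_scale_basis[OF basis, of A "\<lambda>i. of_real (d i) * c i"]
  by (intro diag_opI L.sum_scale_mem basis) simp

lemma diag_basis: "(v k, fscale (of_real (d k)) (v k)) \<in> diag_op M v d"
  by (rule diag_opI) (simp_all add: v_mem L.scale_mem L.ip_scale_left L.orthonormal_ip[OF basis])

lemma diag_dense: "l2_dense M (Domain (diag_op M v d))"
  unfolding l2_dense_def
proof (intro conjI ballI allI impI)
  show "Domain (diag_op M v d) \<subseteq> l2_space M"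
    by (auto simp: diag_op_def)
  fix f and e :: real
  assume f: "f \<in> l2_space M" and "e > 0"
  have "(\<lambda>n. L.nrm (L.proj v n f - f)) \<longlonglongrightarrow> 0"
    by (rule L.conv_nrm[OF proj_conv[OF f]])
  then obtain n where "L.nrm (L.proj v n f - f) < e"
    using \<open>e > 0\<close> by (metis (no_types, lifting) eventually_sequentially le_refl order_tendstoD(2))
  moreover have "l2_norm M (\<lambda>x. f x - L.proj v n f x) = L.nrm (L.proj v n f - f)"
    using l2_norm_eq[OF L.diff_mem[OF f L.proj_mem[OF basis]], of n f]
      L.sq_diff_commute[OF f L.proj_mem[OF basis], of n f]
    by (simp add: fun_diff_def L.nrm_def)
  moreover have "L.proj v n f \<in> Domain (diag_op M v d)"
    unfolding L.proj_def
    using diag_sum_scale[of "{..<n}" "\<lambda>i. l2_inner M f (v i)" d] by (auto intro: DomainI)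
  ultimately show "\<exists>h\<in>Domain (diag_op M v d). l2_norm M (\<lambda>x. f x - h x) < e"
    by force
qed

text \<open>The adjoint relation tested on the pairs (v_k, d_k v_k) alone already fixes the
  coefficients of g. This serves both the self-adjointness of \<open>diag_op\<close> and the
  uniqueness of its square root.\<close>

lemma diag_contains_adjoint:
  assumes "(f, g) \<in> l2_adjoint M T" and T: "\<And>k. (v k, fscale (of_real (d k)) (v k)) \<in> T"
  shows "(f, g) \<in> diag_op M v d"
proof -
  have fg: "f \<in> l2_space M" "g \<in> l2_space M"
    and *: "\<And>h k. (h, k) \<in> T \<Longrightarrow> l2_inner M k f = l2_inner M h g"
    using assms(1) unfolding l2_adjoint_def by blast+
  show ?thesis
  proof (rule diag_opI[OF fg])
    fix k
    show "l2_inner M g (v k) = of_real (d k) * l2_inner M f (v k)"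
    proof -
      have "l2_inner M g (v k) = cnj (l2_inner M (v k) g)"
        by (rule L.ip_cnj[OF fg(2) v_mem])
      also have "l2_inner M (v k) g = of_real (d k) * l2_inner M (v k) f"
        using *[OF T[of k]] by (simp add: L.ip_scale_left fg v_mem)
      also have "cnj \<dots> = of_real (d k) * l2_inner M f (v k)"
        by (simp add: L.ip_cnj[OF fg(1) v_mem])
      finally show ?thesis .
    qed
  qed
qed

lemma diag_adjoint: "l2_adjoint M (diag_op M v d) = diag_op M v d"
proof (intro equalityI subrelI)
  fix f g assume "(f, g) \<in> l2_adjoint M (diag_op M v d)"
  then show "(f, g) \<in> diag_op M v d" by (rule diag_contains_adjoint[OF _ diag_basis])
next
  fix f g assume fg: "(f, g) \<in> diag_op M v d"
  have "l2_inner M k f = l2_inner M h g" if hk: "(h, k) \<in> diag_op M v d" for h k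
  proof -
    have "(\<lambda>i. l2_inner M h (v i) * cnj (l2_inner M g (v i))) sums l2_inner M h g"
      by (rule Parseval[OF diag_opD(1)[OF hk] diag_opD(2)[OF fg]])
    moreover have "(\<lambda>i. l2_inner M k (v i) * cnj (l2_inner M f (v i))) sums l2_inner M k f"
      by (rule Parseval[OF diag_opD(2)[OF hk] diag_opD(1)[OF fg]])
    ultimately show ?thesis
      by (simp add: diag_opD(3)[OF hk] diag_opD(3)[OF fg] mult_ac sums_unique2)
  qed
  then show "(f, g) \<in> l2_adjoint M (diag_op M v d)"
    using diag_opD(1,2)[OF fg] by (auto simp: l2_adjoint_def)
qed

lemma diag_selfadjoint: "l2_selfadjoint M (diag_op M v d)"
  unfolding l2_selfadjoint_def using diag_operator diag_dense diag_adjoint by blast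

lemma diag_inner_sums:
  assumes "(f, g) \<in> diag_op M v d"
  shows "(\<lambda>k. complex_of_real (d k * (cmod (l2_inner M f (v k)))\<^sup>2)) sums l2_inner M g f"
proof -
  have "l2_inner M g (v k) * cnj (l2_inner M f (v k)) = of_real (d k * (cmod (l2_inner M f (v k)))\<^sup>2)" for k
    by (simp add: diag_opD(3)[OF assms] complex_norm_square mult.assoc del: of_real_power)
  then show ?thesis
    using Parseval[OF diag_opD(2,1)[OF assms]] by simp
qed

lemma diag_positive:
  assumes "\<And>k. 0 \<le> d k"
  shows "l2_positive M (diag_op M v d)"
  unfolding l2_positive_def
proof clarify
  fix f g assume fg: "(f, g) \<in> diag_op M v d"
  have "(\<lambda>k. Im (complex_of_real (d k * (cmod (l2_inner M f (v k)))\<^sup>2))) sums Im (l2_inner M g f)"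
    by (rule sums_Im[OF diag_inner_sums[OF fg]])
  then have "Im (l2_inner M g f) = 0"
    by (simp add: sums_iff)
  moreover have re: "(\<lambda>k. Re (complex_of_real (d k * (cmod (l2_inner M f (v k)))\<^sup>2))) sums Re (l2_inner M g f)"
    by (rule sums_Re[OF diag_inner_sums[OF fg]])
  have "0 \<le> Re (l2_inner M g f)"
    by (rule sums_le[OF _ sums_zero re]) (simp add: assms)
  ultimately show "Im (l2_inner M g f) = 0 \<and> 0 \<le> Re (l2_inner M g f)" by simp
qed

lemma diag_square:
  assumes "\<And>k. 0 \<le> d k"
  shows "diag_op M v (\<lambda>k. sqrt (d k)) O diag_op M v (\<lambda>k. sqrt (d k)) = diag_op M v d"
proof (intro equalityI subrelI)
  fix f g assume "(f, g) \<in> diag_op M v (\<lambda>k. sqrt (d k)) O diag_op M v (\<lambda>k. sqrt (d k))"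
  then obtain h where h: "(f, h) \<in> diag_op M v (\<lambda>k. sqrt (d k))" "(h, g) \<in> diag_op M v (\<lambda>k. sqrt (d k))"
    by blast
  show "(f, g) \<in> diag_op M v d"
    using assms
    by (intro diag_opI) (simp_all add: diag_opD[OF h(1)] diag_opD[OF h(2)] mult.assoc[symmetric]
        flip: of_real_mult)
next
  fix f g assume fg: "(f, g) \<in> diag_op M v d"
  \<comment> \<open>The intermediate vector h exists because d |c|^2 = |c| |d c| is at most |c|^2 +
    |d c|^2, and both are summable for f in the domain.\<close>
  have "summable (\<lambda>k. (cmod (of_real (sqrt (d k)) * l2_inner M f (v k)))\<^sup>2)"
  proof (rule summable_comparison_test'[where N = 0])
    show "summable (\<lambda>k. (cmod (l2_inner M f (v k)))\<^sup>2 + (cmod (l2_inner M g (v k)))\<^sup>2)"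
      by (intro summable_add L.Bessel_summable basis diag_opD[OF fg])
    fix k
    have "(cmod (of_real (sqrt (d k)) * l2_inner M f (v k)))\<^sup>2 = cmod (l2_inner M f (v k)) * cmod (l2_inner M g (v k))"
      using assms[of k] by (simp add: diag_opD(3)[OF fg] norm_mult power_mult_distrib power2_eq_square)
    also have "\<dots> \<le> (cmod (l2_inner M f (v k)))\<^sup>2 + (cmod (l2_inner M g (v k)))\<^sup>2"
      using sum_squares_bound[of "cmod (l2_inner M f (v k))" "cmod (l2_inner M g (v k))"]
        mult_nonneg_nonneg[OF norm_ge_zero[of "l2_inner M f (v k)"] norm_ge_zero[of "l2_inner M g (v k)"]]
      unfolding mult.assoc by linarith
    finally show "norm ((cmod (of_real (sqrt (d k)) * l2_inner M f (v k)))\<^sup>2)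
        \<le> (cmod (l2_inner M f (v k)))\<^sup>2 + (cmod (l2_inner M g (v k)))\<^sup>2"
      by simp
  qed
  from L.Riesz_Fischer[OF basis this] obtain h where
    h: "h \<in> l2_space M" "\<And>k. l2_inner M h (v k) = of_real (sqrt (d k)) * l2_inner M f (v k)" by blast
  have "(f, h) \<in> diag_op M v (\<lambda>k. sqrt (d k))"
    by (rule diag_opI) (simp_all add: h diag_opD[OF fg])
  moreover have "(h, g) \<in> diag_op M v (\<lambda>k. sqrt (d k))"
    using assms
    by (intro diag_opI) (simp_all add: h diag_opD[OF fg] mult.assoc[symmetric] flip: of_real_mult)
  ultimately show "(f, g) \<in> diag_op M v (\<lambda>k. sqrt (d k)) O diag_op M v (\<lambda>k. sqrt (d k))"
    by blast
qed

text \<open>If \<open>R\<^sup>2 v = \<mu>\<^sup>2 v\<close> then \<open>y = R v - \<mu> v\<close> satisfies \<open>R y = - \<mu> y\<close>, so positivity forces \<open>y = 0\<close>.\<close>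

lemma positive_root_eigenvector:
  assumes sa: "l2_selfadjoint M R" and pos: "l2_positive M R"
    and \<mu>: "\<mu> > 0" and x: "x \<in> l2_space M"
    and sq: "(x, fscale (of_real (\<mu>\<^sup>2)) x) \<in> R O R"
  shows "(x, fscale (of_real \<mu>) x) \<in> R"
proof -
  have op: "l2_operator M R" using sa by (simp add: l2_selfadjoint_def)
  note opD = l2_operatorD[OF op]
  obtain w where w: "(x, w) \<in> R" "(w, fscale (of_real (\<mu>\<^sup>2)) x) \<in> R"
    using sq by blast
  define y where "y = w + fscale (- of_real \<mu>) x"
  have "(y, fscale (of_real (\<mu>\<^sup>2)) x + fscale (- of_real \<mu>) w) \<in> R"
    unfolding y_def by (intro opD(3,4) w)
  moreover have "fscale (of_real (\<mu>\<^sup>2)) x + fscale (- of_real \<mu>) w = fscale (- of_real \<mu>) y"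
    by (simp add: fun_eq_iff y_def algebra_simps power2_eq_square)
  ultimately have yR: "(y, fscale (- of_real \<mu>) y) \<in> R" by simp
  have y: "y \<in> l2_space M" using opD(1)[OF yR] .
  have "0 \<le> Re (l2_inner M (fscale (- of_real \<mu>) y) y)"
    using pos yR by (auto simp: l2_positive_def)
  then have "0 \<le> - \<mu> * L.sq y"
    by (simp only: L.ip_scale_left[OF y y] L.ip_self[OF y] flip: of_real_minus of_real_mult) simp
  then have "L.sq y = 0"
    using \<mu> L.sq_nonneg[OF y] by (simp add: mult_le_0_iff)
  then have "AE t in M. y t = 0"
    using l2_sq_zero_iff[OF y] by simp
  then have "AE t in M. w t = fscale (of_real \<mu>) x t"
    by eventually_elim (simp add: y_def)
  then show ?thesis
    by (rule opD(5)[OF w(1) x L.scale_mem[OF x] AE_I2[OF refl]])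
qed

text \<open>Any positive self-adjoint root R sends v_k to sqrt(d_k) v_k, so its adjoint, which is R
  itself, lies in the diagonal operator. Taking adjoints reverses the inclusion and gives equality.
  Strict positivity of d is what the eigenvector argument uses.\<close>

lemma diag_sqrt:
  assumes pos: "\<And>k. 0 < d k"
  shows "l2_sqrt M (diag_op M v d) = diag_op M v (\<lambda>k. sqrt (d k))"
  unfolding l2_sqrt_def
proof (rule the_equality)
  let ?D = "diag_op M v (\<lambda>k. sqrt (d k))"
  show "l2_selfadjoint M ?D \<and> l2_positive M ?D \<and> ?D O ?D = diag_op M v d"
    using pos by (intro conjI diag_selfadjoint diag_positive diag_square) (auto simp: less_imp_le)
  fix R assume R: "l2_selfadjoint M R \<and> l2_positive M R \<and> R O R = diag_op M v d"
  have adj: "l2_adjoint M R = R" using R by (simp add: l2_selfadjoint_def)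
  have vR: "(v k, fscale (of_real (sqrt (d k))) (v k)) \<in> R" for k
  proof (rule positive_root_eigenvector)
    show "(v k, fscale (of_real ((sqrt (d k))\<^sup>2)) (v k)) \<in> R O R"
      using diag_basis[of k d] R pos[of k] by simp
  qed (use R pos v_mem in auto)
  have "R \<subseteq> ?D"
  proof (rule subrelI)
    fix f g assume "(f, g) \<in> R"
    then have "(f, g) \<in> l2_adjoint M R" by (simp add: adj)
    then show "(f, g) \<in> ?D" by (rule diag_contains_adjoint[OF _ vR])
  qed
  moreover from l2_adjoint_antimono[OF this, of M] have "?D \<subseteq> R"
    by (simp add: adj diag_adjoint)
  ultimately show "R = ?D" by blast
qed

lemma diag_closure_subset:
  assumes "S \<subseteq> diag_op M v d"
  shows "l2_closure M S \<subseteq> diag_op M v d"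
proof (rule subrelI)
  fix f g assume fg: "(f, g) \<in> l2_closure M S"
  then have f: "f \<in> l2_space M" and g: "g \<in> l2_space M" by (auto simp: l2_closure_def)
  show "(f, g) \<in> diag_op M v d"
  proof (rule diag_opI[OF f g])
    fix k
    have "cmod (l2_inner M g (v k) - of_real (d k) * l2_inner M f (v k)) \<le> 0 + e" if "e > 0" for e
    proof -
      \<comment> \<open>The defect of the coefficient relation is continuous in the graph distance,
        with constant 1 + |d k|.\<close>
      have e': "e / (1 + \<bar>d k\<bar>) > 0" using that by simp
      from fg have "\<forall>e>0. \<exists>(h, l)\<in>S. l2_norm M (\<lambda>x. f x - h x) < e \<and> l2_norm M (\<lambda>x. g x - l x) < e"
        unfolding l2_closure_def by blast
      with e' obtain h l where hl: "(h, l) \<in> S" "l2_norm M (\<lambda>x. f x - h x) < e / (1 + \<bar>d k\<bar>)"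
        "l2_norm M (\<lambda>x. g x - l x) < e / (1 + \<bar>d k\<bar>)" by blast
      have D: "(h, l) \<in> diag_op M v d" using hl(1) assms by blast
      have fh: "f - h \<in> l2_space M" and gl: "g - l \<in> l2_space M"
        by (intro L.diff_mem f g diag_opD[OF D])+
      have n: "L.nrm (f - h) < e / (1 + \<bar>d k\<bar>)" "L.nrm (g - l) < e / (1 + \<bar>d k\<bar>)"
        using hl(2,3) l2_norm_eq[OF fh] l2_norm_eq[OF gl] by (simp_all add: L.nrm_def fun_diff_def)
      have v1: "L.nrm (v k) = 1"
        by (simp add: L.nrm_def L.sq_def L.orthonormal_ip[OF basis])
      have "l2_inner M g (v k) - of_real (d k) * l2_inner M f (v k) =
          l2_inner M (g - l) (v k) - of_real (d k) * l2_inner M (f - h) (v k)"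
        by (simp add: L.ip_diff_left f g v_mem diag_opD[OF D] algebra_simps)
      also have "cmod \<dots> \<le> cmod (l2_inner M (g - l) (v k)) + \<bar>d k\<bar> * cmod (l2_inner M (f - h) (v k))"
        by (rule order_trans[OF norm_triangle_ineq4]) (simp add: norm_mult)
      also have "\<dots> \<le> L.nrm (g - l) + \<bar>d k\<bar> * L.nrm (f - h)"
        using L.Cauchy_Schwarz[OF gl v_mem, of k] L.Cauchy_Schwarz[OF fh v_mem, of k] v1
        by (intro add_mono mult_left_mono) auto
      also have "\<dots> \<le> e / (1 + \<bar>d k\<bar>) + \<bar>d k\<bar> * (e / (1 + \<bar>d k\<bar>))"
        using n by (intro add_mono mult_left_mono) auto
      also have "\<dots> = (1 + \<bar>d k\<bar>) * (e / (1 + \<bar>d k\<bar>))"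
        by (simp only: distrib_right mult_1_left)
      also have "\<dots> = e" by simp
      finally show ?thesis by simp
    qed
    then have "cmod (l2_inner M g (v k) - of_real (d k) * l2_inner M f (v k)) \<le> 0"
      by (rule field_le_epsilon)
    then show "l2_inner M g (v k) = of_real (d k) * l2_inner M f (v k)" by simp
  qed
qed

lemma diag_core:
  assumes D: "D \<subseteq> Domain (diag_op M v d)"
    and approx: "\<And>f g e. (f, g) \<in> diag_op M v d \<Longrightarrow> e > 0 \<Longrightarrow>
      \<exists>h\<in>D. \<exists>l. (h, l) \<in> diag_op M v d \<and> l2_norm M (f - h) < e \<and> l2_norm M (g - l) < e"
  shows "l2_core M D (diag_op M v d)"
  unfolding l2_core_def
proof (intro conjI D equalityI)
  show "l2_closure M (diag_op M v d \<inter> D \<times> UNIV) \<subseteq> diag_op M v d"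
    by (rule diag_closure_subset) blast
  show "diag_op M v d \<subseteq> l2_closure M (diag_op M v d \<inter> D \<times> UNIV)"
  proof (rule subrelI)
    fix f g assume fg: "(f, g) \<in> diag_op M v d"
    show "(f, g) \<in> l2_closure M (diag_op M v d \<inter> D \<times> UNIV)"
      unfolding l2_closure_def
    proof (intro CollectI case_prodI conjI allI impI diag_opD[OF fg])
      fix e :: real assume "e > 0"
      with approx[OF fg] obtain h l where "h \<in> D" "(h, l) \<in> diag_op M v d"
        "l2_norm M (f - h) < e" "l2_norm M (g - l) < e" by blast
      then show "\<exists>(h, k)\<in>diag_op M v d \<inter> D \<times> UNIV.
          l2_norm M (\<lambda>x. f x - h x) < e \<and> l2_norm M (\<lambda>x. g x - k x) < e"
        by (intro bexI[of _ "(h, l)"]) (simp_all add: fun_diff_def)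
    qed
  qed
qed

section \<open>Spectrum of a diagonal operator with eigenvalues tending to infinity\<close>

context
  fixes d :: "nat \<Rightarrow> real"
  assumes d_lim: "filterlim d at_top sequentially"
begin

lemma finite_below: "finite {k. d k \<le> Z}"
proof -
  from d_lim obtain N where N: "\<And>k. k \<ge> N \<Longrightarrow> Z + 1 \<le> d k"
    by (auto simp: filterlim_at_top eventually_sequentially)
  have "{k. d k \<le> Z} \<subseteq> {..<N}"
    using N by (force simp: not_le[symmetric])
  then show ?thesis by (rule finite_subset) simp
qed

lemma finite_near: "finite {k. cmod (of_real (d k) - z) < r}"
proof (rule finite_subset[OF _ finite_below[of "cmod z + r"]])
  show "{k. cmod (of_real (d k) - z) < r} \<subseteq> {k. d k \<le> cmod z + r}"
  proof clarify
    fix k assume "cmod (of_real (d k) - z) < r"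
    moreover have "\<bar>d k\<bar> \<le> cmod (of_real (d k) - z) + cmod z"
      using norm_triangle_sub[of "of_real (d k) :: complex" z] by simp
    ultimately show "d k \<le> cmod z + r" by linarith
  qed
qed

lemma finite_eq: "finite {k. complex_of_real (d k) = z}"
  by (rule finite_subset[OF _ finite_near[of z 1]]) auto

text \<open>Only finitely many \<open>d k\<close> lie within distance 1 of z, so the infimum of the
  distances is a positive minimum.\<close>

lemma resolvent_gap:
  assumes "\<And>k. complex_of_real (d k) \<noteq> z"
  obtains \<delta> where "\<delta> > 0" "\<And>k. \<delta> \<le> cmod (of_real (d k) - z)"
proof -
  let ?A = "(\<lambda>k. cmod (of_real (d k) - z)) ` {k. cmod (of_real (d k) - z) < 1}"
  have fin: "finite (insert 1 ?A)" using finite_near by blast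
  have "Min (insert 1 ?A) > 0"
    using fin assms by (subst Min_gr_iff) auto
  moreover have "Min (insert 1 ?A) \<le> cmod (of_real (d k) - z)" for k
  proof (cases "cmod (of_real (d k) - z) < 1")
    case True
    then show ?thesis using fin by (intro Min_le) auto
  next
    case False
    then show ?thesis using Min_le[OF fin, of 1] by simp
  qed
  ultimately show ?thesis using that by blast
qed

text \<open>The resolvent divides the k-th coefficient by d_k - z. The gap \<delta> gives the lower
  estimate and makes the quotients square summable, so that Riesz-Fischer provides a
  preimage.\<close>

lemma diag_resolvent:
  assumes z: "\<And>k. complex_of_real (d k) \<noteq> z"
  shows "z \<in> l2_resolvent_set M (diag_op M v d)"
proof -
  obtain \<delta> where \<delta>: "\<delta> > 0" "\<And>k. \<delta> \<le> cmod (of_real (d k) - z)"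
    by (rule resolvent_gap[OF z]) (rule that)
  have bound: "l2_norm M f \<le> (1 / \<delta>) * l2_norm M (\<lambda>x. g x - z * f x)" if fg: "(f, g) \<in> diag_op M v d" for f g
  proof -
    note D = diag_opD[OF fg]
    have mem: "g - fscale z f \<in> l2_space M" by (intro L.diff_mem L.scale_mem D)
    have "(\<lambda>k. \<delta>\<^sup>2 * (cmod (l2_inner M f (v k)))\<^sup>2) sums (\<delta>\<^sup>2 * L.sq f)"
      by (intro sums_mult Parseval_sq D)
    moreover have "(\<lambda>k. (cmod (l2_inner M (g - fscale z f) (v k)))\<^sup>2) sums L.sq (g - fscale z f)"
      by (rule Parseval_sq[OF mem])
    moreover have "\<delta>\<^sup>2 * (cmod (l2_inner M f (v k)))\<^sup>2 \<le> (cmod (l2_inner M (g - fscale z f) (v k)))\<^sup>2" for k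
    proof -
      have "l2_inner M (g - fscale z f) (v k) = (of_real (d k) - z) * l2_inner M f (v k)"
        by (simp add: L.ip_diff_left L.ip_scale_left L.scale_mem v_mem D algebra_simps)
      moreover have "\<delta>\<^sup>2 \<le> (cmod (of_real (d k) - z))\<^sup>2"
        using \<delta> by (intro power_mono) auto
      ultimately show ?thesis
        by (simp add: norm_mult power_mult_distrib mult_right_mono)
    qed
    ultimately have "\<delta>\<^sup>2 * L.sq f \<le> L.sq (g - fscale z f)"
      by (rule sums_le[rotated])
    then have "sqrt (\<delta>\<^sup>2 * L.sq f) \<le> sqrt (L.sq (g - fscale z f))"
      by (rule real_sqrt_le_mono)
    then have "\<delta> * l2_norm M f \<le> l2_norm M (g - fscale z f)"
      using \<delta>(1) by (simp add: real_sqrt_mult l2_norm_eq D mem)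
    then show ?thesis
      using \<delta>(1) by (simp add: field_simps fun_diff_def)
  qed
  have onto: "\<exists>(f, g)\<in>diag_op M v d. AE x in M. g x - z * f x = h x" if h: "h \<in> l2_space M" for h
  proof -
    have "summable (\<lambda>k. (cmod (l2_inner M h (v k) / (of_real (d k) - z)))\<^sup>2)"
    proof (rule summable_comparison_test'[where N = 0])
      show "summable (\<lambda>k. (cmod (l2_inner M h (v k)))\<^sup>2 / \<delta>\<^sup>2)"
        by (intro summable_divide L.Bessel_summable basis h)
      show "norm ((cmod (l2_inner M h (v k) / (of_real (d k) - z)))\<^sup>2) \<le> (cmod (l2_inner M h (v k)))\<^sup>2 / \<delta>\<^sup>2" for k
        using \<delta>(1) power_mono[OF \<delta>(2)[of k], of 2]
        by (auto simp: norm_divide power_divide intro!: frac_le)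
    qed
    from L.Riesz_Fischer[OF basis this] obtain f where f: "f \<in> l2_space M"
      "\<And>k. l2_inner M f (v k) = l2_inner M h (v k) / (of_real (d k) - z)" by blast
    have "(f, h + fscale z f) \<in> diag_op M v d"
    proof (rule diag_opI)
      fix k
      show "l2_inner M (h + fscale z f) (v k) = of_real (d k) * l2_inner M f (v k)"
        using z[of k] by (simp add: L.ip_add_left L.ip_scale_left L.scale_mem v_mem f h field_simps)
    qed (auto intro: L.add_mem L.scale_mem f h)
    then show ?thesis by (intro bexI[of _ "(f, h + fscale z f)"]) simp_all
  qed
  show ?thesis
    unfolding l2_resolvent_set_def using bound onto by blast
qed

text \<open>Coefficients of an eigenvector for z vanish unless d_k = z, so the matching v_k form a
  basis. For z outside the list the count is 0 and the eigenspace consists of null functions, which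
  covers both requirements of the eigenvalue sequence at once.\<close>

lemma diag_eigenspace_dim:
  "l2_has_dim M (l2_eigenspace (diag_op M v d) z) (card {k. complex_of_real (d k) = z})"
proof -
  define A where "A = {k. complex_of_real (d k) = z}"
  define n where "n = card A"
  have "finite A" unfolding A_def by (rule finite_eq)
  then obtain h where h: "bij_betw h {0..<n} A"
    unfolding n_def using ex_bij_betw_nat_finite by blast
  have hA: "h i \<in> A" if "i < n" for i using h that by (auto simp: bij_betw_def)
  have h_eq: "h i = h j \<longleftrightarrow> i = j" if "i < n" "j < n" for i j
    using h that by (auto simp: bij_betw_def inj_on_def)
  have comb: "(\<Sum>i<n. fscale (c i) (v (h i))) \<in> l2_space M" for c
    by (intro L.sum_mem L.scale_mem v_mem)
  have coeff: "l2_inner M (\<Sum>i<n. fscale (c i) (v (h i))) (v k) = (\<Sum>i<n. if h i = k then c i else 0)" for c k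
    by (subst L.ip_sum_left) (auto simp: L.scale_mem v_mem L.ip_scale_left L.orthonormal_ip[OF basis] intro!: sum.cong)
  have coeff_h: "l2_inner M (\<Sum>i<n. fscale (c i) (v (h i))) (v (h j)) = c j" if "j < n" for c j
  proof -
    have "(\<Sum>i<n. if h i = h j then c i else 0) = (\<Sum>i<n. if i = j then c i else 0)"
      using that by (intro sum.cong) (auto simp: h_eq)
    then show ?thesis using that by (simp add: coeff)
  qed
  have "\<forall>i<n. v (h i) \<in> l2_eigenspace (diag_op M v d) z"
    using diag_basis[of _ d] hA by (fastforce simp: l2_eigenspace_def A_def fscale_def)
  moreover have "\<forall>i<n. c i = 0" if "AE x in M. (\<Sum>i<n. c i * v (h i) x) = 0" for c
  proof (intro allI impI)
    fix j assume j: "j < n"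
    have "l2_inner M (\<Sum>i<n. fscale (c i) (v (h i))) (v (h j)) = l2_inner M 0 (v (h j))"
      using that by (intro l2_inner_cong_AE comb v_mem L.zero_mem) auto
    then show "c j = 0" by (simp add: coeff_h j L.ip_zero_left v_mem)
  qed
  moreover have "\<exists>c. AE x in M. f x = (\<Sum>i<n. c i * v (h i) x)" if f: "f \<in> l2_eigenspace (diag_op M v d) z" for f
  proof -
    have fg: "(f, fscale z f) \<in> diag_op M v d" using f by (simp add: l2_eigenspace_def fscale_def)
    note D = diag_opD[OF fg]
    have zero: "l2_inner M f (v k) = 0" if "k \<notin> A" for k
      using D(3)[of k] L.ip_scale_left[OF D(1) v_mem, of z k] that by (auto simp: A_def)
    have "AE x in M. f x = (\<Sum>i<n. fscale (l2_inner M f (v (h i))) (v (h i))) x"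
    proof (rule AE_eqI[OF D(1) comb])
      fix k
      show "l2_inner M f (v k) = l2_inner M (\<Sum>i<n. fscale (l2_inner M f (v (h i))) (v (h i))) (v k)"
      proof (cases "k \<in> A")
        case True
        then obtain j where "j < n" "k = h j" using h by (auto simp: bij_betw_def)
        then show ?thesis by (simp add: coeff_h)
      next
        case False
        then have "h i \<noteq> k" if "i < n" for i using hA[OF that] by auto
        then show ?thesis using zero[OF False] by (simp add: coeff)
      qed
    qed
    then show ?thesis by auto
  qed
  ultimately show ?thesis
    unfolding l2_has_dim_def A_def[symmetric] n_def[symmetric]
    by (intro exI[of _ "\<lambda>i. v (h i)"]) blast
qed

lemma diag_discrete_spectrum: "l2_discrete_spectrum M (diag_op M v d)"
  unfolding l2_discrete_spectrum_def
proof (intro ballI conjI)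
  have sub: "l2_spectrum M (diag_op M v d) \<subseteq> (\<lambda>k. complex_of_real (d k)) ` UNIV"
  proof (rule subsetI, rule ccontr)
    fix z assume "z \<in> l2_spectrum M (diag_op M v d)" "z \<notin> range (\<lambda>k. complex_of_real (d k))"
    moreover from this(2) have "z \<in> l2_resolvent_set M (diag_op M v d)"
      by (intro diag_resolvent) auto
    ultimately show False by (simp add: l2_spectrum_def)
  qed
  fix z assume z: "z \<in> l2_spectrum M (diag_op M v d)"
  show "\<not> z islimpt l2_spectrum M (diag_op M v d)"
  proof
    assume "z islimpt l2_spectrum M (diag_op M v d)"
    then have "infinite ((\<lambda>k. complex_of_real (d k)) ` UNIV \<inter> ball z 1)"
      using islimpt_subset[OF _ sub] by (simp add: islimpt_eq_infinite_ball)
    moreover have "(\<lambda>k. complex_of_real (d k)) ` UNIV \<inter> ball z 1 \<subseteq>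
        (\<lambda>k. complex_of_real (d k)) ` {k. cmod (of_real (d k) - z) < 1}"
      by (auto simp: dist_norm norm_minus_commute)
    ultimately show False
      using finite_subset finite_near[of z 1] by blast
  qed
  have "{k. complex_of_real (d k) = z} \<noteq> {}" using z sub by auto
  then have "card {k. complex_of_real (d k) = z} > 0"
    using finite_eq by (simp add: card_gt_0_iff)
  then show "\<exists>n>0. l2_has_dim M (l2_eigenspace (diag_op M v d) z) n"
    using diag_eigenspace_dim by blast
qed

lemma diag_eigenvalue_seq:
  assumes "incseq d"
  shows "l2_eigenvalue_seq M (diag_op M v d) d"
  unfolding l2_eigenvalue_seq_def by (intro conjI allI assms finite_eq diag_eigenspace_dim)

end

end

section \<open>Integrability of powers\<close>

lemma set_integrable_half_line_powr:
  fixes p :: real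
  assumes p: "p > -1"
  shows "set_integrable lborel {0<..<1} (\<lambda>x. x powr p)" "set_integrable lborel {1<..} (\<lambda>x::real. x powr (-2))"
proof -
  have "set_integrable lborel (einterval (ereal 0) (ereal 1)) (\<lambda>x. x powr p)"
  proof (rule interval_integral_FTC_nonneg(1)[where F = "\<lambda>x. x powr (p + 1) / (p + 1)" and A = 0 and B = "1 / (p + 1)"])
    show "DERIV (\<lambda>x. x powr (p + 1) / (p + 1)) x :> x powr p" if "ereal 0 < ereal x" for x
      using that p by (auto intro!: derivative_eq_intros)
    have "((\<lambda>x. x powr (p + 1) / (p + 1)) \<longlongrightarrow> 0 / (p + 1)) (at_right 0)"
      using p by (intro tendsto_divide tendsto_const tendsto_zero_powrI[where b = "p + 1"])
        (auto intro: tendsto_ident_at eventually_mono[OF eventually_at_right_less])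
    then show "(((\<lambda>x. x powr (p + 1) / (p + 1)) \<circ> real_of_ereal) \<longlongrightarrow> 0) (at_right (ereal 0))"
      by (simp add: ereal_tendsto_simps)
    have "((\<lambda>x. x powr (p + 1) / (p + 1)) \<longlongrightarrow> 1 powr (p + 1) / (p + 1)) (at_left 1)"
      using p by (intro tendsto_intros) auto
    then show "(((\<lambda>x. x powr (p + 1) / (p + 1)) \<circ> real_of_ereal) \<longlongrightarrow> 1 / (p + 1)) (at_left (ereal 1))"
      by (simp add: ereal_tendsto_simps)
  qed (use p in \<open>auto intro!: continuous_intros\<close>)
  then show "set_integrable lborel {0<..<1} (\<lambda>x. x powr p)"
    by (simp add: einterval_def greaterThanLessThan_def greaterThan_def lessThan_def Collect_conj_eq)
  have "set_integrable lborel (einterval (ereal 1) \<infinity>) (\<lambda>x. x powr (-2))"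
  proof (rule interval_integral_FTC_nonneg(1)[where F = "\<lambda>x. - inverse x" and A = "-1" and B = 0])
    show "DERIV (\<lambda>x. - inverse x) x :> x powr (-2)" if "ereal 1 < ereal x" for x
      using that by (auto intro!: derivative_eq_intros simp: powr_minus power2_eq_square)
    have "((\<lambda>x::real. - inverse x) \<longlongrightarrow> - inverse 1) (at_right 1)"
      by (intro tendsto_intros) auto
    then show "(((\<lambda>x. - inverse x) \<circ> real_of_ereal) \<longlongrightarrow> -1) (at_right (ereal 1))"
      by (simp add: ereal_tendsto_simps)
    have "((\<lambda>x::real. - inverse x) \<longlongrightarrow> - 0) at_top"
      by (intro tendsto_minus tendsto_inverse_0_at_top filterlim_ident)
    then show "(((\<lambda>x. - inverse x) \<circ> real_of_ereal) \<longlongrightarrow> 0) (at_left \<infinity>)"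
      by (simp add: ereal_tendsto_simps)
  qed (auto intro!: continuous_intros)
  then show "set_integrable lborel {1<..} (\<lambda>x::real. x powr (-2))"
    by (simp add: einterval_def greaterThan_def)
qed

text \<open>One integrable majorant for all weighted decaying functions: the power p governs the
  origin, where only p > -1 matters, and an inverse square governs infinity. The reflected copy of
  \<open>h\<close> covers the negative half line up to the three points 0, 1, -1.\<close>

lemma integrable_powr_majorant:
  fixes p :: real
  assumes p: "p > -1"
  shows "integrable lborel (\<lambda>x. if \<bar>x\<bar> < 1 then \<bar>x\<bar> powr p else \<bar>x\<bar> powr (-2))" (is "integrable lborel ?g")
proof -
  define h :: "real \<Rightarrow> real" where
    "h x = indicator {0<..<1} x *\<^sub>R (x powr p) + indicator {1<..} x *\<^sub>R (x powr (-2))" for x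
  have [measurable]: "h \<in> borel_measurable borel"
    unfolding h_def by measurable
  have h: "integrable lborel h"
    unfolding h_def using set_integrable_half_line_powr[OF p]
    by (intro Bochner_Integration.integrable_add) (simp_all add: set_integrable_def)
  have "integrable lborel (\<lambda>x. h x + h (0 + (-1) * x))"
    by (intro Bochner_Integration.integrable_add h lborel_integrable_real_affine[OF h]) simp
  then show ?thesis
  proof (rule integrable_cong_AE_imp)
    have "AE x in lborel. x \<notin> {0, 1, -1::real}"
      using AE_lborel_singleton[of 0] AE_lborel_singleton[of 1] AE_lborel_singleton[of "-1"]
      by eventually_elim auto
    then show "AE x in lborel. h x + h (0 + (-1) * x) = ?g x"
      by eventually_elim (auto simp: h_def indicator_def)
  qed measurable
qed

subsection \<open>Rapidly decreasing functions\<close>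

text \<open>Decay without smoothness: the class is closed under products, reflections and division
  at a zero, and it contains J \<phi>, whose value at 0 is arbitrary.\<close>

definition rapid :: "(real \<Rightarrow> complex) \<Rightarrow> bool" where
  "rapid f \<longleftrightarrow> f \<in> borel_measurable borel \<and> (\<forall>m. \<exists>C. \<forall>x. \<bar>x\<bar> ^ m * cmod (f x) \<le> C)"

lemma rapid_measurable: "rapid f \<Longrightarrow> f \<in> borel_measurable borel"
  by (simp add: rapid_def)

lemma rapidE:
  assumes "rapid f"
  obtains C where "C \<ge> 0" "\<And>x. \<bar>x\<bar> ^ m * cmod (f x) \<le> C"
proof -
  from assms obtain C where C: "\<And>x. \<bar>x\<bar> ^ m * cmod (f x) \<le> C"
    unfolding rapid_def by blast
  have "0 \<le> \<bar>0\<bar> ^ m * cmod (f 0)" by simp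
  also have "\<dots> \<le> C" by (rule C)
  finally show ?thesis using C that by blast
qed

lemma rapid_dominated:
  assumes f: "rapid f" and g: "g \<in> borel_measurable borel"
    and le: "\<And>x. cmod (g x) \<le> B * (1 + \<bar>x\<bar> ^ n) * cmod (f x)"
  shows "rapid g"
  unfolding rapid_def
proof (intro conjI allI g)
  fix m
  obtain C1 where C1: "C1 \<ge> 0" "\<And>x. \<bar>x\<bar> ^ m * cmod (f x) \<le> C1" using rapidE[OF f] by blast
  obtain C2 where C2: "C2 \<ge> 0" "\<And>x. \<bar>x\<bar> ^ (m + n) * cmod (f x) \<le> C2" using rapidE[OF f] by blast
  have "\<bar>x\<bar> ^ m * cmod (g x) \<le> \<bar>B\<bar> * (C1 + C2)" for x
  proof -
    have "\<bar>x\<bar> ^ m * cmod (g x) \<le> \<bar>x\<bar> ^ m * (B * (1 + \<bar>x\<bar> ^ n) * cmod (f x))"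
      by (intro mult_left_mono le) simp
    also have "\<dots> = B * (\<bar>x\<bar> ^ m * cmod (f x) + \<bar>x\<bar> ^ (m + n) * cmod (f x))"
      by (simp add: algebra_simps power_add)
    also have "\<dots> \<le> \<bar>B\<bar> * (\<bar>x\<bar> ^ m * cmod (f x) + \<bar>x\<bar> ^ (m + n) * cmod (f x))"
      by (intro mult_right_mono) auto
    also have "\<dots> \<le> \<bar>B\<bar> * (C1 + C2)"
      by (intro mult_left_mono add_mono C1 C2) simp
    finally show ?thesis .
  qed
  then show "\<exists>C. \<forall>x. \<bar>x\<bar> ^ m * cmod (g x) \<le> C" by blast
qed

lemma rapid_add:
  assumes f: "rapid f" and g: "rapid g"
  shows "rapid (\<lambda>x. f x + g x)"
  unfolding rapid_def
proof (intro conjI allI)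
  show "(\<lambda>x. f x + g x) \<in> borel_measurable borel"
    using f g by (intro borel_measurable_add rapid_measurable)
  fix m
  obtain C1 where C1: "\<And>x. \<bar>x\<bar> ^ m * cmod (f x) \<le> C1" using rapidE[OF f] by blast
  obtain C2 where C2: "\<And>x. \<bar>x\<bar> ^ m * cmod (g x) \<le> C2" using rapidE[OF g] by blast
  have "\<bar>x\<bar> ^ m * cmod (f x + g x) \<le> C1 + C2" for x
  proof -
    have "\<bar>x\<bar> ^ m * cmod (f x + g x) \<le> \<bar>x\<bar> ^ m * (cmod (f x) + cmod (g x))"
      by (intro mult_left_mono norm_triangle_ineq) simp
    also have "\<dots> \<le> C1 + C2"
      unfolding distrib_left by (intro add_mono C1 C2)
    finally show ?thesis .
  qed
  then show "\<exists>C. \<forall>x. \<bar>x\<bar> ^ m * cmod (f x + g x) \<le> C" by blast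
qed

lemma rapid_cmult:
  assumes f: "rapid f" shows "rapid (\<lambda>x. c * f x)"
proof (rule rapid_dominated[OF f, where n = 0 and B = "cmod c"])
  show "(\<lambda>x. c * f x) \<in> borel_measurable borel"
    using rapid_measurable[OF f] by simp
  show "cmod (c * f x) \<le> cmod c * (1 + \<bar>x\<bar> ^ 0) * cmod (f x)" for x
    by (simp add: norm_mult)
qed

lemma rapid_minus: "rapid f \<Longrightarrow> rapid (\<lambda>x. - f x)"
  using rapid_cmult[of f "-1"] by (simp only: mult_minus1)

lemma rapid_diff: "rapid f \<Longrightarrow> rapid g \<Longrightarrow> rapid (\<lambda>x. f x - g x)"
  unfolding diff_conv_add_uminus by (intro rapid_add rapid_minus)

lemma rapid_power_mult:
  assumes f: "rapid f" shows "rapid (\<lambda>x. of_real (x ^ n) * f x)"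
proof (rule rapid_dominated[OF f, where n = n and B = 1])
  have [measurable]: "f \<in> borel_measurable borel" by (rule rapid_measurable[OF f])
  show "(\<lambda>x. of_real (x ^ n) * f x) \<in> borel_measurable borel" by measurable
  show "cmod (of_real (x ^ n) * f x) \<le> 1 * (1 + \<bar>x\<bar> ^ n) * cmod (f x)" for x
    by (simp add: norm_mult norm_power mult_right_mono)
qed

lemma rapid_cnj:
  assumes f: "rapid f" shows "rapid (\<lambda>x. cnj (f x))"
proof (rule rapid_dominated[OF f, where n = 0 and B = 1])
  show "(\<lambda>x. cnj (f x)) \<in> borel_measurable borel"
    by (rule borel_measurable_cnj[OF rapid_measurable[OF f]])
qed simp

lemma rapid_mult:
  assumes f: "rapid f" and g: "rapid g"
  shows "rapid (\<lambda>x. f x * g x)"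
proof -
  obtain C where C: "C \<ge> 0" "\<And>x. \<bar>x\<bar> ^ 0 * cmod (g x) \<le> C" using rapidE[OF g] by blast
  show ?thesis
  proof (rule rapid_dominated[OF f, where n = 0 and B = C])
    show "(\<lambda>x. f x * g x) \<in> borel_measurable borel"
      using f g by (intro borel_measurable_times rapid_measurable)
    fix x
    have "cmod (f x * g x) = cmod (g x) * cmod (f x)" by (simp add: norm_mult)
    also have "\<dots> \<le> (C * 2) * cmod (f x)"
      using C(1) C(2)[of x] by (intro mult_right_mono) auto
    finally show "cmod (f x * g x) \<le> C * (1 + \<bar>x\<bar> ^ 0) * cmod (f x)" by simp
  qed
qed

lemma rapid_reflect:
  assumes f: "rapid f" shows "rapid (\<lambda>x. f (- x))"
  unfolding rapid_def
proof (intro conjI allI)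
  have [measurable]: "f \<in> borel_measurable borel" by (rule rapid_measurable[OF f])
  show "(\<lambda>x. f (- x)) \<in> borel_measurable borel" by measurable
  fix m
  obtain C where "\<And>x. \<bar>x\<bar> ^ m * cmod (f x) \<le> C" using rapidE[OF f] by blast
  from this[of "- _"] show "\<exists>C. \<forall>x. \<bar>x\<bar> ^ m * cmod (f (- x)) \<le> C" by (intro exI[of _ C]) simp
qed

lemma rapid_if_zero:
  assumes f: "rapid f" shows "rapid (\<lambda>x. if x = 0 then c else f x)"
  unfolding rapid_def
proof (intro conjI allI)
  have [measurable]: "f \<in> borel_measurable borel" by (rule rapid_measurable[OF f])
  show "(\<lambda>x. if x = 0 then c else f x) \<in> borel_measurable borel" by measurable
  fix m
  obtain C where C: "C \<ge> 0" "\<And>x. \<bar>x\<bar> ^ m * cmod (f x) \<le> C" using rapidE[OF f] by blast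
  have "\<bar>x\<bar> ^ m * cmod (if x = 0 then c else f x) \<le> C + cmod c" for x
    using C(1) C(2)[of x] by (cases m) (auto simp: add_increasing2)
  then show "\<exists>C. \<forall>x. \<bar>x\<bar> ^ m * cmod (if x = 0 then c else f x) \<le> C" by blast
qed

text \<open>For |x| \<ge> 1 the division only helps, and near 0 the assumed order of vanishing
  bounds the quotient by |C|. At x = 0 itself a vanishing denominator gives the value 0.\<close>

lemma rapid_divide_power:
  assumes f: "rapid f" and le: "\<And>x. cmod (f x) \<le> C * \<bar>x\<bar> ^ k"
  shows "rapid (\<lambda>x. f x / of_real (x ^ k))"
  unfolding rapid_def
proof (intro conjI allI)
  have [measurable]: "f \<in> borel_measurable borel" by (rule rapid_measurable[OF f])
  show "(\<lambda>x. f x / of_real (x ^ k)) \<in> borel_measurable borel" by measurable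
  fix m
  obtain B where B: "B \<ge> 0" "\<And>x. \<bar>x\<bar> ^ m * cmod (f x) \<le> B" using rapidE[OF f] by blast
  have "\<bar>x\<bar> ^ m * cmod (f x / of_real (x ^ k)) \<le> B + \<bar>C\<bar>" for x
  proof (cases "\<bar>x\<bar> \<ge> 1")
    case True
    then have k: "1 \<le> \<bar>x\<bar> ^ k" by (rule one_le_power)
    then have "\<bar>x\<bar> ^ m * cmod (f x) / \<bar>x\<bar> ^ k \<le> \<bar>x\<bar> ^ m * cmod (f x) / 1"
      by (rule divide_left_mono) (use k in \<open>linarith | simp\<close>)+
    then show ?thesis using B(2)[of x] by (simp add: norm_divide norm_power)
  next
    case False
    have "\<bar>x\<bar> ^ m \<le> 1" using False by (intro power_le_one) auto
    moreover have "cmod (f x / of_real (x ^ k)) \<le> \<bar>C\<bar>"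
    proof (cases "x ^ k = 0")
      case False
      then have "\<bar>x\<bar> ^ k > 0" by (simp flip: power_abs)
      moreover have "cmod (f x) \<le> \<bar>C\<bar> * \<bar>x\<bar> ^ k"
        using le[of x] by (rule order_trans) (intro mult_right_mono, auto)
      ultimately show ?thesis by (simp add: norm_divide norm_power divide_le_eq)
    next
      case True
      then show ?thesis by (simp only: True of_real_0 div_by_0 norm_zero abs_ge_zero)
    qed
    ultimately have "\<bar>x\<bar> ^ m * cmod (f x / of_real (x ^ k)) \<le> 1 * \<bar>C\<bar>"
      by (intro mult_mono) auto
    then show ?thesis using B(1) by simp
  qed
  then show "\<exists>C. \<forall>x. \<bar>x\<bar> ^ m * cmod (f x / of_real (x ^ k)) \<le> C" by blast
qed

lemma rapid_integrable:
  assumes f: "rapid f" and p: "p > -1"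
  shows "integrable lborel (\<lambda>x. \<bar>x\<bar> powr p *\<^sub>R f x)"
proof -
  \<comment> \<open>Decay of order m \<ge> p + 2 leaves the integrable tail |x|^(-2) after
    multiplication by the weight |x|^p.\<close>
  define m where "m = nat \<lceil>p + 2\<rceil>"
  have [measurable]: "f \<in> borel_measurable borel" by (rule rapid_measurable[OF f])
  obtain C1 where C1: "C1 \<ge> 0" "\<And>x. \<bar>x\<bar> ^ 0 * cmod (f x) \<le> C1" using rapidE[OF f] by blast
  obtain C2 where C2: "C2 \<ge> 0" "\<And>x. \<bar>x\<bar> ^ m * cmod (f x) \<le> C2" using rapidE[OF f] by blast
  show ?thesis
  proof (rule Bochner_Integration.integrable_bound)
    show "integrable lborel (\<lambda>x. (C1 + C2) * (if \<bar>x\<bar> < 1 then \<bar>x\<bar> powr p else \<bar>x\<bar> powr (-2)))"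
      by (intro integrable_mult_right integrable_powr_majorant p)
    have "\<bar>x\<bar> powr p * cmod (f x) \<le> (C1 + C2) * (if \<bar>x\<bar> < 1 then \<bar>x\<bar> powr p else \<bar>x\<bar> powr (-2))" for x
    proof (cases "\<bar>x\<bar> < 1")
      case True
      have "\<bar>x\<bar> powr p * cmod (f x) \<le> \<bar>x\<bar> powr p * (C1 + C2)"
        using C1(2)[of x] C2(1) by (intro mult_left_mono) auto
      then show ?thesis using True by (simp add: mult.commute)
    next
      case False
      then have "\<bar>x\<bar> powr (p + 2) \<le> \<bar>x\<bar> powr (real m)"
        unfolding m_def by (intro powr_mono) linarith+
      then have "\<bar>x\<bar> powr (p + 2) * cmod (f x) \<le> \<bar>x\<bar> ^ m * cmod (f x)"
        using False by (intro mult_right_mono) (auto simp: powr_realpow)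
      also have "\<dots> \<le> C1 + C2" using C2(2)[of x] C1(1) by linarith
      finally have "\<bar>x\<bar> powr (-2) * (\<bar>x\<bar> powr (p + 2) * cmod (f x)) \<le> \<bar>x\<bar> powr (-2) * (C1 + C2)"
        by (intro mult_left_mono) auto
      moreover have "\<bar>x\<bar> powr (-2) * \<bar>x\<bar> powr (p + 2) = \<bar>x\<bar> powr p"
        by (simp flip: powr_add)
      ultimately show ?thesis using False by (simp add: mult.assoc[symmetric] mult.commute[of "C1 + C2"])
    qed
    then show "AE x in lborel. norm (\<bar>x\<bar> powr p *\<^sub>R f x)
        \<le> norm ((C1 + C2) * (if \<bar>x\<bar> < 1 then \<bar>x\<bar> powr p else \<bar>x\<bar> powr (-2)))"
      using C1(1) C2(1) by (intro AE_I2) (auto simp: abs_mult)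
  qed measurable
qed

section \<open>The weighted measure\<close>

lemma borel_dunkl [measurable_cong, simp]: "sets (dunkl_measure \<sigma>) = sets borel"
  by (simp add: dunkl_measure_def)

lemma measurable_dunkl [simp]: "borel_measurable (dunkl_measure \<sigma>) = borel_measurable borel"
  by (rule measurable_cong_sets) simp_all

text \<open>The weight vanishes at most at the origin, so the null sets are those of Lebesgue
  measure, whatever the sign of \<sigma>.\<close>

lemma AE_dunkl: "(AE x in dunkl_measure \<sigma>. P x) \<longleftrightarrow> (AE x in lborel. P x)"
proof -
  have "(AE x in dunkl_measure \<sigma>. P x) \<longleftrightarrow> (AE x in lborel. 0 < ennreal (\<bar>x\<bar> powr (2 * \<sigma>)) \<longrightarrow> P x)"
    unfolding dunkl_measure_def by (rule AE_density) simp
  also have "\<dots> \<longleftrightarrow> (AE x in lborel. P x)"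
  proof
    assume "AE x in lborel. 0 < ennreal (\<bar>x\<bar> powr (2 * \<sigma>)) \<longrightarrow> P x"
    then show "AE x in lborel. P x"
      using AE_lborel_singleton[of 0] by eventually_elim auto
  next
    assume "AE x in lborel. P x"
    then show "AE x in lborel. 0 < ennreal (\<bar>x\<bar> powr (2 * \<sigma>)) \<longrightarrow> P x"
      by eventually_elim simp
  qed
  finally show ?thesis .
qed

lemma integrable_dunkl:
  fixes f :: "real \<Rightarrow> 'b::{banach, second_countable_topology}"
  assumes "f \<in> borel_measurable borel"
  shows "integrable (dunkl_measure \<sigma>) f \<longleftrightarrow> integrable lborel (\<lambda>x. \<bar>x\<bar> powr (2 * \<sigma>) *\<^sub>R f x)"
  unfolding dunkl_measure_def by (rule integrable_density) (simp_all add: assms)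

lemma integral_dunkl:
  fixes f :: "real \<Rightarrow> 'b::{banach, second_countable_topology}"
  assumes "f \<in> borel_measurable borel"
  shows "integral\<^sup>L (dunkl_measure \<sigma>) f = integral\<^sup>L lborel (\<lambda>x. \<bar>x\<bar> powr (2 * \<sigma>) *\<^sub>R f x)"
  unfolding dunkl_measure_def by (rule integral_density) (simp_all add: assms)

lemma rapid_l2:
  assumes f: "rapid f" and \<sigma>: "\<sigma> > -1/2"
  shows "f \<in> l2_space (dunkl_measure \<sigma>)"
proof -
  have [measurable]: "f \<in> borel_measurable borel" by (rule rapid_measurable[OF f])
  have "integrable lborel (\<lambda>x. \<bar>x\<bar> powr (2 * \<sigma>) *\<^sub>R (f x * cnj (f x)))"
    using \<sigma> by (intro rapid_integrable rapid_mult rapid_cnj f) auto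
  then have "integrable lborel (\<lambda>x. Re (\<bar>x\<bar> powr (2 * \<sigma>) *\<^sub>R (f x * cnj (f x))))"
    by (rule integrable_Re)
  then have "integrable (dunkl_measure \<sigma>) (\<lambda>x. (cmod (f x))\<^sup>2)"
    by (subst integrable_dunkl) (simp_all add: complex_mult_cnj cmod_power2)
  then show ?thesis by (simp add: l2_space_def)
qed

text \<open>The squared power merges with the weight into exponent 2(\<sigma> + a), integrable at 0
  iff it exceeds -1. With a = -u the hypothesis becomes \<sigma> > u - 1/2.\<close>

lemma l2_abs_power:
  assumes f: "rapid f" and \<sigma>: "\<sigma> + a > -1/2"
  shows "abs_power_mult a f \<in> l2_space (dunkl_measure \<sigma>)"
proof -
  have [measurable]: "f \<in> borel_measurable borel" by (rule rapid_measurable[OF f])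
  have [measurable]: "abs_power_mult a f \<in> borel_measurable borel"
    unfolding abs_power_mult_def[abs_def] by measurable
  have "integrable lborel (\<lambda>x. \<bar>x\<bar> powr (2 * (\<sigma> + a)) *\<^sub>R (f x * cnj (f x)))"
    using \<sigma> by (intro rapid_integrable rapid_mult rapid_cnj f) auto
  then have "integrable lborel (\<lambda>x. Re (\<bar>x\<bar> powr (2 * (\<sigma> + a)) *\<^sub>R (f x * cnj (f x))))"
    by (rule integrable_Re)
  also have "(\<lambda>x. Re (\<bar>x\<bar> powr (2 * (\<sigma> + a)) *\<^sub>R (f x * cnj (f x)))) =
      (\<lambda>x. \<bar>x\<bar> powr (2 * \<sigma>) *\<^sub>R (cmod (abs_power_mult a f x))\<^sup>2)"
  proof
    fix x
    have "\<bar>x\<bar> powr (2 * (\<sigma> + a)) = \<bar>x\<bar> powr (2 * \<sigma>) * (\<bar>x\<bar> powr a)\<^sup>2"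
      by (simp add: power2_eq_square distrib_left flip: powr_add)
    then show "Re (\<bar>x\<bar> powr (2 * (\<sigma> + a)) *\<^sub>R (f x * cnj (f x))) =
        \<bar>x\<bar> powr (2 * \<sigma>) *\<^sub>R (cmod (abs_power_mult a f x))\<^sup>2"
      by (simp add: abs_power_mult_def norm_mult power_mult_distrib cmod_power2 power2_eq_square[of "Re _"]
          power2_eq_square[of "Im _"])
  qed
  finally have "integrable (dunkl_measure \<sigma>) (\<lambda>x. (cmod (abs_power_mult a f x))\<^sup>2)"
    by (subst integrable_dunkl) simp_all
  then show ?thesis by (simp add: l2_space_def)
qed

subsection \<open>Integration by parts on the half line\<close>

text \<open>The weight is smooth only away from 0. Folding the line reduces every integration by
  parts to x > 0 and, for products of a function with J, removes the mixed even-odd terms.\<close>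

lemma integral_fold_half_line:
  fixes f :: "real \<Rightarrow> 'b::{banach, second_countable_topology}"
  assumes f: "integrable lborel f"
  shows "set_integrable lborel {0<..} (\<lambda>x. f x + f (- x))"
    and "integral\<^sup>L lborel f = (LINT x:{0<..}|lborel. f x + f (- x))"
proof -
  have g: "integrable lborel (\<lambda>x. f (0 + (-1) * x))"
    by (rule lborel_integrable_real_affine[OF f]) simp
  have fi: "integrable lborel (\<lambda>x. indicator A x *\<^sub>R f x)" if "A \<in> sets borel" for A
    using integrable_mult_indicator[of A lborel f] f that by simp
  have gi: "integrable lborel (\<lambda>x. indicator A x *\<^sub>R f (- x))" if "A \<in> sets borel" for A
    using integrable_mult_indicator[of A lborel "\<lambda>x. f (- x)"] g that by simp
  show "set_integrable lborel {0<..} (\<lambda>x. f x + f (- x))"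
    unfolding set_integrable_def scaleR_add_right
    by (intro Bochner_Integration.integrable_add fi gi) auto
  have "integral\<^sup>L lborel f = (LINT x|lborel. indicator {0<..} x *\<^sub>R f x + indicator {..<0} x *\<^sub>R f x)"
  proof (rule integral_cong_AE)
    have "AE x in lborel. x \<noteq> (0::real)" by (rule AE_lborel_singleton)
    then show "AE x in lborel. f x = indicator {0<..} x *\<^sub>R f x + indicator {..<0} x *\<^sub>R f x"
      by eventually_elim (auto simp: indicator_def)
  qed (intro borel_measurable_add borel_measurable_integrable f fi; simp)+
  also have "\<dots> = (LINT x|lborel. indicator {0<..} x *\<^sub>R f x) + (LINT x|lborel. indicator {..<0} x *\<^sub>R f x)"
    by (intro Bochner_Integration.integral_add fi) auto
  also have "(LINT x|lborel. indicator {..<0} x *\<^sub>R f x) = (LINT x|lborel. indicator {0<..} x *\<^sub>R f (- x))"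
    by (subst lborel_integral_real_affine[where c = "-1" and t = 0]) (auto intro!: Bochner_Integration.integral_cong simp: indicator_def)
  also have "(LINT x|lborel. indicator {0<..} x *\<^sub>R f x) + \<dots> = (LINT x|lborel. indicator {0<..} x *\<^sub>R f x + indicator {0<..} x *\<^sub>R f (- x))"
    by (intro Bochner_Integration.integral_add[symmetric] fi gi) auto
  finally show "integral\<^sup>L lborel f = (LINT x:{0<..}|lborel. f x + f (- x))"
    by (simp add: set_lebesgue_integral_def scaleR_add_right)
qed

lemma half_line_subset: "{1 / real (Suc n)..real (Suc n)} \<subseteq> {0<..}"
proof
  fix x assume "x \<in> {1 / real (Suc n)..real (Suc n)}"
  then have "1 / real (Suc n) \<le> x" by (simp only: atLeastAtMost_iff)
  moreover have "0 < 1 / real (Suc n)" by simp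
  ultimately have "0 < x" by (rule less_le_trans[rotated])
  then show "x \<in> {0<..}" by simp
qed

lemma half_line_limit:
  fixes f :: "real \<Rightarrow> 'b::{banach, second_countable_topology}"
  assumes f: "set_integrable lborel {0<..} f"
  shows "(\<lambda>n. LINT x:{1 / real (Suc n)..real (Suc n)}|lborel. f x) \<longlonglongrightarrow> (LINT x:{0<..}|lborel. f x)"
proof -
  have U: "(\<Union>n. {1 / real (Suc n)..real (Suc n)}) = {0<..}"
  proof (intro equalityI subsetI)
    fix x :: real assume "x \<in> {0<..}"
    then have x: "x > 0" by simp
    obtain n1 where n1: "inverse (real (Suc n1)) < x" using reals_Archimedean[OF x] by auto
    obtain n2 :: nat where n2: "x < real n2" using reals_Archimedean2 by blast
    have "1 / real (Suc (max n1 n2)) \<le> 1 / real (Suc n1)" by (intro divide_left_mono) auto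
    then have "x \<in> {1 / real (Suc (max n1 n2))..real (Suc (max n1 n2))}"
      using n1 n2 by (auto simp: inverse_eq_divide)
    then show "x \<in> (\<Union>n. {1 / real (Suc n)..real (Suc n)})" by blast
  next
    fix x :: real assume "x \<in> (\<Union>n. {1 / real (Suc n)..real (Suc n)})"
    then obtain n where n: "1 / real (Suc n) \<le> x" by auto
    have "0 < 1 / real (Suc n)" by simp
    also note n
    finally show "x \<in> {0<..}" by simp
  qed
  have "(\<lambda>n. LINT x:{1 / real (Suc n)..real (Suc n)}|lborel. f x) \<longlonglongrightarrow>
      (LINT x:(\<Union>n. {1 / real (Suc n)..real (Suc n)})|lborel. f x)"
  proof (rule set_integral_cont_up)
    show "incseq (\<lambda>n. {1 / real (Suc n)..real (Suc n)})"
      by (intro monoI) (auto intro: order_trans[rotated] frac_le)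
  qed (simp_all only: U f sets_lborel atLeastAtMost_borel)
  then show ?thesis by (simp only: U)
qed

lemma half_line_boundary:
  fixes F :: "real \<Rightarrow> 'b::real_normed_vector"
  assumes "(F \<longlongrightarrow> 0) (at_right 0)" "(F \<longlongrightarrow> 0) at_top"
  shows "(\<lambda>n. F (real (Suc n)) - F (1 / real (Suc n))) \<longlonglongrightarrow> 0"
proof -
  have "filterlim (\<lambda>n. 1 / real (Suc n)) (at_right 0) sequentially"
    unfolding filterlim_at
    using LIMSEQ_inverse_real_of_nat by (auto simp: inverse_eq_divide)
  then have 1: "(\<lambda>n. F (1 / real (Suc n))) \<longlonglongrightarrow> 0"
    by (rule filterlim_compose[OF assms(1)])
  have "filterlim (\<lambda>n. real (Suc n)) at_top sequentially"
    by (rule filterlim_compose[OF filterlim_real_sequentially filterlim_Suc])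
  then have 2: "(\<lambda>n. F (real (Suc n))) \<longlonglongrightarrow> 0"
    by (rule filterlim_compose[OF assms(2)])
  show ?thesis using tendsto_diff[OF 2 1] by simp
qed

lemma half_line_FTC:
  fixes F f :: "real \<Rightarrow> 'b::euclidean_space"
  assumes int: "set_integrable lborel {0<..} f"
    and F: "\<And>x. x > 0 \<Longrightarrow> (F has_vector_derivative f x) (at x)"
    and f: "continuous_on {0<..} f"
    and lim: "(F \<longlongrightarrow> 0) (at_right 0)" "(F \<longlongrightarrow> 0) at_top"
  shows "(LINT x:{0<..}|lborel. f x) = 0"
proof (rule LIMSEQ_unique[OF half_line_limit[OF int]])
  have "(LINT x:{1 / real (Suc n)..real (Suc n)}|lborel. f x) = F (real (Suc n)) - F (1 / real (Suc n))" for n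
  proof -
    have pos: "0 < 1 / real (Suc n)" by simp
    have "1 / real (Suc n) \<le> real (Suc n)"
      using mult_mono[of 1 "real (Suc n)" 1 "real (Suc n)"] by (simp add: divide_le_eq)
    then show ?thesis
      unfolding set_lebesgue_integral_def
    proof (rule integral_FTC_atLeastAtMost)
      show "(F has_vector_derivative f x) (at x within {1 / real (Suc n)..real (Suc n)})"
        if "1 / real (Suc n) \<le> x" for x
        by (rule has_vector_derivative_at_within, rule F, rule less_le_trans[OF pos that])
      show "continuous_on {1 / real (Suc n)..real (Suc n)} f"
        by (rule continuous_on_subset[OF f half_line_subset])
    qed
  qed
  then show "(\<lambda>n. LINT x:{1 / real (Suc n)..real (Suc n)}|lborel. f x) \<longlonglongrightarrow> 0"
    using half_line_boundary[OF lim] by simp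
qed

text \<open>Only the majorant g is assumed integrable, not the derivative f, so the comparison is
  made on the exhausting compact intervals before passing to the limit.\<close>

lemma half_line_FTC_le:
  fixes F f g :: "real \<Rightarrow> real"
  assumes int: "set_integrable lborel {0<..} g"
    and F: "\<And>x. x > 0 \<Longrightarrow> (F has_vector_derivative f x) (at x)"
    and f: "continuous_on {0<..} f"
    and le: "\<And>x. x > 0 \<Longrightarrow> f x \<le> g x"
    and lim: "(F \<longlongrightarrow> 0) (at_right 0)" "(F \<longlongrightarrow> 0) at_top"
  shows "0 \<le> (LINT x:{0<..}|lborel. g x)"
proof (rule LIMSEQ_le[OF half_line_boundary[OF lim] half_line_limit[OF int]])
  have "F (real (Suc n)) - F (1 / real (Suc n)) \<le> (LINT x:{1 / real (Suc n)..real (Suc n)}|lborel. g x)" for n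
  proof -
    have pos: "0 < 1 / real (Suc n)" by simp
    have le': "1 / real (Suc n) \<le> real (Suc n)"
      using mult_mono[of 1 "real (Suc n)" 1 "real (Suc n)"] by (simp add: divide_le_eq)
    have cont: "continuous_on {1 / real (Suc n)..real (Suc n)} f"
      by (rule continuous_on_subset[OF f half_line_subset])
    have "(LINT x:{1 / real (Suc n)..real (Suc n)}|lborel. f x) = F (real (Suc n)) - F (1 / real (Suc n))"
      unfolding set_lebesgue_integral_def using le'
    proof (rule integral_FTC_atLeastAtMost)
      show "(F has_vector_derivative f x) (at x within {1 / real (Suc n)..real (Suc n)})"
        if "1 / real (Suc n) \<le> x" for x
        by (rule has_vector_derivative_at_within, rule F, rule less_le_trans[OF pos that])
    qed (rule cont)
    moreover have "(LINT x:{1 / real (Suc n)..real (Suc n)}|lborel. f x) \<le>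
        (LINT x:{1 / real (Suc n)..real (Suc n)}|lborel. g x)"
    proof (rule set_integral_mono)
      show "set_integrable lborel {1 / real (Suc n)..real (Suc n)} f"
        by (rule borel_integrable_atLeastAtMost'[OF cont])
      show "set_integrable lborel {1 / real (Suc n)..real (Suc n)} g"
        by (rule set_integrable_subset[OF int _ half_line_subset]) simp
      show "f x \<le> g x" if "x \<in> {1 / real (Suc n)..real (Suc n)}" for x
        using subsetD[OF half_line_subset that] by (intro le) (simp only: greaterThan_iff)
    qed
    ultimately show ?thesis by simp
  qed
  then show "\<exists>N. \<forall>n\<ge>N. F (real (Suc n)) - F (1 / real (Suc n)) \<le>
      (LINT x:{1 / real (Suc n)..real (Suc n)}|lborel. g x)" by blast
qed

subsection \<open>The Dunkl oscillator on Schwartz functions\<close>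

text \<open>The intended derivatives are supplied as a sequence, so that membership needs one
  derivative rule and one decay estimate, uniform in n, and no iterated differentiation.\<close>

lemma schwartzI:
  assumes deriv: "\<And>n x. (\<Phi> n has_vector_derivative \<Phi> (Suc n) x) (at x)"
    and rapid: "\<And>n. rapid (\<Phi> n)"
  shows "\<Phi> 0 \<in> schwartz"
proof -
  have "vderiv (\<Phi> n) = \<Phi> (Suc n)" for n
    unfolding vderiv_def using deriv by (intro ext vector_derivative_at)
  then have pow: "(vderiv ^^ n) (\<Phi> 0) = \<Phi> n" for n
    by (induction n) simp_all
  show ?thesis
    unfolding schwartz_def mem_Collect_eq pow
  proof (intro allI conjI)
    show "\<Phi> n differentiable (at x)" for n x
      using deriv by (rule differentiableI_vector)
    fix n m
    obtain C where "\<And>x. \<bar>x\<bar> ^ m * cmod (\<Phi> n x) \<le> C" using rapidE[OF rapid] by blast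
    then show "bounded (range (\<lambda>x. complex_of_real (x ^ m) * \<Phi> n x))"
      by (auto simp: bounded_iff norm_mult norm_power)
  qed
qed

lemma schwartz_deriv_power:
  assumes "\<phi> \<in> schwartz"
  shows "((vderiv ^^ n) \<phi> has_vector_derivative (vderiv ^^ Suc n) \<phi> x) (at x)"
proof -
  have "(vderiv ^^ n) \<phi> differentiable (at x)"
    using assms by (simp add: schwartz_def)
  then show ?thesis by (simp add: vector_derivative_works vderiv_def)
qed

lemma schwartz_rapid_power:
  assumes "\<phi> \<in> schwartz"
  shows "rapid ((vderiv ^^ n) \<phi>)"
  unfolding rapid_def
proof (intro conjI allI)
  have "continuous_on UNIV ((vderiv ^^ n) \<phi>)"
    using schwartz_deriv_power[OF assms]
    by (intro continuous_at_imp_continuous_on ballI has_vector_derivative_continuous)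
  then show "(vderiv ^^ n) \<phi> \<in> borel_measurable borel"
    by (rule borel_measurable_continuous_onI)
  fix m
  have "bounded (range (\<lambda>x. complex_of_real (x ^ m) * (vderiv ^^ n) \<phi> x))"
    using assms by (simp add: schwartz_def)
  then show "\<exists>C. \<forall>x. \<bar>x\<bar> ^ m * cmod ((vderiv ^^ n) \<phi> x) \<le> C"
    by (auto simp: bounded_iff norm_mult norm_power)
qed

lemma schwartz_rapid: "\<phi> \<in> schwartz \<Longrightarrow> rapid \<phi>"
  using schwartz_rapid_power[of \<phi> 0] by simp

lemma schwartz_deriv: "\<phi> \<in> schwartz \<Longrightarrow> (\<phi> has_vector_derivative vderiv \<phi> x) (at x)"
  using schwartz_deriv_power[of \<phi> 0 x] by simp

lemma schwartz_vderiv: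
  assumes "\<phi> \<in> schwartz" shows "vderiv \<phi> \<in> schwartz"
proof -
  have "(\<lambda>n. (vderiv ^^ Suc n) \<phi>) 0 \<in> schwartz"
    by (rule schwartzI) (rule schwartz_deriv_power[OF assms] schwartz_rapid_power[OF assms])+
  then show ?thesis by simp
qed

lemma schwartz_add:
  assumes "\<phi> \<in> schwartz" "\<psi> \<in> schwartz"
  shows "(\<lambda>x. \<phi> x + \<psi> x) \<in> schwartz"
proof -
  have "(\<lambda>n x. (vderiv ^^ n) \<phi> x + (vderiv ^^ n) \<psi> x) 0 \<in> schwartz"
    by (rule schwartzI)
      (intro has_vector_derivative_add schwartz_deriv_power rapid_add schwartz_rapid_power assms)+
  then show ?thesis by simp
qed

lemma schwartz_cmult:
  assumes "\<phi> \<in> schwartz"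
  shows "(\<lambda>x. c * \<phi> x) \<in> schwartz"
proof -
  have "(\<lambda>n x. c * (vderiv ^^ n) \<phi> x) 0 \<in> schwartz"
    by (rule schwartzI)
      (intro has_vector_derivative_mult_right schwartz_deriv_power rapid_cmult schwartz_rapid_power assms)+
  then show ?thesis by simp
qed

lemma schwartz_sum:
  assumes "\<And>i. i \<in> A \<Longrightarrow> F i \<in> schwartz"
  shows "(\<Sum>i\<in>A. fscale (c i) (F i)) \<in> schwartz"
proof -
  have z: "(\<lambda>x. 0) \<in> schwartz"
    using schwartzI[of "\<lambda>n x. 0"] by (auto simp: rapid_def)
  have add: "f + g \<in> schwartz" if "f \<in> schwartz" "g \<in> schwartz" for f g
    using schwartz_add[OF that] by (simp add: plus_fun_def)
  have scale: "fscale c f \<in> schwartz" if "f \<in> schwartz" for c f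
    using schwartz_cmult[OF that] by (simp add: fscale_def)
  show ?thesis
    using assms
    by (induction A rule: infinite_finite_induct)
      (simp_all add: z[folded zero_fun_def] add scale)
qed

lemma has_vector_derivative_reflect:
  assumes "(f has_vector_derivative f') (at (- x))"
  shows "((\<lambda>x. f (- x)) has_vector_derivative - f') (at x)"
proof -
  have "((\<lambda>x. - x) has_vector_derivative - 1) (at x)"
    by (auto intro!: derivative_eq_intros)
  from vector_diff_chain_at[OF this assms] show ?thesis by (simp add: o_def)
qed

lemma even_part_deriv:
  assumes "(f has_vector_derivative f' x) (at x)" "(f has_vector_derivative f' (- x)) (at (- x))"
  shows "(even_part f has_vector_derivative odd_part f' x) (at x)"
proof -
  have "((\<lambda>x. (f x + f (- x)) / 2) has_vector_derivative (f' x + - f' (- x)) / 2) (at x)"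
    by (intro has_vector_derivative_divide has_vector_derivative_add assms(1)
        has_vector_derivative_reflect[OF assms(2)])
  then show ?thesis by (simp add: even_part_def[abs_def] odd_part_def)
qed

lemma odd_part_deriv:
  assumes "(f has_vector_derivative f' x) (at x)" "(f has_vector_derivative f' (- x)) (at (- x))"
  shows "(odd_part f has_vector_derivative even_part f' x) (at x)"
proof -
  have "((\<lambda>x. (f x - f (- x)) / 2) has_vector_derivative (f' x - - f' (- x)) / 2) (at x)"
    by (intro has_vector_derivative_divide has_vector_derivative_diff assms(1)
        has_vector_derivative_reflect[OF assms(2)])
  then show ?thesis by (simp add: even_part_def odd_part_def[abs_def])
qed

lemma even_odd_sum: "even_part f x + odd_part f x = f x"
  by (simp add: even_part_def odd_part_def add_divide_distrib[symmetric])

lemma odd_part_minus: "odd_part f (- x) = - odd_part f x"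
  by (simp add: odd_part_def minus_divide_left)

lemma rapid_odd_part: "rapid f \<Longrightarrow> rapid (odd_part f)"
  using rapid_cmult[OF rapid_diff[OF _ rapid_reflect], of f f "1/2"] by (simp add: odd_part_def[abs_def])

lemma cmod_le_of_vector_derivative:
  fixes f :: "real \<Rightarrow> complex"
  assumes deriv: "\<And>t. (f has_vector_derivative f' t) (at t)"
    and le: "\<And>t. \<bar>t\<bar> \<le> \<bar>x\<bar> \<Longrightarrow> cmod (f' t) \<le> B"
  shows "cmod (f x - f 0) \<le> B * \<bar>x\<bar>"
proof -
  have "norm (f x - f 0) \<le> B * norm (x - 0)"
  proof (rule differentiable_bound[where S = "closed_segment 0 x" and f' = "\<lambda>t h. h *\<^sub>R f' t"])
    fix t assume "t \<in> closed_segment 0 x"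
    then have t: "\<bar>t\<bar> \<le> \<bar>x\<bar>" by (auto simp: closed_segment_eq_real_ivl split: if_splits)
    show "(f has_derivative (\<lambda>h. h *\<^sub>R f' t)) (at t within closed_segment 0 x)"
      using has_vector_derivative_at_within[OF deriv] by (simp add: has_vector_derivative_def)
    show "onorm (\<lambda>h. h *\<^sub>R f' t) \<le> B"
      by (rule onorm_le) (use mult_right_mono[OF le[OF t] abs_ge_zero] in \<open>simp add: mult.commute\<close>)
  qed auto
  then show ?thesis by simp
qed

text \<open>One formula for both parities, with the rank-one Dunkl Laplacian written out: the
  singular part is 2 \<sigma> (\<phi>'/x - odd(\<phi>)/x^2), arranged as a single quotient whose
  numerator vanishes to second order at 0.\<close>

definition J_reg :: "real \<Rightarrow> real \<Rightarrow> (real \<Rightarrow> complex) \<Rightarrow> real \<Rightarrow> complex" where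
  "J_reg s \<sigma> \<phi> x = - vderiv (vderiv \<phi>) x + of_real (s\<^sup>2 * x\<^sup>2) * \<phi> x
     - of_real (2 * \<sigma>) * ((of_real x * vderiv \<phi> x - odd_part \<phi> x) / of_real (x ^ 2))"

lemma schwartz_even_part_vderiv:
  assumes "\<phi> \<in> schwartz"
  shows "vderiv (even_part \<phi>) = odd_part (vderiv \<phi>)" "vderiv (odd_part \<phi>) = even_part (vderiv \<phi>)"
  unfolding vderiv_def[of "even_part \<phi>", abs_def] vderiv_def[of "odd_part \<phi>", abs_def]
  by (intro ext vector_derivative_at even_part_deriv odd_part_deriv schwartz_deriv assms)+

lemma dunkl_J_eq:
  assumes \<phi>: "\<phi> \<in> schwartz" and x: "x \<noteq> 0"
  shows "dunkl_J s \<sigma> \<phi> x = J_reg s \<sigma> \<phi> x"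
proof -
  note \<phi>' = schwartz_vderiv[OF \<phi>]
  have "((\<lambda>y. inverse y *\<^sub>R odd_part \<phi> y) has_vector_derivative
      inverse x *\<^sub>R even_part (vderiv \<phi>) x + (- inverse (x\<^sup>2)) *\<^sub>R odd_part \<phi> x) (at x)"
    using x by (intro has_vector_derivative_scaleR odd_part_deriv schwartz_deriv \<phi>)
      (auto intro!: derivative_eq_intros simp: power2_eq_square)
  then have "vderiv (\<lambda>y. inverse y *\<^sub>R odd_part \<phi> y) x =
      inverse x *\<^sub>R even_part (vderiv \<phi>) x + (- inverse (x\<^sup>2)) *\<^sub>R odd_part \<phi> x"
    by (simp add: vderiv_def vector_derivative_at)
  also have "(\<lambda>y. inverse y *\<^sub>R odd_part \<phi> y) = (\<lambda>y. odd_part \<phi> y / of_real y)"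
    by (simp add: scaleR_conv_of_real divide_inverse mult.commute)
  also have "inverse x *\<^sub>R even_part (vderiv \<phi>) x + (- inverse (x\<^sup>2)) *\<^sub>R odd_part \<phi> x =
      (of_real x * even_part (vderiv \<phi>) x - odd_part \<phi> x) / of_real (x\<^sup>2)"
    using x by (simp add: scaleR_conv_of_real field_simps power2_eq_square)
  finally have quot: "vderiv (\<lambda>y. odd_part \<phi> y / of_real y) x =
      (of_real x * even_part (vderiv \<phi>) x - odd_part \<phi> x) / of_real (x\<^sup>2)" .
  have "dunkl_J s \<sigma> \<phi> x =
    - (even_part (vderiv (vderiv \<phi>)) x + odd_part (vderiv (vderiv \<phi>)) x)
    + of_real (s\<^sup>2 * x\<^sup>2) * (even_part \<phi> x + odd_part \<phi> x)
    - of_real (2 * \<sigma>) * ((of_real x * (even_part (vderiv \<phi>) x + odd_part (vderiv \<phi>) x) - odd_part \<phi> x) / of_real (x\<^sup>2))"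
    unfolding dunkl_J_def dunkl_J_even_def dunkl_J_odd_def quot
      schwartz_even_part_vderiv[OF \<phi>] schwartz_even_part_vderiv[OF \<phi>']
    using x by (simp add: field_simps power2_eq_square)
  then show ?thesis
    unfolding even_odd_sum by (simp only: J_reg_def)
qed

lemma odd_part_bound:
  assumes \<phi>: "\<phi> \<in> schwartz"
  shows "\<exists>C\<ge>0. \<forall>x. cmod (odd_part \<phi> x) \<le> C * \<bar>x\<bar>"
proof -
  obtain C where C: "C \<ge> 0" "\<And>x. \<bar>x\<bar> ^ 0 * cmod (vderiv \<phi> x) \<le> C"
    using rapidE[OF schwartz_rapid[OF schwartz_vderiv[OF \<phi>]]] by blast
  have "cmod (odd_part \<phi> x) \<le> C * \<bar>x\<bar>" for x
  proof -
    have "cmod (even_part (vderiv \<phi>) t) \<le> C" for t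
      using norm_triangle_ineq[of "vderiv \<phi> t" "vderiv \<phi> (- t)"] C(2)[of t] C(2)[of "- t"]
      by (simp add: even_part_def norm_divide)
    then have "cmod (odd_part \<phi> x - odd_part \<phi> 0) \<le> C * \<bar>x\<bar>"
      by (intro cmod_le_of_vector_derivative[where f' = "even_part (vderiv \<phi>)"] odd_part_deriv schwartz_deriv \<phi>)
    then show ?thesis by (simp add: odd_part_def)
  qed
  then show ?thesis using C(1) by blast
qed

text \<open>The numerator G = x \<phi>' - odd(\<phi>) has derivative x \<phi>'' + odd(\<phi>'),
  which is O(|x|) because odd(\<phi>') vanishes at 0. Hence G = O(x^2), and dividing by x^2
  preserves rapid decay.\<close>

lemma rapid_J_reg:
  assumes \<phi>: "\<phi> \<in> schwartz"
  shows "rapid (J_reg s \<sigma> \<phi>)"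
proof -
  note \<phi>' = schwartz_vderiv[OF \<phi>]
  note \<phi>'' = schwartz_vderiv[OF \<phi>']
  obtain C1 where C1: "C1 \<ge> 0" "\<And>x. \<bar>x\<bar> ^ 0 * cmod (vderiv (vderiv \<phi>) x) \<le> C1"
    using rapidE[OF schwartz_rapid[OF \<phi>'']] by blast
  obtain C2 where C2: "C2 \<ge> 0" "\<And>x. cmod (odd_part (vderiv \<phi>) x) \<le> C2 * \<bar>x\<bar>"
    using odd_part_bound[OF \<phi>'] by blast
  define C where "C = C1 + C2"
  have C: "C \<ge> 0" "cmod (vderiv (vderiv \<phi>) x) \<le> C" for x
    using C1(1) C1(2)[of x] C2(1) by (auto simp: C_def)
  have odd': "cmod (odd_part (vderiv \<phi>) x) \<le> C * \<bar>x\<bar>" for x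
  proof -
    have "C2 * \<bar>x\<bar> \<le> C * \<bar>x\<bar>" using C1(1) by (intro mult_right_mono) (auto simp: C_def)
    then show ?thesis using C2(2)[of x] by linarith
  qed
  define G where "G x = of_real (x ^ 1) * vderiv \<phi> x - odd_part \<phi> x" for x
  have G: "rapid G"
    unfolding G_def by (intro rapid_diff rapid_power_mult rapid_odd_part schwartz_rapid \<phi> \<phi>')
  have "cmod (G x) \<le> (2 * C) * \<bar>x\<bar> ^ 2" for x
  proof -
    have "(G has_vector_derivative (of_real t * vderiv (vderiv \<phi>) t + odd_part (vderiv \<phi>) t)) (at t)" for t
    proof -
      have "((\<lambda>x. x *\<^sub>R vderiv \<phi> x - odd_part \<phi> x) has_vector_derivative
          (t *\<^sub>R vderiv (vderiv \<phi>) t + 1 *\<^sub>R vderiv \<phi> t) - even_part (vderiv \<phi>) t) (at t)"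
        by (intro has_vector_derivative_diff has_vector_derivative_scaleR odd_part_deriv schwartz_deriv \<phi> \<phi>' DERIV_ident)
      moreover have "vderiv \<phi> t - even_part (vderiv \<phi>) t = odd_part (vderiv \<phi>) t"
        using even_odd_sum[of "vderiv \<phi>" t] by (simp add: algebra_simps)
      ultimately show ?thesis
        by (simp add: G_def[abs_def] scaleR_conv_of_real add_diff_eq[symmetric])
    qed
    moreover have "cmod (of_real t * vderiv (vderiv \<phi>) t + odd_part (vderiv \<phi>) t) \<le> 2 * C * \<bar>x\<bar>" if "\<bar>t\<bar> \<le> \<bar>x\<bar>" for t
    proof -
      have "cmod (of_real t * vderiv (vderiv \<phi>) t) \<le> \<bar>t\<bar> * C"
        using C(2)[of t] by (simp add: norm_mult mult_left_mono)
      then have "cmod (of_real t * vderiv (vderiv \<phi>) t + odd_part (vderiv \<phi>) t) \<le> \<bar>t\<bar> * C + C * \<bar>t\<bar>"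
        using odd'[of t] by (intro norm_triangle_le) linarith
      also have "\<dots> = 2 * C * \<bar>t\<bar>" by simp
      also have "\<dots> \<le> 2 * C * \<bar>x\<bar>" using C(1) that by (intro mult_left_mono) auto
      finally show ?thesis .
    qed
    ultimately have "cmod (G x - G 0) \<le> (2 * C * \<bar>x\<bar>) * \<bar>x\<bar>"
      by (rule cmod_le_of_vector_derivative)
    then show ?thesis by (simp add: G_def odd_part_def power2_eq_square)
  qed
  then have *: "rapid (\<lambda>x. G x / of_real (x ^ 2))" by (rule rapid_divide_power[OF G])
  have "rapid (\<lambda>x. - vderiv (vderiv \<phi>) x + of_real (s\<^sup>2) * (of_real (x ^ 2) * \<phi> x))"
    by (intro rapid_add rapid_minus rapid_cmult rapid_power_mult schwartz_rapid \<phi> \<phi>'')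
  from rapid_diff[OF this rapid_cmult[OF *]] have "rapid (\<lambda>x. - vderiv (vderiv \<phi>) x + of_real (s\<^sup>2) * (of_real (x ^ 2) * \<phi> x)
     - of_real (2 * \<sigma>) * (G x / of_real (x ^ 2)))" .
  then show ?thesis
    by (simp add: J_reg_def[abs_def] G_def mult.assoc)
qed

lemma rapid_dunkl_J:
  assumes "\<phi> \<in> schwartz"
  shows "rapid (dunkl_J s \<sigma> \<phi>)"
proof -
  have "dunkl_J s \<sigma> \<phi> = (\<lambda>x. if x = 0 then dunkl_J s \<sigma> \<phi> 0 else J_reg s \<sigma> \<phi> x)"
    using dunkl_J_eq[OF assms] by (intro ext) simp
  then show ?thesis using rapid_if_zero[OF rapid_J_reg[OF assms]] by metis
qed

lemma powr_rapid_at_top: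
  assumes f: "rapid f"
  shows "((\<lambda>x. x powr p *\<^sub>R f x) \<longlongrightarrow> 0) at_top"
proof -
  define m where "m = nat \<lceil>p + 1\<rceil>"
  obtain C where C: "C \<ge> 0" "\<And>x. \<bar>x\<bar> ^ m * cmod (f x) \<le> C" using rapidE[OF f] by blast
  show ?thesis
  proof (rule Lim_null_comparison)
    show "\<forall>\<^sub>F x in at_top. norm (x powr p *\<^sub>R f x) \<le> C * inverse x"
      using eventually_ge_at_top[of 1]
    proof eventually_elim
      case (elim x)
      have "x powr (p + 1) \<le> x powr real m"
        unfolding m_def by (intro powr_mono) (use elim in linarith)+
      then have "x powr (p + 1) * cmod (f x) \<le> x ^ m * cmod (f x)"
        using elim by (intro mult_right_mono) (auto simp: powr_realpow)
      also have "\<dots> \<le> C" using C(2)[of x] elim by simp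
      finally have "inverse x * (x powr (p + 1) * cmod (f x)) \<le> inverse x * C"
        using elim by (intro mult_left_mono) auto
      moreover have "inverse x * x powr (p + 1) = x powr p"
        using elim by (simp add: powr_add)
      ultimately show ?case by (simp add: mult.assoc[symmetric] mult.commute)
    qed
    show "((\<lambda>x. C * inverse x) \<longlongrightarrow> 0) at_top"
      by (intro tendsto_mult_right_zero tendsto_inverse_0_at_top filterlim_ident)
  qed
qed

lemma powr_at_right_0:
  fixes f :: "real \<Rightarrow> complex"
  assumes le: "\<And>x. x > 0 \<Longrightarrow> cmod (f x) \<le> C * x ^ k" and p: "p + real k > 0"
  shows "((\<lambda>x. x powr p *\<^sub>R f x) \<longlongrightarrow> 0) (at_right 0)"
proof (rule Lim_null_comparison)
  show "\<forall>\<^sub>F x in at_right 0. norm (x powr p *\<^sub>R f x) \<le> C * x powr (p + real k)"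
    using eventually_at_right_less[of 0]
  proof eventually_elim
    case (elim x)
    have "x powr p * cmod (f x) \<le> x powr p * (C * x ^ k)"
      using le[OF elim] by (intro mult_left_mono) auto
    then show ?case using elim by (simp add: powr_add powr_realpow mult_ac)
  qed
  have "((\<lambda>x. x powr (p + real k)) \<longlongrightarrow> 0) (at_right 0)"
    by (rule tendsto_zero_powrI[where b = "p + real k"])
      (use p in \<open>auto intro: tendsto_ident_at eventually_mono[OF eventually_at_right_less]\<close>)
  then show "((\<lambda>x. C * x powr (p + real k)) \<longlongrightarrow> 0) (at_right 0)"
    by (rule tendsto_mult_right_zero)
qed

lemma has_vector_derivative_powr_scaleR:
  assumes "x > 0" "(f has_vector_derivative f') (at x)"
  shows "((\<lambda>x. x powr p *\<^sub>R f x) has_vector_derivative (x powr p *\<^sub>R f' + (p * x powr (p - 1)) *\<^sub>R f x)) (at x)"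
  by (rule has_vector_derivative_scaleR) (use assms in \<open>auto intro!: derivative_eq_intros\<close>)

text \<open>Green's identity: after folding, the potential and the odd(\<phi>)/x^2 terms cancel, and
  what remains is the derivative of x^(2\<sigma>) n(x), where n is minus twice the odd part of the
  Wronskian m = \<phi>' cnj(\<psi>) - \<phi> cnj(\<psi>'). The boundary value at 0 disappears since
  n = O(x) and 2\<sigma> + 1 > 0.\<close>

theorem dunkl_J_symmetric:
  assumes \<phi>: "\<phi> \<in> schwartz" and \<psi>: "\<psi> \<in> schwartz" and \<sigma>: "\<sigma> > -1/2"
  shows "l2_inner (dunkl_measure \<sigma>) (dunkl_J s \<sigma> \<phi>) \<psi> = l2_inner (dunkl_measure \<sigma>) \<phi> (dunkl_J s \<sigma> \<psi>)"
proof -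
  let ?J = "dunkl_J s \<sigma>" and ?w = "\<lambda>x. \<bar>x\<bar> powr (2 * \<sigma>)"
  note \<phi>' = schwartz_vderiv[OF \<phi>] and \<psi>' = schwartz_vderiv[OF \<psi>]
  note \<phi>'' = schwartz_vderiv[OF \<phi>'] and \<psi>'' = schwartz_vderiv[OF \<psi>']
  have r1: "rapid (\<lambda>x. ?J \<phi> x * cnj (\<psi> x))" and r2: "rapid (\<lambda>x. \<phi> x * cnj (?J \<psi> x))"
    by (intro rapid_mult rapid_cnj rapid_dunkl_J schwartz_rapid \<phi> \<psi>)+
  define K where "K x = ?w x *\<^sub>R (?J \<phi> x * cnj (\<psi> x) - \<phi> x * cnj (?J \<psi> x))" for x
  have K: "integrable lborel K"
    unfolding K_def using \<sigma> by (intro rapid_integrable rapid_diff r1 r2) simp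
  have "l2_inner (dunkl_measure \<sigma>) (?J \<phi>) \<psi> - l2_inner (dunkl_measure \<sigma>) \<phi> (?J \<psi>) = integral\<^sup>L lborel K"
    unfolding l2_inner_def integral_dunkl[OF rapid_measurable[OF r1]] integral_dunkl[OF rapid_measurable[OF r2]] K_def
    using \<sigma> by (subst Bochner_Integration.integral_diff[symmetric]) (auto intro!: rapid_integrable r1 r2 simp: scaleR_diff_right)
  also have "\<dots> = (LINT x:{0<..}|lborel. K x + K (- x))"
    by (rule integral_fold_half_line[OF K])
  also have "\<dots> = 0"
  proof -
    define m where "m x = vderiv \<phi> x * cnj (\<psi> x) - \<phi> x * cnj (vderiv \<psi> x)" for x
    define m' where "m' x = vderiv (vderiv \<phi>) x * cnj (\<psi> x) - \<phi> x * cnj (vderiv (vderiv \<psi>) x)" for x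
    have m: "rapid m" and m': "rapid m'"
      unfolding m_def m'_def by (intro rapid_diff rapid_mult rapid_cnj schwartz_rapid \<phi> \<psi> \<phi>' \<psi>' \<phi>'' \<psi>'')+
    have mderiv: "(m has_vector_derivative m' x) (at x)" for x
    proof -
      have "(m has_vector_derivative
          (vderiv \<phi> x * cnj (vderiv \<psi> x) + vderiv (vderiv \<phi>) x * cnj (\<psi> x)) -
          (\<phi> x * cnj (vderiv (vderiv \<psi>) x) + vderiv \<phi> x * cnj (vderiv \<psi> x))) (at x)"
        unfolding m_def[abs_def]
        by (intro has_vector_derivative_diff has_vector_derivative_mult has_vector_derivative_cnj
            schwartz_deriv \<phi> \<psi> \<phi>' \<psi>')
      then show ?thesis by (simp add: m'_def algebra_simps)
    qed
    define n where "n x = - (m x - m (- x))" for x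
    define n' where "n' x = - (m' x + m' (- x))" for x
    have n: "rapid n" unfolding n_def by (intro rapid_minus rapid_diff m rapid_reflect)
    have nderiv: "(n has_vector_derivative n' x) (at x)" for x
    proof -
      have "(n has_vector_derivative - (m' x - - m' (- x))) (at x)"
        unfolding n_def[abs_def]
        by (intro has_vector_derivative_minus has_vector_derivative_diff mderiv has_vector_derivative_reflect)
      then show ?thesis by (simp add: n'_def)
    qed
    obtain C where C: "\<And>x. \<bar>x\<bar> ^ 0 * cmod (m' x) \<le> C" using rapidE[OF m'] by blast
    \<comment> \<open>\<open>n\<close> vanishes at 0 and has bounded derivative; this extra order
      compensates the weight, which is unbounded at 0 when \<sigma> < 0.\<close>
    have nle: "cmod (n x) \<le> (2 * C) * \<bar>x\<bar>" for x
    proof -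
      have "cmod (n' t) \<le> 2 * C" for t
        using norm_triangle_ineq[of "m' t" "m' (- t)"] C[of t] C[of "- t"]
        unfolding n'_def norm_minus_cancel by simp
      from cmod_le_of_vector_derivative[OF nderiv this, of x] show ?thesis by (simp add: n_def)
    qed
    define f where "f x = x powr (2 * \<sigma>) *\<^sub>R n' x + (2 * \<sigma> * x powr (2 * \<sigma> - 1)) *\<^sub>R n x" for x
    have Kf: "K x + K (- x) = f x" if x: "x > 0" for x
    proof -
      have p: "x powr (2 * \<sigma> - 1) = x powr (2 * \<sigma>) / x"
        using x by (simp add: powr_diff)
      have J: "?J \<phi> x = J_reg s \<sigma> \<phi> x" "?J \<psi> x = J_reg s \<sigma> \<psi> x"
        "?J \<phi> (- x) = J_reg s \<sigma> \<phi> (- x)" "?J \<psi> (- x) = J_reg s \<sigma> \<psi> (- x)"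
        using x by (auto intro!: dunkl_J_eq \<phi> \<psi>)
      have "K x + K (- x) = x powr (2 * \<sigma>) *\<^sub>R
         ((J_reg s \<sigma> \<phi> x * cnj (\<psi> x) - \<phi> x * cnj (J_reg s \<sigma> \<psi> x)) +
          (J_reg s \<sigma> \<phi> (- x) * cnj (\<psi> (- x)) - \<phi> (- x) * cnj (J_reg s \<sigma> \<psi> (- x))))"
        using x by (simp add: K_def J scaleR_add_right)
      also have "\<dots> = x powr (2 * \<sigma>) *\<^sub>R (n' x + of_real (2 * \<sigma> / x) * n x)"
        using x unfolding J_reg_def n'_def n_def m_def m'_def odd_part_def
        by (intro arg_cong2[where f = scaleR] refl) (simp add: field_simps power2_eq_square)
      also have "\<dots> = f x"
        using x unfolding f_def p by (simp add: scaleR_conv_of_real field_simps)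
      finally show ?thesis .
    qed
    have "(LINT x:{0<..}|lborel. K x + K (- x)) = (LINT x:{0<..}|lborel. f x)"
      by (rule set_lebesgue_integral_cong) (auto simp: Kf)
    also have "\<dots> = 0"
    proof (rule half_line_FTC)
      have "set_integrable lborel {0<..} (\<lambda>x. K x + K (- x)) \<longleftrightarrow> set_integrable lborel {0<..} f"
        by (rule set_integrable_cong) (auto simp: Kf)
      then show "set_integrable lborel {0<..} f"
        using integral_fold_half_line(1)[OF K] by blast
      show "((\<lambda>x. x powr (2 * \<sigma>) *\<^sub>R n x) has_vector_derivative f x) (at x)" if "x > 0" for x
        unfolding f_def by (rule has_vector_derivative_powr_scaleR[OF that nderiv])
      show "((\<lambda>x. x powr (2 * \<sigma>) *\<^sub>R n x) \<longlongrightarrow> 0) at_top" by (rule powr_rapid_at_top[OF n])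
      show "((\<lambda>x. x powr (2 * \<sigma>) *\<^sub>R n x) \<longlongrightarrow> 0) (at_right 0)"
      proof (rule powr_at_right_0[where k = 1 and C = "2 * C"])
        show "cmod (n x) \<le> 2 * C * x ^ 1" if "x > 0" for x
          using nle[of x] that by simp
      qed (use \<sigma> in simp)
      have "continuous_on UNIV n"
        by (intro continuous_at_imp_continuous_on ballI has_vector_derivative_continuous[OF nderiv])
      moreover have "continuous_on UNIV m'"
      proof -
        have c: "continuous_on UNIV g" if "g \<in> schwartz" for g
          using schwartz_deriv[OF that]
          by (intro continuous_at_imp_continuous_on ballI has_vector_derivative_continuous)
        show ?thesis unfolding m'_def by (intro continuous_intros c \<phi> \<psi> \<phi>'' \<psi>'')
      qed
      then have "continuous_on UNIV (\<lambda>x. m' (- x))"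
        by (rule continuous_on_compose2) (auto intro: continuous_intros)
      ultimately show "continuous_on {0<..} f"
        unfolding f_def n'_def using \<open>continuous_on UNIV m'\<close>
        by (intro continuous_intros) (auto intro: continuous_on_subset)
    qed
    finally show ?thesis .
  qed
  finally show ?thesis by simp
qed

subsection \<open>A Hardy-type inequality\<close>

text \<open>The pointwise algebra behind the Hardy inequality, with w = x^(2\<sigma>), y = x^(-2u),
  e and o the two parities of \<phi>, and ae = |e|^2, be = Re(e' cnj e), ce = |e'|^2, de = Re(e''
  cnj e), while ao, bo, co, d1 are the same for o. Right minus left is 2w times two squares and two
  nonnegative remainders. The odd square carries the extra coefficient \<alpha>/x: for \<sigma> < 0
  the choice \<alpha> = 2\<sigma> gives 2\<sigma> + \<alpha>(2\<sigma> - 1) - \<alpha>^2 = 0,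
  cancelling the attractive 2\<sigma>/x^2, and its cross term has a good sign because \<alpha> \<le>
  0.\<close>

lemma weighted_square_inequality:
  fixes x y w be ce ae de bo co ao d1 :: real
  assumes x: "x > 0" and y: "y > 0" and w: "w > 0" and \<kappa>: "\<kappa> \<ge> 0"
    and ae: "ae \<ge> 0" and ao: "ao \<ge> 0"
    and V: "V \<le> s\<^sup>2 * x\<^sup>2 + \<kappa> * (1 - 2 * u + 2 * \<sigma>) * y - \<kappa>\<^sup>2 * (x\<^sup>2 * y\<^sup>2)"
    and \<alpha>: "\<alpha> = (if \<sigma> \<ge> 0 then 0 else 2 * \<sigma>)"
    and sqe: "0 \<le> ce + 2 * (\<kappa> * (x * y)) * be + (\<kappa> * (x * y))\<^sup>2 * ae"
    and sqo: "0 \<le> co + 2 * (\<kappa> * (x * y) + \<alpha> / x) * bo + (\<kappa> * (x * y) + \<alpha> / x)\<^sup>2 * ao"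
  shows "- 2 * (w * (de + ce + d1 + co) + 2 * \<sigma> * (w / x) * (be + bo)
      + \<kappa> * (w * (x * y) * (2 * be + 2 * bo) + (2 * \<sigma> + 1 - 2 * u) * (w * y) * (ae + ao))
      + \<alpha> * (w / x * (2 * bo) + (2 * \<sigma> - 1) * (w / x\<^sup>2) * ao))
    \<le> 2 * w * ((- de - 2 * \<sigma> * be / x + s\<^sup>2 * x\<^sup>2 * ae) + (- d1 - 2 * \<sigma> * bo / x + 2 * \<sigma> * ao / x\<^sup>2 + s\<^sup>2 * x\<^sup>2 * ao)
      - V * (ae + ao))"
proof -
  have V': "0 \<le> (s\<^sup>2 * x\<^sup>2 + \<kappa> * (1 - 2 * u + 2 * \<sigma>) * y - \<kappa>\<^sup>2 * (x\<^sup>2 * y\<^sup>2) - V) * (ae + ao)"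
    using V ae ao by (intro mult_nonneg_nonneg) auto
  have \<alpha>': "0 \<le> (2 * \<sigma> + \<alpha> * (2 * \<sigma> - 1) - \<alpha>\<^sup>2) / x\<^sup>2 * ao - 2 * \<kappa> * \<alpha> * y * ao"
  proof (cases "\<sigma> \<ge> 0")
    case True
    then show ?thesis using \<alpha> ao by simp
  next
    case False
    then have a: "\<alpha> = 2 * \<sigma>" using \<alpha> by simp
    have "0 \<le> \<kappa> * y * ao * (- \<sigma>)" using \<kappa> y ao False by (intro mult_nonneg_nonneg) auto
    then show ?thesis unfolding a by (simp add: algebra_simps power2_eq_square)
  qed
  have "0 \<le> (ce + 2 * (\<kappa> * (x * y)) * be + (\<kappa> * (x * y))\<^sup>2 * ae)
      + (co + 2 * (\<kappa> * (x * y) + \<alpha> / x) * bo + (\<kappa> * (x * y) + \<alpha> / x)\<^sup>2 * ao)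
      + (s\<^sup>2 * x\<^sup>2 + \<kappa> * (1 - 2 * u + 2 * \<sigma>) * y - \<kappa>\<^sup>2 * (x\<^sup>2 * y\<^sup>2) - V) * (ae + ao)
      + ((2 * \<sigma> + \<alpha> * (2 * \<sigma> - 1) - \<alpha>\<^sup>2) / x\<^sup>2 * ao - 2 * \<kappa> * \<alpha> * y * ao)"
    using sqe sqo V' \<alpha>' by linarith
  then have "0 \<le> 2 * w * ((ce + 2 * (\<kappa> * (x * y)) * be + (\<kappa> * (x * y))\<^sup>2 * ae)
      + (co + 2 * (\<kappa> * (x * y) + \<alpha> / x) * bo + (\<kappa> * (x * y) + \<alpha> / x)\<^sup>2 * ao)
      + (s\<^sup>2 * x\<^sup>2 + \<kappa> * (1 - 2 * u + 2 * \<sigma>) * y - \<kappa>\<^sup>2 * (x\<^sup>2 * y\<^sup>2) - V) * (ae + ao)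
      + ((2 * \<sigma> + \<alpha> * (2 * \<sigma> - 1) - \<alpha>\<^sup>2) / x\<^sup>2 * ao - 2 * \<kappa> * \<alpha> * y * ao))"
    using w by (intro mult_nonneg_nonneg) auto
  also have "\<dots> = 2 * w * ((- de - 2 * \<sigma> * be / x + s\<^sup>2 * x\<^sup>2 * ae) + (- d1 - 2 * \<sigma> * bo / x + 2 * \<sigma> * ao / x\<^sup>2 + s\<^sup>2 * x\<^sup>2 * ao)
      - V * (ae + ao))
    - (- 2 * (w * (de + ce + d1 + co) + 2 * \<sigma> * (w / x) * (be + bo)
      + \<kappa> * (w * (x * y) * (2 * be + 2 * bo) + (2 * \<sigma> + 1 - 2 * u) * (w * y) * (ae + ao))
      + \<alpha> * (w / x * (2 * bo) + (2 * \<sigma> - 1) * (w / x\<^sup>2) * ao)))"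
    using x by (simp add: field_simps power2_eq_square)
  finally show ?thesis by (rule iffD1[OF diff_ge_0_iff_ge])
qed

lemma schwartz_continuous: "\<phi> \<in> schwartz \<Longrightarrow> continuous_on A \<phi>"
  using schwartz_deriv by (intro continuous_at_imp_continuous_on ballI has_vector_derivative_continuous) blast

lemma schwartz_even_part: "\<phi> \<in> schwartz \<Longrightarrow> even_part \<phi> \<in> schwartz"
  and schwartz_odd_part: "\<phi> \<in> schwartz \<Longrightarrow> odd_part \<phi> \<in> schwartz"
proof -
  assume \<phi>: "\<phi> \<in> schwartz"
  have "(\<lambda>n x. (- 1) ^ n * (vderiv ^^ n) \<phi> (- x)) 0 \<in> schwartz"
  proof (rule schwartzI)
    fix n x
    have "((\<lambda>x. (- 1) ^ n * (vderiv ^^ n) \<phi> (- x)) has_vector_derivative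
        (- 1) ^ n * - (vderiv ^^ Suc n) \<phi> (- x)) (at x)"
      by (intro has_vector_derivative_mult_right has_vector_derivative_reflect schwartz_deriv_power \<phi>)
    then show "((\<lambda>x. (- 1) ^ n * (vderiv ^^ n) \<phi> (- x)) has_vector_derivative
        (- 1) ^ Suc n * (vderiv ^^ Suc n) \<phi> (- x)) (at x)" by simp
    show "rapid (\<lambda>x. (- 1) ^ n * (vderiv ^^ n) \<phi> (- x))"
      by (intro rapid_cmult rapid_reflect schwartz_rapid_power \<phi>)
  qed
  then have r: "(\<lambda>x. \<phi> (- x)) \<in> schwartz" by simp
  show "even_part \<phi> \<in> schwartz"
    using schwartz_cmult[OF schwartz_add[OF \<phi> r], of "1/2"] by (simp add: even_part_def[abs_def])
  show "odd_part \<phi> \<in> schwartz"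
    using schwartz_cmult[OF schwartz_add[OF \<phi> schwartz_cmult[OF r, of "- 1"]], of "1/2"]
    by (simp add: odd_part_def[abs_def])
qed

text \<open>J preserves parity, so the mixed even-odd products at x and -x cancel and the form
  splits into an even and an odd contribution.\<close>

lemma J_reg_even_odd:
  assumes \<phi>: "\<phi> \<in> schwartz" and x: "x \<noteq> 0"
  shows "J_reg s \<sigma> \<phi> x * cnj (\<phi> x) + J_reg s \<sigma> \<phi> (- x) * cnj (\<phi> (- x)) =
    2 * ((- even_part (vderiv (vderiv \<phi>)) x - of_real (2 * \<sigma> / x) * odd_part (vderiv \<phi>) x
          + of_real (s\<^sup>2 * x\<^sup>2) * even_part \<phi> x) * cnj (even_part \<phi> x)
       + (- odd_part (vderiv (vderiv \<phi>)) x - of_real (2 * \<sigma> / x) * even_part (vderiv \<phi>) x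
          + of_real (2 * \<sigma> / x\<^sup>2) * odd_part \<phi> x
          + of_real (s\<^sup>2 * x\<^sup>2) * odd_part \<phi> x) * cnj (odd_part \<phi> x))"
proof -
  define e od where "e = even_part \<phi> x" and "od = odd_part \<phi> x"
  define e1 o1 where "e1 = even_part (vderiv \<phi>) x" and "o1 = odd_part (vderiv \<phi>) x"
  define e2 o2 where "e2 = even_part (vderiv (vderiv \<phi>)) x" and "o2 = odd_part (vderiv (vderiv \<phi>)) x"
  have v: "\<phi> x = e + od" "\<phi> (- x) = e - od" "vderiv \<phi> x = e1 + o1" "vderiv \<phi> (- x) = e1 - o1"
    "vderiv (vderiv \<phi>) x = e2 + o2" "vderiv (vderiv \<phi>) (- x) = e2 - o2"
    unfolding e_def od_def e1_def o1_def e2_def o2_def even_part_def odd_part_def by (simp_all add: field_simps)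
  have od: "odd_part \<phi> (- x) = - od" by (simp add: od_def odd_part_minus)
  show ?thesis
    unfolding J_reg_def v od
    unfolding e_def[symmetric] od_def[symmetric] e1_def[symmetric] o1_def[symmetric] e2_def[symmetric] o2_def[symmetric]
    using x by (simp add: field_simps power2_eq_square)
qed

text \<open>\<open>T\<close> is the integrand of the difference of the two sides. Its folded version
  dominates the derivative of \<open>F\<close>, which tends to 0 at both ends of the half line, so
  its integral is nonnegative. The hypothesis \<open>V\<close> asks that the potential produced by
  the square cover a |x|^(-2u) - b.\<close>

lemma dunkl_form_lower:
  assumes \<phi>: "\<phi> \<in> schwartz" and u: "0 < u" and \<sigma>: "\<sigma> > u - 1/2" and \<kappa>: "\<kappa> \<ge> 0"
    and V: "\<And>x. x > 0 \<Longrightarrow> a * x powr (- 2 * u) - b \<le>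
      s\<^sup>2 * x\<^sup>2 + \<kappa> * (1 - 2 * u + 2 * \<sigma>) * x powr (- 2 * u) - \<kappa>\<^sup>2 * x powr (2 - 4 * u)"
  shows "a * l2_sq (dunkl_measure \<sigma>) (abs_power_mult (- u) \<phi>) - b * l2_sq (dunkl_measure \<sigma>) \<phi>
    \<le> Re (l2_inner (dunkl_measure \<sigma>) (dunkl_J s \<sigma> \<phi>) \<phi>)"
proof -
  let ?M = "dunkl_measure \<sigma>" and ?J = "dunkl_J s \<sigma> \<phi>"
  note \<phi>' = schwartz_vderiv[OF \<phi>]
  note \<phi>'' = schwartz_vderiv[OF \<phi>']
  have \<sigma>': "\<sigma> > -1/2" using u \<sigma> by simp
  have [measurable]: "\<phi> \<in> borel_measurable borel" "?J \<in> borel_measurable borel"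
    by (intro rapid_measurable schwartz_rapid rapid_dunkl_J \<phi>)+
  have [measurable]: "abs_power_mult (- u) \<phi> \<in> borel_measurable borel"
    unfolding abs_power_mult_def[abs_def] by measurable
  define T1 where "T1 x = Re (\<bar>x\<bar> powr (2 * \<sigma>) *\<^sub>R (?J x * cnj (\<phi> x)))" for x
  define T2 where "T2 x = \<bar>x\<bar> powr (2 * \<sigma>) *\<^sub>R (cmod (abs_power_mult (- u) \<phi> x))\<^sup>2" for x
  define T3 where "T3 x = \<bar>x\<bar> powr (2 * \<sigma>) *\<^sub>R (cmod (\<phi> x))\<^sup>2" for x
  define T where "T x = T1 x - a * T2 x + b * T3 x" for x
  have i1': "integrable lborel (\<lambda>x. \<bar>x\<bar> powr (2 * \<sigma>) *\<^sub>R (?J x * cnj (\<phi> x)))"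
    using \<sigma>' by (intro rapid_integrable rapid_mult rapid_cnj rapid_dunkl_J schwartz_rapid \<phi>) auto
  have mm: "(\<lambda>x. ?J x * cnj (\<phi> x)) \<in> borel_measurable borel"
    by (intro borel_measurable_times borel_measurable_cnj) measurable
  from i1' have i1: "integrable lborel T1"
    unfolding T1_def by (rule integrable_Re)
  have m2: "abs_power_mult (- u) \<phi> \<in> l2_space ?M"
    using \<sigma> by (intro l2_abs_power schwartz_rapid \<phi>) auto
  have m3: "\<phi> \<in> l2_space ?M"
    by (intro rapid_l2 schwartz_rapid \<phi> \<sigma>')
  have i2: "integrable lborel T2"
    using l2_spaceD(2)[OF m2] unfolding T2_def by (subst (asm) integrable_dunkl) auto
  have i3: "integrable lborel T3"
    using l2_spaceD(2)[OF m3] unfolding T3_def by (subst (asm) integrable_dunkl) auto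
  have T: "integrable lborel T"
    unfolding T_def by (intro Bochner_Integration.integrable_add Bochner_Integration.integrable_diff integrable_mult_right i1 i2 i3)
  have "integral\<^sup>L lborel T = integral\<^sup>L lborel T1 - a * integral\<^sup>L lborel T2 + b * integral\<^sup>L lborel T3"
    unfolding T_def by (simp add: i1 i2 i3)
  also have "integral\<^sup>L lborel T1 = Re (l2_inner ?M ?J \<phi>)"
    unfolding l2_inner_def T1_def integral_Re[OF i1'] integral_dunkl[OF mm] ..
  also have "integral\<^sup>L lborel T2 = l2_sq ?M (abs_power_mult (- u) \<phi>)"
    unfolding l2_sq_eq[OF m2] T2_def by (subst integral_dunkl) auto
  also have "integral\<^sup>L lborel T3 = l2_sq ?M \<phi>"
    unfolding l2_sq_eq[OF m3] T3_def by (subst integral_dunkl) auto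
  finally have eq: "integral\<^sup>L lborel T =
    Re (l2_inner ?M ?J \<phi>) - a * l2_sq ?M (abs_power_mult (- u) \<phi>) + b * l2_sq ?M \<phi>" .
  define \<alpha> where "\<alpha> = (if \<sigma> \<ge> 0 then 0 else 2 * \<sigma>)"
  define e od where "e = even_part \<phi>" and "od = odd_part \<phi>"
  define e1 o1 where "e1 = odd_part (vderiv \<phi>)" and "o1 = even_part (vderiv \<phi>)"
  define e2 o2 where "e2 = even_part (vderiv (vderiv \<phi>))" and "o2 = odd_part (vderiv (vderiv \<phi>))"
  have S: "e \<in> schwartz" "od \<in> schwartz" "e1 \<in> schwartz" "o1 \<in> schwartz" "e2 \<in> schwartz" "o2 \<in> schwartz"
    unfolding e_def od_def e1_def o1_def e2_def o2_def
    by (intro schwartz_even_part schwartz_odd_part \<phi> \<phi>' \<phi>'')+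
  have D: "(e has_vector_derivative e1 x) (at x)" "(od has_vector_derivative o1 x) (at x)"
    "(e1 has_vector_derivative e2 x) (at x)" "(o1 has_vector_derivative o2 x) (at x)" for x
    unfolding e_def od_def e1_def o1_def e2_def o2_def
    by (intro even_part_deriv odd_part_deriv schwartz_deriv \<phi> \<phi>')+
  define P where "P x = e1 x * cnj (e x) + o1 x * cnj (od x)" for x
  define P' where "P' x = (e1 x * cnj (e1 x) + e2 x * cnj (e x)) + (o1 x * cnj (o1 x) + o2 x * cnj (od x))" for x
  define A where "A x = e x * cnj (e x) + od x * cnj (od x)" for x
  define A' where "A' x = (e x * cnj (e1 x) + e1 x * cnj (e x)) + (od x * cnj (o1 x) + o1 x * cnj (od x))" for x
  define Q where "Q x = od x * cnj (od x)" for x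
  define Q' where "Q' x = od x * cnj (o1 x) + o1 x * cnj (od x)" for x
  have PD: "(P has_vector_derivative P' x) (at x)" "(A has_vector_derivative A' x) (at x)"
    "(Q has_vector_derivative Q' x) (at x)" for x
    unfolding P_def[abs_def] P'_def A_def[abs_def] A'_def Q_def[abs_def] Q'_def
    by (intro has_vector_derivative_add has_vector_derivative_mult has_vector_derivative_cnj D)+
  have PR: "rapid P" "rapid A" "rapid Q"
    unfolding P_def[abs_def] A_def[abs_def] Q_def[abs_def]
    by (intro rapid_add rapid_mult rapid_cnj schwartz_rapid S)+
  have PC: "continuous_on {0<..} P" "continuous_on {0<..} P'" "continuous_on {0<..} A"
      "continuous_on {0<..} A'" "continuous_on {0<..} Q" "continuous_on {0<..} Q'"
    unfolding P_def[abs_def] A_def[abs_def] Q_def[abs_def] P'_def[abs_def] A'_def[abs_def] Q'_def[abs_def]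
    by (intro continuous_intros schwartz_continuous S)+
  \<comment> \<open>The three boundary terms: from integrating \<phi>'' by parts, from the cross
    term of the square with coefficient \<kappa>, and from the correction \<alpha>/x on the odd
    part. The factor 2 is due to folding.\<close>
  define F where "F x = (- 2) *\<^sub>R (x powr (2 * \<sigma>) *\<^sub>R P x + \<kappa> *\<^sub>R (x powr (2 * \<sigma> + 1 - 2 * u) *\<^sub>R A x)
      + \<alpha> *\<^sub>R (x powr (2 * \<sigma> - 1) *\<^sub>R Q x))" for x
  define f where "f x = (- 2) *\<^sub>R ((x powr (2 * \<sigma>) *\<^sub>R P' x + (2 * \<sigma> * x powr (2 * \<sigma> - 1)) *\<^sub>R P x)
      + \<kappa> *\<^sub>R (x powr (2 * \<sigma> + 1 - 2 * u) *\<^sub>R A' x + ((2 * \<sigma> + 1 - 2 * u) * x powr (2 * \<sigma> + 1 - 2 * u - 1)) *\<^sub>R A x)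
      + \<alpha> *\<^sub>R (x powr (2 * \<sigma> - 1) *\<^sub>R Q' x + ((2 * \<sigma> - 1) * x powr (2 * \<sigma> - 1 - 1)) *\<^sub>R Q x))" for x
  have FD: "(F has_vector_derivative f x) (at x)" if "x > 0" for x
    unfolding F_def[abs_def] f_def
    by (intro bounded_linear.has_vector_derivative[OF bounded_linear_scaleR_right] has_vector_derivative_add has_vector_derivative_powr_scaleR PD that)
  \<comment> \<open>At 0 the odd functions \<open>od\<close> and \<open>e1\<close> are O(x), so the
    terms of \<open>F\<close> behave at worst like x^(2\<sigma> + 1), x^(2\<sigma> + 1 - 2u) and
    x^(2\<sigma> + 1). The first and last exponents are positive by \<sigma> > -1/2, the middle one
    by \<sigma> > u - 1/2.\<close>
  obtain C1 where C1: "C1 \<ge> 0" "\<And>x. cmod (od x) \<le> C1 * \<bar>x\<bar>" using odd_part_bound[OF \<phi>] unfolding od_def by blast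
  obtain C2 where C2: "C2 \<ge> 0" "\<And>x. cmod (e1 x) \<le> C2 * \<bar>x\<bar>" using odd_part_bound[OF \<phi>'] unfolding e1_def by blast
  obtain C3 where C3: "C3 \<ge> 0" "\<And>x. \<bar>x\<bar> ^ 0 * cmod (e x) \<le> C3" using rapidE[OF schwartz_rapid[OF S(1)]] by blast
  obtain C4 where C4: "C4 \<ge> 0" "\<And>x. \<bar>x\<bar> ^ 0 * cmod (o1 x) \<le> C4" using rapidE[OF schwartz_rapid[OF S(4)]] by blast
  obtain C5 where C5: "C5 \<ge> 0" "\<And>x. \<bar>x\<bar> ^ 0 * cmod (A x) \<le> C5" using rapidE[OF PR(2)] by blast
  have F0: "(F \<longlongrightarrow> (- 2) *\<^sub>R (0 + \<kappa> *\<^sub>R 0 + \<alpha> *\<^sub>R 0)) (at_right 0)"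
    unfolding F_def[abs_def]
  proof (intro tendsto_scaleR tendsto_add tendsto_const)
    show "((\<lambda>x. x powr (2 * \<sigma>) *\<^sub>R P x) \<longlongrightarrow> 0) (at_right 0)"
    proof (rule powr_at_right_0[where k = 1 and C = "C2 * C3 + C4 * C1"])
      fix x :: real assume "x > 0"
      have "cmod (P x) \<le> cmod (e1 x) * cmod (e x) + cmod (o1 x) * cmod (od x)"
        unfolding P_def by (rule order_trans[OF norm_triangle_ineq]) (simp add: norm_mult)
      also have "\<dots> \<le> (C2 * \<bar>x\<bar>) * C3 + C4 * (C1 * \<bar>x\<bar>)"
        using C3(2)[of x] C4(2)[of x] C1 C2 C3(1) C4(1) by (intro add_mono mult_mono) auto
      finally show "cmod (P x) \<le> (C2 * C3 + C4 * C1) * x ^ 1"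
        using \<open>x > 0\<close> by (simp add: algebra_simps)
    qed (use \<sigma>' in simp)
    show "((\<lambda>x. x powr (2 * \<sigma> + 1 - 2 * u) *\<^sub>R A x) \<longlongrightarrow> 0) (at_right 0)"
      by (rule powr_at_right_0[where k = 0 and C = C5]) (use \<sigma> C5 in auto)
    show "((\<lambda>x. x powr (2 * \<sigma> - 1) *\<^sub>R Q x) \<longlongrightarrow> 0) (at_right 0)"
    proof (rule powr_at_right_0[where k = 2 and C = "C1 * C1"])
      fix x :: real assume "x > 0"
      have "cmod (Q x) \<le> (C1 * \<bar>x\<bar>) * (C1 * \<bar>x\<bar>)"
        unfolding Q_def norm_mult complex_mod_cnj using C1 by (intro mult_mono) auto
      then show "cmod (Q x) \<le> C1 * C1 * x ^ 2"
        using \<open>x > 0\<close> by (simp add: algebra_simps power2_eq_square)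
    qed (use \<sigma>' in simp)
  qed
  have Ftop: "(F \<longlongrightarrow> (- 2) *\<^sub>R (0 + \<kappa> *\<^sub>R 0 + \<alpha> *\<^sub>R 0)) at_top"
    unfolding F_def[abs_def]
    by (intro tendsto_scaleR tendsto_add tendsto_const powr_rapid_at_top PR)
  have ineq: "Re (f x) \<le> T x + T (- x)" if x: "x > 0" for x
  proof -
    define y w where "y = x powr (- 2 * u)" and "w = x powr (2 * \<sigma>)"
    have pos: "y > 0" "w > 0" using x by (simp_all add: y_def w_def)
    have pw: "x powr (2 * \<sigma> - 1) = w / x" "x powr (2 * \<sigma> - 1 - 1) = w / x\<^sup>2"
      "x powr (2 * \<sigma> + 1 - 2 * u) = w * (x * y)" "x powr (2 * \<sigma> + 1 - 2 * u - 1) = w * y"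
    proof -
      have "x powr (2 * \<sigma> + 1 - 2 * u) = x powr (2 * \<sigma> + (1 + - 2 * u))" by (simp add: algebra_simps)
      also have "\<dots> = w * (x * y)"
        unfolding powr_add w_def y_def using x by simp
      finally show "x powr (2 * \<sigma> + 1 - 2 * u) = w * (x * y)" .
      have "x powr (2 * \<sigma> + 1 - 2 * u - 1) = x powr (2 * \<sigma> + - 2 * u)" by (simp add: algebra_simps)
      also have "\<dots> = w * y"
        unfolding powr_add w_def y_def using x by simp
      finally show "x powr (2 * \<sigma> + 1 - 2 * u - 1) = w * y" .
    qed (use x in \<open>simp_all add: w_def powr_diff power2_eq_square\<close>)
    have pw2: "x powr (2 - 4 * u) = x\<^sup>2 * y\<^sup>2"
    proof -
      have "x powr (2 - 4 * u) = x powr (2 + (- 2 * u + - 2 * u))" by simp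
      also have "\<dots> = x\<^sup>2 * (y * y)" using x by (simp only: powr_add y_def) simp
      finally show ?thesis by (simp add: power2_eq_square)
    qed
    have V': "a * y - b \<le> s\<^sup>2 * x\<^sup>2 + \<kappa> * (1 - 2 * u + 2 * \<sigma>) * y - \<kappa>\<^sup>2 * (x\<^sup>2 * y\<^sup>2)"
      using V[OF x] unfolding pw2 y_def[symmetric] .
    have sq: "0 \<le> (cmod p)\<^sup>2 + 2 * t * Re (p * cnj q) + t\<^sup>2 * (cmod q)\<^sup>2" for p q :: complex and t :: real
    proof -
      have "0 \<le> (cmod (p + of_real t * q))\<^sup>2" by simp
      also have "\<dots> = (cmod p)\<^sup>2 + 2 * t * Re (p * cnj q) + t\<^sup>2 * (cmod q)\<^sup>2"
        unfolding cmod_power2 by (simp add: power2_eq_square algebra_simps)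
      finally show ?thesis .
    qed
    have TT: "T x + T (- x) = 2 * w * ((- Re (e2 x * cnj (e x)) - 2 * \<sigma> * Re (e1 x * cnj (e x)) / x + s\<^sup>2 * x\<^sup>2 * (cmod (e x))\<^sup>2)
        + (- Re (o2 x * cnj (od x)) - 2 * \<sigma> * Re (o1 x * cnj (od x)) / x + 2 * \<sigma> * (cmod (od x))\<^sup>2 / x\<^sup>2 + s\<^sup>2 * x\<^sup>2 * (cmod (od x))\<^sup>2)
        - (a * y - b) * ((cmod (e x))\<^sup>2 + (cmod (od x))\<^sup>2))"
    proof -
      have J: "?J x = J_reg s \<sigma> \<phi> x" "?J (- x) = J_reg s \<sigma> \<phi> (- x)"
        using x by (auto intro!: dunkl_J_eq \<phi>)
      have "T1 x + T1 (- x) = w * Re (J_reg s \<sigma> \<phi> x * cnj (\<phi> x) + J_reg s \<sigma> \<phi> (- x) * cnj (\<phi> (- x)))"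
        using x by (simp add: T1_def J w_def distrib_left)
      also have "\<dots> = w * Re (2 * ((- e2 x - of_real (2 * \<sigma> / x) * e1 x + of_real (s\<^sup>2 * x\<^sup>2) * e x) * cnj (e x)
         + (- o2 x - of_real (2 * \<sigma> / x) * o1 x + of_real (2 * \<sigma> / x\<^sup>2) * od x + of_real (s\<^sup>2 * x\<^sup>2) * od x) * cnj (od x)))"
        unfolding e_def od_def e1_def o1_def e2_def o2_def by (subst J_reg_even_odd) (use \<phi> x in auto)
      also have "\<dots> = 2 * w * ((- Re (e2 x * cnj (e x)) - 2 * \<sigma> * Re (e1 x * cnj (e x)) / x + s\<^sup>2 * x\<^sup>2 * (cmod (e x))\<^sup>2)
        + (- Re (o2 x * cnj (od x)) - 2 * \<sigma> * Re (o1 x * cnj (od x)) / x + 2 * \<sigma> * (cmod (od x))\<^sup>2 / x\<^sup>2 + s\<^sup>2 * x\<^sup>2 * (cmod (od x))\<^sup>2))"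
        unfolding cmod_power2 using x
        by (simp add: field_simps power2_eq_square)
      finally have T1: "T1 x + T1 (- x) = \<dots>" .
      have par: "(cmod (\<phi> x))\<^sup>2 + (cmod (\<phi> (- x)))\<^sup>2 = 2 * ((cmod (e x))\<^sup>2 + (cmod (od x))\<^sup>2)"
      proof -
        have v: "\<phi> x = e x + od x" "\<phi> (- x) = e x - od x"
          unfolding e_def od_def even_part_def odd_part_def by (simp_all add: field_simps)
        show ?thesis unfolding v cmod_power2 by (simp add: power2_eq_square algebra_simps)
      qed
      have T3: "T3 x + T3 (- x) = 2 * w * ((cmod (e x))\<^sup>2 + (cmod (od x))\<^sup>2)"
      proof -
        have "T3 x + T3 (- x) = w * ((cmod (\<phi> x))\<^sup>2 + (cmod (\<phi> (- x)))\<^sup>2)"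
          using x by (simp add: T3_def w_def distrib_left)
        then show ?thesis unfolding par by simp
      qed
      have T2: "T2 x + T2 (- x) = 2 * w * y * ((cmod (e x))\<^sup>2 + (cmod (od x))\<^sup>2)"
      proof -
        have y: "(x powr (- u))\<^sup>2 = y"
          by (simp add: y_def power2_eq_square flip: powr_add)
        have "T2 x + T2 (- x) = w * (y * (cmod (\<phi> x))\<^sup>2) + w * (y * (cmod (\<phi> (- x)))\<^sup>2)"
          using x by (simp add: T2_def w_def abs_power_mult_def norm_mult power_mult_distrib y)
        also have "\<dots> = w * y * ((cmod (\<phi> x))\<^sup>2 + (cmod (\<phi> (- x)))\<^sup>2)"
          by (simp only: distrib_left mult.assoc)
        finally show ?thesis unfolding par by simp
      qed
      have "T x + T (- x) = (T1 x + T1 (- x)) - a * (T2 x + T2 (- x)) + b * (T3 x + T3 (- x))"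
        by (simp add: T_def algebra_simps)
      then show ?thesis
        unfolding T1 T2 T3 by (simp add: algebra_simps)
    qed
    have cc: "z * cnj z = of_real ((cmod z)\<^sup>2)" for z by (simp only: complex_norm_square)
    have rc: "Re (p * cnj q) = Re (q * cnj p)" for p q by (simp add: mult.commute)
    define be bo de d1 ce co ae ao where "be = Re (e1 x * cnj (e x))" and "bo = Re (o1 x * cnj (od x))"
      and "de = Re (e2 x * cnj (e x))" and "d1 = Re (o2 x * cnj (od x))" and "ce = (cmod (e1 x))\<^sup>2"
      and "co = (cmod (o1 x))\<^sup>2" and "ae = (cmod (e x))\<^sup>2" and "ao = (cmod (od x))\<^sup>2"
    note defs = be_def bo_def de_def d1_def ce_def co_def ae_def ao_def
    have RP: "Re (P x) = be + bo" "Re (P' x) = (ce + de) + (co + d1)" "Re (A x) = ae + ao"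
      "Re (A' x) = (be + be) + (bo + bo)" "Re (Q x) = ao" "Re (Q' x) = bo + bo"
      unfolding P_def P'_def A_def A'_def Q_def Q'_def cc plus_complex.sel Re_complex_of_real
        rc[of "e x" "e1 x"] rc[of "od x" "o1 x"] defs by (rule refl)+
    have "Re (f x) = - 2 * ((w * ((ce + de) + (co + d1)) + (2 * \<sigma> * (w / x)) * (be + bo))
      + \<kappa> * (w * (x * y) * ((be + be) + (bo + bo)) + ((2 * \<sigma> + 1 - 2 * u) * (w * y)) * (ae + ao))
      + \<alpha> * (w / x * (bo + bo) + ((2 * \<sigma> - 1) * (w / x\<^sup>2)) * ao))"
      unfolding f_def pw w_def[symmetric] scaleR_complex.sel plus_complex.sel RP ..
    also have "\<dots> = - 2 * (w * (de + ce + d1 + co) + 2 * \<sigma> * (w / x) * (be + bo)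
      + \<kappa> * (w * (x * y) * (2 * be + 2 * bo) + (2 * \<sigma> + 1 - 2 * u) * (w * y) * (ae + ao))
      + \<alpha> * (w / x * (2 * bo) + (2 * \<sigma> - 1) * (w / x\<^sup>2) * ao))"
      by (simp only: mult_2 add_ac)
    also have "\<dots> \<le> 2 * w * ((- de - 2 * \<sigma> * be / x + s\<^sup>2 * x\<^sup>2 * ae)
        + (- d1 - 2 * \<sigma> * bo / x + 2 * \<sigma> * ao / x\<^sup>2 + s\<^sup>2 * x\<^sup>2 * ao) - (a * y - b) * (ae + ao))"
    proof (rule weighted_square_inequality[OF x pos \<kappa> _ _ V' \<alpha>_def])
      show "0 \<le> ce + 2 * (\<kappa> * (x * y)) * be + (\<kappa> * (x * y))\<^sup>2 * ae"
        unfolding defs by (rule sq)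
      show "0 \<le> co + 2 * (\<kappa> * (x * y) + \<alpha> / x) * bo + (\<kappa> * (x * y) + \<alpha> / x)\<^sup>2 * ao"
        unfolding defs by (rule sq)
    qed (simp_all add: ae_def ao_def)
    also have "\<dots> = T x + T (- x)"
      unfolding TT defs ..
    finally show ?thesis .
  qed
  have "0 \<le> (LINT x:{0<..}|lborel. T x + T (- x))"
  proof (rule half_line_FTC_le[where F = "\<lambda>x. Re (F x)" and f = "\<lambda>x. Re (f x)"])
    show "set_integrable lborel {0<..} (\<lambda>x. T x + T (- x))"
      by (rule integral_fold_half_line(1)[OF T])
    show "((\<lambda>x. Re (F x)) has_vector_derivative Re (f x)) (at x)" if "x > 0" for x
      by (rule bounded_linear.has_vector_derivative[OF bounded_linear_Re FD[OF that]])
    show "continuous_on {0<..} (\<lambda>x. Re (f x))"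
      unfolding f_def by (intro continuous_intros PC) auto
    show "((\<lambda>x. Re (F x)) \<longlongrightarrow> 0) (at_right 0)" "((\<lambda>x. Re (F x)) \<longlongrightarrow> 0) at_top"
      using tendsto_Re[OF F0] tendsto_Re[OF Ftop] by simp_all
  qed (rule ineq)
  also have "\<dots> = integral\<^sup>L lborel T"
    by (rule integral_fold_half_line(2)[OF T, symmetric])
  finally show ?thesis unfolding eq by linarith
qed

text \<open>The exponent 2 - 4u lies strictly between -2u and 2, so the first power dominates up to
  \<delta>, the second beyond R, and in between a constant suffices. \<delta> and R are where the
  respective comparisons turn into equalities.\<close>

lemma powr_interpolation:
  fixes u A B :: real
  assumes u: "0 < u" "u < 1" and A: "A > 0" and B: "B > 0"
  shows "\<exists>C>0. \<forall>y>0. A * y powr (2 - 4 * u) \<le> B * y powr (- 2 * u) + y\<^sup>2 + C"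
proof -
  define q \<delta> R where "q = 2 - 4 * u" and "\<delta> = (B / A) powr (1 / (2 - 2 * u))" and "R = A powr (1 / (4 * u))"
  have pos: "\<delta> > 0" "R > 0" using A B by (simp_all add: \<delta>_def R_def)
  define C where "C = A * (\<delta> powr q + R powr q)"
  have "A * y powr q \<le> B * y powr (- 2 * u) + y\<^sup>2 + C" if y: "y > 0" for y
  proof -
    have nn: "0 \<le> B * y powr (- 2 * u)" "0 \<le> y\<^sup>2" "0 \<le> C"
      using A B by (simp_all add: C_def)
    consider "y \<le> \<delta>" | "R \<le> y" | "\<delta> < y" "y < R" by linarith
    then show ?thesis
    proof cases
      case 1
      have "y powr (2 - 2 * u) \<le> \<delta> powr (2 - 2 * u)"
        using 1 y u by (intro powr_mono2) auto
      also have "\<dots> = B / A" using u A B by (simp add: \<delta>_def powr_powr)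
      finally have "A * y powr (2 - 2 * u) \<le> B" using A by (simp add: field_simps)
      then have "A * y powr (2 - 2 * u) * y powr (- 2 * u) \<le> B * y powr (- 2 * u)"
        by (intro mult_right_mono) auto
      moreover have "y powr (2 - 2 * u) * y powr (- 2 * u) = y powr q"
        by (simp add: q_def flip: powr_add)
      ultimately have "A * y powr q \<le> B * y powr (- 2 * u)" by (simp only: mult.assoc)
      then show ?thesis using nn by linarith
    next
      case 2
      have "A = R powr (4 * u)" using u A by (simp add: R_def powr_powr)
      also have "\<dots> \<le> y powr (4 * u)" using 2 pos u by (intro powr_mono2) auto
      finally have "A * y powr q \<le> y powr (4 * u) * y powr q" by (intro mult_right_mono) auto
      also have "\<dots> = y powr 2" by (simp add: q_def flip: powr_add)
      also have "\<dots> = y\<^sup>2" using y by simp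
      finally show ?thesis using nn by linarith
    next
      case 3
      have "y powr q \<le> \<delta> powr q + R powr q"
      proof (cases "q \<ge> 0")
        case True
        then have "y powr q \<le> R powr q" using 3 y by (intro powr_mono2) auto
        then show ?thesis by (simp add: add_increasing)
      next
        case False
        then have "y powr q \<le> \<delta> powr q" using 3 pos by (intro powr_mono2') auto
        then show ?thesis by (simp add: add_increasing2)
      qed
      then have "A * y powr q \<le> C" using A by (simp add: C_def)
      then show ?thesis using nn by linarith
    qed
  qed
  moreover have "C > 0" using A pos by (simp add: C_def add_pos_pos)
  ultimately show ?thesis unfolding q_def by blast
qed

subsection \<open>Totality of the Gaussian moments\<close>

lemma power_le_exp: "t \<ge> 0 \<Longrightarrow> t ^ m \<le> fact m * exp (t::real)"
proof -
  assume t: "t \<ge> 0"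
  have "(\<Sum>n\<in>{m}. t ^ n /\<^sub>R fact n) \<le> (\<Sum>n. t ^ n /\<^sub>R fact n)"
    using t by (intro sum_le_suminf summable_exp_generic) auto
  then have "t ^ m / fact m \<le> exp t"
    by (simp add: exp_def divide_inverse mult.commute)
  then show ?thesis by (simp add: field_simps)
qed

lemma rapid_gauss:
  assumes s: "s > 0"
  shows "rapid (\<lambda>x. of_real (exp (- (s * x\<^sup>2) / 2)))"
  unfolding rapid_def
proof (intro conjI allI)
  fix m
  have "\<bar>x\<bar> ^ m * cmod (of_real (exp (- (s * x\<^sup>2) / 2))) \<le> 1 + (2 / s) ^ m * fact m" for x
  proof -
    define t where "t = s * x\<^sup>2 / 2"
    have t: "t \<ge> 0" using s by (simp add: t_def)
    have e1: "exp (- t) \<le> 1" using t by simp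
    have "\<bar>x\<bar> ^ m \<le> 1 + (x\<^sup>2) ^ m"
    proof (cases "\<bar>x\<bar> \<le> 1")
      case True
      then have "\<bar>x\<bar> ^ m \<le> 1" by (intro power_le_one) auto
      then show ?thesis by (simp add: add_increasing2)
    next
      case False
      then have "1 * \<bar>x\<bar> \<le> \<bar>x\<bar> * \<bar>x\<bar>" by (intro mult_right_mono) auto
      then have "\<bar>x\<bar> \<le> \<bar>x\<bar>\<^sup>2" by (simp only: power2_eq_square mult_1_left)
      then have "\<bar>x\<bar> ^ m \<le> (\<bar>x\<bar>\<^sup>2) ^ m" by (intro power_mono) auto
      then show ?thesis by simp
    qed
    then have "\<bar>x\<bar> ^ m * exp (- t) \<le> (1 + (x\<^sup>2) ^ m) * exp (- t)"
      by (intro mult_right_mono) auto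
    also have "\<dots> = exp (- t) + (2 / s) ^ m * (t ^ m * exp (- t))"
    proof -
      have "(x\<^sup>2) ^ m = (2 / s * t) ^ m" using s by (simp add: t_def)
      then show ?thesis by (simp only: power_mult_distrib distrib_right mult_1_left mult.assoc)
    qed
    also have "\<dots> \<le> 1 + (2 / s) ^ m * fact m"
    proof (intro add_mono mult_left_mono e1)
      have "t ^ m * exp (- t) \<le> fact m * exp t * exp (- t)"
        by (intro mult_right_mono power_le_exp t) simp
      also have "fact m * exp t * exp (- t) = fact m"
        by (simp add: mult.assoc flip: exp_add)
      finally show "t ^ m * exp (- t) \<le> fact m" .
    qed (use s in simp)
    finally have "\<bar>x\<bar> ^ m * exp (- t) \<le> 1 + (2 / s) ^ m * fact m" .
    then show ?thesis by (simp add: t_def)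
  qed
  then show "\<exists>C. \<forall>x. \<bar>x\<bar> ^ m * cmod (of_real (exp (- (s * x\<^sup>2) / 2))) \<le> C" by blast
qed measurable

lemma rapid_exp_gauss:
  assumes s: "s > 0"
  shows "rapid (\<lambda>x. of_real (exp (a * \<bar>x\<bar>) * exp (- (s * x\<^sup>2) / 2)))"
proof (rule rapid_dominated[OF rapid_gauss, where n = 0 and B = "exp (a\<^sup>2 / s)"])
  show "s / 2 > 0" using s by simp
  fix x :: real
  \<comment> \<open>Completing the square: half of the Gaussian exponent pays for the factor exp(a
    |x|).\<close>
  have "0 \<le> (a / sqrt s - sqrt s * \<bar>x\<bar> / 2)\<^sup>2" by simp
  also have "\<dots> = a\<^sup>2 / s - a * \<bar>x\<bar> + s * x\<^sup>2 / 4"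
    using s by (simp add: power2_diff power_divide power_mult_distrib)
  finally have "a * \<bar>x\<bar> + - (s * x\<^sup>2) / 2 \<le> a\<^sup>2 / s + - (s / 2 * x\<^sup>2) / 2"
    by (simp add: field_simps)
  then have "exp (a * \<bar>x\<bar>) * exp (- (s * x\<^sup>2) / 2) \<le> exp (a\<^sup>2 / s) * exp (- (s / 2 * x\<^sup>2) / 2)"
    by (simp only: exp_add[symmetric] exp_le_cancel_iff)
  also have "\<dots> \<le> exp (a\<^sup>2 / s) * (1 + \<bar>x\<bar> ^ 0) * exp (- (s / 2 * x\<^sup>2) / 2)"
    by (intro mult_right_mono) auto
  finally show "cmod (of_real (exp (a * \<bar>x\<bar>) * exp (- (s * x\<^sup>2) / 2))) \<le>
      exp (a\<^sup>2 / s) * (1 + \<bar>x\<bar> ^ 0) * cmod (of_real (exp (- (s / 2 * x\<^sup>2) / 2)))"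
    unfolding norm_of_real abs_mult abs_exp_cancel .
qed measurable

text \<open>A signed density all of whose moments vanish has vanishing characteristic function, so its
  positive and negative parts agree by the uniqueness theorem for characteristic functions.\<close>

lemma moments_zero_imp_zero:
  fixes F :: "real \<Rightarrow> real"
  assumes [measurable]: "F \<in> borel_measurable borel"
    and int: "\<And>a. integrable lborel (\<lambda>x. exp (a * \<bar>x\<bar>) * F x)"
    and moments: "\<And>n. (LINT x|lborel. x ^ n * F x) = 0"
  shows "AE x in lborel. F x = 0"
proof -
  have F: "integrable lborel F" using int[of 0] by simp
  \<comment> \<open>The exponential series is integrated term by term and each term is a moment. All
    partial sums are dominated by exp(|t| |x|) |F x|, which is where the exponential integrability
    enters.\<close>
  have char0: "(CLINT x|lborel. iexp (t * x) * of_real (F x)) = 0" for t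
  proof -
    define S where "S k x = (\<Sum>n<k. (\<i> * of_real (t * x)) ^ n / fact n) * of_real (F x)" for k x
    have dom: "integrable lborel (\<lambda>x. norm (exp (\<bar>t\<bar> * \<bar>x\<bar>) * F x))"
      by (intro integrable_norm int)
    have bound: "norm (S k x) \<le> norm (exp (\<bar>t\<bar> * \<bar>x\<bar>) * F x)" for k x
    proof -
      have "norm (\<Sum>n<k. (\<i> * complex_of_real (t * x)) ^ n / fact n) \<le> (\<Sum>n<k. (\<bar>t\<bar> * \<bar>x\<bar>) ^ n /\<^sub>R fact n)"
        by (rule sum_norm_le) (simp add: norm_divide norm_mult norm_power divide_inverse abs_mult mult.commute norm_inverse norm_fact)
      also have "\<dots> \<le> exp (\<bar>t\<bar> * \<bar>x\<bar>)"
        unfolding exp_def by (rule sum_le_suminf[OF summable_exp_generic]) simp_all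
      finally show ?thesis
        unfolding S_def norm_mult norm_of_real real_norm_def abs_mult abs_exp_cancel abs_abs abs_idempotent
        by (rule mult_right_mono) simp
    qed
    have lim: "(\<lambda>k. S k x) \<longlonglongrightarrow> iexp (t * x) * of_real (F x)" for x
    proof -
      have "(\<lambda>n. (\<i> * complex_of_real (t * x)) ^ n /\<^sub>R fact n) sums exp (\<i> * complex_of_real (t * x))"
        by (rule exp_converges)
      then show ?thesis
        unfolding S_def sums_def
        by (intro tendsto_mult tendsto_const) (simp add: scaleR_conv_of_real divide_inverse mult.commute)
    qed
    have "(\<lambda>k. CLINT x|lborel. S k x) \<longlonglongrightarrow> (CLINT x|lborel. iexp (t * x) * of_real (F x))"
    proof (rule integral_dominated_convergence[OF _ _ dom])
      show "(\<lambda>x. iexp (t * x) * of_real (F x)) \<in> borel_measurable lborel" by measurable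
      show "S k \<in> borel_measurable lborel" for k unfolding S_def by measurable
      show "AE x in lborel. (\<lambda>k. S k x) \<longlonglongrightarrow> iexp (t * x) * of_real (F x)" using lim by simp
      show "AE x in lborel. norm (S k x) \<le> norm (exp (\<bar>t\<bar> * \<bar>x\<bar>) * F x)" for k using bound by simp
    qed
    moreover have "(CLINT x|lborel. S k x) = 0" for k
    proof -
      have mi: "integrable lborel (\<lambda>x. x ^ n * F x)" for n
      proof (rule Bochner_Integration.integrable_bound)
        show "integrable lborel (\<lambda>x. fact n * (exp (1 * \<bar>x\<bar>) * F x))" by (intro integrable_mult_right int)
        show "AE x in lborel. norm (x ^ n * F x) \<le> norm (fact n * (exp (1 * \<bar>x\<bar>) * F x))"
        proof (rule AE_I2)
          fix x :: real
          have "\<bar>x\<bar> ^ n * \<bar>F x\<bar> \<le> (fact n * exp \<bar>x\<bar>) * \<bar>F x\<bar>"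
            using power_le_exp[of "\<bar>x\<bar>" n] by (intro mult_right_mono) auto
          then show "norm (x ^ n * F x) \<le> norm (fact n * (exp (1 * \<bar>x\<bar>) * F x))"
            by (simp add: abs_mult power_abs mult.assoc)
        qed
      qed measurable
      have mi': "integrable lborel (\<lambda>x. complex_of_real (x ^ n * F x))" for n
        using mi by (rule integrable_of_real)
      have "S k x = (\<Sum>n<k. (\<i> * of_real t) ^ n / fact n * complex_of_real (x ^ n * F x))" for x
        unfolding S_def sum_distrib_right by (intro sum.cong refl) (simp add: power_mult_distrib)
      then have "(CLINT x|lborel. S k x) = (\<Sum>n<k. (\<i> * of_real t) ^ n / fact n * (CLINT x|lborel. complex_of_real (x ^ n * F x)))"
        using mi' by (simp add: Bochner_Integration.integral_sum)
      also have "\<dots> = 0"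
        unfolding integral_complex_of_real moments by simp
      finally show ?thesis .
    qed
    ultimately show ?thesis using LIMSEQ_unique[OF _ tendsto_const] by simp
  qed
  define P N where "P x = max (F x) 0" and "N x = max (- F x) 0" for x
  have [measurable]: "P \<in> borel_measurable borel" "N \<in> borel_measurable borel"
    unfolding P_def[abs_def] N_def[abs_def] by measurable
  have FPN: "F x = P x - N x" and nn: "P x \<ge> 0" "N x \<ge> 0" for x by (auto simp: P_def N_def)
  have P: "integrable lborel P" and N: "integrable lborel N"
    unfolding P_def[abs_def] N_def[abs_def] using F by (auto intro!: integrable_max)
  \<comment> \<open>The positive and negative parts have the same mass by the zeroth moment, so one
    constant normalises both to probability densities. When it is 0, both parts vanish and nothing
    has to be normalised.\<close>
  define c where "c = integral\<^sup>L lborel P"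
  have cN: "c = integral\<^sup>L lborel N"
    using moments[of 0] Bochner_Integration.integral_diff[OF P N] by (simp add: FPN c_def)
  have c0: "c \<ge> 0" unfolding c_def using nn by simp
  show ?thesis
  proof (cases "c = 0")
    case True
    have "AE x in lborel. P x = 0"
      using True integral_nonneg_eq_0_iff_AE[OF P] nn by (simp add: c_def)
    moreover have "AE x in lborel. N x = 0"
      using True integral_nonneg_eq_0_iff_AE[OF N] nn by (simp add: cN)
    ultimately show ?thesis by eventually_elim (simp add: FPN)
  next
    case False
    then have c: "c > 0" using c0 by simp
    have dist: "real_distribution (density lborel (\<lambda>x. ennreal (G x / c)))"
      and char: "char (density lborel (\<lambda>x. ennreal (G x / c))) t = (CLINT x|lborel. iexp (t * x) * of_real (G x)) / of_real c"
      if G: "integrable lborel G" "\<And>x. G x \<ge> 0" "integral\<^sup>L lborel G = c" for G :: "real \<Rightarrow> real" and t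
    proof -
      have [measurable]: "G \<in> borel_measurable borel"
        using borel_measurable_integrable[OF G(1)] by simp
      have "(\<integral>\<^sup>+x. ennreal (G x / c) \<partial>lborel) = ennreal (LINT x|lborel. G x / c)"
        using G c by (intro nn_integral_eq_integral integrable_divide) auto
      also have "(LINT x|lborel. G x / c) = 1" using G c by simp
      finally have "(\<integral>\<^sup>+x. ennreal (G x / c) \<partial>lborel) = 1" by simp
      then have "prob_space (density lborel (\<lambda>x. ennreal (G x / c)))"
        by (intro prob_spaceI) (simp add: emeasure_density)
      then show "real_distribution (density lborel (\<lambda>x. ennreal (G x / c)))"
        by (simp add: real_distribution_def real_distribution_axioms_def)
      have "char (density lborel (\<lambda>x. ennreal (G x / c))) t = (CLINT x|lborel. (G x / c) *\<^sub>R iexp (t * x))"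
        unfolding char_def using G c by (intro integral_density) auto
      also have "\<dots> = (CLINT x|lborel. iexp (t * x) * of_real (G x) / of_real c)"
        by (simp add: scaleR_conv_of_real mult.commute)
      finally show "char (density lborel (\<lambda>x. ennreal (G x / c))) t = (CLINT x|lborel. iexp (t * x) * of_real (G x)) / of_real c"
        by simp
    qed
    have ie: "integrable lborel (\<lambda>x. iexp (t * x) * complex_of_real (G x))" if "integrable lborel G" for G t
    proof (rule Bochner_Integration.integrable_bound[OF that])
      have [measurable]: "G \<in> borel_measurable borel"
        using borel_measurable_integrable[OF that] by simp
      show "(\<lambda>x. iexp (t * x) * complex_of_real (G x)) \<in> borel_measurable lborel" by measurable
    qed (simp add: norm_mult)
    have "char (density lborel (\<lambda>x. ennreal (P x / c))) = char (density lborel (\<lambda>x. ennreal (N x / c)))"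
    proof
      fix t
      have "(CLINT x|lborel. iexp (t * x) * of_real (P x)) - (CLINT x|lborel. iexp (t * x) * of_real (N x))
          = (CLINT x|lborel. iexp (t * x) * of_real (F x))"
        by (subst Bochner_Integration.integral_diff[symmetric, OF ie[OF P] ie[OF N]]) (simp add: FPN algebra_simps)
      then have "(CLINT x|lborel. iexp (t * x) * of_real (P x)) = (CLINT x|lborel. iexp (t * x) * of_real (N x))"
        unfolding char0 right_minus_eq .
      then show "char (density lborel (\<lambda>x. ennreal (P x / c))) t = char (density lborel (\<lambda>x. ennreal (N x / c))) t"
        using char[OF P nn(1), of t] char[OF N nn(2), of t] c_def cN by simp
    qed
    then have "density lborel (\<lambda>x. ennreal (P x / c)) = density lborel (\<lambda>x. ennreal (N x / c))"
      using dist[OF P nn(1)] dist[OF N nn(2)] c_def cN by (intro Levy_uniqueness) auto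
    then have "AE x in lborel. ennreal (P x / c) = ennreal (N x / c)"
      by (subst (asm) sigma_finite_measure.density_unique_iff[OF sigma_finite_lborel]) auto
    then show ?thesis
    proof eventually_elim
      case (elim x)
      then have "P x / c = N x / c" using nn c by (subst (asm) ennreal_inj) auto
      then show ?case using c by (simp add: FPN)
    qed
  qed
qed

text \<open>The real and imaginary parts of weight times f times Gaussian have vanishing moments.
  Their integrability against exp(a |x|) holds because f and exp(a |x|) times the Gaussian are both
  square integrable for the weight. Dividing out the weight and the Gaussian costs only the point
  0.\<close>

lemma gaussian_moments_total:
  assumes f: "f \<in> l2_space (dunkl_measure \<sigma>)" and \<sigma>: "\<sigma> > -1/2" and s: "s > 0"
    and zero: "\<And>n. l2_inner (dunkl_measure \<sigma>) f (\<lambda>x. of_real (x ^ n * exp (- (s * x\<^sup>2) / 2))) = 0"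
  shows "AE x in dunkl_measure \<sigma>. f x = 0"
proof -
  let ?M = "dunkl_measure \<sigma>"
  have [measurable]: "f \<in> borel_measurable borel" using l2_spaceD(1)[OF f] by simp
  define g where "g x = exp (- (s * x\<^sup>2) / 2)" for x :: real
  have [measurable]: "g \<in> borel_measurable borel" unfolding g_def by measurable
  define G where "G x = \<bar>x\<bar> powr (2 * \<sigma>) *\<^sub>R (f x * of_real (g x))" for x
  have [measurable]: "G \<in> borel_measurable borel" unfolding G_def by measurable
  have expG: "integrable lborel (\<lambda>x. of_real (exp (a * \<bar>x\<bar>)) * G x)" for a
  proof -
    have "(\<lambda>x. complex_of_real (exp (a * \<bar>x\<bar>) * g x)) \<in> l2_space ?M"
      unfolding g_def by (intro rapid_l2 rapid_exp_gauss s \<sigma>)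
    from l2_integrable_mult[OF f this]
    have "integrable ?M (\<lambda>x. f x * of_real (exp (a * \<bar>x\<bar>) * g x))" by simp
    then have "integrable lborel (\<lambda>x. \<bar>x\<bar> powr (2 * \<sigma>) *\<^sub>R (f x * of_real (exp (a * \<bar>x\<bar>) * g x)))"
      by (subst (asm) integrable_dunkl) auto
    then show ?thesis
      by (simp add: G_def scaleR_conv_of_real mult_ac)
  qed
  have momG: "(CLINT x|lborel. of_real (x ^ n) * G x) = 0" for n
  proof -
    have "l2_inner ?M f (\<lambda>x. of_real (x ^ n * g x)) = (CLINT x|?M. f x * of_real (x ^ n * g x))"
      by (simp add: l2_inner_def)
    also have "\<dots> = (CLINT x|lborel. \<bar>x\<bar> powr (2 * \<sigma>) *\<^sub>R (f x * of_real (x ^ n * g x)))"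
      by (rule integral_dunkl) measurable
    also have "\<dots> = (CLINT x|lborel. of_real (x ^ n) * G x)"
      by (simp add: G_def scaleR_conv_of_real mult_ac)
    finally show ?thesis using zero[of n] by (simp add: g_def)
  qed
  have pG: "integrable lborel (\<lambda>x. of_real (x ^ n) * G x)" for n
  proof (rule Bochner_Integration.integrable_bound)
    show "integrable lborel (\<lambda>x. fact n * (of_real (exp (1 * \<bar>x\<bar>)) * G x))"
      by (intro integrable_mult_right expG)
    show "AE x in lborel. norm (of_real (x ^ n) * G x) \<le> norm (fact n * (of_real (exp (1 * \<bar>x\<bar>)) * G x))"
    proof (rule AE_I2)
      fix x :: real
      have "\<bar>x\<bar> ^ n * cmod (G x) \<le> (fact n * exp \<bar>x\<bar>) * cmod (G x)"
        using power_le_exp[of "\<bar>x\<bar>" n] by (intro mult_right_mono) auto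
      then show "norm (of_real (x ^ n) * G x) \<le> norm (fact n * (of_real (exp (1 * \<bar>x\<bar>)) * G x))"
        by (simp add: norm_mult power_abs mult.assoc norm_power)
    qed
  qed measurable
  have "AE x in lborel. Re (G x) = 0"
  proof (rule moments_zero_imp_zero)
    show "integrable lborel (\<lambda>x. exp (a * \<bar>x\<bar>) * Re (G x))" for a
      using integrable_Re[OF expG[of a]] by simp
    show "(LINT x|lborel. x ^ n * Re (G x)) = 0" for n
      using integral_Re[OF pG[of n]] momG[of n] by simp
  qed measurable
  moreover have "AE x in lborel. Im (G x) = 0"
  proof (rule moments_zero_imp_zero)
    show "integrable lborel (\<lambda>x. exp (a * \<bar>x\<bar>) * Im (G x))" for a
      using integrable_Im[OF expG[of a]] by simp
    show "(LINT x|lborel. x ^ n * Im (G x)) = 0" for n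
      using integral_Im[OF pG[of n]] momG[of n] by simp
  qed measurable
  ultimately have "AE x in lborel. f x = 0"
    using AE_lborel_singleton[of 0]
  proof eventually_elim
    case (elim x)
    then have "G x = 0" by (simp add: complex_eq_iff)
    then show ?case using elim(3) by (simp add: G_def g_def)
  qed
  then show ?thesis by (simp add: AE_dunkl)
qed

text \<open>Half of the coefficient of |x|^(-2u) gained from the square is kept; the other half,
  together with s^2 x^2, absorbs the loss \<kappa>^2 |x|^(2 - 4u) by
  \<open>powr_interpolation\<close>. Putting y = x sqrt(s) removes s from that estimate, so C
  depends only on \<epsilon>, \<sigma> and u.\<close>

theorem inverse_power_form_bound:
  assumes u: "0 < u" "u < 1" and \<sigma>: "\<sigma> > u - 1/2" and \<epsilon>: "\<epsilon> > 0"
  shows "\<exists>C>0. \<forall>s>0. \<forall>\<phi>\<in>schwartz.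
    l2_sq (dunkl_measure \<sigma>) (abs_power_mult (- u) \<phi>) \<le>
      \<epsilon> * s powr (u - 1) * Re (l2_inner (dunkl_measure \<sigma>) (dunkl_J s \<sigma> \<phi>) \<phi>)
      + C * s powr u * l2_sq (dunkl_measure \<sigma>) \<phi>"
proof -
  define c where "c = 1 - 2 * u + 2 * \<sigma>"
  have c: "c > 0" using \<sigma> by (simp add: c_def)
  \<comment> \<open>Chosen so that \<kappa> c = 2 s^(1-u) / \<epsilon>: one share 1/\<epsilon>
    becomes the coefficient of the form, the other is spent on the interpolation.\<close>
  define K where "K = 2 / (c * \<epsilon>)"
  have K: "K > 0" using c \<epsilon> by (simp add: K_def)
  have Kc: "K * c / 2 = 1 / \<epsilon>" using c \<epsilon> by (simp add: K_def)
  obtain C where C: "C > 0" "\<And>y. y > 0 \<Longrightarrow> K\<^sup>2 * y powr (2 - 4 * u) \<le> (1 / \<epsilon>) * y powr (- 2 * u) + y\<^sup>2 + C"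
    using powr_interpolation[OF u, of "K\<^sup>2" "1 / \<epsilon>"] K \<epsilon> by auto
  have main: "l2_sq (dunkl_measure \<sigma>) (abs_power_mult (- u) \<phi>) \<le>
      \<epsilon> * s powr (u - 1) * Re (l2_inner (dunkl_measure \<sigma>) (dunkl_J s \<sigma> \<phi>) \<phi>)
      + \<epsilon> * C * s powr u * l2_sq (dunkl_measure \<sigma>) \<phi>"
    if s: "s > 0" and \<phi>: "\<phi> \<in> schwartz" for s \<phi>
  proof -
    let ?h = "l2_sq (dunkl_measure \<sigma>) (abs_power_mult (- u) \<phi>)"
    let ?j = "Re (l2_inner (dunkl_measure \<sigma>) (dunkl_J s \<sigma> \<phi>) \<phi>)"
    let ?n = "l2_sq (dunkl_measure \<sigma>) \<phi>"
    define \<kappa> where "\<kappa> = K * s powr (1 - u)"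
    have "(1 / \<epsilon> * s powr (1 - u)) * x powr (- 2 * u) - s * C \<le>
        s\<^sup>2 * x\<^sup>2 + \<kappa> * (1 - 2 * u + 2 * \<sigma>) * x powr (- 2 * u) - \<kappa>\<^sup>2 * x powr (2 - 4 * u)"
      if x: "x > 0" for x
    proof -
      define y where "y = sqrt s * x"
      have y: "y > 0" using s x by (simp add: y_def)
      have ypowr: "y powr p = s powr (p / 2) * x powr p" for p
        using s x by (simp add: y_def powr_mult powr_half_sqrt[symmetric] powr_powr)
      have e1: "s * y powr (2 - 4 * u) = (s powr (1 - u))\<^sup>2 * x powr (2 - 4 * u)"
      proof -
        have "s * s powr ((2 - 4 * u) / 2) = s powr (1 + (2 - 4 * u) / 2)"
          using s by (simp add: powr_add)
        also have "1 + (2 - 4 * u) / 2 = (1 - u) + (1 - u)" by (simp add: field_simps)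
        also have "s powr \<dots> = (s powr (1 - u))\<^sup>2"
          by (simp only: powr_add power2_eq_square)
        finally show ?thesis by (simp add: ypowr)
      qed
      have e2: "s * y powr (- 2 * u) = s powr (1 - u) * x powr (- 2 * u)"
      proof -
        have "s * s powr ((- 2 * u) / 2) = s powr (1 + - u)"
          using s unfolding powr_add by simp
        then show ?thesis by (simp add: ypowr)
      qed
      have e3: "s * y\<^sup>2 = s\<^sup>2 * x\<^sup>2" using s by (simp add: y_def power_mult_distrib power2_eq_square)
      have "s * (K\<^sup>2 * y powr (2 - 4 * u)) \<le> s * ((1 / \<epsilon>) * y powr (- 2 * u) + y\<^sup>2 + C)"
        using s by (intro mult_left_mono C y) simp
      then have "K\<^sup>2 * (s * y powr (2 - 4 * u)) \<le> (1 / \<epsilon>) * (s * y powr (- 2 * u)) + s * y\<^sup>2 + s * C"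
        by (simp add: algebra_simps)
      then have *: "\<kappa>\<^sup>2 * x powr (2 - 4 * u) \<le> (1 / \<epsilon>) * (s powr (1 - u) * x powr (- 2 * u)) + s\<^sup>2 * x\<^sup>2 + s * C"
        unfolding e1 e2 e3 by (simp add: \<kappa>_def power_mult_distrib mult.assoc)
      have "\<kappa> * c * x powr (- 2 * u) = 2 * (K * c / 2) * (s powr (1 - u) * x powr (- 2 * u))"
        by (simp add: \<kappa>_def)
      then have "\<kappa> * c * x powr (- 2 * u) = 2 * ((1 / \<epsilon>) * (s powr (1 - u) * x powr (- 2 * u)))"
        unfolding Kc by simp
      moreover define Z where "Z = (1 / \<epsilon>) * (s powr (1 - u) * x powr (- 2 * u))"
      ultimately show ?thesis
        using * unfolding c_def[symmetric] mult.assoc[of "1 / \<epsilon>"] Z_def[symmetric] by linarith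
    qed
    then have "(1 / \<epsilon> * s powr (1 - u)) * ?h - (s * C) * ?n \<le> ?j"
      using K s \<sigma> u by (intro dunkl_form_lower[OF \<phi>, where \<kappa> = \<kappa>]) (auto simp: \<kappa>_def)
    then have "\<epsilon> * s powr (u - 1) * ((1 / \<epsilon> * s powr (1 - u)) * ?h - (s * C) * ?n) \<le> \<epsilon> * s powr (u - 1) * ?j"
      using \<epsilon> by (intro mult_left_mono) auto
    moreover have "\<epsilon> * s powr (u - 1) * ((1 / \<epsilon> * s powr (1 - u)) * ?h - (s * C) * ?n)
        = (s powr (u - 1) * s powr (1 - u)) * ?h - \<epsilon> * C * (s powr (u - 1) * s) * ?n"
      using \<epsilon> by (simp add: field_simps)
    moreover have "s powr (u - 1) * s powr (1 - u) = 1" using s by (simp flip: powr_add)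
    moreover have "s powr (u - 1) * s = s powr u"
      using s powr_add[of s "u - 1" 1] by simp
    ultimately show ?thesis by simp
  qed
  then show ?thesis using C(1) \<epsilon> by (intro exI[of _ "\<epsilon> * C"]) simp
qed

subsection \<open>The eigenfunctions of the Dunkl oscillator\<close>

definition gauss_poly :: "real \<Rightarrow> real poly \<Rightarrow> real \<Rightarrow> complex" where
  "gauss_poly s p x = of_real (poly p x * exp (- (s * x\<^sup>2) / 2))"

lemma rapid_gauss_poly:
  assumes "s > 0"
  shows "rapid (gauss_poly s p)"
proof (induction p)
  case 0
  then show ?case by (auto simp: gauss_poly_def[abs_def] rapid_def)
next
  case (pCons a p)
  have "rapid (\<lambda>x. of_real a * of_real (exp (- (s * x\<^sup>2) / 2)) + of_real (x ^ 1) * gauss_poly s p x)"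
    by (intro rapid_add rapid_cmult rapid_power_mult rapid_gauss pCons assms)
  then show ?case
    by (simp add: gauss_poly_def[abs_def] distrib_right mult.assoc)
qed

lemma gauss_poly_deriv:
  "(gauss_poly s p has_vector_derivative gauss_poly s (pderiv p - [:0, s:] * p) x) (at x)"
proof -
  have "((\<lambda>x. poly p x * exp (- (s * x\<^sup>2) / 2)) has_real_derivative
      (poly (pderiv p - [:0, s:] * p) x * exp (- (s * x\<^sup>2) / 2))) (at x)"
    by (auto intro!: derivative_eq_intros simp: algebra_simps)
  then have "((\<lambda>x. poly p x * exp (- (s * x\<^sup>2) / 2)) has_vector_derivative
      (poly (pderiv p - [:0, s:] * p) x * exp (- (s * x\<^sup>2) / 2))) (at x)"
    by (simp add: has_real_derivative_iff_has_vector_derivative)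
  from bounded_linear.has_vector_derivative[OF bounded_linear_of_real this]
  show ?thesis by (simp add: gauss_poly_def[abs_def])
qed

lemma vderiv_gauss_poly: "vderiv (gauss_poly s p) = gauss_poly s (pderiv p - [:0, s:] * p)"
  unfolding vderiv_def[abs_def] by (intro ext vector_derivative_at gauss_poly_deriv)

lemma gauss_poly_schwartz:
  assumes "s > 0"
  shows "gauss_poly s p \<in> schwartz"
proof -
  have "(\<lambda>n. gauss_poly s (((\<lambda>p. pderiv p - [:0, s:] * p) ^^ n) p)) 0 \<in> schwartz"
    by (rule schwartzI) (simp_all only: funpow.simps(2) o_apply gauss_poly_deriv rapid_gauss_poly[OF assms])
  then show ?thesis by simp
qed

text \<open>The Dunkl Laplacian sends x^m to \<open>hermite_step \<sigma> m\<close> times x^(m-2).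
  It is 0 for m = 0 and m = 1.\<close>

definition hermite_step :: "real \<Rightarrow> nat \<Rightarrow> real" where
  "hermite_step \<sigma> m = real m * (real m - 1) + 2 * \<sigma> * (real m - (if odd m then 1 else 0))"

text \<open>These are the coefficients of exp(-\<Delta>/(4s)) x^n, with \<Delta> the Dunkl
  Laplacian; for \<sigma> = 0 this gives the monic rescaled Hermite polynomials.\<close>

primrec hermite_coeff :: "real \<Rightarrow> real \<Rightarrow> nat \<Rightarrow> nat \<Rightarrow> real" where
  "hermite_coeff s \<sigma> n 0 = 1"
| "hermite_coeff s \<sigma> n (Suc i) = - hermite_coeff s \<sigma> n i * hermite_step \<sigma> (n - 2 * i) / (4 * s * real (Suc i))"

definition hermite :: "real \<Rightarrow> real \<Rightarrow> nat \<Rightarrow> real poly" where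
  "hermite s \<sigma> n = (\<Sum>i\<le>n div 2. monom (hermite_coeff s \<sigma> n i) (n - 2 * i))"

definition dunkl_energy :: "real \<Rightarrow> real \<Rightarrow> nat \<Rightarrow> real" where
  "dunkl_energy s \<sigma> k = (2 * real k + 1 + 2 * \<sigma>) * s"

lemma pderiv_sum_monom: "pderiv (\<Sum>i\<in>A. monom (c i) (d i)) = (\<Sum>i\<in>A. monom (real (d i) * c i) (d i - 1))"
  by (induction A rule: infinite_finite_induct) (simp_all add: pderiv_add pderiv_monom)

lemma poly_hermite: "poly (hermite s \<sigma> n) x = (\<Sum>i\<le>n div 2. hermite_coeff s \<sigma> n i * x ^ (n - 2 * i))"
  by (simp add: hermite_def poly_sum poly_monom)

lemma poly_pderiv_hermite:
  "x * poly (pderiv (hermite s \<sigma> n)) x =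
    (\<Sum>i\<le>n div 2. real (n - 2 * i) * hermite_coeff s \<sigma> n i * x ^ (n - 2 * i))"
proof -
  have *: "x * (real m * c * x ^ (m - 1)) = real m * c * x ^ m" for m c
    by (cases m) simp_all
  show ?thesis
    unfolding hermite_def pderiv_sum_monom poly_sum poly_monom sum_distrib_left
    by (intro sum.cong refl *)
qed

lemma poly_pderiv2_hermite:
  "x\<^sup>2 * poly (pderiv (pderiv (hermite s \<sigma> n))) x =
    (\<Sum>i\<le>n div 2. real (n - 2 * i) * (real (n - 2 * i) - 1) * hermite_coeff s \<sigma> n i * x ^ (n - 2 * i))"
proof -
  have *: "x\<^sup>2 * (real (m - 1) * (real m * c) * x ^ (m - 1 - 1)) = real m * (real m - 1) * c * x ^ m" for m c
  proof (cases "m \<le> 1")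
    case False
    then obtain k where "m = Suc (Suc k)" by (metis not_le Suc_le_D One_nat_def Suc_le_eq less_Suc_eq_le old.nat.exhaust not_less_eq_eq zero_le)
    then show ?thesis by (simp add: power2_eq_square algebra_simps)
  qed (auto simp: le_Suc_eq)
  show ?thesis
    unfolding hermite_def pderiv_sum_monom poly_sum poly_monom sum_distrib_left
    by (intro sum.cong refl *)
qed

lemma poly_hermite_minus: "poly (hermite s \<sigma> n) (- x) = (if odd n then - 1 else 1) * poly (hermite s \<sigma> n) x"
proof -
  have "(- x) ^ (n - 2 * i) = (if odd n then - 1 else 1) * x ^ (n - 2 * i)" if "i \<le> n div 2" for i
  proof -
    have "2 * i \<le> n" using that by auto
    then have "odd (n - 2 * i) \<longleftrightarrow> odd n" by simp
    then show ?thesis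
      using power_minus_odd[of "n - 2 * i" x] power_minus_even[of "n - 2 * i" x] by (cases "odd n") simp_all
  qed
  then show ?thesis
    unfolding poly_hermite sum_distrib_left by (intro sum.cong refl) (simp add: mult.left_commute)
qed

text \<open>The equation -\<Delta> p = 2s(n p - x p') for the polynomial p, multiplied by x^2. It is
  a comparison of coefficients after shifting the index by one; the unmatched last term has degree 0
  or 1, where \<open>hermite_step\<close> vanishes.\<close>

lemma hermite_recurrence:
  assumes s: "s > 0"
  shows "- (\<Sum>i\<le>n div 2. hermite_step \<sigma> (n - 2 * i) * hermite_coeff s \<sigma> n i * x ^ (n - 2 * i)) =
    2 * s * x\<^sup>2 * (\<Sum>i\<le>n div 2. real (2 * i) * hermite_coeff s \<sigma> n i * x ^ (n - 2 * i))"
proof -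
  let ?N = "n div 2" and ?c = "hermite_coeff s \<sigma> n"
  have last: "hermite_step \<sigma> (n - 2 * ?N) = 0"
  proof -
    have "n - 2 * ?N = n mod 2" by (simp add: minus_mult_div_eq_mod)
    then show ?thesis by (cases "odd n") (auto simp: hermite_step_def odd_iff_mod_2_eq_one even_iff_mod_2_eq_zero)
  qed
  have "2 * s * x\<^sup>2 * (\<Sum>i\<le>?N. real (2 * i) * ?c i * x ^ (n - 2 * i)) =
      (\<Sum>i\<le>?N. 4 * s * real i * ?c i * (x\<^sup>2 * x ^ (n - 2 * i)))"
    by (simp add: sum_distrib_left mult_ac)
  also have "\<dots> = (\<Sum>i<?N. 4 * s * real (Suc i) * ?c (Suc i) * (x\<^sup>2 * x ^ (n - 2 * Suc i)))"
    by (subst sum.atMost_shift) simp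
  also have "\<dots> = (\<Sum>i<?N. - (hermite_step \<sigma> (n - 2 * i) * ?c i * x ^ (n - 2 * i)))"
  proof (intro sum.cong refl)
    fix i assume "i \<in> {..<?N}"
    then have i: "2 * Suc i \<le> n" by auto
    have "x\<^sup>2 * x ^ (n - 2 * Suc i) = x ^ (2 + (n - 2 * Suc i))" by (simp only: power_add)
    also have "2 + (n - 2 * Suc i) = n - 2 * i" using i by simp
    finally have *: "x\<^sup>2 * x ^ (n - 2 * Suc i) = x ^ (n - 2 * i)" .
    have "4 * s * real (Suc i) * ?c (Suc i) = - (hermite_step \<sigma> (n - 2 * i) * ?c i)"
      using s by (simp add: mult.commute del: of_nat_Suc)
    then show "4 * s * real (Suc i) * ?c (Suc i) * (x\<^sup>2 * x ^ (n - 2 * Suc i)) = - (hermite_step \<sigma> (n - 2 * i) * ?c i * x ^ (n - 2 * i))"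
      unfolding * by simp
  qed
  also have "\<dots> = - (\<Sum>i<Suc ?N. hermite_step \<sigma> (n - 2 * i) * ?c i * x ^ (n - 2 * i))"
    by (simp add: last sum_negf)
  finally show ?thesis by (simp add: lessThan_Suc_atMost)
qed

text \<open>Multiplication by x^2 turns every quotient into the quantities A, B, C. Differentiating
  the Gaussian contributes s x^2 (A + 2B + 2\<sigma>A), and the polynomial equation
  \<open>eqn\<close> replaces the rest by 2s x^2 (nA - B), so the B terms cancel.\<close>

lemma J_reg_hermite:
  assumes s: "s > 0" and x: "x \<noteq> 0"
  shows "J_reg s \<sigma> (gauss_poly s (hermite s \<sigma> n)) x = of_real (dunkl_energy s \<sigma> n) * gauss_poly s (hermite s \<sigma> n) x"
proof -
  define p where "p = hermite s \<sigma> n"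
  define g where "g = exp (- (s * x\<^sup>2) / 2)"
  define A B C od where "A = poly p x" and "B = x * poly (pderiv p) x"
    and "C = x\<^sup>2 * poly (pderiv (pderiv p)) x" and "od = (if odd n then 1 else 0 :: real)"
  have eqn: "- (C + 2 * \<sigma> * (B - od * A)) = 2 * s * x\<^sup>2 * (real n * A - B)"
  proof -
    have "C + 2 * \<sigma> * (B - od * A) =
        (\<Sum>i\<le>n div 2. hermite_step \<sigma> (n - 2 * i) * hermite_coeff s \<sigma> n i * x ^ (n - 2 * i))"
      unfolding A_def B_def C_def p_def poly_hermite poly_pderiv_hermite poly_pderiv2_hermite
        sum_distrib_left sum_subtractf[symmetric] sum.distrib[symmetric]
    proof (intro sum.cong refl)
      fix i assume "i \<in> {..n div 2}"
      then have "2 * i \<le> n" by auto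
      then have "odd (n - 2 * i) \<longleftrightarrow> odd n" by simp
      then show "real (n - 2 * i) * (real (n - 2 * i) - 1) * hermite_coeff s \<sigma> n i * x ^ (n - 2 * i) +
          2 * \<sigma> * (real (n - 2 * i) * hermite_coeff s \<sigma> n i * x ^ (n - 2 * i) -
            od * (hermite_coeff s \<sigma> n i * x ^ (n - 2 * i))) =
          hermite_step \<sigma> (n - 2 * i) * hermite_coeff s \<sigma> n i * x ^ (n - 2 * i)"
        by (simp only: hermite_step_def od_def) (simp only: algebra_simps)
    qed
    moreover have "real n * A - B = (\<Sum>i\<le>n div 2. real (2 * i) * hermite_coeff s \<sigma> n i * x ^ (n - 2 * i))"
      unfolding A_def B_def p_def poly_hermite poly_pderiv_hermite sum_distrib_left sum_subtractf[symmetric]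
    proof (intro sum.cong refl)
      fix i assume "i \<in> {..n div 2}"
      then have "2 * i \<le> n" by auto
      then have *: "real (2 * i) = real n - real (n - 2 * i)" by (simp only: of_nat_diff)
      show "real n * (hermite_coeff s \<sigma> n i * x ^ (n - 2 * i)) - real (n - 2 * i) * hermite_coeff s \<sigma> n i * x ^ (n - 2 * i) =
          real (2 * i) * hermite_coeff s \<sigma> n i * x ^ (n - 2 * i)"
        unfolding * by (simp only: left_diff_distrib mult.assoc)
    qed
    ultimately show ?thesis using hermite_recurrence[OF s, where n = n and \<sigma> = \<sigma> and x = x] by simp
  qed
  have v0: "gauss_poly s p x = of_real (A * g)" by (simp add: gauss_poly_def A_def g_def)
  have v1: "of_real x * vderiv (gauss_poly s p) x = of_real ((B - s * x\<^sup>2 * A) * g)"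
    unfolding vderiv_gauss_poly gauss_poly_def A_def B_def g_def of_real_mult[symmetric]
    by (simp add: algebra_simps power2_eq_square)
  have v2: "of_real (x\<^sup>2) * vderiv (vderiv (gauss_poly s p)) x =
      of_real ((C - s * x\<^sup>2 * A - 2 * s * x\<^sup>2 * B + s\<^sup>2 * x ^ 4 * A) * g)"
    unfolding vderiv_gauss_poly gauss_poly_def A_def B_def C_def g_def of_real_mult[symmetric]
    by (simp add: algebra_simps power2_eq_square power4_eq_xxxx pderiv_diff pderiv_mult pderiv_pCons pderiv_smult)
  have vo: "odd_part (gauss_poly s p) x = of_real (od * A * g)"
    unfolding odd_part_def gauss_poly_def
    by (simp add: p_def poly_hermite_minus od_def A_def g_def)
  have x2: "complex_of_real (x\<^sup>2) \<noteq> 0" using x by simp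
  have "of_real (x\<^sup>2) * J_reg s \<sigma> (gauss_poly s p) x =
      - (of_real (x\<^sup>2) * vderiv (vderiv (gauss_poly s p)) x) + of_real (s\<^sup>2 * x ^ 4) * gauss_poly s p x
      - of_real (2 * \<sigma>) * (of_real x * vderiv (gauss_poly s p) x - odd_part (gauss_poly s p) x)"
    using x unfolding J_reg_def by (simp add: field_simps power2_eq_square power4_eq_xxxx)
  also have "\<dots> = of_real ((- (C + 2 * \<sigma> * (B - od * A)) + s * x\<^sup>2 * (A + 2 * B + 2 * \<sigma> * A)) * g)"
    unfolding v0 v1 v2 vo of_real_mult[symmetric] of_real_minus[symmetric] of_real_add[symmetric] of_real_diff[symmetric]
    by (rule arg_cong[where f = of_real]) (simp add: algebra_simps)
  also have "\<dots> = of_real (x\<^sup>2) * (of_real (dunkl_energy s \<sigma> n) * gauss_poly s p x)"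
    unfolding eqn v0 dunkl_energy_def of_real_mult[symmetric]
    by (rule arg_cong[where f = of_real]) (simp add: algebra_simps)
  finally show ?thesis using x2 unfolding p_def by (simp only: mult_cancel_left) simp
qed

lemma hermite_nonzero: "hermite s \<sigma> n \<noteq> 0"
proof -
  have "coeff (hermite s \<sigma> n) n = (\<Sum>i\<le>n div 2. if n - 2 * i = n then hermite_coeff s \<sigma> n i else 0)"
    by (simp add: hermite_def coeff_sum)
  also have "\<dots> = (\<Sum>i\<le>n div 2. if i = 0 then 1 else 0)"
    by (intro sum.cong refl) auto
  also have "\<dots> = 1" by simp
  finally show ?thesis by auto
qed

lemma schwartz_l2: "\<phi> \<in> schwartz \<Longrightarrow> \<sigma> > -1/2 \<Longrightarrow> \<phi> \<in> l2_space (dunkl_measure \<sigma>)"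
  by (intro rapid_l2 schwartz_rapid)

lemma dunkl_J_l2: "\<phi> \<in> schwartz \<Longrightarrow> \<sigma> > -1/2 \<Longrightarrow> dunkl_J s \<sigma> \<phi> \<in> l2_space (dunkl_measure \<sigma>)"
  by (intro rapid_l2 rapid_dunkl_J)

context
  fixes s \<sigma> :: real
  assumes s: "s > 0" and \<sigma>: "\<sigma> > -1/2"
begin

private abbreviation (input) "M \<equiv> dunkl_measure \<sigma>"
private abbreviation (input) "h n \<equiv> gauss_poly s (hermite s \<sigma> n)"

interpretation L: hilbert_ip "l2_space M" fscale "l2_inner M"
  by (rule l2_hilbert)

private lemma S_l2: "\<phi> \<in> schwartz \<Longrightarrow> \<phi> \<in> l2_space M"
  and J_l2: "\<phi> \<in> schwartz \<Longrightarrow> dunkl_J t \<sigma> \<phi> \<in> l2_space M"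
  using \<sigma> by (simp_all add: schwartz_l2 dunkl_J_l2)

private lemma h_schwartz: "h n \<in> schwartz"
  by (rule gauss_poly_schwartz[OF s])

private lemma inner_J_h:
  assumes "\<phi> \<in> schwartz"
  shows "l2_inner M (dunkl_J s \<sigma> \<phi>) (h n) = of_real (dunkl_energy s \<sigma> n) * l2_inner M \<phi> (h n)"
proof -
  have "l2_inner M (dunkl_J s \<sigma> \<phi>) (h n) = l2_inner M \<phi> (dunkl_J s \<sigma> (h n))"
    by (rule dunkl_J_symmetric[OF assms h_schwartz \<sigma>])
  also have "\<dots> = l2_inner M \<phi> (fscale (of_real (dunkl_energy s \<sigma> n)) (h n))"
  proof (rule l2_inner_cong_AE)
    have "AE x in lborel. dunkl_J s \<sigma> (h n) x = fscale (of_real (dunkl_energy s \<sigma> n)) (h n) x"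
      using AE_lborel_singleton[of 0]
      by eventually_elim (simp add: dunkl_J_eq[OF h_schwartz] J_reg_hermite[OF s])
    then show "AE x in M. dunkl_J s \<sigma> (h n) x = fscale (of_real (dunkl_energy s \<sigma> n)) (h n) x"
      by (simp add: AE_dunkl)
  qed (auto intro: S_l2 J_l2 L.scale_mem assms h_schwartz)
  also have "\<dots> = of_real (dunkl_energy s \<sigma> n) * l2_inner M \<phi> (h n)"
    by (simp add: L.ip_scale_right S_l2 assms h_schwartz)
  finally show ?thesis .
qed

private lemma h_orthogonal:
  assumes "n \<noteq> m"
  shows "l2_inner M (h n) (h m) = 0"
proof -
  have l2: "h n \<in> l2_space M" "h m \<in> l2_space M" by (intro S_l2 h_schwartz)+
  have Jl2: "dunkl_J s \<sigma> (h n) \<in> l2_space M" "dunkl_J s \<sigma> (h m) \<in> l2_space M" by (intro J_l2 h_schwartz)+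
  have 1: "l2_inner M (dunkl_J s \<sigma> (h n)) (h m) = of_real (dunkl_energy s \<sigma> m) * l2_inner M (h n) (h m)"
    by (rule inner_J_h[OF h_schwartz])
  have "l2_inner M (dunkl_J s \<sigma> (h n)) (h m) = l2_inner M (h n) (dunkl_J s \<sigma> (h m))"
    by (rule dunkl_J_symmetric[OF h_schwartz h_schwartz \<sigma>])
  also have "\<dots> = cnj (l2_inner M (dunkl_J s \<sigma> (h m)) (h n))" by (rule L.ip_cnj[OF l2(1) Jl2(2)])
  also have "\<dots> = of_real (dunkl_energy s \<sigma> n) * l2_inner M (h n) (h m)"
    by (simp add: inner_J_h[OF h_schwartz] L.ip_cnj[OF l2])
  finally have "(complex_of_real (dunkl_energy s \<sigma> n) - of_real (dunkl_energy s \<sigma> m)) * l2_inner M (h n) (h m) = 0"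
    unfolding left_diff_distrib using 1 by (simp only: right_minus_eq)
  moreover have "dunkl_energy s \<sigma> n \<noteq> dunkl_energy s \<sigma> m"
    using assms s by (simp add: dunkl_energy_def)
  ultimately show ?thesis by simp
qed

private lemma h_pos: "L.sq (h n) > 0"
proof (rule ccontr)
  assume "\<not> L.sq (h n) > 0"
  then have "L.sq (h n) = 0"
    using L.sq_nonneg[OF S_l2[OF h_schwartz], of n] by linarith
  then have "AE x in lborel. h n x = 0"
    using l2_sq_zero_iff[OF S_l2[OF h_schwartz], of n] by (simp add: AE_dunkl)
  moreover have "AE x in lborel. x \<notin> {x. poly (hermite s \<sigma> n) x = 0}"
    by (intro AE_not_in finite_imp_null_set_lborel poly_roots_finite hermite_nonzero)
  ultimately have "AE x in lborel. h n x = 0 \<and> x \<notin> {x. poly (hermite s \<sigma> n) x = 0}"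
    by (rule eventually_conj)
  \<comment> \<open>A polynomial with finitely many zeros times a positive exponential cannot vanish
    almost everywhere, for otherwise the whole line, and with it the unit interval, would be
    null.\<close>
  then have "AE x in (lborel :: real measure). False"
    by (rule eventually_mono) (simp add: gauss_poly_def)
  then obtain N where N: "UNIV \<subseteq> N" "emeasure lborel N = 0" "N \<in> sets (lborel :: real measure)"
    by (rule AE_E) auto
  then have "emeasure lborel {0..1::real} \<le> emeasure lborel N"
    by (intro emeasure_mono) auto
  then show False using N(2) by simp
qed

definition herm :: "nat \<Rightarrow> real \<Rightarrow> complex" where
  "herm n = fscale (of_real (1 / L.nrm (h n))) (h n)"

lemma herm_schwartz: "herm n \<in> schwartz"
  unfolding herm_def fscale_def by (rule schwartz_cmult[OF h_schwartz])

lemma inner_J_herm: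
  assumes "\<phi> \<in> schwartz"
  shows "l2_inner M (dunkl_J s \<sigma> \<phi>) (herm n) = of_real (dunkl_energy s \<sigma> n) * l2_inner M \<phi> (herm n)"
  by (simp add: herm_def L.ip_scale_right S_l2 J_l2 h_schwartz assms inner_J_h)

private lemma inner_h_herm: "f \<in> l2_space M \<Longrightarrow> l2_inner M f (herm n) = 0 \<Longrightarrow> l2_inner M f (h n) = 0"
  using h_pos[of n] by (simp add: herm_def L.ip_scale_right S_l2 h_schwartz L.nrm_def)

lemma herm_orthonormal: "L.orthonormal herm"
  unfolding L.orthonormal_def
proof (intro conjI allI)
  show "herm i \<in> l2_space M" for i by (intro S_l2 herm_schwartz)
  fix i j
  show "l2_inner M (herm i) (herm j) = (if i = j then 1 else 0)"
  proof (cases "i = j")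
    case True
    have "L.sq (herm j) = 1"
      using h_pos[of j]
      by (simp add: herm_def L.sq_scale S_l2 h_schwartz norm_divide power_divide L.nrm_def)
    then show ?thesis
      using True by (simp add: L.ip_self S_l2 herm_schwartz)
  next
    case False
    then show ?thesis
      by (simp add: herm_def L.ip_scale_left L.ip_scale_right L.scale_mem S_l2 h_schwartz h_orthogonal)
  qed
qed

text \<open>The Hermite polynomials are monic and triangular, so orthogonality to all of them gives
  orthogonality to all Gaussian moments by strong induction on the degree, and the moments are
  total.\<close>

lemma herm_basis: "l2_basis M herm"
proof
  show "L.orthonormal herm" by (rule herm_orthonormal)
  fix f assume f: "f \<in> l2_space M" and zero: "\<And>k. l2_inner M f (herm k) = 0"
  show "AE x in M. f x = 0"
  proof (rule gaussian_moments_total[OF f \<sigma> s])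
    fix n
    define m where "m k = gauss_poly s (monom 1 k)" for k
    have m: "m k \<in> l2_space M" for k
      unfolding m_def by (intro S_l2 gauss_poly_schwartz s)
    have "l2_inner M f (m n) = 0"
    proof (induction n rule: less_induct)
      case (less n)
      have "h n = (\<Sum>i\<le>n div 2. fscale (of_real (hermite_coeff s \<sigma> n i)) (m (n - 2 * i)))"
        by (rule ext) (simp add: m_def gauss_poly_def poly_hermite poly_monom sum_distrib_right mult.assoc)
      then have "l2_inner M f (h n) = (\<Sum>i\<le>n div 2. l2_inner M f (fscale (of_real (hermite_coeff s \<sigma> n i)) (m (n - 2 * i))))"
        by (simp only: L.ip_sum_right[OF L.scale_mem[OF m] f])
      also have "\<dots> = (\<Sum>i\<le>n div 2. if i = 0 then l2_inner M f (m n) else 0)"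
      proof (intro sum.cong refl)
        fix i assume "i \<in> {..n div 2}"
        then show "l2_inner M f (fscale (of_real (hermite_coeff s \<sigma> n i)) (m (n - 2 * i))) =
            (if i = 0 then l2_inner M f (m n) else 0)"
          using less[of "n - 2 * i"] by (auto simp: L.ip_scale_right f m)
      qed
      also have "\<dots> = l2_inner M f (m n)" by simp
      finally show ?case using inner_h_herm[OF f zero] by simp
    qed
    then show "l2_inner M f (\<lambda>x. of_real (x ^ n * exp (- (s * x\<^sup>2) / 2))) = 0"
      by (simp add: m_def gauss_poly_def[abs_def] poly_monom)
  qed
qed

end

subsection \<open>The perturbed form\<close>

lemma l2_conv_AE_subseq:
  assumes F: "\<And>n. F n \<in> l2_space M" and f: "f \<in> l2_space M" and conv: "semi_ip.conv (l2_inner M) F f"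
  shows "\<exists>r. strict_mono (r :: nat \<Rightarrow> nat) \<and> (AE x in M. (\<lambda>n. F (r n) x) \<longlonglongrightarrow> f x)"
proof -
  interpret L: semi_ip "l2_space M" fscale "l2_inner M" by (rule l2_semi_ip)
  have mem: "F n - f \<in> l2_space M" for n by (intro L.diff_mem F f)
  have "(\<lambda>n. LINT x|M. norm ((cmod (F n x - f x))\<^sup>2)) \<longlonglongrightarrow> 0"
    using conv l2_sq_eq[OF mem] by (simp add: L.conv_def)
  moreover have "integrable M (\<lambda>x. (cmod (F n x - f x))\<^sup>2)" for n
    using l2_spaceD(2)[OF mem, of n] by simp
  ultimately obtain r where r: "strict_mono (r :: nat \<Rightarrow> nat)"
    "AE x in M. (\<lambda>n. (cmod (F (r n) x - f x))\<^sup>2) \<longlonglongrightarrow> 0"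
    using tendsto_L1_AE_subseq[of M "\<lambda>n x. (cmod (F n x - f x))\<^sup>2"] by blast
  from r(2) have "AE x in M. (\<lambda>n. F (r n) x) \<longlonglongrightarrow> f x"
  proof eventually_elim
    case (elim x)
    then have "(\<lambda>n. sqrt ((cmod (F (r n) x - f x))\<^sup>2)) \<longlonglongrightarrow> sqrt 0"
      by (rule tendsto_real_sqrt)
    then show ?case by (simp add: tendsto_norm_zero_iff LIM_zero_iff)
  qed
  then show ?thesis using r(1) by blast
qed

lemma abs_power_mult_add: "abs_power_mult a (f + g) = abs_power_mult a f + abs_power_mult a g"
  by (simp add: fun_eq_iff abs_power_mult_def distrib_left)

lemma abs_power_mult_fscale: "abs_power_mult a (fscale c f) = fscale c (abs_power_mult a f)"
  by (simp add: fun_eq_iff abs_power_mult_def)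

lemma abs_power_mult_measurable:
  "f \<in> borel_measurable borel \<Longrightarrow> abs_power_mult a f \<in> borel_measurable borel"
  unfolding abs_power_mult_def[abs_def] by measurable

locale dunkl_perturbed =
  fixes u \<sigma> s \<xi> :: real
  assumes u: "0 < u" "u < 1" and \<sigma>u: "\<sigma> > u - 1/2" and s: "s > 0" and \<xi>: "\<xi> > 0"
begin

lemma \<sigma>: "\<sigma> > -1/2" using u \<sigma>u by simp

abbreviation (input) "M \<equiv> dunkl_measure \<sigma>"
abbreviation (input) "e \<equiv> herm s \<sigma>"
abbreviation (input) "E \<equiv> dunkl_energy s \<sigma>"

sublocale e: l2_basis M e
  by (rule herm_basis[OF s \<sigma>])

lemma S_l2: "\<phi> \<in> schwartz \<Longrightarrow> \<phi> \<in> l2_space M"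
  by (rule schwartz_l2[OF _ \<sigma>])

lemma J_l2: "\<phi> \<in> schwartz \<Longrightarrow> dunkl_J t \<sigma> \<phi> \<in> l2_space M"
  by (rule dunkl_J_l2[OF _ \<sigma>])

lemma e_schwartz: "e k \<in> schwartz"
  by (rule herm_schwartz[OF s \<sigma>])

lemma h_l2: "\<phi> \<in> schwartz \<Longrightarrow> abs_power_mult (- u) \<phi> \<in> l2_space M"
  by (rule l2_abs_power[OF schwartz_rapid], assumption) (use \<sigma>u in linarith)

lemma energy_mono: "i \<le> k \<Longrightarrow> E i \<le> E k"
  using s by (simp add: dunkl_energy_def)

lemma energy_pos: "E k > 0"
  using s \<sigma> by (simp add: dunkl_energy_def)

text \<open>The form domain of the closed extension of J, described through its eigenbasis:
  membership is finiteness of the energy series, and no derivative of a nonsmooth function has to be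
  defined.\<close>

definition V :: "(real \<Rightarrow> complex) set" where
  "V = {f \<in> l2_space M. summable (\<lambda>k. E k * (cmod (l2_inner M f (e k)))\<^sup>2)}"

definition jform :: "(real \<Rightarrow> complex) \<Rightarrow> (real \<Rightarrow> complex) \<Rightarrow> complex" where
  "jform f g = (\<Sum>k. of_real (E k) * l2_inner M f (e k) * cnj (l2_inner M g (e k)))"

definition hform :: "(real \<Rightarrow> complex) \<Rightarrow> (real \<Rightarrow> complex) \<Rightarrow> complex" where
  "hform f g = l2_inner M (abs_power_mult (- u) f) (abs_power_mult (- u) g)"

definition aform :: "(real \<Rightarrow> complex) \<Rightarrow> (real \<Rightarrow> complex) \<Rightarrow> complex" where
  "aform f g = jform f g + of_real \<xi> * hform f g"

lemma V_l2: "f \<in> V \<Longrightarrow> f \<in> l2_space M"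
  and V_summable: "f \<in> V \<Longrightarrow> summable (\<lambda>k. E k * (cmod (l2_inner M f (e k)))\<^sup>2)"
  by (simp_all add: V_def)

lemma V_add:
  assumes f: "f \<in> V" and g: "g \<in> V"
  shows "f + g \<in> V"
proof -
  have "summable (\<lambda>k. E k * (cmod (l2_inner M (f + g) (e k)))\<^sup>2)"
  proof (rule summable_comparison_test'[where N = 0])
    show "summable (\<lambda>k. 2 * (E k * (cmod (l2_inner M f (e k)))\<^sup>2) + 2 * (E k * (cmod (l2_inner M g (e k)))\<^sup>2))"
      by (intro summable_add summable_mult V_summable f g)
    fix k
    have "E k * (cmod (l2_inner M (f + g) (e k)))\<^sup>2 \<le>
        E k * (2 * (cmod (l2_inner M f (e k)))\<^sup>2 + 2 * (cmod (l2_inner M g (e k)))\<^sup>2)"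
      unfolding e.L.ip_add_left[OF V_l2[OF f] V_l2[OF g] e.v_mem]
      by (rule mult_left_mono[OF cmod_add_sq_le less_imp_le[OF energy_pos]])
    then show "norm (E k * (cmod (l2_inner M (f + g) (e k)))\<^sup>2) \<le>
        2 * (E k * (cmod (l2_inner M f (e k)))\<^sup>2) + 2 * (E k * (cmod (l2_inner M g (e k)))\<^sup>2)"
      using energy_pos[of k] by (simp only: real_norm_def abs_mult abs_of_pos abs_power2 distrib_left mult.left_commute[of "E k" 2])
  qed
  then show ?thesis unfolding V_def mem_Collect_eq by (intro conjI e.L.add_mem V_l2 f g)
qed

lemma V_scale:
  assumes f: "f \<in> V"
  shows "fscale c f \<in> V"
proof -
  have eq: "(\<lambda>k. E k * (cmod (l2_inner M (fscale c f) (e k)))\<^sup>2) =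
      (\<lambda>k. (cmod c)\<^sup>2 * (E k * (cmod (l2_inner M f (e k)))\<^sup>2))"
    by (intro ext) (simp add: e.L.ip_scale_left V_l2 f e.v_mem norm_mult power_mult_distrib)
  have "summable (\<lambda>k. E k * (cmod (l2_inner M (fscale c f) (e k)))\<^sup>2)"
    unfolding eq by (intro summable_mult V_summable f)
  then show ?thesis using e.L.scale_mem V_l2[OF f] by (simp add: V_def)
qed

lemma V_zero: "0 \<in> V"
  by (simp add: V_def e.L.zero_mem e.L.ip_zero_left e.v_mem)

lemma jform_sums:
  assumes f: "f \<in> V" and g: "g \<in> V"
  shows "(\<lambda>k. of_real (E k) * l2_inner M f (e k) * cnj (l2_inner M g (e k))) sums jform f g"
proof -
  have "summable (\<lambda>k. of_real (E k) * l2_inner M f (e k) * cnj (l2_inner M g (e k)))"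
  proof (rule summable_comparison_test'[where N = 0])
    show "summable (\<lambda>k. E k * (cmod (l2_inner M f (e k)))\<^sup>2 + E k * (cmod (l2_inner M g (e k)))\<^sup>2)"
      by (intro summable_add V_summable f g)
    fix k
    have *: "0 \<le> p \<Longrightarrow> 0 \<le> q \<Longrightarrow> E k * p * q \<le> E k * p\<^sup>2 + E k * q\<^sup>2" for p q
    proof -
      assume "0 \<le> p" "0 \<le> q"
      then have "p * q \<le> p\<^sup>2 + q\<^sup>2"
        using sum_squares_bound[of p q] mult_nonneg_nonneg[of p q] by linarith
      then have "E k * (p * q) \<le> E k * (p\<^sup>2 + q\<^sup>2)"
        by (rule mult_left_mono[OF _ less_imp_le[OF energy_pos]])
      then show ?thesis by (simp only: distrib_left mult.assoc)
    qed
    show "norm (of_real (E k) * l2_inner M f (e k) * cnj (l2_inner M g (e k))) \<le>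
        E k * (cmod (l2_inner M f (e k)))\<^sup>2 + E k * (cmod (l2_inner M g (e k)))\<^sup>2"
      using *[OF norm_ge_zero norm_ge_zero] energy_pos[of k] by (simp only: norm_mult complex_mod_cnj norm_of_real abs_of_pos)
  qed
  then show ?thesis unfolding jform_def by (rule summable_sums)
qed

lemma jform_semi_ip: "semi_ip V fscale jform"
proof
  show "jform (f + g) h = jform f h + jform g h" if "f \<in> V" "g \<in> V" "h \<in> V" for f g h
  proof (rule sums_unique2[OF jform_sums[OF V_add[OF that(1,2)] that(3)]])
    show "(\<lambda>k. of_real (E k) * l2_inner M (f + g) (e k) * cnj (l2_inner M h (e k))) sums (jform f h + jform g h)"
      using sums_add[OF jform_sums[OF that(1,3)] jform_sums[OF that(2,3)]]
      unfolding e.L.ip_add_left[OF that(1,2)[THEN V_l2] e.v_mem] distrib_left distrib_right .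
  qed
  show "jform (fscale c f) g = c * jform f g" if "f \<in> V" "g \<in> V" for c f g
  proof (rule sums_unique2[OF jform_sums[OF V_scale[OF that(1)] that(2)]])
    show "(\<lambda>k. of_real (E k) * l2_inner M (fscale c f) (e k) * cnj (l2_inner M g (e k))) sums (c * jform f g)"
      using sums_mult[OF jform_sums[OF that], of c]
      by (simp add: e.L.ip_scale_left V_l2 that e.v_mem mult_ac)
  qed
  show "jform f g = cnj (jform g f)" if "f \<in> V" "g \<in> V" for f g
  proof (rule sums_unique2[OF jform_sums[OF that]])
    show "(\<lambda>k. of_real (E k) * l2_inner M f (e k) * cnj (l2_inner M g (e k))) sums cnj (jform g f)"
      using sums_cnj[THEN iffD2, OF jform_sums[OF that(2,1)]] by (simp add: mult_ac)
  qed
  show "0 \<le> Re (jform f f)" if "f \<in> V" for f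
  proof (rule sums_le[OF _ sums_zero sums_Re[OF jform_sums[OF that that]]])
    fix k
    have "of_real (E k) * l2_inner M f (e k) * cnj (l2_inner M f (e k)) = of_real (E k * (cmod (l2_inner M f (e k)))\<^sup>2)"
      by (simp add: complex_norm_square mult.assoc del: of_real_power)
    then show "0 \<le> Re (of_real (E k) * l2_inner M f (e k) * cnj (l2_inner M f (e k)))"
      using energy_pos[of k] by (simp only: Re_complex_of_real) simp
  qed
qed (assumption | rule V_zero V_add V_scale e.L.scale_scale e.L.scale_minus_one)+

sublocale j: semi_ip V fscale jform
  by (rule jform_semi_ip)

lemma jsq_sums:
  assumes "f \<in> V"
  shows "(\<lambda>k. E k * (cmod (l2_inner M f (e k)))\<^sup>2) sums j.sq f"
proof -
  have eq: "of_real (E k) * l2_inner M f (e k) * cnj (l2_inner M f (e k)) = of_real (E k * (cmod (l2_inner M f (e k)))\<^sup>2)" for k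
    by (simp add: complex_norm_square mult.assoc del: of_real_power)
  show ?thesis
    using sums_Re[OF jform_sums[OF assms assms]] unfolding j.sq_def eq Re_complex_of_real .
qed

lemma jsq_ge:
  assumes "f \<in> V"
  shows "E 0 * l2_sq M f \<le> j.sq f"
proof (rule sums_le[OF _ sums_mult[OF e.Parseval_sq[OF V_l2[OF assms]]] jsq_sums[OF assms]])
  show "E 0 * (cmod (l2_inner M f (e k)))\<^sup>2 \<le> E k * (cmod (l2_inner M f (e k)))\<^sup>2" for k
    by (intro mult_right_mono energy_mono) auto
qed

lemma schwartz_J_sums:
  assumes t: "t > 0" and \<phi>: "\<phi> \<in> schwartz" and g: "g \<in> l2_space M"
  shows "(\<lambda>k. of_real (dunkl_energy t \<sigma> k) * l2_inner M \<phi> (herm t \<sigma> k) * cnj (l2_inner M g (herm t \<sigma> k)))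
    sums l2_inner M (dunkl_J t \<sigma> \<phi>) g"
  using l2_basis.Parseval[OF herm_basis[OF t \<sigma>] J_l2[OF \<phi>, of t] g]
  unfolding inner_J_herm[OF t \<sigma> \<phi>] .

lemma schwartz_J_sums_sq:
  assumes t: "t > 0" and \<phi>: "\<phi> \<in> schwartz"
  shows "(\<lambda>k. dunkl_energy t \<sigma> k * (cmod (l2_inner M \<phi> (herm t \<sigma> k)))\<^sup>2)
    sums Re (l2_inner M (dunkl_J t \<sigma> \<phi>) \<phi>)"
proof -
  have eq: "of_real (dunkl_energy t \<sigma> k) * l2_inner M \<phi> (herm t \<sigma> k) * cnj (l2_inner M \<phi> (herm t \<sigma> k)) =
      of_real (dunkl_energy t \<sigma> k * (cmod (l2_inner M \<phi> (herm t \<sigma> k)))\<^sup>2)" for k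
    by (simp add: complex_norm_square mult.assoc del: of_real_power)
  show ?thesis
    using sums_Re[OF schwartz_J_sums[OF t \<phi> S_l2[OF \<phi>]]] unfolding eq Re_complex_of_real .
qed

lemma schwartz_V:
  assumes "\<phi> \<in> schwartz" shows "\<phi> \<in> V"
  unfolding V_def mem_Collect_eq
  by (intro conjI S_l2[OF assms] sums_summable[OF schwartz_J_sums_sq[OF s assms]])

lemma jform_schwartz:
  assumes "\<phi> \<in> schwartz" "\<psi> \<in> schwartz"
  shows "jform \<phi> \<psi> = l2_inner M (dunkl_J s \<sigma> \<phi>) \<psi>"
  by (rule sums_unique2[OF jform_sums[OF assms[THEN schwartz_V]]
        schwartz_J_sums[OF s assms(1) S_l2[OF assms(2)]]])

lemma jsq_schwartz: "\<phi> \<in> schwartz \<Longrightarrow> j.sq \<phi> = Re (l2_inner M (dunkl_J s \<sigma> \<phi>) \<phi>)"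
  by (simp add: j.sq_def jform_schwartz)

lemma proj_schwartz: "e.L.proj e n f \<in> schwartz"
  unfolding e.L.proj_def by (intro schwartz_sum e_schwartz)

lemma jsq_minus_proj:
  assumes f: "f \<in> V"
  shows "j.sq (f - e.L.proj e n f) = j.sq f - (\<Sum>k<n. E k * (cmod (l2_inner M f (e k)))\<^sup>2)"
proof -
  have d: "f - e.L.proj e n f \<in> V" by (intro j.diff_mem f schwartz_V proj_schwartz)
  have c: "l2_inner M (f - e.L.proj e n f) (e k) = (if k < n then 0 else l2_inner M f (e k))" for k
    by (simp add: e.L.ip_diff_left V_l2 f S_l2 proj_schwartz e.v_mem e.L.ip_proj_basis e.basis)
  have "(\<lambda>k. E k * (cmod (l2_inner M f (e k)))\<^sup>2 - (if k \<in> {..<n} then E k * (cmod (l2_inner M f (e k)))\<^sup>2 else 0))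
      sums (j.sq f - (\<Sum>k<n. E k * (cmod (l2_inner M f (e k)))\<^sup>2))"
    by (intro sums_diff jsq_sums f sums_If_finite_set) simp
  moreover have "E k * (cmod (l2_inner M f (e k)))\<^sup>2 - (if k \<in> {..<n} then E k * (cmod (l2_inner M f (e k)))\<^sup>2 else 0) =
      E k * (cmod (l2_inner M (f - e.L.proj e n f) (e k)))\<^sup>2" for k
    by (simp add: c)
  ultimately show ?thesis
    using sums_unique2[OF jsq_sums[OF d]] by simp
qed

lemma jsq_proj_le:
  assumes f: "f \<in> V"
  shows "j.sq (e.L.proj e n f) \<le> j.sq f"
proof (rule sums_le[OF _ jsq_sums[OF schwartz_V[OF proj_schwartz]] jsq_sums[OF f]])
  show "E k * (cmod (l2_inner M (e.L.proj e n f) (e k)))\<^sup>2 \<le> E k * (cmod (l2_inner M f (e k)))\<^sup>2" for k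
    using energy_pos[of k] by (simp add: e.L.ip_proj_basis e.basis)
qed

text \<open>The partial sums of f in the basis \<open>e\<close> are Schwartz, so they satisfy the
  bound, and both terms on the right only grow towards their values at f. Fatou along an almost
  everywhere convergent subsequence gives the claim for f, including square integrability of
  |x|^(-u) f.\<close>

lemma V_inverse_power_bound:
  assumes \<alpha>\<beta>: "\<alpha> \<ge> 0" "\<beta> \<ge> 0"
    and le: "\<And>\<phi>. \<phi> \<in> schwartz \<Longrightarrow> l2_sq M (abs_power_mult (- u) \<phi>) \<le> \<alpha> * j.sq \<phi> + \<beta> * l2_sq M \<phi>"
    and f: "f \<in> V"
  shows "abs_power_mult (- u) f \<in> l2_space M" "l2_sq M (abs_power_mult (- u) f) \<le> \<alpha> * j.sq f + \<beta> * l2_sq M f"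
proof -
  let ?P = "\<lambda>n. e.L.proj e n f"
  have P_l2: "?P n \<in> l2_space M" for n by (rule S_l2[OF proj_schwartz])
  have "\<exists>r. strict_mono (r :: nat \<Rightarrow> nat) \<and> (AE x in M. (\<lambda>n. ?P (r n) x) \<longlonglongrightarrow> f x)"
    by (rule l2_conv_AE_subseq[OF P_l2 V_l2[OF f] e.proj_conv[OF V_l2[OF f]]])
  then obtain r :: "nat \<Rightarrow> nat" where "strict_mono r \<and> (AE x in M. (\<lambda>n. ?P (r n) x) \<longlonglongrightarrow> f x)"
    by (rule exE)
  note r = conjunct2[OF this]
  have 1: "abs_power_mult (- u) (?P (r n)) \<in> l2_space M" for n
    by (rule h_l2[OF proj_schwartz])
  have 2: "abs_power_mult (- u) f \<in> borel_measurable M"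
    using abs_power_mult_measurable l2_spaceD(1)[OF V_l2[OF f]] by simp
  have 3: "AE x in M. (\<lambda>n. abs_power_mult (- u) (?P (r n)) x) \<longlonglongrightarrow> abs_power_mult (- u) f x"
    using r unfolding abs_power_mult_def by eventually_elim (intro tendsto_intros)
  have 4: "l2_sq M (abs_power_mult (- u) (?P (r n))) \<le> \<alpha> * j.sq f + \<beta> * l2_sq M f" if "n \<ge> 0" for n
  proof -
    have "l2_sq M (?P (r n)) \<le> l2_sq M f"
      using e.L.Bessel[OF e.basis V_l2[OF f]] by (simp add: e.L.sq_proj e.basis)
    then have "\<alpha> * j.sq (?P (r n)) + \<beta> * l2_sq M (?P (r n)) \<le> \<alpha> * j.sq f + \<beta> * l2_sq M f"
      by (intro add_mono mult_left_mono jsq_proj_le f \<alpha>\<beta>)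
    then show ?thesis using le[OF proj_schwartz, of "r n" f] by linarith
  qed
  show "abs_power_mult (- u) f \<in> l2_space M" by (rule l2_Fatou(1)[OF 1 2 3 4])
  show "l2_sq M (abs_power_mult (- u) f) \<le> \<alpha> * j.sq f + \<beta> * l2_sq M f" by (rule l2_Fatou(2)[OF 1 2 3 4])
qed

text \<open>The form bound with \<epsilon> = 1; its zeroth-order term is absorbed into j because
  \<open>E 0 > 0\<close> bounds j from below by a multiple of the squared norm. It makes the norms
  of a and j equivalent on V.\<close>

lemma h_relatively_bounded:
  "\<exists>A>0. \<forall>f\<in>V. abs_power_mult (- u) f \<in> l2_space M \<and> l2_sq M (abs_power_mult (- u) f) \<le> A * j.sq f"
proof -
  obtain C where C: "C > 0" "\<And>\<phi>. \<phi> \<in> schwartz \<Longrightarrow> l2_sq M (abs_power_mult (- u) \<phi>) \<le>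
      1 * s powr (u - 1) * Re (l2_inner M (dunkl_J s \<sigma> \<phi>) \<phi>) + C * s powr u * l2_sq M \<phi>"
    using inverse_power_form_bound[OF u \<sigma>u zero_less_one] s by blast
  define \<alpha> \<beta> where "\<alpha> = s powr (u - 1)" and "\<beta> = C * s powr u"
  have pos: "\<alpha> > 0" "\<beta> > 0" using s C by (simp_all add: \<alpha>_def \<beta>_def)
  have le: "l2_sq M (abs_power_mult (- u) \<phi>) \<le> \<alpha> * j.sq \<phi> + \<beta> * l2_sq M \<phi>" if "\<phi> \<in> schwartz" for \<phi>
    using C(2)[OF that] by (simp add: \<alpha>_def \<beta>_def jsq_schwartz that)
  note B = V_inverse_power_bound[OF less_imp_le[OF pos(1)] less_imp_le[OF pos(2)] le]
  show ?thesis
  proof (intro exI[of _ "\<alpha> + \<beta> / E 0"] conjI ballI)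
    show "\<alpha> + \<beta> / E 0 > 0" using pos energy_pos[of 0] by (simp add: add_pos_pos)
    fix f assume f: "f \<in> V"
    show "abs_power_mult (- u) f \<in> l2_space M" by (rule B(1)[OF _ f])
    have "l2_sq M f \<le> j.sq f / E 0"
      using jsq_ge[OF f] energy_pos[of 0] by (simp add: field_simps)
    then have "\<beta> * l2_sq M f \<le> \<beta> * (j.sq f / E 0)" using pos by (intro mult_left_mono) auto
    then show "l2_sq M (abs_power_mult (- u) f) \<le> (\<alpha> + \<beta> / E 0) * j.sq f"
      using B(2)[OF _ f] by (simp add: distrib_right)
  qed
qed

lemma h_V_l2: "f \<in> V \<Longrightarrow> abs_power_mult (- u) f \<in> l2_space M"
  using h_relatively_bounded by blast

lemma hform_semi_ip: "semi_ip V fscale hform"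
proof
  show "hform (f + g) h = hform f h + hform g h" if "f \<in> V" "g \<in> V" "h \<in> V" for f g h
    by (simp add: hform_def abs_power_mult_add e.L.ip_add_left h_V_l2 that)
  show "hform (fscale c f) g = c * hform f g" if "f \<in> V" "g \<in> V" for c f g
    by (simp add: hform_def abs_power_mult_fscale e.L.ip_scale_left h_V_l2 that)
  show "hform f g = cnj (hform g f)" if "f \<in> V" "g \<in> V" for f g
    unfolding hform_def by (rule e.L.ip_cnj[OF h_V_l2[OF that(1)] h_V_l2[OF that(2)]])
  show "0 \<le> Re (hform f f)" if "f \<in> V" for f
    unfolding hform_def by (rule e.L.ip_ge_0[OF h_V_l2[OF that]])
qed (assumption | rule V_zero V_add V_scale e.L.scale_scale e.L.scale_minus_one)+

sublocale h: semi_ip V fscale hform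
  by (rule hform_semi_ip)

lemma hsq_eq: "f \<in> V \<Longrightarrow> h.sq f = l2_sq M (abs_power_mult (- u) f)"
  by (simp add: h.sq_def hform_def e.L.sq_def)

lemma aform_semi_ip: "semi_ip V fscale aform"
proof
  show "aform f g = cnj (aform g f)" if "f \<in> V" "g \<in> V" for f g
    using j.ip_cnj[OF that] h.ip_cnj[OF that] by (simp add: aform_def)
  show "0 \<le> Re (aform f f)" if "f \<in> V" for f
    using j.ip_ge_0[OF that] h.ip_ge_0[OF that] \<xi> by (simp add: aform_def)
  show "aform (f + g) h = aform f h + aform g h" if "f \<in> V" "g \<in> V" "h \<in> V" for f g h
    unfolding aform_def j.ip_add_left[OF that] h.ip_add_left[OF that] by (simp only: distrib_left add_ac)
  show "aform (fscale c f) g = c * aform f g" if "f \<in> V" "g \<in> V" for c f g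
    unfolding aform_def j.ip_scale_left[OF that] h.ip_scale_left[OF that] by (simp only: distrib_left mult_ac)
qed (assumption | rule V_zero V_add V_scale e.L.scale_scale e.L.scale_minus_one)+

lemma b_semi_ip: "semi_ip V fscale (l2_inner M)"
proof
  show "l2_inner M f g = cnj (l2_inner M g f)" if "f \<in> V" "g \<in> V" for f g
    by (rule e.L.ip_cnj[OF V_l2[OF that(1)] V_l2[OF that(2)]])
  show "l2_inner M (f + g) h = l2_inner M f h + l2_inner M g h" if "f \<in> V" "g \<in> V" "h \<in> V" for f g h
    by (intro e.L.ip_add_left V_l2 that)
  show "l2_inner M (fscale c f) g = c * l2_inner M f g" if "f \<in> V" "g \<in> V" for c f g
    by (intro e.L.ip_scale_left V_l2 that)
  show "0 \<le> Re (l2_inner M f f)" if "f \<in> V" for f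
    by (intro e.L.ip_ge_0 V_l2 that)
qed (assumption | rule V_zero V_add V_scale e.L.scale_scale e.L.scale_minus_one)+

lemma asq_eq: "f \<in> V \<Longrightarrow> semi_ip.sq aform f = j.sq f + \<xi> * h.sq f"
  by (simp add: semi_ip.sq_def[OF aform_semi_ip] aform_def j.sq_def h.sq_def)

lemma jsq_le_asq: "f \<in> V \<Longrightarrow> j.sq f \<le> semi_ip.sq aform f"
  using \<xi> h.sq_nonneg[of f] by (simp add: asq_eq)

lemma asq_le_jsq: "\<exists>A>0. \<forall>f\<in>V. semi_ip.sq aform f \<le> A * j.sq f"
proof -
  obtain A where A: "A > 0" "\<And>f. f \<in> V \<Longrightarrow> l2_sq M (abs_power_mult (- u) f) \<le> A * j.sq f"
    using h_relatively_bounded by blast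
  have "semi_ip.sq aform f \<le> (1 + \<xi> * A) * j.sq f" if f: "f \<in> V" for f
    using mult_left_mono[OF A(2)[OF f], of \<xi>] \<xi> by (simp add: asq_eq hsq_eq f algebra_simps)
  then show ?thesis using A(1) \<xi> by (intro exI[of _ "1 + \<xi> * A"]) (simp add: add_pos_pos)
qed

text \<open>An a-Cauchy sequence is Cauchy in the ambient space and has a limit f there. That f lies
  in V and is an a-limit is checked on finite energy sums, where the limit may be taken coefficient
  by coefficient, followed by the equivalence of the norms of a and j.\<close>

lemma aform_complete:
  assumes F: "\<And>n. F n \<in> V"
    and Cauchy: "\<And>\<epsilon>. \<epsilon> > 0 \<Longrightarrow> \<exists>N. \<forall>m\<ge>N. \<forall>n\<ge>N. semi_ip.sq aform (F m - F n) < \<epsilon>"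
  shows "\<exists>f\<in>V. semi_ip.conv aform F f"
proof -
  have l2_le: "l2_sq M f \<le> semi_ip.sq aform f / E 0" if "f \<in> V" for f
  proof -
    have "E 0 * l2_sq M f \<le> semi_ip.sq aform f"
      using jsq_ge[OF that] jsq_le_asq[OF that] by linarith
    then show ?thesis using energy_pos[of 0] by (simp add: field_simps)
  qed
  have "\<exists>f\<in>l2_space M. e.L.conv F f"
  proof (rule l2_complete)
    fix \<epsilon> :: real assume "\<epsilon> > 0"
    then have "\<epsilon> * E 0 > 0" using energy_pos by simp
    from Cauchy[OF this] obtain N where N: "\<And>m n. m \<ge> N \<Longrightarrow> n \<ge> N \<Longrightarrow> semi_ip.sq aform (F m - F n) < \<epsilon> * E 0"
      by blast
    have "l2_sq M (F m - F n) < \<epsilon>" if "m \<ge> N" "n \<ge> N" for m n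
    proof -
      have "semi_ip.sq aform (F m - F n) / E 0 < \<epsilon>"
        using N[OF that] energy_pos[of 0] by (simp add: divide_less_eq)
      then show ?thesis using l2_le[OF j.diff_mem[OF F F], of m n] by linarith
    qed
    then show "\<exists>N. \<forall>m\<ge>N. \<forall>n\<ge>N. l2_sq M (F m - F n) < \<epsilon>" by blast
  qed (intro V_l2 F)
  then obtain f where f: "f \<in> l2_space M" "e.L.conv F f" by blast
  have close: "F m - f \<in> V \<and> j.sq (F m - f) \<le> \<epsilon>"
    if N: "\<And>n. n \<ge> N \<Longrightarrow> semi_ip.sq aform (F m - F n) \<le> \<epsilon>" for N m \<epsilon>
  proof -
    have d: "F m - f \<in> l2_space M" by (intro e.L.diff_mem V_l2 F f)
    \<comment> \<open>The bound is uniform in the number K of coefficients, so the full energy of F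
      m - f is at most \<epsilon> and F m - f lies in V.\<close>
    have part: "(\<Sum>k<K. E k * (cmod (l2_inner M (F m - f) (e k)))\<^sup>2) \<le> \<epsilon>" for K
    proof (rule LIMSEQ_le_const2)
      have "(\<lambda>n. l2_inner M (F m - F n) (e k)) \<longlonglongrightarrow> l2_inner M (F m - f) (e k)" for k
        using tendsto_diff[OF tendsto_const e.L.conv_ip[OF f(2) V_l2[OF F] f(1) e.v_mem], of "l2_inner M (F m) (e k)" k]
        by (simp add: e.L.ip_diff_left V_l2 F f e.v_mem)
      then show "(\<lambda>n. \<Sum>k<K. E k * (cmod (l2_inner M (F m - F n) (e k)))\<^sup>2) \<longlonglongrightarrow>
          (\<Sum>k<K. E k * (cmod (l2_inner M (F m - f) (e k)))\<^sup>2)"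
        by (intro tendsto_sum tendsto_mult tendsto_const tendsto_power tendsto_norm)
      have "(\<Sum>k<K. E k * (cmod (l2_inner M (F m - F n) (e k)))\<^sup>2) \<le> \<epsilon>" if "n \<ge> N" for n
      proof -
        have V: "F m - F n \<in> V" by (intro j.diff_mem F)
        have "(\<Sum>k<K. E k * (cmod (l2_inner M (F m - F n) (e k)))\<^sup>2) \<le> j.sq (F m - F n)"
          using sum_le_suminf[OF V_summable[OF V], of "{..<K}"] energy_pos
          by (simp add: sums_unique[OF jsq_sums[OF V]] less_imp_le)
        then show ?thesis using jsq_le_asq[OF V] N[OF that] by linarith
      qed
      then show "\<exists>N. \<forall>n\<ge>N. (\<Sum>k<K. E k * (cmod (l2_inner M (F m - F n) (e k)))\<^sup>2) \<le> \<epsilon>" by blast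
    qed
    have "summable (\<lambda>k. E k * (cmod (l2_inner M (F m - f) (e k)))\<^sup>2)"
      by (rule summableI_nonneg_bounded[OF _ part]) (simp add: energy_pos less_imp_le)
    then have V: "F m - f \<in> V" using d by (simp add: V_def)
    have "j.sq (F m - f) \<le> \<epsilon>"
      using LIMSEQ_le_const2[OF jsq_sums[OF V, unfolded sums_def]] part by blast
    then show ?thesis using V by simp
  qed
  obtain N where N: "\<And>m n. m \<ge> N \<Longrightarrow> n \<ge> N \<Longrightarrow> semi_ip.sq aform (F m - F n) < 1"
    using Cauchy[of 1] by auto
  have "F N - f \<in> V" using close[of N N 1] N[of N] by (simp add: less_imp_le)
  from j.diff_mem[OF F[of N] this] have fV: "f \<in> V" by simp
  obtain A where A: "A > 0" "\<And>f. f \<in> V \<Longrightarrow> semi_ip.sq aform f \<le> A * j.sq f"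
    using asq_le_jsq by blast
  have "semi_ip.conv aform F f"
    unfolding semi_ip.conv_def[OF aform_semi_ip]
  proof (rule LIMSEQ_I)
    fix \<epsilon> :: real assume \<epsilon>: "\<epsilon> > 0"
    then have "\<epsilon> / (2 * A) > 0" using A by simp
    from Cauchy[OF this] obtain N where N: "\<And>m n. m \<ge> N \<Longrightarrow> n \<ge> N \<Longrightarrow> semi_ip.sq aform (F m - F n) < \<epsilon> / (2 * A)"
      by blast
    have "norm (semi_ip.sq aform (F m - f) - 0) < \<epsilon>" if "m \<ge> N" for m
    proof -
      have c: "F m - f \<in> V" "j.sq (F m - f) \<le> \<epsilon> / (2 * A)"
        using close[of N m "\<epsilon> / (2 * A)"] N[OF that] by (auto simp: less_imp_le)
      have "semi_ip.sq aform (F m - f) \<le> A * j.sq (F m - f)" by (rule A(2)[OF c(1)])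
      also have "\<dots> \<le> A * (\<epsilon> / (2 * A))" using A(1) c(2) by (intro mult_left_mono) auto
      also have "\<dots> < \<epsilon>" using A(1) \<epsilon> by (simp add: field_simps)
      finally show ?thesis using semi_ip.sq_nonneg[OF aform_semi_ip c(1)] by simp
    qed
    then show "\<exists>N. \<forall>m\<ge>N. norm (semi_ip.sq aform (F m - f) - 0) < \<epsilon>" by blast
  qed
  then show ?thesis using fV by blast
qed

sublocale a: hilbert_ip V fscale aform
  by (intro hilbert_ip.intro aform_semi_ip hilbert_ip_axioms.intro aform_complete) auto

sublocale b: semi_ip V fscale "l2_inner M"
  by (rule b_semi_ip)

lemma e_orthonormal_V: "b.orthonormal e"
  using e.basis unfolding b.orthonormal_def e.L.orthonormal_def by (simp add: schwartz_V e_schwartz)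

lemma energy_unbounded: "\<epsilon> > 0 \<Longrightarrow> \<exists>N. \<forall>k\<ge>N. 1 \<le> \<epsilon> * E k"
proof -
  assume \<epsilon>: "\<epsilon> > 0"
  obtain N :: nat where N: "1 / (\<epsilon> * s) < real N" using reals_Archimedean2 by blast
  have "1 \<le> \<epsilon> * E k" if "k \<ge> N" for k
  proof -
    have "1 / (\<epsilon> * s) \<le> 2 * real k + 1 + 2 * \<sigma>" using N that \<sigma> by simp
    then have "(\<epsilon> * s) * (1 / (\<epsilon> * s)) \<le> (\<epsilon> * s) * (2 * real k + 1 + 2 * \<sigma>)"
      using \<epsilon> s by (intro mult_left_mono) auto
    then show ?thesis using \<epsilon> s by (simp add: dunkl_energy_def mult_ac)
  qed
  then show ?thesis by blast
qed

text \<open>Compactness is the growth of the unperturbed energies: once \<epsilon> E_k \<ge> 1, the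
  k-th squared coefficient is covered by \<epsilon> times its energy, and j \<le> a because the
  perturbation is nonnegative.\<close>

sublocale compact_pair V fscale aform "l2_inner M" e "1 / E 0"
proof
  show "b.orthonormal e" by (rule e_orthonormal_V)
  show "l2_sq M f \<le> 1 / E 0 * a.sq f" if f: "f \<in> V" for f
    using jsq_ge[OF f] jsq_le_asq[OF f] energy_pos[of 0] by (simp add: field_simps)
  show "\<exists>N. \<forall>f\<in>V. l2_sq M f \<le> (\<Sum>i<N. (cmod (l2_inner M f (e i)))\<^sup>2) + \<epsilon> * a.sq f" if \<epsilon>: "\<epsilon> > 0" for \<epsilon>
  proof -
    obtain N where N: "\<And>k. k \<ge> N \<Longrightarrow> 1 \<le> \<epsilon> * E k" using energy_unbounded[OF \<epsilon>] by blast
    have "l2_sq M f \<le> (\<Sum>i<N. (cmod (l2_inner M f (e i)))\<^sup>2) + \<epsilon> * a.sq f" if f: "f \<in> V" for f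
    proof -
      have "l2_sq M f \<le> (\<Sum>i<N. (cmod (l2_inner M f (e i)))\<^sup>2) + \<epsilon> * j.sq f"
      proof (rule sums_le[OF _ e.Parseval_sq[OF V_l2[OF f]]])
        show "(\<lambda>i. (if i \<in> {..<N} then (cmod (l2_inner M f (e i)))\<^sup>2 else 0) + \<epsilon> * (E i * (cmod (l2_inner M f (e i)))\<^sup>2))
            sums ((\<Sum>i<N. (cmod (l2_inner M f (e i)))\<^sup>2) + \<epsilon> * j.sq f)"
          by (intro sums_add sums_mult jsq_sums f sums_If_finite_set) simp
        fix i
        show "(cmod (l2_inner M f (e i)))\<^sup>2 \<le>
            (if i \<in> {..<N} then (cmod (l2_inner M f (e i)))\<^sup>2 else 0) + \<epsilon> * (E i * (cmod (l2_inner M f (e i)))\<^sup>2)"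
        proof (cases "i < N")
          case True
          then show ?thesis using \<epsilon> energy_pos[of i] by simp
        next
          case False
          then have "1 * (cmod (l2_inner M f (e i)))\<^sup>2 \<le> (\<epsilon> * E i) * (cmod (l2_inner M f (e i)))\<^sup>2"
            by (intro mult_right_mono N) auto
          then show ?thesis using False by (simp add: mult.assoc)
        qed
      qed
      also have "\<dots> \<le> (\<Sum>i<N. (cmod (l2_inner M f (e i)))\<^sup>2) + \<epsilon> * a.sq f"
        using \<epsilon> jsq_le_asq[OF f] by simp
      finally show ?thesis .
    qed
    then show ?thesis by blast
  qed
  show "a.sq f = 0" if f: "f \<in> V" and z: "l2_sq M f = 0" for f
  proof -
    have "l2_inner M f (e k) = 0" for k
      using e.L.Cauchy_Schwarz_sq[OF V_l2[OF f] e.v_mem, of k] z by simp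
    then have "j.sq f = 0"
      using sums_unique2[OF jsq_sums[OF f]] by simp
    moreover obtain A where "a.sq f \<le> A * j.sq f" using asq_le_jsq f by blast
    ultimately show ?thesis using a.sq_nonneg[OF f] by simp
  qed
qed

text \<open>The j-square of the remainder is the tail of a convergent series, and a is bounded by a
  multiple of j. As these partial sums are Schwartz, Schwartz functions are dense in V for the
  energy norm.\<close>

lemma schwartz_dense:
  assumes f: "f \<in> V"
  shows "a.conv (\<lambda>n. e.L.proj e n f) f"
  unfolding a.conv_def
proof -
  obtain A where A: "A > 0" "\<And>f. f \<in> V \<Longrightarrow> a.sq f \<le> A * j.sq f"
    using asq_le_jsq by blast
  have "(\<lambda>n. j.sq f - (\<Sum>k<n. E k * (cmod (l2_inner M f (e k)))\<^sup>2)) \<longlonglongrightarrow> j.sq f - j.sq f"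
    using jsq_sums[OF f] unfolding sums_def by (intro tendsto_diff tendsto_const)
  then have "(\<lambda>n. A * j.sq (f - e.L.proj e n f)) \<longlonglongrightarrow> 0"
    using tendsto_mult_right_zero by (simp add: jsq_minus_proj f)
  then show "(\<lambda>n. a.sq (e.L.proj e n f - f)) \<longlonglongrightarrow> 0"
  proof (rule Lim_null_comparison[OF always_eventually, rotated], intro allI)
    fix n
    have m: "e.L.proj e n f \<in> V" by (intro schwartz_V proj_schwartz)
    have "a.sq (e.L.proj e n f - f) = a.sq (f - e.L.proj e n f)"
      by (rule a.sq_diff_commute[OF m f])
    also have "\<dots> \<le> A * j.sq (f - e.L.proj e n f)"
      by (intro A a.diff_mem f m)
    finally show "norm (a.sq (e.L.proj e n f - f)) \<le> A * j.sq (f - e.L.proj e n f)"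
      by (simp add: a.sq_nonneg a.diff_mem m f)
  qed
qed

end

subsection \<open>Bounds for the eigenvalues\<close>

lemma dunkl_J_frequency: "dunkl_J s \<sigma> \<phi> x = dunkl_J t \<sigma> \<phi> x + of_real ((s\<^sup>2 - t\<^sup>2) * x\<^sup>2) * \<phi> x"
proof -
  have "\<phi> x = even_part \<phi> x + odd_part \<phi> x"
    by (simp add: even_part_def odd_part_def field_simps)
  then show ?thesis
    by (simp add: dunkl_J_def dunkl_J_even_def dunkl_J_odd_def algebra_simps)
qed

context dunkl_perturbed
begin

text \<open>Oscillators of frequencies s and t differ by the multiplication operator (s^2 - t^2)
  x^2, so a lower bound c0 for this function plus the perturbation integrates to a comparison of
  forms.\<close>

lemma schwartz_form_lower:
  assumes c0: "\<And>x. x \<noteq> 0 \<Longrightarrow> c0 \<le> \<xi> * (\<bar>x\<bar> powr (- u))\<^sup>2 + (s\<^sup>2 - t\<^sup>2) * x\<^sup>2"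
    and \<phi>: "\<phi> \<in> schwartz"
  shows "Re (l2_inner M (dunkl_J t \<sigma> \<phi>) \<phi>) + c0 * l2_sq M \<phi> \<le> a.sq \<phi>"
proof -
  note S = S_l2[OF \<phi>]
  have int: "integrable M (\<lambda>x. Re (dunkl_J t \<sigma> \<phi> x * cnj (\<phi> x)))" for t
    by (intro integrable_Re l2_integrable_mult J_l2 \<phi> S)
  have inner: "Re (l2_inner M (dunkl_J t \<sigma> \<phi>) \<phi>) = (LINT x|M. Re (dunkl_J t \<sigma> \<phi> x * cnj (\<phi> x)))" for t
    unfolding l2_inner_def by (rule integral_Re[symmetric, OF l2_integrable_mult[OF J_l2[OF \<phi>] S]])
  note i1 = l2_spaceD(2)[OF S] and i2 = l2_spaceD(2)[OF h_l2[OF \<phi>]]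
  have "(LINT x|M. Re (dunkl_J t \<sigma> \<phi> x * cnj (\<phi> x)) + c0 * (cmod (\<phi> x))\<^sup>2) \<le>
      (LINT x|M. Re (dunkl_J s \<sigma> \<phi> x * cnj (\<phi> x)) + \<xi> * (cmod (abs_power_mult (- u) \<phi> x))\<^sup>2)"
  proof (rule integral_mono_AE)
    show "integrable M (\<lambda>x. Re (dunkl_J t \<sigma> \<phi> x * cnj (\<phi> x)) + c0 * (cmod (\<phi> x))\<^sup>2)"
      by (intro Bochner_Integration.integrable_add int integrable_mult_right i1)
    show "integrable M (\<lambda>x. Re (dunkl_J s \<sigma> \<phi> x * cnj (\<phi> x)) + \<xi> * (cmod (abs_power_mult (- u) \<phi> x))\<^sup>2)"
      by (intro Bochner_Integration.integrable_add int integrable_mult_right i2)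
    have *: "Re (dunkl_J t \<sigma> \<phi> x * cnj (\<phi> x)) + c0 * (cmod (\<phi> x))\<^sup>2 \<le>
      Re (dunkl_J s \<sigma> \<phi> x * cnj (\<phi> x)) + \<xi> * (cmod (abs_power_mult (- u) \<phi> x))\<^sup>2" if "x \<noteq> 0" for x
    proof -
      have "Re (dunkl_J s \<sigma> \<phi> x * cnj (\<phi> x)) =
          Re (dunkl_J t \<sigma> \<phi> x * cnj (\<phi> x)) + (s\<^sup>2 - t\<^sup>2) * x\<^sup>2 * (cmod (\<phi> x))\<^sup>2"
        unfolding dunkl_J_frequency[of s \<sigma> \<phi> x t] distrib_right mult.assoc complex_norm_square[symmetric]
        by (simp add: of_real_mult[symmetric] mult.assoc del: of_real_mult of_real_diff of_real_power)
      moreover have "c0 * (cmod (\<phi> x))\<^sup>2 \<le> (\<xi> * (\<bar>x\<bar> powr (- u))\<^sup>2 + (s\<^sup>2 - t\<^sup>2) * x\<^sup>2) * (cmod (\<phi> x))\<^sup>2"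
        by (intro mult_right_mono c0 that) simp
      ultimately show ?thesis
        by (simp add: abs_power_mult_def norm_mult power_mult_distrib algebra_simps)
    qed
    show "AE x in M. Re (dunkl_J t \<sigma> \<phi> x * cnj (\<phi> x)) + c0 * (cmod (\<phi> x))\<^sup>2 \<le>
      Re (dunkl_J s \<sigma> \<phi> x * cnj (\<phi> x)) + \<xi> * (cmod (abs_power_mult (- u) \<phi> x))\<^sup>2"
      unfolding AE_dunkl using AE_lborel_singleton[of 0] by eventually_elim (rule *)
  qed
  then have "Re (l2_inner M (dunkl_J t \<sigma> \<phi>) \<phi>) + c0 * l2_sq M \<phi> \<le>
      Re (l2_inner M (dunkl_J s \<sigma> \<phi>) \<phi>) + \<xi> * l2_sq M (abs_power_mult (- u) \<phi>)"
    by (simp only: inner l2_sq_eq[OF S] l2_sq_eq[OF h_l2[OF \<phi>]] Bochner_Integration.integral_add int i1 i2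
        integrable_mult_right integral_mult_right_zero)
  then show ?thesis
    by (simp only: asq_eq hsq_eq schwartz_V \<phi> jsq_schwartz)
qed

text \<open>The Schwartz approximants of f need not be orthogonal to the first k eigenfunctions of
  frequency t. The inequality is therefore proved for all Schwartz functions with a correction term
  made of those coefficients; it is continuous under the approximation and vanishes at f.\<close>

lemma form_lower_orthogonal:
  assumes t: "t > 0"
    and c0: "\<And>x. x \<noteq> 0 \<Longrightarrow> c0 \<le> \<xi> * (\<bar>x\<bar> powr (- u))\<^sup>2 + (s\<^sup>2 - t\<^sup>2) * x\<^sup>2"
    and f: "f \<in> V" and orth: "\<And>j. j < k \<Longrightarrow> l2_inner M f (herm t \<sigma> j) = 0"
  shows "(dunkl_energy t \<sigma> k + c0) * l2_sq M f \<le> a.sq f"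
proof -
  let ?E = "dunkl_energy t \<sigma>" and ?g = "herm t \<sigma>"
  interpret g: l2_basis M ?g by (rule herm_basis[OF t \<sigma>])
  have gS: "?g i \<in> schwartz" for i by (rule herm_schwartz[OF t \<sigma>])
  have S: "(?E k + c0) * l2_sq M \<phi> \<le> a.sq \<phi> + (\<Sum>i<k. (?E k - ?E i) * (cmod (l2_inner M \<phi> (?g i)))\<^sup>2)"
    if \<phi>: "\<phi> \<in> schwartz" for \<phi>
  proof -
    have "?E k * l2_sq M \<phi> \<le> Re (l2_inner M (dunkl_J t \<sigma> \<phi>) \<phi>) + (\<Sum>i<k. (?E k - ?E i) * (cmod (l2_inner M \<phi> (?g i)))\<^sup>2)"
    proof (rule sums_le[OF _ sums_mult[OF g.Parseval_sq[OF S_l2[OF \<phi>]]]])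
      show "(\<lambda>i. ?E i * (cmod (l2_inner M \<phi> (?g i)))\<^sup>2 +
          (if i \<in> {..<k} then (?E k - ?E i) * (cmod (l2_inner M \<phi> (?g i)))\<^sup>2 else 0))
        sums (Re (l2_inner M (dunkl_J t \<sigma> \<phi>) \<phi>) + (\<Sum>i<k. (?E k - ?E i) * (cmod (l2_inner M \<phi> (?g i)))\<^sup>2))"
        by (intro sums_add schwartz_J_sums_sq t \<phi> sums_If_finite_set) simp
      fix i
      show "?E k * (cmod (l2_inner M \<phi> (?g i)))\<^sup>2 \<le> ?E i * (cmod (l2_inner M \<phi> (?g i)))\<^sup>2 +
          (if i \<in> {..<k} then (?E k - ?E i) * (cmod (l2_inner M \<phi> (?g i)))\<^sup>2 else 0)"
      proof (cases "i < k")
        case True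
        then show ?thesis by (simp add: algebra_simps)
      next
        case False
        then have "?E k \<le> ?E i" using t by (simp add: dunkl_energy_def)
        then have "?E k * (cmod (l2_inner M \<phi> (?g i)))\<^sup>2 \<le> ?E i * (cmod (l2_inner M \<phi> (?g i)))\<^sup>2"
          by (rule mult_right_mono) simp
        then show ?thesis using False by simp
      qed
    qed
    moreover have "Re (l2_inner M (dunkl_J t \<sigma> \<phi>) \<phi>) + c0 * l2_sq M \<phi> \<le> a.sq \<phi>"
      by (rule schwartz_form_lower[OF c0 \<phi>])
    ultimately show ?thesis unfolding distrib_right by linarith
  qed
  let ?P = "\<lambda>n. e.L.proj e n f"
  have PV: "?P n \<in> V" for n by (intro schwartz_V proj_schwartz)
  have conv: "b.conv ?P f"
    by (rule a_conv_imp_b_conv[OF schwartz_dense[OF f] PV f])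
  have "(?E k + c0) * l2_sq M f \<le> a.sq f + (\<Sum>i<k. (?E k - ?E i) * (cmod (l2_inner M f (?g i)))\<^sup>2)"
  proof (rule LIMSEQ_le)
    show "(\<lambda>n. (?E k + c0) * l2_sq M (?P n)) \<longlonglongrightarrow> (?E k + c0) * l2_sq M f"
      by (intro tendsto_mult tendsto_const b.conv_sq[OF conv PV f])
    show "(\<lambda>n. a.sq (?P n) + (\<Sum>i<k. (?E k - ?E i) * (cmod (l2_inner M (?P n) (?g i)))\<^sup>2)) \<longlonglongrightarrow>
        a.sq f + (\<Sum>i<k. (?E k - ?E i) * (cmod (l2_inner M f (?g i)))\<^sup>2)"
      by (intro tendsto_add tendsto_sum tendsto_mult tendsto_const tendsto_power tendsto_norm
          a.conv_sq[OF schwartz_dense[OF f] PV f] b.conv_ip[OF conv PV f schwartz_V[OF gS]])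
    show "\<exists>N. \<forall>n\<ge>N. (?E k + c0) * l2_sq M (?P n) \<le>
        a.sq (?P n) + (\<Sum>i<k. (?E k - ?E i) * (cmod (l2_inner M (?P n) (?g i)))\<^sup>2)"
      using S[OF proj_schwartz] by blast
  qed
  also have "(\<Sum>i<k. (?E k - ?E i) * (cmod (l2_inner M f (?g i)))\<^sup>2) = 0"
    by (intro sum.neutral ballI) (simp add: orth)
  finally show ?thesis by simp
qed

section \<open>Eigenfunctions, square root and core of the perturbed operator\<close>

context
  fixes v :: "nat \<Rightarrow> real \<Rightarrow> complex" and \<mu> :: "nat \<Rightarrow> real"
  assumes sp: "spectral_pair V fscale aform (l2_inner M) e (1 / E 0) v \<mu>"
begin

interpretation sp: spectral_pair V fscale aform "l2_inner M" e "1 / E 0" v \<mu>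
  by (rule sp)

text \<open>Each \<open>e i\<close> lies in V and is therefore the energy limit, hence the norm
  limit, of its partial sums in v. A function orthogonal to all v_k is then orthogonal to all e_i,
  which are already known to be total.\<close>

lemma eigenfunction_basis: "l2_basis M v"
proof
  show "e.L.orthonormal v"
    using sp.v V_l2 unfolding b.orthonormal_def e.L.orthonormal_def by blast
  fix f assume f: "f \<in> l2_space M" and zero: "\<And>k. l2_inner M f (v k) = 0"
  have "l2_inner M f (e i) = 0" for i
  proof -
    let ?P = "\<lambda>n. b.proj v n (e i)"
    have iV: "e i \<in> V" by (intro schwartz_V e_schwartz)
    have PV: "?P n \<in> V" for n by (rule b.proj_mem[OF sp.v])
    have "b.conv ?P (e i)" by (rule a_conv_imp_b_conv[OF sp.proj_conv[OF iV] PV iV])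
    then have "e.L.conv ?P (e i)" unfolding b.conv_def e.L.conv_def .
    from e.L.conv_ip_right[OF this V_l2[OF PV] V_l2[OF iV] f]
    have "(\<lambda>n. l2_inner M f (?P n)) \<longlonglongrightarrow> l2_inner M f (e i)" .
    moreover have "l2_inner M f (?P n) = 0" for n
      unfolding b.proj_def
      by (simp add: e.L.ip_sum_right e.L.ip_scale_right e.L.scale_mem V_l2 sp.vV f zero)
    ultimately show ?thesis by (simp add: LIMSEQ_const_iff)
  qed
  then show "AE x in M. f x = 0" by (rule e.total_AE[OF f])
qed

interpretation v: l2_basis M v
  by (rule eigenfunction_basis)

abbreviation (input) "R \<equiv> diag_op M v (\<lambda>k. sqrt (\<mu> k))"

text \<open>Finite energy is exactly square summability of the coefficients multiplied by sqrt(\<mu>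
  k), and Riesz-Fischer turns these into a function.\<close>

lemma root_domain:
  assumes f: "f \<in> V"
  shows "\<exists>g. (f, g) \<in> R"
proof -
  have eq: "Re (of_real (\<mu> k) * l2_inner M f (v k) * cnj (l2_inner M f (v k))) =
      (cmod (of_real (sqrt (\<mu> k)) * l2_inner M f (v k)))\<^sup>2" for k
    using sp.\<mu>_pos[of k]
    by (simp add: mult.assoc complex_norm_square[symmetric] norm_mult power_mult_distrib
        del: of_real_power Re_complex_of_real) (simp flip: of_real_power)
  have "summable (\<lambda>k. (cmod (of_real (sqrt (\<mu> k)) * l2_inner M f (v k)))\<^sup>2)"
    using sums_summable[OF sums_Re[OF sp.a_expansion[OF f f]]] unfolding eq .
  from e.L.Riesz_Fischer[OF v.basis this]
  obtain g where "g \<in> l2_space M" "\<And>k. l2_inner M g (v k) = of_real (sqrt (\<mu> k)) * l2_inner M f (v k)"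
    by (elim bexE) blast
  then show ?thesis by (intro exI diag_opI V_l2[OF f])
qed

lemma root_form:
  assumes f: "f \<in> V" "(f, g) \<in> R" and f': "f' \<in> V" "(f', g') \<in> R"
  shows "l2_inner M g g' = aform f f'"
proof -
  have "of_real (sqrt (\<mu> k)) * l2_inner M f (v k) * cnj (of_real (sqrt (\<mu> k)) * l2_inner M f' (v k)) =
      of_real (\<mu> k) * l2_inner M f (v k) * cnj (l2_inner M f' (v k))" for k
  proof -
    have sq: "complex_of_real (sqrt (\<mu> k)) * of_real (sqrt (\<mu> k)) = of_real (\<mu> k)"
      using sp.\<mu>_pos[of k] by (simp add: of_real_mult[symmetric] del: of_real_mult)
    have "of_real (sqrt (\<mu> k)) * p * cnj (of_real (sqrt (\<mu> k)) * q) =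
        of_real (sqrt (\<mu> k)) * of_real (sqrt (\<mu> k)) * p * cnj q" for p q
      by simp
    then show ?thesis unfolding sq .
  qed
  then show ?thesis
    using v.Parseval[OF diag_opD(2)[OF f(2)] diag_opD(2)[OF f'(2)]] sp.a_expansion[OF f(1) f'(1)]
    by (simp only: diag_opD(3)[OF f(2)] diag_opD(3)[OF f'(2)] sums_unique2)
qed

text \<open>Two approximations in the graph norm: truncating f in the basis v, which truncates its
  image as well and lands in V, and then replacing the truncation by a Schwartz function close to it
  in energy. By \<open>root_form\<close> the energy is the squared norm of the image.\<close>

lemma root_core: "l2_core M schwartz R"
proof (rule v.diag_core)
  show "schwartz \<subseteq> Domain R" using root_domain schwartz_V by blast
  fix f g and \<epsilon> :: real assume fg: "(f, g) \<in> R" and \<epsilon>: "\<epsilon> > 0"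
  note f = diag_opD(1)[OF fg] and g = diag_opD(2)[OF fg]
  define P Q where "P n = e.L.proj v n f" and "Q n = e.L.proj v n g" for n
  have PQ: "(P n, Q n) \<in> R" for n
    using v.diag_sum_scale[of "{..<n}" "\<lambda>i. l2_inner M f (v i)" "\<lambda>k. sqrt (\<mu> k)"]
    unfolding P_def Q_def e.L.proj_def diag_opD(3)[OF fg] by simp
  have PV: "P n \<in> V" for n
    using b.proj_mem[OF sp.v, of n f] unfolding P_def b.proj_def e.L.proj_def .
  note Pl = V_l2[OF PV] and Ql = diag_opD(2)[OF PQ]
  have ev: "eventually (\<lambda>n. e.L.nrm (P n - f) < \<epsilon> / 2 \<and> e.L.nrm (Q n - g) < \<epsilon> / 2) sequentially"
    using order_tendstoD(2)[OF e.L.conv_nrm[OF v.proj_conv[OF f]], of "\<epsilon> / 2"]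
      order_tendstoD(2)[OF e.L.conv_nrm[OF v.proj_conv[OF g]], of "\<epsilon> / 2"] \<epsilon>
    unfolding P_def Q_def by (intro eventually_conj) simp_all
  then obtain n where n: "e.L.nrm (P n - f) < \<epsilon> / 2" "e.L.nrm (Q n - g) < \<epsilon> / 2"
    by (auto simp: eventually_sequentially)
  \<comment> \<open>A single energy bound has to control both components: the image with constant 1,
    the argument with constant 1 / E 0.\<close>
  define \<delta> where "\<delta> = (\<epsilon> / 2)\<^sup>2 * min 1 (E 0)"
  have "\<delta> > 0" using \<epsilon> energy_pos[of 0] by (simp add: \<delta>_def)
  with schwartz_dense[OF PV[of n]] have "eventually (\<lambda>m. a.sq (e.L.proj e m (P n) - P n) < \<delta>) sequentially"
    unfolding a.conv_def by (intro order_tendstoD(2))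
  then obtain m where m: "a.sq (e.L.proj e m (P n) - P n) < \<delta>"
    by (auto simp: eventually_sequentially)
  define h where "h = e.L.proj e m (P n)"
  have hS: "h \<in> schwartz" unfolding h_def by (rule proj_schwartz)
  note hV = schwartz_V[OF hS]
  obtain l where l: "(h, l) \<in> R" using root_domain[OF hV] by blast
  note ll = diag_opD(2)[OF l]
  have dV: "P n - h \<in> V" by (intro a.diff_mem PV hV)
  have "a.sq (P n - h) < \<delta>" using m a.sq_diff_commute[OF PV[of n] hV] by (simp add: h_def)
  have "(P n - h, Q n - l) \<in> R"
    using v.diag_add[OF PQ[of n] v.diag_scale[OF l, of "- 1"]] by (simp add: e.L.scale_minus_one)
  from root_form[OF dV this dV this] have "l2_sq M (Q n - l) = a.sq (P n - h)"
    by (simp add: e.L.sq_def a.sq_def)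
  also have "\<dots> < (\<epsilon> / 2)\<^sup>2"
  proof -
    have "(\<epsilon> / 2)\<^sup>2 * min 1 (E 0) \<le> (\<epsilon> / 2)\<^sup>2 * 1" by (intro mult_left_mono) auto
    then show ?thesis using \<open>a.sq (P n - h) < \<delta>\<close> by (simp add: \<delta>_def)
  qed
  finally have Ql2: "e.L.nrm (Q n - l) < \<epsilon> / 2"
    unfolding e.L.nrm_def using \<epsilon> real_sqrt_less_mono[of "l2_sq M (Q n - l)" "(\<epsilon> / 2)\<^sup>2"] by simp
  have "E 0 * l2_sq M (P n - h) \<le> a.sq (P n - h)"
    using jsq_ge[OF dV] jsq_le_asq[OF dV] by linarith
  also have "\<dots> < E 0 * (\<epsilon> / 2)\<^sup>2"
  proof -
    have "(\<epsilon> / 2)\<^sup>2 * min 1 (E 0) \<le> (\<epsilon> / 2)\<^sup>2 * E 0" by (intro mult_left_mono) auto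
    then show ?thesis using \<open>a.sq (P n - h) < \<delta>\<close> by (simp add: \<delta>_def mult.commute)
  qed
  finally have "l2_sq M (P n - h) < (\<epsilon> / 2)\<^sup>2" using energy_pos[of 0] by simp
  then have Pl2: "e.L.nrm (P n - h) < \<epsilon> / 2"
    unfolding e.L.nrm_def using \<epsilon> real_sqrt_less_mono[of "l2_sq M (P n - h)" "(\<epsilon> / 2)\<^sup>2"] by simp
  have "l2_norm M (f - h) = e.L.nrm (f - h)"
    unfolding e.L.nrm_def by (intro l2_norm_eq e.L.diff_mem f S_l2 hS)
  also have "\<dots> \<le> e.L.nrm (f - P n) + e.L.nrm (P n - h)"
    by (intro e.L.nrm_triangle_diff f Pl S_l2 hS)
  also have "e.L.nrm (f - P n) = e.L.nrm (P n - f)"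
    unfolding e.L.nrm_def e.L.sq_diff_commute[OF f Pl] ..
  finally have 1: "l2_norm M (f - h) < \<epsilon>" using Pl2 n by linarith
  have "l2_norm M (g - l) = e.L.nrm (g - l)"
    unfolding e.L.nrm_def by (intro l2_norm_eq e.L.diff_mem g ll)
  also have "\<dots> \<le> e.L.nrm (g - Q n) + e.L.nrm (Q n - l)"
    by (intro e.L.nrm_triangle_diff g Ql ll)
  also have "e.L.nrm (g - Q n) = e.L.nrm (Q n - g)"
    unfolding e.L.nrm_def e.L.sq_diff_commute[OF g Ql] ..
  finally have 2: "l2_norm M (g - l) < \<epsilon>" using Ql2 n by linarith
  show "\<exists>h\<in>schwartz. \<exists>l. (h, l) \<in> R \<and> l2_norm M (f - h) < \<epsilon> \<and> l2_norm M (g - l) < \<epsilon>"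
    using hS l 1 2 by blast
qed

text \<open>On the span of the first k + 1 unperturbed eigenfunctions j is at most E_k times the
  squared norm, and the form bound controls the perturbation by j and the norm, so min-max
  applies.\<close>

lemma eigenvalue_le:
  assumes \<alpha>\<beta>: "\<alpha> \<ge> 0" "\<beta> \<ge> 0"
    and le: "\<And>\<phi>. \<phi> \<in> schwartz \<Longrightarrow> l2_sq M (abs_power_mult (- u) \<phi>) \<le>
      \<alpha> * Re (l2_inner M (dunkl_J s \<sigma> \<phi>) \<phi>) + \<beta> * l2_sq M \<phi>"
  shows "\<mu> k \<le> E k * (1 + \<xi> * \<alpha>) + \<xi> * \<beta>"
proof (rule sp.eigenvalue_upper[OF e_orthonormal_V])
  fix c
  define f where "f = (\<Sum>i\<le>k. fscale (c i) (e i))"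
  have fS: "f \<in> schwartz" unfolding f_def by (intro schwartz_sum e_schwartz)
  note fV = schwartz_V[OF fS]
  have c: "l2_inner M f (e i) = (if i \<in> {..k} then c i else 0)" for i
    unfolding f_def by (rule e.L.ip_sum_scale_basis[OF e.basis, of "{..k}" c i]) simp
  have jf: "j.sq f \<le> E k * l2_sq M f"
  proof (rule sums_le[OF _ jsq_sums[OF fV] sums_mult[OF e.Parseval_sq[OF V_l2[OF fV]]]])
    show "E i * (cmod (l2_inner M f (e i)))\<^sup>2 \<le> E k * (cmod (l2_inner M f (e i)))\<^sup>2" for i
      using energy_mono[of i k] by (cases "i \<le> k") (auto simp: c intro: mult_right_mono)
  qed
  have "h.sq f \<le> \<alpha> * j.sq f + \<beta> * l2_sq M f"
    using le[OF fS] by (simp only: hsq_eq fV jsq_schwartz fS)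
  then have "\<xi> * h.sq f \<le> \<xi> * (\<alpha> * j.sq f + \<beta> * l2_sq M f)"
    using \<xi> by (intro mult_left_mono) auto
  then have "a.sq f \<le> (1 + \<xi> * \<alpha>) * j.sq f + \<xi> * \<beta> * l2_sq M f"
    by (simp add: asq_eq fV algebra_simps)
  also have "\<dots> \<le> (1 + \<xi> * \<alpha>) * (E k * l2_sq M f) + \<xi> * \<beta> * l2_sq M f"
    using \<alpha>\<beta> \<xi> by (intro add_right_mono mult_left_mono jf) auto
  also have "\<dots> = (E k * (1 + \<xi> * \<alpha>) + \<xi> * \<beta>) * l2_sq M f" by (simp add: algebra_simps)
  finally show "a.sq (\<Sum>i\<le>k. fscale (c i) (e i)) \<le> (E k * (1 + \<xi> * \<alpha>) + \<xi> * \<beta>) * l2_sq M (\<Sum>i\<le>k. fscale (c i) (e i))"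
    unfolding f_def .
qed

lemma eigenvalue_ge:
  assumes t: "t > 0"
    and c0: "\<And>x. x \<noteq> 0 \<Longrightarrow> c0 \<le> \<xi> * (\<bar>x\<bar> powr (- u))\<^sup>2 + (s\<^sup>2 - t\<^sup>2) * x\<^sup>2"
  shows "dunkl_energy t \<sigma> k + c0 \<le> \<mu> k"
proof (rule sp.eigenvalue_lower[of k "herm t \<sigma>"])
  show "herm t \<sigma> j \<in> V" for j by (intro schwartz_V herm_schwartz[OF t \<sigma>])
  show "(dunkl_energy t \<sigma> k + c0) * l2_sq M f \<le> a.sq f"
    if "f \<in> V" "\<And>j. j < k \<Longrightarrow> l2_inner M f (herm t \<sigma> j) = 0" for f
    by (rule form_lower_orthogonal[OF t c0 that])
qed

end

end

text \<open>Tangent at z = 1, obtained from ln z \<le> z - 1 and exp r \<ge> 1 + r.\<close>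

lemma powr_minus_tangent:
  fixes u z :: real
  assumes "u \<ge> 0" "z > 0"
  shows "1 + u - u * z \<le> z powr (- u)"
proof -
  have "u * ln z \<le> u * (z - 1)" using assms by (intro mult_left_mono ln_le_minus_one)
  then have "1 + u - u * z \<le> 1 + (- u) * ln z" by (simp add: algebra_simps)
  also have "\<dots> \<le> z powr (- u)"
    using assms exp_ge_add_one_self[of "(- u) * ln z"] by (simp add: powr_def)
  finally show ?thesis .
qed

text \<open>The tangent inequality at z = 1 rescaled by z = x^2 s / q, that is, the tangent of
  r^(-u) at r = q/s; q^(-u) s^u is the value there.\<close>

lemma inverse_power_tangent:
  fixes u s q x :: real
  assumes u: "u > 0" and s: "s > 0" and q: "q > 0" and x: "x \<noteq> 0"
  shows "(1 + u) * (q powr (- u) * s powr u) \<le>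
    (\<bar>x\<bar> powr (- u))\<^sup>2 + u * (q powr (- u) * s powr u) * (s / q) * x\<^sup>2"
proof -
  define w where "w = q powr (- u) * s powr u"
  define z where "z = \<bar>x\<bar>\<^sup>2 * (s / q)"
  have z: "z > 0" using s q x by (simp add: z_def)
  have "z powr (- u) = (\<bar>x\<bar> powr 2) powr (- u) * (s powr (- u) / q powr (- u))"
    using s q x unfolding z_def by (subst powr_mult) (simp_all add: powr_divide)
  also have "(\<bar>x\<bar> powr 2) powr (- u) = (\<bar>x\<bar> powr (- u))\<^sup>2"
    unfolding power2_eq_square powr_powr powr_add[symmetric] by simp
  finally have "w * z powr (- u) = (\<bar>x\<bar> powr (- u))\<^sup>2"
    using s q by (simp add: w_def powr_minus)
  moreover have "w * (1 + u - u * z) \<le> w * z powr (- u)"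
    using powr_minus_tangent[of u z] u z by (intro mult_left_mono) (auto simp: w_def)
  moreover have "w * (1 + u - u * z) = (1 + u) * w - u * w * (s / q) * x\<^sup>2"
    by (simp add: z_def algebra_simps)
  ultimately show ?thesis unfolding w_def by linarith
qed

section \<open>Assembling the operator and choosing the constants\<close>

definition dunkl_perturbation ::
    "real \<Rightarrow> real \<Rightarrow> real \<Rightarrow> real \<Rightarrow> real l2_op \<Rightarrow> (nat \<Rightarrow> real) \<Rightarrow> bool" where
  "dunkl_perturbation u \<sigma> s \<xi> U \<mu> \<longleftrightarrow>
    l2_selfadjoint (dunkl_measure \<sigma>) U \<and>
    l2_positive (dunkl_measure \<sigma>) U \<and>
    l2_core (dunkl_measure \<sigma>) schwartz (l2_sqrt (dunkl_measure \<sigma>) U) \<and>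
    (\<forall>\<phi>\<in>schwartz. \<forall>\<psi>\<in>schwartz.
      l2_inner (dunkl_measure \<sigma>) (l2_apply (l2_sqrt (dunkl_measure \<sigma>) U) \<phi>)
        (l2_apply (l2_sqrt (dunkl_measure \<sigma>) U) \<psi>) =
      l2_inner (dunkl_measure \<sigma>) (dunkl_J s \<sigma> \<phi>) \<psi> +
      complex_of_real \<xi> * l2_inner (dunkl_measure \<sigma>) (abs_power_mult (- u) \<phi>) (abs_power_mult (- u) \<psi>)) \<and>
    l2_discrete_spectrum (dunkl_measure \<sigma>) U \<and>
    l2_eigenvalue_seq (dunkl_measure \<sigma>) U \<mu>"

context dunkl_perturbed
begin

text \<open>The eigenvalue bounds are exported as implications, with the parameters \<alpha>,
  \<beta>, t and c still free, because one operator has to serve every \<epsilon> and every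
  \<open>B\<close>.\<close>

lemma perturbation_exists:
  obtains U \<mu> where "dunkl_perturbation u \<sigma> s \<xi> U \<mu>"
    and "\<And>\<alpha> \<beta> k. \<alpha> \<ge> 0 \<Longrightarrow> \<beta> \<ge> 0 \<Longrightarrow> (\<And>\<phi>. \<phi> \<in> schwartz \<Longrightarrow> l2_sq M (abs_power_mult (- u) \<phi>) \<le>
        \<alpha> * Re (l2_inner M (dunkl_J s \<sigma> \<phi>) \<phi>) + \<beta> * l2_sq M \<phi>) \<Longrightarrow> \<mu> k \<le> E k * (1 + \<xi> * \<alpha>) + \<xi> * \<beta>"
    and "\<And>t c k. t > 0 \<Longrightarrow> (\<And>x. x \<noteq> 0 \<Longrightarrow> c \<le> \<xi> * (\<bar>x\<bar> powr (- u))\<^sup>2 + (s\<^sup>2 - t\<^sup>2) * x\<^sup>2) \<Longrightarrow>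
        dunkl_energy t \<sigma> k + c \<le> \<mu> k"
proof -
  from spectral obtain v \<mu> where *: "b.orthonormal v \<and> incseq \<mu> \<and> (\<forall>k. 0 < \<mu> k) \<and>
      filterlim \<mu> at_top sequentially \<and>
      (\<forall>k. \<forall>f\<in>V. aform f (v k) = of_real (\<mu> k) * l2_inner M f (v k)) \<and>
      (\<forall>k. \<forall>f\<in>V. (\<forall>i<k. l2_inner M f (v i) = 0) \<longrightarrow> \<mu> k * l2_sq M f \<le> a.sq f)"
    by (elim exE)
  have sp: "spectral_pair V fscale aform (l2_inner M) e (1 / E 0) v \<mu>"
    using * by unfold_locales auto
  interpret sp: spectral_pair V fscale aform "l2_inner M" e "1 / E 0" v \<mu> by (rule sp)
  interpret v: l2_basis M v by (rule eigenfunction_basis[OF sp])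
  let ?U = "diag_op M v \<mu>" and ?R = "diag_op M v (\<lambda>k. sqrt (\<mu> k))"
  have sqrt: "l2_sqrt M ?U = ?R" by (rule v.diag_sqrt[OF sp.\<mu>_pos])
  have form: "l2_inner M (l2_apply ?R \<phi>) (l2_apply ?R \<psi>) = l2_inner M (dunkl_J s \<sigma> \<phi>) \<psi> +
      complex_of_real \<xi> * l2_inner M (abs_power_mult (- u) \<phi>) (abs_power_mult (- u) \<psi>)"
    if "\<phi> \<in> schwartz" "\<psi> \<in> schwartz" for \<phi> \<psi>
  proof -
    have R: "(f, l2_apply ?R f) \<in> ?R" if "f \<in> schwartz" for f
      unfolding l2_apply_def by (rule someI_ex[OF root_domain[OF sp schwartz_V[OF that]]])
    show ?thesis
      using root_form[OF sp schwartz_V[OF that(1)] R[OF that(1)] schwartz_V[OF that(2)] R[OF that(2)]]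
      by (simp add: aform_def hform_def jform_schwartz that)
  qed
  have "dunkl_perturbation u \<sigma> s \<xi> ?U \<mu>"
    unfolding dunkl_perturbation_def sqrt
    by (intro conjI ballI form v.diag_selfadjoint v.diag_positive root_core[OF sp]
        v.diag_discrete_spectrum v.diag_eigenvalue_seq sp.\<mu>_inc sp.\<mu>_lim less_imp_le sp.\<mu>_pos)
  then show ?thesis
    using eigenvalue_le[OF sp] eigenvalue_ge[OF sp] by (rule that)
qed

end

lemma dunkl_perturbation_bounds:
  fixes u \<sigma> :: real
  assumes u: "0 < u" "u < 1" and \<sigma>u: "\<sigma> > u - 1/2"
    and Cb: "\<And>\<epsilon> s \<phi>. \<epsilon> > 0 \<Longrightarrow> s > 0 \<Longrightarrow> \<phi> \<in> schwartz \<Longrightarrow>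
      l2_sq (dunkl_measure \<sigma>) (abs_power_mult (- u) \<phi>) \<le>
        \<epsilon> * s powr (u - 1) * Re (l2_inner (dunkl_measure \<sigma>) (dunkl_J s \<sigma> \<phi>) \<phi>) +
        C \<epsilon> * s powr u * l2_sq (dunkl_measure \<sigma>) \<phi>"
    and C: "\<And>\<epsilon>. \<epsilon> > 0 \<Longrightarrow> C \<epsilon> > 0"
    and s: "s > 0" and \<xi>: "\<xi> > 0"
  shows "\<exists>U \<mu>. dunkl_perturbation u \<sigma> s \<xi> U \<mu> \<and>
    (\<forall>B>0. \<xi> * s powr (u - 1) \<le> B \<longrightarrow>
      (\<forall>k. (2 * real k + 1 + 2 * \<sigma>) * s +
        \<xi> * (2 + 2 * \<bar>\<sigma>\<bar> + 2 * B) powr (- u) * s powr u * real (k + 1) powr (- u) \<le> \<mu> k)) \<and>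
    (\<forall>\<epsilon>>0. \<forall>k. \<mu> k \<le> (2 * real k + 1 + 2 * \<sigma>) * (s + \<xi> * \<epsilon> * s powr u) + \<xi> * C \<epsilon> * s powr u)"
proof -
  interpret dunkl_perturbed u \<sigma> s \<xi>
    using u \<sigma>u s \<xi> by unfold_locales
  show ?thesis
  proof (rule perturbation_exists)
    fix U \<mu> assume U: "dunkl_perturbation u \<sigma> s \<xi> U \<mu>"
      and upper: "\<And>\<alpha> \<beta> k. \<alpha> \<ge> 0 \<Longrightarrow> \<beta> \<ge> 0 \<Longrightarrow> (\<And>\<phi>. \<phi> \<in> schwartz \<Longrightarrow> l2_sq M (abs_power_mult (- u) \<phi>) \<le>
          \<alpha> * Re (l2_inner M (dunkl_J s \<sigma> \<phi>) \<phi>) + \<beta> * l2_sq M \<phi>) \<Longrightarrow> \<mu> k \<le> E k * (1 + \<xi> * \<alpha>) + \<xi> * \<beta>"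
      and lower: "\<And>t c k. t > 0 \<Longrightarrow> (\<And>x. x \<noteq> 0 \<Longrightarrow> c \<le> \<xi> * (\<bar>x\<bar> powr (- u))\<^sup>2 + (s\<^sup>2 - t\<^sup>2) * x\<^sup>2) \<Longrightarrow>
          dunkl_energy t \<sigma> k + c \<le> \<mu> k"
    define y where "y = s powr u"
    have y: "y > 0" and ys: "s powr (u - 1) = y / s" using s by (simp_all add: y_def powr_diff)
    have "\<mu> k \<le> (2 * real k + 1 + 2 * \<sigma>) * (s + \<xi> * \<epsilon> * y) + \<xi> * C \<epsilon> * y" if \<epsilon>: "\<epsilon> > 0" for \<epsilon> k
    proof -
      have "\<mu> k \<le> E k * (1 + \<xi> * (\<epsilon> * (y / s))) + \<xi> * (C \<epsilon> * y)"
        using Cb[OF \<epsilon> s] y s \<epsilon> C[OF \<epsilon>] by (intro upper) (auto simp: ys y_def)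
      also have "\<dots> = (2 * real k + 1 + 2 * \<sigma>) * (s + \<xi> * \<epsilon> * y) + \<xi> * C \<epsilon> * y"
        using s by (simp add: dunkl_energy_def field_simps)
      finally show ?thesis .
    qed
    moreover have "(2 * real k + 1 + 2 * \<sigma>) * s +
          \<xi> * (2 + 2 * \<bar>\<sigma>\<bar> + 2 * B) powr (- u) * y * real (k + 1) powr (- u) \<le> \<mu> k"
      if B: "B > 0" "\<xi> * s powr (u - 1) \<le> B" for B k
    proof -
      define m where "m = 2 * real k + 1 + 2 * \<sigma>"
      \<comment> \<open>The part 2 + 2|\<sigma>| ensures m \<le> q and the part 2B ensures \<delta>
        < 1. The tangent point is q / s, and the resulting constant D is \<rho>^(-u).\<close>
      define \<rho> where "\<rho> = 2 + 2 * \<bar>\<sigma>\<bar> + 2 * B"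
      define q where "q = \<rho> * real (k + 1)"
      define w where "w = q powr (- u)"
      \<comment> \<open>Chosen so that s^2 - t^2 = s^2 \<delta> cancels \<xi> times the slope of the
        tangent; what remains of the potential is the constant \<xi> (1 + u) w y.\<close>
      define \<delta> where "\<delta> = \<xi> * (y / s) * u * w / q"
      have \<rho>: "\<rho> > 0" "\<rho> \<ge> 2 * B" using B by (simp_all add: \<rho>_def)
      have "\<rho> * 1 \<le> \<rho> * real (k + 1)" using \<rho> by (intro mult_left_mono) auto
      then have q\<rho>: "\<rho> \<le> q" by (simp add: q_def)
      have q1: "q \<ge> 1" using q\<rho> B by (simp add: \<rho>_def)
      have w: "w > 0" "w \<le> 1" using q1 u powr_mono[of "- u" 0 q] by (auto simp: w_def)
      have m0: "m > 0" using \<sigma> by (simp add: m_def)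
      have mq: "m \<le> q"
      proof -
        define N where "N = real (k + 1)"
        have "2 * real k + 1 \<le> 2 * N" "1 \<le> N" by (simp_all add: N_def)
        then have "2 * \<sigma> \<le> 2 * (\<bar>\<sigma>\<bar> * N)" "0 \<le> B * N"
          using B mult_left_mono[of 1 N "\<bar>\<sigma>\<bar>"] abs_ge_self[of \<sigma>] by (simp_all add: mult_left_mono)
        then have "m \<le> 2 * N + 2 * (\<bar>\<sigma>\<bar> * N) + 2 * (B * N)"
          unfolding m_def using \<open>2 * real k + 1 \<le> 2 * N\<close> by (intro order_trans[OF _ add_increasing2[OF _ add_mono]]) auto
        then show ?thesis by (simp only: q_def \<rho>_def distrib_right N_def mult.assoc)
      qed
      have "\<xi> * (y / s) * (u * w) \<le> B * 1"
        using B u w mult_le_one[of u w] by (intro mult_mono) (auto simp: ys)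
      then have "\<delta> \<le> B / q" unfolding \<delta>_def mult.assoc mult_1_right using q1 by (intro divide_right_mono) auto
      also have "\<dots> < 1" using q1 q\<rho> \<rho> B by simp
      finally have \<delta>1: "\<delta> < 1" .
      have \<delta>0: "\<delta> \<ge> 0" using \<xi> y s u w q1 by (simp add: \<delta>_def)
      define t where "t = s * sqrt (1 - \<delta>)"
      have t: "t > 0" using s \<delta>1 by (simp add: t_def)
      have "(1 - \<delta>)\<^sup>2 \<le> 1 - \<delta>"
        using \<delta>0 \<delta>1 mult_left_mono[of "1 - \<delta>" 1 "1 - \<delta>"] by (simp add: power2_eq_square)
      then have "1 - \<delta> \<le> sqrt (1 - \<delta>)" by (rule real_le_rsqrt)
      then have ts: "s * (1 - \<delta>) \<le> t" using s by (simp add: t_def)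
      have st: "s\<^sup>2 - t\<^sup>2 = \<xi> * (u * (w * y) * (s / q))"
      proof -
        have "s\<^sup>2 - t\<^sup>2 = s\<^sup>2 * \<delta>" using \<delta>1 by (simp add: t_def power_mult_distrib algebra_simps)
        then show ?thesis using s q1 by (simp add: \<delta>_def power2_eq_square field_simps)
      qed
      have "dunkl_energy t \<sigma> k + \<xi> * ((1 + u) * (w * y)) \<le> \<mu> k"
      proof (rule lower[OF t])
        fix x :: real assume "x \<noteq> 0"
        then have "(1 + u) * (w * y) \<le> (\<bar>x\<bar> powr (- u))\<^sup>2 + u * (w * y) * (s / q) * x\<^sup>2"
          unfolding w_def y_def using u s q1 by (intro inverse_power_tangent) auto
        then have "\<xi> * ((1 + u) * (w * y)) \<le> \<xi> * ((\<bar>x\<bar> powr (- u))\<^sup>2 + u * (w * y) * (s / q) * x\<^sup>2)"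
          using \<xi> by (intro mult_left_mono) auto
        then show "\<xi> * ((1 + u) * (w * y)) \<le> \<xi> * (\<bar>x\<bar> powr (- u))\<^sup>2 + (s\<^sup>2 - t\<^sup>2) * x\<^sup>2"
          unfolding st by (simp only: distrib_left mult.assoc)
      qed
      moreover have "m * (s * (1 - \<delta>)) \<le> dunkl_energy t \<sigma> k"
        unfolding dunkl_energy_def m_def[symmetric] using ts m0 by (intro mult_left_mono) auto
      \<comment> \<open>Since m \<le> q, lowering the frequency costs at most \<xi> u w y, which
        leaves \<xi> w y of the gain \<xi> (1 + u) w y.\<close>
      moreover have "m * (s * \<delta>) \<le> \<xi> * (u * (w * y))"
      proof -
        have "m * (s * \<delta>) \<le> q * (s * \<delta>)" using mq s \<delta>0 by (intro mult_right_mono) auto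
        also have "\<dots> = \<xi> * (u * (w * y))" using s q1 by (simp add: \<delta>_def field_simps)
        finally show ?thesis .
      qed
      ultimately have "m * s + \<xi> * (w * y) \<le> \<mu> k"
        by (simp add: algebra_simps)
      moreover have "w = \<rho> powr (- u) * real (k + 1) powr (- u)"
        unfolding w_def q_def using \<rho> by (intro powr_mult)
      ultimately show ?thesis by (simp add: m_def \<rho>_def mult_ac)
    qed
    ultimately show ?thesis using U unfolding y_def by blast
  qed
qed

text \<open>Operators and eigenvalue sequences are fixed for all s and \<xi> before the constants,
  so that the uniformity of \<open>D\<close> and \<open>C\<close> in s and \<xi> has a meaning. For
  a single pair, \<open>B\<close> equal to \<xi> s^(u-1) makes the lower bound applicable.\<close>

theorem theorem1p1:
  fixes u \<sigma> :: real
  assumes "0 < u" and "u < 1" and "\<sigma> > u - 1/2"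
  shows "\<exists>(U :: real \<Rightarrow> real \<Rightarrow> real l2_op) (\<Lambda> :: real \<Rightarrow> real \<Rightarrow> nat \<Rightarrow> real).
    (\<forall>s>0. \<forall>\<xi>>0.
       l2_selfadjoint (dunkl_measure \<sigma>) (U s \<xi>) \<and>
       l2_positive (dunkl_measure \<sigma>) (U s \<xi>) \<and>
       l2_core (dunkl_measure \<sigma>) schwartz (l2_sqrt (dunkl_measure \<sigma>) (U s \<xi>)) \<and>
       (\<forall>\<phi>\<in>schwartz. \<forall>\<psi>\<in>schwartz.
          l2_inner (dunkl_measure \<sigma>)
            (l2_apply (l2_sqrt (dunkl_measure \<sigma>) (U s \<xi>)) \<phi>)
            (l2_apply (l2_sqrt (dunkl_measure \<sigma>) (U s \<xi>)) \<psi>) =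
          l2_inner (dunkl_measure \<sigma>) (dunkl_J s \<sigma> \<phi>) \<psi> +
          complex_of_real \<xi> *
            l2_inner (dunkl_measure \<sigma>) (abs_power_mult (- u) \<phi>) (abs_power_mult (- u) \<psi>)) \<and>
       l2_discrete_spectrum (dunkl_measure \<sigma>) (U s \<xi>) \<and>
       l2_eigenvalue_seq (dunkl_measure \<sigma>) (U s \<xi>) (\<Lambda> s \<xi>)) \<and>
    (\<forall>B>0. \<exists>D>0. \<forall>s>0. \<forall>\<xi>>0. \<xi> * s powr (u - 1) \<le> B \<longrightarrow>
       (\<forall>k. (2 * real k + 1 + 2 * \<sigma>) * s + \<xi> * D * s powr u * real (k + 1) powr (- u)
              \<le> \<Lambda> s \<xi> k)) \<and>
    (\<forall>\<epsilon>>0. \<exists>C>0. \<forall>s>0. \<forall>\<xi>>0. \<forall>k.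
       \<Lambda> s \<xi> k \<le> (2 * real k + 1 + 2 * \<sigma>) * (s + \<xi> * \<epsilon> * s powr u) + \<xi> * C * s powr u)"
proof -
  \<comment> \<open>C is made a function of \<epsilon> before s and \<xi> appear, so the operators
    chosen later all obey the same constants.\<close>
  have "\<forall>\<epsilon>. \<exists>C. \<epsilon> > 0 \<longrightarrow> C > 0 \<and> (\<forall>s>0. \<forall>\<phi>\<in>schwartz.
      l2_sq (dunkl_measure \<sigma>) (abs_power_mult (- u) \<phi>) \<le>
        \<epsilon> * s powr (u - 1) * Re (l2_inner (dunkl_measure \<sigma>) (dunkl_J s \<sigma> \<phi>) \<phi>) +
        C * s powr u * l2_sq (dunkl_measure \<sigma>) \<phi>)"
    using inverse_power_form_bound[OF assms] by blast
  from choice[OF this] obtain C where C: "\<And>\<epsilon>. \<epsilon> > 0 \<Longrightarrow> C \<epsilon> > 0"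
    "\<And>\<epsilon> s \<phi>. \<epsilon> > 0 \<Longrightarrow> s > 0 \<Longrightarrow> \<phi> \<in> schwartz \<Longrightarrow>
      l2_sq (dunkl_measure \<sigma>) (abs_power_mult (- u) \<phi>) \<le>
        \<epsilon> * s powr (u - 1) * Re (l2_inner (dunkl_measure \<sigma>) (dunkl_J s \<sigma> \<phi>) \<phi>) +
        C \<epsilon> * s powr u * l2_sq (dunkl_measure \<sigma>) \<phi>"
    by blast
  define P where "P s \<xi> p \<longleftrightarrow> dunkl_perturbation u \<sigma> s \<xi> (fst p) (snd p) \<and>
    (\<forall>B>0. \<xi> * s powr (u - 1) \<le> B \<longrightarrow>
      (\<forall>k. (2 * real k + 1 + 2 * \<sigma>) * s +
        \<xi> * (2 + 2 * \<bar>\<sigma>\<bar> + 2 * B) powr (- u) * s powr u * real (k + 1) powr (- u) \<le> snd p k)) \<and>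
    (\<forall>\<epsilon>>0. \<forall>k. snd p k \<le> (2 * real k + 1 + 2 * \<sigma>) * (s + \<xi> * \<epsilon> * s powr u) + \<xi> * C \<epsilon> * s powr u)"
    for s \<xi> and p :: "real l2_op \<times> (nat \<Rightarrow> real)"
  have ex: "\<exists>p. P s \<xi> p" if "s > 0" "\<xi> > 0" for s \<xi>
    using dunkl_perturbation_bounds[OF assms C(2,1) that] unfolding P_def by (simp add: split_paired_Ex)
  \<comment> \<open>One choice per pair (s, \<xi>); the predicate already contains the bounds for
    every B and every \<epsilon>.\<close>
  define p where "p s \<xi> = (SOME p. P s \<xi> p)" for s \<xi>
  have p: "P s \<xi> (p s \<xi>)" if "s > 0" "\<xi> > 0" for s \<xi>
    unfolding p_def by (rule someI_ex[OF ex[OF that]])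
  show ?thesis
  proof (intro exI conjI)
    show "\<forall>s>0. \<forall>\<xi>>0.
       l2_selfadjoint (dunkl_measure \<sigma>) (fst (p s \<xi>)) \<and>
       l2_positive (dunkl_measure \<sigma>) (fst (p s \<xi>)) \<and>
       l2_core (dunkl_measure \<sigma>) schwartz (l2_sqrt (dunkl_measure \<sigma>) (fst (p s \<xi>))) \<and>
       (\<forall>\<phi>\<in>schwartz. \<forall>\<psi>\<in>schwartz.
          l2_inner (dunkl_measure \<sigma>)
            (l2_apply (l2_sqrt (dunkl_measure \<sigma>) (fst (p s \<xi>))) \<phi>)
            (l2_apply (l2_sqrt (dunkl_measure \<sigma>) (fst (p s \<xi>))) \<psi>) =
          l2_inner (dunkl_measure \<sigma>) (dunkl_J s \<sigma> \<phi>) \<psi> +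
          complex_of_real \<xi> *
            l2_inner (dunkl_measure \<sigma>) (abs_power_mult (- u) \<phi>) (abs_power_mult (- u) \<psi>)) \<and>
       l2_discrete_spectrum (dunkl_measure \<sigma>) (fst (p s \<xi>)) \<and>
       l2_eigenvalue_seq (dunkl_measure \<sigma>) (fst (p s \<xi>)) (snd (p s \<xi>))"
      using p unfolding P_def dunkl_perturbation_def by blast
    show "\<forall>B>0. \<exists>D>0. \<forall>s>0. \<forall>\<xi>>0. \<xi> * s powr (u - 1) \<le> B \<longrightarrow>
       (\<forall>k. (2 * real k + 1 + 2 * \<sigma>) * s + \<xi> * D * s powr u * real (k + 1) powr (- u)
              \<le> snd (p s \<xi>) k)"
    proof (intro allI impI)
      fix B :: real assume B: "B > 0"
      then have "(2 + 2 * \<bar>\<sigma>\<bar> + 2 * B) powr (- u) > 0" by simp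
      then show "\<exists>D>0. \<forall>s>0. \<forall>\<xi>>0. \<xi> * s powr (u - 1) \<le> B \<longrightarrow>
       (\<forall>k. (2 * real k + 1 + 2 * \<sigma>) * s + \<xi> * D * s powr u * real (k + 1) powr (- u)
              \<le> snd (p s \<xi>) k)"
        using p B unfolding P_def by blast
    qed
    show "\<forall>\<epsilon>>0. \<exists>C>0. \<forall>s>0. \<forall>\<xi>>0. \<forall>k.
       snd (p s \<xi>) k \<le> (2 * real k + 1 + 2 * \<sigma>) * (s + \<xi> * \<epsilon> * s powr u) + \<xi> * C * s powr u"
    proof (intro allI impI)
      fix \<epsilon> :: real assume \<epsilon>: "\<epsilon> > 0"
      show "\<exists>C>0. \<forall>s>0. \<forall>\<xi>>0. \<forall>k.
       snd (p s \<xi>) k \<le> (2 * real k + 1 + 2 * \<sigma>) * (s + \<xi> * \<epsilon> * s powr u) + \<xi> * C * s powr u"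
        using p \<epsilon> unfolding P_def by (intro exI[of _ "C \<epsilon>"] conjI C(1)) blast+
    qed
  qed
qed

end
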